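(* Let $f$ belong to $H^2_{(reg)}(\mathcal T^-)$ (resp. $H^2_{(reg)}(\mathcal T^+)$), and let $\tilde f_{+,\nu}$ (resp. $\tilde f_{-,\nu}$) be its Lorentzian Fourier-Helgason transform. Then the holomorphic function $F$ in $\mathcal T^-$ (resp. $\mathcal T^+$) whose boundary value is $f$ is given by $$F(z)=\frac{1}{2\pi^2}\int_0^\infty\frac{\nu\tanh\pi\nu}{e^{\pm\pi\nu}\cosh\pi\nu}\,{\rm d}\nu\int_\gamma[z\cdot\xi]^{-\frac12+i\nu}\,\tilde f_{\pm,\nu}(\xi)\,{\rm d}\mu_\gamma(\xi),$$ with the upper sign in the case $f\in H^2_{(reg)}(\mathcal T^-)$ and the lower sign in the case $f\in H^2_{(reg)}(\mathcal T^+)$; here $\gamma$ is any loop in the class described in the context.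
   Context: For $z,z'\in\mathbb C^3$ put $[z\cdot z']=z_0z'_0-z_1z'_1-z_2z'_2$, $z^2=[z\cdot z]$. $X=\{x\in\mathbb R^3:x^2=-1\}$, $X^{(c)}=\{z\in\mathbb C^3:z^2=-1\}$, $z=x+iy$. ${\rm d}\sigma(x)=\frac{{\rm d}x_1{\rm d}x_2}{2|x_0|}$ on $X$. $V^+=\{y:y^2>0,y_0>0\}$, $V^-=-V^+$, $C^+=\{\xi\in\mathbb R^3\setminus\{0\}:\xi^2=0,\xi_0>0\}$. $\mathcal T^\pm=\{z=x+iy\in X^{(c)}:y\in V^\pm\}$; for $z\in\mathcal T^\pm$, $\xi\in C^+$ one has $\pm{\rm Im}[z\cdot\xi]>0$. Complex powers $t^s$ are taken on the principal branch (positive on $(0,\infty)$, holomorphic on $\mathbb C\setminus(-\infty,0]$); for real $t\neq0$, $t_\pm^s=Y(t)|t|^s+e^{\pm i\pi s}Y(-t)|t|^s$ ($Y$ the Heaviside function) are the boundary values from the upper/lower half-plane. Parametrization: $z(\lambda,\mu)=\big(\frac{1+\lambda\mu}{\lambda-\mu},\frac{1-\lambda\mu}{\lambda-\mu},\frac{\lambda+\mu}{\lambda-\mu}\big)$; tubes $\tau^{\varepsilon,\varepsilon'}=\{\varepsilon{\rm Im}\lambda>0,\varepsilon'{\rm Im}\mu>0\}$; $\mathcal T^+$ is associated with $\tau^{-,+}$ and $\mathcal T^-$ with $\tau^{+,-}$. $H^2(\mathcal T^\pm)$: functions $F$ holomorphic in $\mathcal T^\pm$ with boundary value $f\in L^2(X,{\rm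 d}\sigma)$ from $\mathcal T^\pm$ and with $(\lambda-\mu)^{-1}F(z(\lambda,\mu))$ in the Hardy space $H^2$ of the associated tube. $H^2_{(reg)}(\mathcal T^\pm)$: those $F\in H^2(\mathcal T^\pm)$ with $|(\lambda-\mu)^{-1}F(z(\lambda,\mu))|\le c\,(1+|\lambda|)^{-1}(1+|\mu|)^{-1}$ on the closure of the associated tube, for some constant $c$ (we identify $F$ with its boundary value $f$). Lorentzian Fourier-Helgason transforms: $\tilde f_{\pm,\nu}(\xi)=\int_X([x\cdot\xi])_\pm^{-\frac12-i\nu}f(x)\,{\rm d}\sigma(x)$ for $\xi\in C^+$, $\nu\in\mathbb R$. Cycles: let $\omega=\frac{{\rm d}\xi_0\wedge{\rm d}\xi_1\wedge{\rm d}\xi_2}{{\rm d}(\xi^2)}\big|_{C^+}$, $\Xi(\xi)=(\xi_0,\xi_1,\xi_2)$; $\gamma$ is any loop on $C^+$ homotopic to $\gamma_0=\{(1,\cos\alpha,\sin\alpha):-\pi\le\alpha\le\pi\}$ and ${\rm d}\mu_\gamma$ is the restriction of the one-form $i_\Xi\omega$ to $\gamma$ (so that ${\rm d}\mu_{\gamma_0}={\rm d}\alpha/2$). *)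

theory Defs
  imports "HOL-Analysis.Analysis"
begin

type_synonym r3 = "real \<times> real \<times> real"
type_synonym c3 = "complex \<times> complex \<times> complex"

definition lorC :: "c3 \<Rightarrow> c3 \<Rightarrow> complex" where
  "lorC z w = (case z of (z0, z1, z2) \<Rightarrow> case w of (w0, w1, w2) \<Rightarrow> z0 * w0 - z1 * w1 - z2 * w2)"

definition lorR :: "r3 \<Rightarrow> r3 \<Rightarrow> real" where
  "lorR x y = (case x of (x0, x1, x2) \<Rightarrow> case y of (y0, y1, y2) \<Rightarrow> x0 * y0 - x1 * y1 - x2 * y2)"

definition cplx3 :: "r3 \<Rightarrow> c3" where
  "cplx3 x = (case x of (x0, x1, x2) \<Rightarrow> (complex_of_real x0, complex_of_real x1, complex_of_real x2))"

definition re3 :: "c3 \<Rightarrow> r3" where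
  "re3 z = (case z of (z0, z1, z2) \<Rightarrow> (Re z0, Re z1, Re z2))"

definition im3 :: "c3 \<Rightarrow> r3" where
  "im3 z = (case z of (z0, z1, z2) \<Rightarrow> (Im z0, Im z1, Im z2))"

definition Xhyp :: "r3 set" where
  "Xhyp = {x. lorR x x = -1}"

definition Xc :: "c3 set" where
  "Xc = {z. lorC z z = -1}"

definition Vcone :: "real \<Rightarrow> r3 set" where
  "Vcone e = {y. lorR y y > 0 \<and> e * fst y > 0}"

definition Cplus :: "r3 set" where
  "Cplus = {\<xi>. \<xi> \<noteq> 0 \<and> lorR \<xi> \<xi> = 0 \<and> fst \<xi> > 0}"

definition Ttube :: "real \<Rightarrow> c3 set" where
  "Ttube e = {z \<in> Xc. im3 z \<in> Vcone e}"

definition zpar :: "complex \<Rightarrow> complex \<Rightarrow> c3" where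
  "zpar l m = ((1 + l * m) / (l - m), (1 - l * m) / (l - m), (l + m) / (l - m))"

text \<open>The tube in C^2 associated with Ttube e: T^+ <-> tau^{-,+}, T^- <-> tau^{+,-}.\<close>
definition ptube :: "real \<Rightarrow> (complex \<times> complex) set" where
  "ptube e = {(l, m). - e * Im l > 0 \<and> e * Im m > 0}"

definition pquad :: "real \<Rightarrow> (real \<times> real) set" where
  "pquad e = {(a, b). - e * a > 0 \<and> e * b > 0}"

definition holo2 :: "(complex \<times> complex \<Rightarrow> complex) \<Rightarrow> (complex \<times> complex) set \<Rightarrow> bool" where
  "holo2 G S \<longleftrightarrow> open S \<and>
     (\<forall>p\<in>S. \<exists>a b. (G has_derivative (\<lambda>(h, k). a * h + b * k)) (at p))"

definition hardy2 :: "real \<Rightarrow> (complex \<times> complex \<Rightarrow> complex) \<Rightarrow> bool" where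
  "hardy2 e G \<longleftrightarrow> holo2 G (ptube e) \<and>
     (\<exists>M. \<forall>a b. (a, b) \<in> pquad e \<longrightarrow>
        integrable lborel (\<lambda>p::real\<times>real. (cmod (G (Complex (fst p) a, Complex (snd p) b)))\<^sup>2) \<and>
        (\<integral>p. (cmod (G (Complex (fst p) a, Complex (snd p) b)))\<^sup>2 \<partial>lborel) \<le> M)"

definition bval2 :: "real \<Rightarrow> (complex \<times> complex \<Rightarrow> complex) \<Rightarrow> (real \<times> real \<Rightarrow> complex) \<Rightarrow> bool" where
  "bval2 e G g \<longleftrightarrow>
     (\<forall>\<^sub>F ab in at (0, 0) within pquad e.
        integrable lborel (\<lambda>p::real\<times>real. (cmod (G (Complex (fst p) (fst ab), Complex (snd p) (snd ab)) - g p))\<^sup>2)) \<and>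
     ((\<lambda>ab. \<integral>p. (cmod (G (Complex (fst p) (fst ab), Complex (snd p) (snd ab)) - g p))\<^sup>2 \<partial>lborel)
        \<longlongrightarrow> 0) (at (0, 0) within pquad e)"

definition Xchart :: "real \<Rightarrow> real \<times> real \<Rightarrow> r3" where
  "Xchart e p = (e * sqrt ((fst p)\<^sup>2 + (snd p)\<^sup>2 - 1), fst p, snd p)"

definition Xdom :: "(real \<times> real) set" where
  "Xdom = {p. (fst p)\<^sup>2 + (snd p)\<^sup>2 > 1}"

text \<open>Integral over X with respect to d sigma = dx1 dx2 / (2 |x0|).\<close>
definition Xint :: "(r3 \<Rightarrow> complex) \<Rightarrow> complex" where
  "Xint g = (\<integral>p. indicator Xdom p *\<^sub>R
      ((g (Xchart 1 p) + g (Xchart (-1) p)) / complex_of_real (2 * sqrt ((fst p)\<^sup>2 + (snd p)\<^sup>2 - 1))) \<partial>lborel)"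

definition L2X :: "(r3 \<Rightarrow> complex) \<Rightarrow> bool" where
  "L2X f \<longleftrightarrow> (\<forall>e \<in> {1, -1::real}.
      (\<lambda>p. f (Xchart e p)) \<in> borel_measurable lborel \<and>
      integrable lborel (\<lambda>p. indicator Xdom p *
         ((cmod (f (Xchart e p)))\<^sup>2 / (2 * sqrt ((fst p)\<^sup>2 + (snd p)\<^sup>2 - 1)))))"

definition H2reg :: "real \<Rightarrow> (c3 \<Rightarrow> complex) \<Rightarrow> (r3 \<Rightarrow> complex) \<Rightarrow> bool" where
  "H2reg e F f \<longleftrightarrow>
     (let G = (\<lambda>(l, m). F (zpar l m) / (l - m));
          g = (\<lambda>p::real\<times>real. f (re3 (zpar (of_real (fst p)) (of_real (snd p))))
                  / complex_of_real (fst p - snd p))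
      in L2X f \<and> hardy2 e G \<and> bval2 e G g \<and>
         (\<exists>c. \<forall>l m. (l, m) \<in> ptube e \<longrightarrow>
              cmod (G (l, m)) \<le> c / ((1 + cmod l) * (1 + cmod m))))"

text \<open>Boundary values t_+^s (e = 1) and t_-^s (e = -1).\<close>
definition tpow :: "real \<Rightarrow> real \<Rightarrow> complex \<Rightarrow> complex" where
  "tpow e t s = (if t > 0 then complex_of_real t powr s
                 else if t < 0 then exp (complex_of_real (e * pi) * \<i> * s) * complex_of_real (- t) powr s
                 else 0)"

definition FH :: "real \<Rightarrow> (r3 \<Rightarrow> complex) \<Rightarrow> real \<Rightarrow> r3 \<Rightarrow> complex" where
  "FH e f \<nu> \<xi> = Xint (\<lambda>x. tpow e (lorR x \<xi>) (- 1/2 - \<i> * complex_of_real \<nu>) * f x)"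

definition gamma0 :: "real \<Rightarrow> r3" where
  "gamma0 t = (1, cos (2 * pi * t - pi), sin (2 * pi * t - pi))"

definition admissible_loop :: "(real \<Rightarrow> r3) \<Rightarrow> bool" where
  "admissible_loop \<gamma> \<longleftrightarrow> \<gamma> piecewise_C1_differentiable_on {0..1} \<and>
     path_image \<gamma> \<subseteq> Cplus \<and> pathfinish \<gamma> = pathstart \<gamma> \<and>
     homotopic_loops Cplus \<gamma> gamma0"

text \<open>Integral over gamma against d mu_gamma = i_Xi omega = (xi1 d xi2 - xi2 d xi1) / (2 xi0).\<close>
definition cycle_int :: "(r3 \<Rightarrow> complex) \<Rightarrow> (real \<Rightarrow> r3) \<Rightarrow> complex" where
  "cycle_int g \<gamma> = integral {0..1} (\<lambda>t.
      g (\<gamma> t) * complex_of_real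
        ((fst (snd (\<gamma> t)) * snd (snd (vector_derivative \<gamma> (at t)))
          - snd (snd (\<gamma> t)) * fst (snd (vector_derivative \<gamma> (at t))))
         / (2 * fst (\<gamma> t))))"

end

theory Submission
  imports Defs "HOL-Complex_Analysis.Complex_Analysis"
begin

text \<open>
  Write \<open>s = -1/2 + i \<nu>\<close> and \<open>s' = -1/2 - i \<nu>\<close>. With \<open>A = i e [z \<cdot> \<xi>]\<close> and \<open>B = -i e [x \<cdot> \<xi>]\<close> one has
  \<open>exp (- e \<pi> \<nu>) [z \<cdot> \<xi>]\<^sup>s ([x \<cdot> \<xi>])\<^sub>e\<^sup>s\<^sup>' = A\<^sup>s B\<^sup>s\<^sup>'\<close>, where \<open>Re A > 0\<close> and \<open>B\<close> is imaginary, so that after exchanging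
  the integrations the theorem reduces to the kernel identity
  \<open>\<integral>\<nu> tanh (\<pi> \<nu>) / cosh (\<pi> \<nu>) \<integral>A\<^sup>s B\<^sup>s\<^sup>' d\<xi> d\<nu> = 1 / (\<pi> (1 + [z \<cdot> x]))\<close> and to the fact that
  \<open>1 / (1 + [z \<cdot> x])\<close> is, in the coordinates \<open>(\<lambda>, \<mu>)\<close>, the product of two Cauchy kernels. For the kernel identity,
  the Fourier transform of \<open>1 / cosh\<close> turns \<open>A\<^sup>s B\<^sup>s\<^sup>'\<close> into \<open>1 / (u A + B)\<close>, whose mean over the circle is
  \<open>1 / sqrt (u\<^sup>2 + 1 + 2 u [z \<cdot> x])\<close>, the Lorentz square of \<open>u i e z - i e x\<close> being \<open>u\<^sup>2 + 1 + 2 u [z \<cdot> x]\<close>. The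
  exchange of the integrations rests on the local integrability of \<open>|[x \<cdot> \<xi>]|\<close> to the power \<open>-1/2\<close>, uniformly in \<open>\<xi>\<close>.
\<close>

section \<open>Vanishing of half-plane integrals\<close>

text \<open>The obstacle is the weight \<nu> tanh(pi \<nu>): it is unbounded, hence not the Fourier
  transform of an integrable function. It is written as a positive superposition of 1 - cos(\<nu> y)
  with density proportional to cosh(y/2) / sinh(y/2)^2, which comes from the partial fractions of
  tanh. Subtracting the value at y = 0 tames the double pole of that density, and positivity makes
  Fubini applicable. What remains has an elementary primitive, so no Legendre function occurs. The
  decay in \<nu> comes from |Im (Ln A - Ln B)| <= b < pi against 1 / cosh(pi \<nu>); such a b exists
  because the directions form a compact circle. The boundary value is given only as an L2 limit, so
  its decay bound holds almost everywhere, and the continuity of the transform in \<xi> rests on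
  uniform integrability, as the singular lines of [x.\<xi>] move with \<xi>. The constant 1 / (2
  pi^2) inverts the product of pi from the cycle, 1 / pi from the kernel identity, and 2 pi^2, that
  is the 4 pi^2 of two Cauchy integrals over the factor 2 in 1 + [z.x].\<close>

lemma LBINT_symmetric_limit:
  fixes h :: "real \<Rightarrow> complex"
  assumes "integrable lborel h"
  shows "((\<lambda>R. LBINT x=ereal (-R)..ereal R. h x) \<longlongrightarrow> (\<integral>x. h x \<partial>lborel)) at_top"
proof -
  have "((\<lambda>R. set_lebesgue_integral lborel {-R..R} h) \<longlongrightarrow> (\<integral>x. h x \<partial>lborel)) at_top"
    unfolding set_lebesgue_integral_def
  proof (rule integral_dominated_convergence_at_top[where w="\<lambda>x. cmod (h x)"])
    show "AE x in lborel. ((\<lambda>R. indicat_real {- R..R} x *\<^sub>R h x) \<longlongrightarrow> h x) at_top"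
    proof (rule AE_I2)
      fix x :: real
      have "\<forall>\<^sub>F R in at_top. indicat_real {- R..R} x *\<^sub>R h x = h x"
        using eventually_ge_at_top[of "\<bar>x\<bar>"] by eventually_elim (auto simp: indicator_def)
      then show "((\<lambda>R. indicat_real {- R..R} x *\<^sub>R h x) \<longlongrightarrow> h x) at_top"
        by (rule tendsto_eventually)
    qed
  qed (use assms in \<open>auto simp: indicator_def\<close>)
  then show ?thesis
  proof (rule Lim_transform_eventually)
    show "\<forall>\<^sub>F R in at_top. set_lebesgue_integral lborel {-R..R} h = (LBINT x=ereal (-R)..ereal R. h x)"
      using eventually_ge_at_top[of 0] by eventually_elim (simp add: interval_integral_Icc)
  qed
qed

text \<open>On a convex open set one primitive serves all horizontal lines at once, so moving a line
  of integration becomes a comparison of values of that primitive at the corners of a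
  rectangle.\<close>

lemma convex_holomorphic_horizontal_FTC:
  fixes q :: "complex \<Rightarrow> complex"
  assumes hol: "q holomorphic_on S" and conv: "convex S" and op: "open S"
  obtains g where "\<And>z. z \<in> S \<Longrightarrow> (g has_field_derivative q z) (at z)"
    "\<And>R y. R \<ge> 0 \<Longrightarrow> (\<And>x. Complex x y \<in> S) \<Longrightarrow>
       (LBINT x=ereal (-R)..ereal R. q (Complex x y)) = g (Complex R y) - g (Complex (-R) y)"
proof -
  obtain g where g: "\<And>z. z \<in> S \<Longrightarrow> (g has_field_derivative q z) (at z)"
    using holomorphic_convex_primitive'[OF conv op hol] at_within_open[OF _ op] by metis
  moreover have "(LBINT x=ereal (-R)..ereal R. q (Complex x y)) = g (Complex R y) - g (Complex (-R) y)"
    if R: "R \<ge> 0" and inS: "\<And>x. Complex x y \<in> S" for R y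
  proof (rule interval_integral_FTC_finite)
    have c: "continuous_on A (\<lambda>x. Complex x y)" for A
      unfolding Complex_eq by (intro continuous_intros)
    have "continuous_on S q" using hol holomorphic_on_imp_continuous_on by blast
    then show "continuous_on {min (-R) R..max (-R) R} (\<lambda>x. q (Complex x y))"
      by (rule continuous_on_compose2[OF _ c]) (use inS in auto)
    fix x
    have d: "((\<lambda>x. Complex x y) has_vector_derivative 1) (at x within {min (-R) R..max (-R) R})"
      unfolding Complex_eq
      by (auto intro!: derivative_eq_intros simp: has_vector_derivative_def fun_eq_iff scaleR_conv_of_real)
    show "((\<lambda>x. g (Complex x y)) has_vector_derivative q (Complex x y)) (at x within {min (-R) R..max (-R) R})"
      using field_vector_diff_chain_within[OF d, of g "q (Complex x y)"] g[OF inS[of x]]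
      by (auto simp: o_def has_field_derivative_at_within)
  qed
  ultimately show ?thesis using that by blast
qed

lemma closed_segment_Complex:
  "closed_segment (Complex x a) (Complex x b) = Complex x ` closed_segment a b"
  by (auto simp: closed_segment_def complex_eq_iff image_iff algebra_simps)

lemma vertical_increment_bound:
  assumes g: "\<And>y. y \<in> closed_segment a b \<Longrightarrow> (g has_field_derivative q (Complex x y)) (at (Complex x y))"
    and bound: "\<And>y. y \<in> closed_segment a b \<Longrightarrow> cmod (q (Complex x y)) \<le> M"
  shows "cmod (g (Complex x b) - g (Complex x a)) \<le> M * \<bar>b - a\<bar>"
proof -
  have "cmod (g (Complex x b) - g (Complex x a)) \<le> M * cmod (Complex x b - Complex x a)"
  proof (rule field_differentiable_bound[where S="closed_segment (Complex x a) (Complex x b)"])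
    fix z assume "z \<in> closed_segment (Complex x a) (Complex x b)"
    then obtain y where y: "y \<in> closed_segment a b" "z = Complex x y"
      unfolding closed_segment_Complex by auto
    show "(g has_field_derivative q z) (at z within closed_segment (Complex x a) (Complex x b))"
      using g y has_field_derivative_at_within by blast
    show "cmod (q z) \<le> M" using bound y by auto
  qed auto
  moreover have "cmod (Complex x b - Complex x a) = \<bar>b - a\<bar>"
    by (simp add: complex_diff cmod_def)
  ultimately show ?thesis by simp
qed

text \<open>The two truncated integrals differ by the increments of a primitive over the vertical
  sides at R and -R. Each increment is at most \<open>M\<close> times |\<theta>|, and
  \<open>M\<close> vanishes at both ends.\<close>

lemma holomorphic_horizontal_shift:
  fixes q :: "complex \<Rightarrow> complex" and a b :: real
  assumes hol: "q holomorphic_on {z. a < Im z \<and> Im z < b}"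
    and ab: "a < 0" "0 < b" and \<theta>: "a < \<theta>" "\<theta> < b"
    and bound: "\<And>x y. y \<in> closed_segment 0 \<theta> \<Longrightarrow> cmod (q (Complex x y)) \<le> M x"
    and M: "(M \<longlongrightarrow> 0) at_top" "(M \<longlongrightarrow> 0) at_bot"
    and int: "integrable lborel (\<lambda>x. q (of_real x))" "integrable lborel (\<lambda>x. q (Complex x \<theta>))"
  shows "(\<integral>x. q (Complex x \<theta>) \<partial>lborel) = (\<integral>x. q (of_real x) \<partial>lborel)"
proof -
  define S where "S = {z. a < Im z \<and> Im z < b}"
  have S: "S = {z. a < Im z} \<inter> {z. Im z < b}" by (auto simp: S_def)
  have conv: "convex S" unfolding S
    by (intro convex_Int convex_halfspace_Im_gt convex_halfspace_Im_lt)
  have op: "open S" unfolding S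
    by (intro open_Int open_halfspace_Im_gt open_halfspace_Im_lt)
  obtain g where g: "\<And>z. z \<in> S \<Longrightarrow> (g has_field_derivative q z) (at z)"
    and FTC: "\<And>R y. R \<ge> 0 \<Longrightarrow> (\<And>x. Complex x y \<in> S) \<Longrightarrow>
       (LBINT x=ereal (-R)..ereal R. q (Complex x y)) = g (Complex R y) - g (Complex (-R) y)"
    using convex_holomorphic_horizontal_FTC[OF hol[folded S_def] conv op] by blast
  have inS: "Complex x y \<in> S" if "y \<in> closed_segment 0 \<theta>" for x y
    using that ab \<theta> by (auto simp: S_def closed_segment_eq_real_ivl split: if_splits)
  have vert: "cmod (g (Complex x \<theta>) - g (Complex x 0)) \<le> M x * \<bar>\<theta> - 0\<bar>" for x
    by (rule vertical_increment_bound[where q=q]) (use g inS bound in auto)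
  have "((\<lambda>R. (LBINT x=ereal (-R)..ereal R. q (Complex x \<theta>)) - (LBINT x=ereal (-R)..ereal R. q (of_real x))) \<longlongrightarrow> 0) at_top"
  proof (rule Lim_null_comparison)
    show "\<forall>\<^sub>F R in at_top. cmod ((LBINT x=ereal (-R)..ereal R. q (Complex x \<theta>)) - (LBINT x=ereal (-R)..ereal R. q (of_real x)))
      \<le> (M R + M (-R)) * \<bar>\<theta>\<bar>"
      using eventually_ge_at_top[of 0]
    proof eventually_elim
      case (elim R)
      have 0: "q (of_real x) = q (Complex x 0)" for x by (simp add: complex_of_real_def)
      have eq: "(LBINT x=ereal (-R)..ereal R. q (Complex x \<theta>)) - (LBINT x=ereal (-R)..ereal R. q (of_real x))
        = (g (Complex R \<theta>) - g (Complex R 0)) - (g (Complex (-R) \<theta>) - g (Complex (-R) 0))"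
        unfolding 0 by (simp add: FTC elim inS)
      have "cmod ((g (Complex R \<theta>) - g (Complex R 0)) - (g (Complex (-R) \<theta>) - g (Complex (-R) 0)))
          \<le> M R * \<bar>\<theta>\<bar> + M (-R) * \<bar>\<theta>\<bar>"
        by (rule order_trans[OF norm_triangle_ineq4 add_mono]) (use vert in auto)
      then show ?case unfolding eq by (simp add: algebra_simps)
    qed
    have "((\<lambda>R. M (-R)) \<longlongrightarrow> 0) at_top" using M(2) by (simp add: filterlim_at_bot_mirror)
    then show "((\<lambda>R. (M R + M (-R)) * \<bar>\<theta>\<bar>) \<longlongrightarrow> 0) at_top"
      using M(1) by (auto intro!: tendsto_eq_intros)
  qed
  moreover have "((\<lambda>R. (LBINT x=ereal (-R)..ereal R. q (Complex x \<theta>)) - (LBINT x=ereal (-R)..ereal R. q (of_real x)))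
     \<longlongrightarrow> (\<integral>x. q (Complex x \<theta>) \<partial>lborel) - (\<integral>x. q (of_real x) \<partial>lborel)) at_top"
    by (intro tendsto_diff LBINT_symmetric_limit int)
  ultimately show ?thesis using tendsto_unique[OF trivial_limit_at_top_linorder] by force
qed

text \<open>The segment [-R, R] is closed up by the other three sides of a rectangle of height R.
  They have total length 4R and lie at distance at least R from 0, so quadratic decay leaves
  4C/R.\<close>

lemma upper_half_plane_integral_zero:
  assumes hol: "q holomorphic_on {z. Im z > -d}" and d: "d > 0"
    and bound: "\<And>z. Im z \<ge> 0 \<Longrightarrow> cmod z \<ge> R0 \<Longrightarrow> cmod (q z) \<le> C / (cmod z)\<^sup>2"
    and int: "integrable lborel (\<lambda>x. q (of_real x))"
  shows "(\<integral>x. q (of_real x) \<partial>lborel) = 0"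
proof -
  define S where "S = {z. Im z > -d}"
  have conv: "convex S" and op: "open S" unfolding S_def
    by (auto intro: convex_halfspace_Im_gt open_halfspace_Im_gt)
  obtain g where g: "\<And>z. z \<in> S \<Longrightarrow> (g has_field_derivative q z) (at z)"
    and FTC: "\<And>R y. R \<ge> 0 \<Longrightarrow> (\<And>x. Complex x y \<in> S) \<Longrightarrow>
       (LBINT x=ereal (-R)..ereal R. q (Complex x y)) = g (Complex R y) - g (Complex (-R) y)"
    using convex_holomorphic_horizontal_FTC[OF hol[folded S_def] conv op] by blast
  have C: "C \<ge> 0"
  proof -
    have "0 \<le> C / (cmod (of_real (max 1 \<bar>R0\<bar>)))\<^sup>2"
      by (rule order_trans[OF norm_ge_zero bound]) auto
    moreover have "(cmod (of_real (max 1 \<bar>R0\<bar>)))\<^sup>2 > 0" by simp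
    ultimately show ?thesis by (metis not_le zero_le_divide_iff)
  qed
  have inS: "Complex x y \<in> S" if "y \<ge> 0" for x y using that d by (auto simp: S_def)
  have sq: "cmod (q z) \<le> C / R\<^sup>2" if "Im z \<ge> 0" "cmod z \<ge> R" "R \<ge> \<bar>R0\<bar>" "R > 0" for R z
  proof -
    have "C / (cmod z)\<^sup>2 \<le> C / R\<^sup>2"
      using that C by (intro divide_left_mono power_mono mult_pos_pos) auto
    then show ?thesis using bound[of z] that by linarith
  qed
  have ge: "cmod (Complex x y) \<ge> \<bar>x\<bar>" "cmod (Complex x y) \<ge> \<bar>y\<bar>" for x y
    using abs_Re_le_cmod[of "Complex x y"] abs_Im_le_cmod[of "Complex x y"] by auto
  have "((\<lambda>R. (LBINT x=ereal (-R)..ereal R. q (of_real x))) \<longlongrightarrow> 0) at_top"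
  proof (rule Lim_null_comparison)
    show "\<forall>\<^sub>F R in at_top. cmod (LBINT x=ereal (-R)..ereal R. q (of_real x)) \<le> 4 * C / R"
      using eventually_ge_at_top[of "max 1 \<bar>R0\<bar>"]
    proof eventually_elim
      case (elim R)
      have 0: "q (of_real x) = q (Complex x 0)" for x by (simp add: complex_of_real_def)
      have e: "(LBINT x=ereal (-R)..ereal R. q (of_real x)) = g (Complex R 0) - g (Complex (-R) 0)"
        unfolding 0 using elim inS by (intro FTC) auto
      have v: "cmod (g (Complex x R) - g (Complex x 0)) \<le> C / R\<^sup>2 * \<bar>R - 0\<bar>" if "\<bar>x\<bar> = R" for x
        by (rule vertical_increment_bound[where q=q])
          (use g inS elim ge[of x] that in \<open>auto intro!: sq simp: closed_segment_eq_real_ivl\<close>)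
      have h: "cmod (g (Complex R R) - g (Complex (-R) R)) \<le> C / R\<^sup>2 * cmod (Complex R R - Complex (-R) R)"
      proof (rule field_differentiable_bound[where S="closed_segment (Complex R R) (Complex (-R) R)"])
        fix z assume z: "z \<in> closed_segment (Complex R R) (Complex (-R) R)"
        then obtain u where u: "z = (1 - u) *\<^sub>R Complex R R + u *\<^sub>R Complex (-R) R"
          by (auto simp: closed_segment_def)
        have "Im z = R"
          unfolding u by (simp add: algebra_simps)
        then have zz: "Im z \<ge> 0" "z \<in> S" "cmod z \<ge> R" using elim d abs_Im_le_cmod[of z] by (auto simp: S_def)
        show "(g has_field_derivative q z) (at z within closed_segment (Complex R R) (Complex (-R) R))"
          using g zz has_field_derivative_at_within by blast
        show "cmod (q z) \<le> C / R\<^sup>2" using sq zz elim by auto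
      qed auto
      have "cmod (Complex R R - Complex (-R) R) = 2 * R" using elim by (simp add: complex_diff cmod_def real_sqrt_mult)
      with h have h: "cmod (g (Complex R R) - g (Complex (-R) R)) \<le> 2 * C / R" using elim by (simp add: power2_eq_square mult.commute)
      have v1: "cmod (g (Complex R R) - g (Complex R 0)) \<le> C / R" using v[of R] elim by (simp add: power2_eq_square)
      have v2: "cmod (g (Complex (-R) R) - g (Complex (-R) 0)) \<le> C / R" using v[of "-R"] elim by (simp add: power2_eq_square)
      have "g (Complex R 0) - g (Complex (-R) 0) = - (g (Complex R R) - g (Complex R 0))
          + ((g (Complex R R) - g (Complex (-R) R)) + (g (Complex (-R) R) - g (Complex (-R) 0)))" by simp
      then have "cmod (g (Complex R 0) - g (Complex (-R) 0)) \<le> C / R + (2 * C / R + C / R)"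
        using v1 v2 h by (metis (no_types, lifting) add_mono norm_minus_cancel norm_triangle_le)
      then show ?case unfolding e by (simp add: field_simps)
    qed
    show "((\<lambda>R. 4 * C / R) \<longlongrightarrow> 0) at_top"
      by (intro tendsto_divide_0[OF tendsto_const] filterlim_at_top_imp_at_infinity filterlim_ident)
  qed
  with LBINT_symmetric_limit[OF int] show ?thesis
    using tendsto_unique[OF trivial_limit_at_top_linorder] by blast
qed

section \<open>Partial fractions of the hyperbolic tangent\<close>

text \<open>The product Gamma(z) Gamma(1 - z) is differentiated in two ways, by the product rule and
  through its closed form pi / sin(pi z); cancelling the product leaves the identity.\<close>

lemma Digamma_reflection_complex:
  assumes "(z::complex) \<notin> \<int>"
  shows "Digamma (1 - z) - Digamma z = of_real pi * cot (of_real pi * z)"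
proof -
  have nz: "z \<notin> \<int>\<^sub>\<le>\<^sub>0" "1 - z \<notin> \<int>\<^sub>\<le>\<^sub>0"
    using assms nonpos_Ints_Int Ints_diff[OF Ints_1, of "1 - z"] by auto
  have s: "sin (of_real pi * z) \<noteq> 0"
    using assms by (auto simp: sin_eq_0)
  have "((\<lambda>z. Gamma z * Gamma (1 - z)) has_field_derivative
     Gamma z * Digamma z * Gamma (1 - z) - Gamma (1 - z) * Digamma (1 - z) * Gamma z) (at z)"
    using nz by (auto intro!: derivative_eq_intros)
  moreover have "((\<lambda>z. Gamma z * Gamma (1 - z)) has_field_derivative
     - (of_real pi * (cos (of_real pi * z) * of_real pi)) / (sin (of_real pi * z))\<^sup>2) (at z)"
    unfolding Gamma_reflection_complex using s
    by (auto intro!: derivative_eq_intros simp: power2_eq_square)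
  ultimately have "Gamma z * Digamma z * Gamma (1 - z) - Gamma (1 - z) * Digamma (1 - z) * Gamma z
    = - (of_real pi * (cos (of_real pi * z) * of_real pi)) / (sin (of_real pi * z))\<^sup>2"
    by (rule DERIV_unique)
  then have "(Gamma z * Gamma (1 - z)) * (Digamma (1 - z) - Digamma z) =
     (of_real pi * (cos (of_real pi * z) * of_real pi)) / (sin (of_real pi * z))\<^sup>2"
    by (simp add: algebra_simps)
  then show ?thesis
    unfolding Gamma_reflection_complex using s
    by (simp add: cot_def divide_simps power2_eq_square)
qed

lemma cosh_of_real_complex: "cosh (complex_of_real x) = of_real (cosh x)"
  using exp_of_real[of "- x", where 'a=complex] by (simp add: cosh_field_def exp_of_real)

lemma tan_imaginary: "tan (\<i> * complex_of_real x) = \<i> * of_real (tanh x)"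
proof -
  have "complex_of_real (tanh x) = tanh (complex_of_real x)"
    by (simp add: tanh_def cosh_of_real_complex sinh_field_def cosh_field_def flip: exp_of_real of_real_minus)
  then show ?thesis by (simp add: tanh_conv_tan)
qed

text \<open>At z = 1/2 + i \<nu> the reflected point 1 - z is the conjugate of z, so the reflection
  formula becomes a real series: the logarithms in the limit formula for Digamma cancel, and the
  cotangent at pi/2 + i pi \<nu> is -i tanh(pi \<nu>).\<close>

lemma tanh_partial_fractions:
  assumes "\<nu> > 0"
  shows "(\<lambda>n. \<nu> / ((real n + 1/2)\<^sup>2 + \<nu>\<^sup>2)) sums (pi * tanh (pi * \<nu>) / 2)"
proof -
  define z where "z = Complex (1/2) \<nu>"
  have zn: "z + of_nat n \<noteq> 0" "1 - z + of_nat n \<noteq> 0" for n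
    using assms by (auto simp: z_def complex_eq_iff)
  have "z \<notin> \<int>" using assms by (auto simp: z_def Ints_def complex_eq_iff)
  note refl = Digamma_reflection_complex[OF this]
  have "(\<lambda>m. (of_real (ln (real m)) - (\<Sum>n<m. inverse (1 - z + of_nat n)))
      - (of_real (ln (real m)) - (\<Sum>n<m. inverse (z + of_nat n)))) \<longlonglongrightarrow> Digamma (1 - z) - Digamma z"
    using zn[of 0] by (intro tendsto_diff Digamma_LIMSEQ) auto
  moreover have "(of_real (ln (real m)) - (\<Sum>n<m. inverse (1 - z + of_nat n)))
      - (of_real (ln (real m)) - (\<Sum>n<m. inverse (z + of_nat n)))
     = - (2 * \<i> * of_real (\<Sum>n<m. \<nu> / ((real n + 1/2)\<^sup>2 + \<nu>\<^sup>2)))" for m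
  proof -
    have "inverse (z + of_nat n) - inverse (1 - z + of_nat n)
        = - (2 * \<i> * of_real (\<nu> / ((real n + 1/2)\<^sup>2 + \<nu>\<^sup>2)))" for n
    proof -
      have "(z + of_nat n) * (1 - z + of_nat n) = of_real ((real n + 1/2)\<^sup>2 + \<nu>\<^sup>2)"
        by (simp add: z_def complex_eq_iff power2_eq_square algebra_simps)
      moreover have "(1 - z + of_nat n) - (z + of_nat n) = - (2 * \<i> * of_real \<nu>)"
        by (simp add: z_def complex_eq_iff)
      moreover have "inverse (z + of_nat n) - inverse (1 - z + of_nat n) =
        ((1 - z + of_nat n) - (z + of_nat n)) / ((z + of_nat n) * (1 - z + of_nat n))"
        using zn[of n] by (simp add: field_simps)
      ultimately show ?thesis by simp
    qed
    then have "(\<Sum>n<m. inverse (z + of_nat n)) - (\<Sum>n<m. inverse (1 - z + of_nat n)) =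
        (\<Sum>n<m. - (2 * \<i> * of_real (\<nu> / ((real n + 1/2)\<^sup>2 + \<nu>\<^sup>2))))"
      unfolding sum_subtractf[symmetric] by (intro sum.cong) auto
    then show ?thesis
      by (simp add: sum_distrib_left sum_negf del: of_real_divide)
  qed
  ultimately have "(\<lambda>m. - (2 * \<i> * of_real (\<Sum>n<m. \<nu> / ((real n + 1/2)\<^sup>2 + \<nu>\<^sup>2)))) \<longlonglongrightarrow> of_real pi * cot (of_real pi * z)"
    by (simp add: refl)
  from tendsto_Im[OF this] have "(\<lambda>m. - (2 * (\<Sum>n<m. \<nu> / ((real n + 1/2)\<^sup>2 + \<nu>\<^sup>2)))) \<longlonglongrightarrow> Im (of_real pi * cot (of_real pi * z))"
    by simp
  then have "(\<lambda>m. (-1/2) * - (2 * (\<Sum>n<m. \<nu> / ((real n + 1/2)\<^sup>2 + \<nu>\<^sup>2)))) \<longlonglongrightarrow> (-1/2) * Im (of_real pi * cot (of_real pi * z))"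
    by (intro tendsto_mult_left)
  moreover have "(-1/2) * Im (of_real pi * cot (of_real pi * z)) = pi * tanh (pi * \<nu>) / 2"
  proof -
    have e: "of_real pi * z = of_real pi / 2 + \<i> * of_real (pi * \<nu>)"
      by (simp add: z_def complex_eq_iff)
    have "cot (of_real pi * z) = - tan (\<i> * of_real (pi * \<nu>))"
      unfolding e by (simp add: cot_def tan_def sin_add cos_add)
    also have "\<dots> = - (\<i> * of_real (tanh (pi * \<nu>)))"
      by (simp only: tan_imaginary)
    finally show ?thesis by simp
  qed
  ultimately show ?thesis unfolding sums_def by (simp only: mult_minus_right mult_minus_left minus_minus) simp
qed

text \<open>Density in y > 0 that represents 2 pi \<nu> tanh(pi \<nu>) as an integral of 1 -
  cos(\<nu> y). It behaves like 4/y^2 at 0, so only pairings with functions vanishing fast enough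
  there converge.\<close>

definition tanh_kernel :: "real \<Rightarrow> real" where
  "tanh_kernel y = cosh (y/2) / (sinh (y/2))\<^sup>2"

text \<open>With q = exp(-y/2) the kernel is 2q(1 + q^2) / (1 - q^2)^2, a combination of the
  geometric series in q^2 and its derivative; the coefficient n + 1/2 is (n + 1) - 1/2.\<close>

lemma tanh_kernel_sums:
  assumes "y > 0"
  shows "(\<lambda>n. 4 * (real n + 1/2) * exp (- (real n + 1/2) * y)) sums tanh_kernel y"
proof -
  define q where "q = exp (-y/2)"
  have q: "0 < q" "q < 1" using assms by (auto simp: q_def)
  have q2: "q^2 < 1" using q by (simp add: power_less_one_iff)
  have e1: "(\<lambda>n. real (Suc n) * (q^2)^n) sums (1 / (1 - q^2)^2)"
    using geometric_deriv_sums[of "q^2"] q2 by simp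
  have e2: "(\<lambda>n. (q^2)^n) sums (1 / (1 - q^2))"
    using geometric_sums[of "q^2"] q2 by simp
  have "(\<lambda>n. 4 * q * (real (Suc n) * (q^2)^n - 1/2 * (q^2)^n)) sums (4 * q * (1 / (1 - q^2)^2 - 1/2 * (1 / (1 - q^2))))"
    by (intro sums_mult sums_diff e1 e2)
  moreover have "4 * q * (real (Suc n) * (q^2)^n - 1/2 * (q^2)^n) = 4 * (real n + 1/2) * exp (- (real n + 1/2) * y)" for n
  proof -
    have "exp (- (real n + 1/2) * y) = q * (q^2)^n"
      unfolding q_def exp_of_nat_mult[symmetric] power_mult[symmetric] exp_add[symmetric]
      by (simp add: algebra_simps)
    then show ?thesis by (simp add: algebra_simps)
  qed
  moreover have "4 * q * (1 / (1 - q^2)^2 - 1/2 * (1 / (1 - q^2))) = tanh_kernel y"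
  proof -
    have "exp (y/2) = 1 / q" by (simp add: q_def exp_minus field_simps)
    then have "cosh (y/2) = (1/q + q) / 2" "sinh (y/2) = (1/q - q) / 2"
      by (simp_all add: cosh_field_def sinh_field_def q_def)
    then have c: "cosh (y/2) = (1 + q^2) / (2*q)" "sinh (y/2) = (1 - q^2) / (2*q)"
      using q by (simp_all add: field_simps power2_eq_square)
    have "1 - q^2 \<noteq> 0" using q2 by simp
    then show ?thesis unfolding tanh_kernel_def c using q
      by (simp add: divide_simps) (simp add: algebra_simps power2_eq_square)
  qed
  ultimately show ?thesis by simp
qed

text \<open>The value is 1/a - a/(a^2 + \<nu>^2); \<open>?F\<close> is the explicit primitive,
  vanishing at infinity.\<close>

lemma nn_integral_one_minus_cos_exp:
  assumes "a > 0"
  shows "(\<integral>\<^sup>+y. ennreal ((1 - cos (\<nu> * y)) * exp (- a * y)) * indicator {0..} y \<partial>lborel) = ennreal (\<nu>\<^sup>2 / (a * (a\<^sup>2 + \<nu>\<^sup>2)))"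
proof -
  let ?F = "\<lambda>y. - exp (- a * y) / a - exp (- a * y) * (\<nu> * sin (\<nu> * y) - a * cos (\<nu> * y)) / (a\<^sup>2 + \<nu>\<^sup>2)"
  have p: "a\<^sup>2 + \<nu>\<^sup>2 > 0" using assms by (simp add: add_pos_nonneg)
  have "(\<integral>\<^sup>+y. ennreal ((1 - cos (\<nu> * y)) * exp (- a * y)) * indicator {0..} y \<partial>lborel) = ennreal (0 - ?F 0)"
  proof (rule nn_integral_FTC_atLeast)
    fix y :: real
    show "(?F has_field_derivative (1 - cos (\<nu> * y)) * exp (- a * y)) (at y)"
      using assms p apply (auto intro!: derivative_eq_intros)
      by (simp add: divide_simps) (simp add: algebra_simps power2_eq_square)
    show "0 \<le> (1 - cos (\<nu> * y)) * exp (- a * y)" by simp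
  next
    have e: "((\<lambda>y. exp (- a * y)) \<longlongrightarrow> 0) at_top"
      using assms by (intro filterlim_compose[OF exp_at_bot] filterlim_tendsto_neg_mult_at_bot[OF tendsto_const] filterlim_ident) auto
    have "((\<lambda>y. exp (- a * y) * (\<nu> * sin (\<nu> * y) - a * cos (\<nu> * y))) \<longlongrightarrow> 0) at_top"
    proof (rule Lim_null_comparison)
      show "\<forall>\<^sub>F y in at_top. norm (exp (- a * y) * (\<nu> * sin (\<nu> * y) - a * cos (\<nu> * y))) \<le> exp (- a * y) * (\<bar>\<nu>\<bar> + a)"
      proof (rule always_eventually, rule allI)
        fix y
        have "\<bar>\<nu> * sin (\<nu> * y)\<bar> \<le> \<bar>\<nu>\<bar>" "\<bar>a * cos (\<nu> * y)\<bar> \<le> a"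
          using assms by (auto simp: abs_mult mult_left_le)
        then have "\<bar>\<nu> * sin (\<nu> * y) - a * cos (\<nu> * y)\<bar> \<le> \<bar>\<nu>\<bar> + a" by linarith
        then show "norm (exp (- a * y) * (\<nu> * sin (\<nu> * y) - a * cos (\<nu> * y))) \<le> exp (- a * y) * (\<bar>\<nu>\<bar> + a)"
          by (simp add: abs_mult)
      qed
      show "((\<lambda>y. exp (- a * y) * (\<bar>\<nu>\<bar> + a)) \<longlongrightarrow> 0) at_top" by (rule tendsto_mult_left_zero[OF e])
    qed
    from tendsto_diff[OF tendsto_minus[OF tendsto_divide[OF e tendsto_const]] tendsto_divide[OF this tendsto_const]]
    show "(?F \<longlongrightarrow> 0) at_top" using assms p by simp
  qed auto
  moreover have "0 - ?F 0 = \<nu>\<^sup>2 / (a * (a\<^sup>2 + \<nu>\<^sup>2))"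
    using assms p by (simp add: divide_simps) (simp add: algebra_simps power2_eq_square)
  ultimately show ?thesis by simp
qed

text \<open>Every summand is nonnegative, so the series may be integrated termwise. The coefficient
  4(n + 1/2) cancels the 1/a of the term integral and leaves 4 \<nu> times the partial fractions of
  tanh.\<close>

lemma nn_integral_tanh_kernel:
  assumes "\<nu> > 0"
  shows "(\<integral>\<^sup>+y. ennreal ((1 - cos (\<nu> * y)) * tanh_kernel y) * indicator {0<..} y \<partial>lborel) = ennreal (2 * pi * \<nu> * tanh (pi * \<nu>))"
proof -
  let ?a = "\<lambda>n. real n + 1/2"
  let ?h = "\<lambda>n y. ennreal (4 * ?a n) * (ennreal ((1 - cos (\<nu> * y)) * exp (- ?a n * y)) * indicator {0..} y)"
  have "(\<integral>\<^sup>+y. ennreal ((1 - cos (\<nu> * y)) * tanh_kernel y) * indicator {0<..} y \<partial>lborel) = (\<integral>\<^sup>+y. (\<Sum>n. ?h n y) \<partial>lborel)"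
  proof (rule nn_integral_cong_AE)
    have "AE y in lborel. y \<noteq> (0::real)" by (rule AE_lborel_singleton)
    then show "AE y in lborel. ennreal ((1 - cos (\<nu> * y)) * tanh_kernel y) * indicator {0<..} y = (\<Sum>n. ?h n y)"
    proof eventually_elim
      case (elim y)
      show ?case
      proof (cases "y > 0")
        case True
        have "(\<lambda>n. (1 - cos (\<nu> * y)) * (4 * ?a n * exp (- ?a n * y))) sums ((1 - cos (\<nu> * y)) * tanh_kernel y)"
          by (intro sums_mult tanh_kernel_sums True)
        then have "(\<Sum>n. ennreal ((1 - cos (\<nu> * y)) * (4 * ?a n * exp (- ?a n * y)))) = ennreal ((1 - cos (\<nu> * y)) * tanh_kernel y)"
          by (intro suminf_ennreal_eq) auto
        moreover have "?h n y = ennreal ((1 - cos (\<nu> * y)) * (4 * ?a n * exp (- ?a n * y)))" for n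
          using True ennreal_mult[of "4 * ?a n" "(1 - cos (\<nu> * y)) * exp (- ?a n * y)"]
            by (subst mult.left_commute) (simp add: mult_ac)
        ultimately show ?thesis using True by simp
      qed (use elim in auto)
    qed
  qed
  also have "\<dots> = (\<Sum>n. \<integral>\<^sup>+y. ?h n y \<partial>lborel)"
    by (intro nn_integral_suminf) measurable
  also have "\<dots> = (\<Sum>n. ennreal (4 * \<nu> * (\<nu> / ((real n + 1/2)\<^sup>2 + \<nu>\<^sup>2))))"
  proof (intro suminf_cong)
    fix n
    have "(\<integral>\<^sup>+y. ?h n y \<partial>lborel) = ennreal (4 * ?a n) * ennreal (\<nu>\<^sup>2 / (?a n * ((?a n)\<^sup>2 + \<nu>\<^sup>2)))"
      by (subst nn_integral_cmult, measurable) (subst nn_integral_one_minus_cos_exp, auto)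
    also have "\<dots> = ennreal (4 * \<nu> * (\<nu> / ((real n + 1/2)\<^sup>2 + \<nu>\<^sup>2)))"
    proof (subst ennreal_mult[symmetric])
      have "4 * a * (\<nu>\<^sup>2 / (a * (a\<^sup>2 + \<nu>\<^sup>2))) = 4 * \<nu> * (\<nu> / (a\<^sup>2 + \<nu>\<^sup>2))" if "a > 0" for a
        using that by (simp add: power2_eq_square)
      from this[of "?a n"] show "ennreal (4 * ?a n * (\<nu>\<^sup>2 / (?a n * ((?a n)\<^sup>2 + \<nu>\<^sup>2)))) = ennreal (4 * \<nu> * (\<nu> / ((real n + 1/2)\<^sup>2 + \<nu>\<^sup>2)))"
        by simp
    qed auto
    finally show "(\<integral>\<^sup>+y. ?h n y \<partial>lborel) = \<dots>" .
  qed
  also have "\<dots> = ennreal (4 * \<nu> * (pi * tanh (pi * \<nu>) / 2))"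
    using assms by (intro suminf_ennreal_eq sums_mult tanh_partial_fractions) auto
  finally show ?thesis by (simp add: mult_ac)
qed

section \<open>Exponential integrals from Euler's Gamma integral\<close>

lemma absolutely_integrable_UNIV_lborel:
  fixes f :: "real \<Rightarrow> complex"
  assumes "f \<in> borel_measurable borel" "f absolutely_integrable_on UNIV"
  shows "integrable lborel f" "integral\<^sup>L lborel f = integral UNIV f"
proof -
  have "integrable lebesgue f" using assms(2) by (simp add: set_integrable_def)
  then show i: "integrable lborel f" using assms(1) by (simp add: integrable_completion)
  show "integral\<^sup>L lborel f = integral UNIV f"
    using has_integral_integral_lborel[OF i] by (simp add: integral_unique)
qed

lemma has_bochner_integral_exp_decay:
  assumes "b > (0::real)"
  shows "has_bochner_integral lborel (\<lambda>t. indicator {0<..} t * exp (- t * b)) (1 / b)"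
proof (rule has_bochner_integral_nn_integral)
  have "(\<integral>\<^sup>+t. ennreal (exp (- t * b)) * indicator {0..} t \<partial>lborel) = ennreal (0 - (- exp (- 0 * b) / b))"
  proof (rule nn_integral_FTC_atLeast)
    show "((\<lambda>t. - exp (- t * b) / b) has_field_derivative exp (- t * b)) (at t)" for t
      using assms by (auto intro!: derivative_eq_intros)
    have e: "((\<lambda>t. exp (- t * b)) \<longlongrightarrow> 0) at_top"
      using filterlim_compose[OF exp_at_bot filterlim_tendsto_neg_mult_at_bot[OF tendsto_const _ filterlim_ident, of "-b"]] assms
      by (simp add: mult.commute)
    show "((\<lambda>t. - exp (- t * b) / b) \<longlongrightarrow> 0) at_top"
      using tendsto_divide[OF tendsto_minus[OF e] tendsto_const, of b] assms by simp
  qed auto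
  moreover have "(\<integral>\<^sup>+t. ennreal (indicator {0<..} t * exp (- t * b)) \<partial>lborel) = (\<integral>\<^sup>+t. ennreal (exp (- t * b)) * indicator {0..} t \<partial>lborel)"
    by (rule nn_integral_cong_AE, rule eventually_mono[OF AE_lborel_singleton[of 0]]) (auto simp: indicator_def)
  ultimately show "(\<integral>\<^sup>+t. ennreal (indicator {0<..} t * exp (- t * b)) \<partial>lborel) = ennreal (1 / b)" by simp
qed (use assms in auto)

lemma integrable_exp_abs_decay:
  assumes "c > (0::real)"
  shows "integrable lborel (\<lambda>x. exp (- c * \<bar>x\<bar>))"
proof -
  let ?h = "\<lambda>t. indicator {0<..} t * exp (- t * c)"
  have i: "integrable lborel ?h" using has_bochner_integral_exp_decay[OF assms] by (rule integrable.intros)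
  have i': "integrable lborel (\<lambda>x. ?h (- x))" using lborel_integrable_real_affine[OF i, of "-1" 0] by simp
  show ?thesis
  proof (rule Bochner_Integration.integrable_bound[OF Bochner_Integration.integrable_add[OF i i']])
    show "AE x in lborel. norm (exp (- c * \<bar>x\<bar>)) \<le> norm (?h x + ?h (- x))"
      by (rule eventually_mono[OF AE_lborel_singleton[of 0]]) (auto simp: indicator_def mult.commute)
  qed auto
qed

text \<open>Euler's integral under the substitution \<tau> = t exp(y), which replaces the half-line
  by the whole line and moves the power of t out as a factor.\<close>

lemma Gamma_exponential_integral:
  assumes s: "Re s > 0" and t: "t > 0"
  shows "integrable lborel (\<lambda>y. exp (s * of_real y) * of_real (exp (- t * exp y)))"
    "(\<integral>y. exp (s * of_real y) * of_real (exp (- t * exp y)) \<partial>lborel) = Gamma s * of_real t powr (- s)"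
proof -
  let ?f = "\<lambda>\<tau>. complex_of_real \<tau> powr (s - 1) / of_real (exp \<tau>)"
  let ?F = "\<lambda>y. \<bar>t * exp y\<bar> *\<^sub>R ?f (t * exp y)"
  have img: "(\<lambda>y. t * exp y) ` UNIV = {0<..}"
  proof safe
    fix x :: real assume "x > 0"
    then have "x = t * exp (ln (x / t))" using t by simp
    then show "x \<in> range (\<lambda>y. t * exp y)" by blast
  qed (use t in auto)
  have "?F absolutely_integrable_on UNIV \<and> integral UNIV ?F = Gamma s \<longleftrightarrow>
     ?f absolutely_integrable_on ((\<lambda>y. t * exp y) ` UNIV) \<and> integral ((\<lambda>y. t * exp y) ` UNIV) ?f = Gamma s"
    by (rule has_absolute_integral_change_of_variables_real)
      (use t in \<open>auto intro!: derivative_eq_intros injI\<close>)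
  moreover have "?f absolutely_integrable_on {0<..}" "integral {0<..} ?f = Gamma s"
    using absolutely_integrable_Gamma_integral'[OF s] Gamma_integral_complex'[OF s] by auto
  ultimately have F: "?F absolutely_integrable_on UNIV" "integral UNIV ?F = Gamma s" unfolding img by auto
  have eq: "?F y = of_real t powr s * (exp (s * of_real y) * of_real (exp (- t * exp y)))" for y
  proof -
    have L: "Ln (complex_of_real (t * exp y)) = of_real (ln t) + of_real y"
      using t by (subst Ln_of_real) (auto simp: ln_mult)
    have L': "Ln (complex_of_real t) = of_real (ln t)" using t by (subst Ln_of_real) auto
    have a: "of_real (t * exp y) powr (s - 1) = exp ((s - 1) * (of_real (ln t) + of_real y))"
      using t by (subst powr_def) (simp only: L, simp)
    have b: "complex_of_real \<bar>t * exp y\<bar> = exp (of_real (ln t) + of_real y)"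
      using t by (simp add: exp_add exp_of_real)
    have c: "complex_of_real t powr s = exp (s * of_real (ln t))"
      using t by (subst powr_def) (simp only: L', simp)
    show ?thesis
      unfolding scaleR_conv_of_real a b c
      by (simp add: exp_add[symmetric] exp_minus field_simps del: of_real_exp)
  qed
  have tp: "of_real t powr s \<noteq> (0::complex)" using t by simp
  have meas: "(\<lambda>y. exp (s * of_real y) * of_real (exp (- t * exp y))) \<in> borel_measurable borel"
    by measurable
  have "?F \<in> borel_measurable borel" unfolding eq using meas by measurable
  note A = absolutely_integrable_UNIV_lborel[OF this F(1), unfolded F(2)]
  then show i: "integrable lborel (\<lambda>y. exp (s * of_real y) * of_real (exp (- t * exp y)))"
    using integrable_mult_right[OF A(1)[unfolded eq], of "inverse (of_real t powr s)"] tp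
    by (simp add: mult.assoc[symmetric])
  show "(\<integral>y. exp (s * of_real y) * of_real (exp (- t * exp y)) \<partial>lborel) = Gamma s * of_real t powr (- s)"
    using A(2) unfolding eq using tp by (simp add: powr_minus field_simps)
qed

text \<open>1 / (1 + exp y) is the Laplace integral of exp(-t(1 + exp y)). After Fubini the
  y-integral is Gamma(s) t^(-s) up to exp(-t), the remaining t-integral is Gamma(1 - s), and the
  reflection formula closes the computation.\<close>

lemma logistic_exponential_integral:
  assumes s: "0 < Re s" "Re s < 1"
  shows "integrable lborel (\<lambda>y. exp (s * of_real y) / of_real (1 + exp y))"
    "(\<integral>y. exp (s * of_real y) / of_real (1 + exp y) \<partial>lborel) = of_real pi / sin (of_real pi * s)"
proof -
  define K where "K = (\<lambda>(y::real, t::real). indicator {0<..} t *\<^sub>R (exp (s * of_real y) * of_real (exp (- t * (1 + exp y)))))"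
  have Km: "K \<in> borel_measurable (lborel \<Otimes>\<^sub>M lborel)"
    unfolding K_def by measurable
  have inner: "has_bochner_integral lborel (\<lambda>t. K (y, t)) (exp (s * of_real y) / of_real (1 + exp y))" for y
  proof -
    have "has_bochner_integral lborel (\<lambda>t. indicator {0<..} t * exp (- t * (1 + exp y))) (1 / (1 + exp y))"
      by (intro has_bochner_integral_exp_decay add_pos_pos) auto
    from has_bochner_integral_mult_right[OF has_bochner_integral_of_real[OF this, where 'a=complex], of "exp (s * of_real y)"]
    show ?thesis by (simp add: K_def scaleR_conv_of_real mult_ac)
  qed
  have innorm: "(\<integral>t. norm (K (y, t)) \<partial>lborel) = exp (Re s * y) / (1 + exp y)" for y
  proof -
    have "has_bochner_integral lborel (\<lambda>t. exp (Re s * y) * (indicator {0<..} t * exp (- t * (1 + exp y)))) (exp (Re s * y) * (1 / (1 + exp y)))"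
      by (intro has_bochner_integral_mult_right has_bochner_integral_exp_decay add_pos_pos) auto
    then have "(\<integral>t. exp (Re s * y) * (indicator {0<..} t * exp (- t * (1 + exp y))) \<partial>lborel) = exp (Re s * y) / (1 + exp y)"
      by (simp add: has_bochner_integral_iff)
    moreover have "norm (K (y, t)) = exp (Re s * y) * (indicator {0<..} t * exp (- t * (1 + exp y)))" for t
      by (simp add: K_def norm_mult mult_ac)
    ultimately show ?thesis by simp
  qed
  \<comment> \<open>Decay rate common to both ends: the integrand behaves like exp(Re s y) at
    -infinity and like exp((Re s - 1) y) at +infinity.\<close>
  define c where "c = min (Re s) (1 - Re s)"
  have c: "c > 0" using s by (auto simp: c_def)
  have dec: "exp (Re s * y) / (1 + exp y) \<le> exp (- c * \<bar>y\<bar>)" for y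
  proof (cases "y \<ge> 0")
    case True
    have "exp (Re s * y) / (1 + exp y) \<le> exp (Re s * y) / exp y"
      by (intro divide_left_mono mult_pos_pos) (auto simp: add_pos_pos)
    also have "\<dots> = exp (- (1 - Re s) * y)" by (simp add: exp_diff[symmetric] algebra_simps)
    also have "\<dots> \<le> exp (- c * \<bar>y\<bar>)"
      using True mult_right_mono[of c "1 - Re s" y] by (simp add: c_def left_diff_distrib)
    finally show ?thesis .
  next
    case False
    have "exp (Re s * y) / (1 + exp y) \<le> exp (Re s * y) / 1"
      by (intro divide_left_mono mult_pos_pos) (auto simp: add_pos_pos)
    also have "\<dots> \<le> exp (- c * \<bar>y\<bar>)" using False mult_right_mono_neg[of c "Re s" y] by (simp add: c_def)
    finally show ?thesis by simp
  qed
  have int: "integrable lborel (\<lambda>y. exp (Re s * y) / (1 + exp y))"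
    by (rule Bochner_Integration.integrable_bound[OF integrable_exp_abs_decay[OF c]])
      (use dec in \<open>auto simp: add_pos_pos abs_of_pos\<close>)
  have pi: "integrable (lborel \<Otimes>\<^sub>M lborel) K"
    by (rule lborel_pair.Fubini_integrable[OF Km])
      (use int inner in \<open>auto simp: innorm has_bochner_integral_iff\<close>)
  show "integrable lborel (\<lambda>y. exp (s * of_real y) / of_real (1 + exp y))"
    by (rule Bochner_Integration.integrable_bound[OF int])
      (auto simp: norm_divide norm_mult add_pos_pos abs_of_pos simp del: of_real_add)
  have "(\<integral>y. exp (s * of_real y) / of_real (1 + exp y) \<partial>lborel) = (\<integral>y. (\<integral>t. K (y, t) \<partial>lborel) \<partial>lborel)"
    using inner by (simp add: has_bochner_integral_iff)
  also have "\<dots> = (\<integral>t. (\<integral>y. K (y, t) \<partial>lborel) \<partial>lborel)"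
    using lborel_pair.Fubini_integral[of "\<lambda>y t. K (y, t)"] pi by simp
  also have "\<dots> = (\<integral>t. indicator {0<..} t *\<^sub>R (Gamma s * (of_real t powr ((1 - s) - 1) / of_real (exp t))) \<partial>lborel)"
  proof (rule Bochner_Integration.integral_cong[OF refl])
    fix t :: real
    show "(\<integral>y. K (y, t) \<partial>lborel) = indicator {0<..} t *\<^sub>R (Gamma s * (of_real t powr ((1 - s) - 1) / of_real (exp t)))"
    proof (cases "t > 0")
      case True
      have "K (y, t) = of_real (exp (- t)) * (exp (s * of_real y) * of_real (exp (- t * exp y)))" for y
        using True by (simp add: K_def algebra_simps exp_diff exp_minus divide_inverse)
      then have "(\<integral>y. K (y, t) \<partial>lborel) = of_real (exp (- t)) * (Gamma s * of_real t powr (- s))"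
        by (simp only: integral_mult_right_zero Gamma_exponential_integral(2)[OF s(1) True])
      then show ?thesis using True
        by (simp add: exp_minus field_simps)
    qed (simp add: K_def)
  qed
  also have "\<dots> = Gamma s * (\<integral>t. indicator {0<..} t *\<^sub>R (of_real t powr ((1 - s) - 1) / of_real (exp t)) \<partial>lborel)"
    by (subst integral_mult_right_zero[symmetric]) (simp add: scaleR_conv_of_real mult_ac)
  also have "(\<integral>t. indicator {0<..} t *\<^sub>R (of_real t powr ((1 - s) - 1) / of_real (exp t)) \<partial>lborel) = Gamma (1 - s)"
  proof -
    let ?f = "\<lambda>t. complex_of_real t powr ((1 - s) - 1) / of_real (exp t)"
    have ab: "?f absolutely_integrable_on {0<..}"
      by (rule absolutely_integrable_Gamma_integral') (use s in simp)
    have m: "set_borel_measurable borel {0<..} ?f"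
      unfolding set_borel_measurable_def by measurable
    have "set_integrable lborel {0<..} ?f"
      using ab m unfolding set_integrable_def set_borel_measurable_def by (simp add: integrable_completion)
    then have "(LINT t:{0<..}|lborel. ?f t) = integral {0<..} ?f"
      by (rule set_borel_integral_eq_integral)
    also have "\<dots> = Gamma (1 - s)"
      by (rule integral_unique, rule Gamma_integral_complex') (use s in simp)
    finally show ?thesis by (simp add: set_lebesgue_integral_def)
  qed
  also have "Gamma s * Gamma (1 - s) = of_real pi / sin (of_real pi * s)"
    by (rule Gamma_reflection_complex)
  finally show "(\<integral>y. exp (s * of_real y) / of_real (1 + exp y) \<partial>lborel) = of_real pi / sin (of_real pi * s)" .
qed

section \<open>The Fourier pair of the hyperbolic secant\<close>

text \<open>The logistic integral at s = \<zeta> + 1/2, because 1 + exp y = exp(y/2) 2 cosh(y/2);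
  the strip |Re \<zeta>| < 1/2 is 0 < Re s < 1.\<close>

lemma sech_Fourier_strip:
  assumes "\<bar>Re \<zeta>\<bar> < 1/2"
  shows "integrable lborel (\<lambda>y. exp (\<zeta> * of_real y) / of_real (2 * cosh (y/2)))"
    "(\<integral>y. exp (\<zeta> * of_real y) / of_real (2 * cosh (y/2)) \<partial>lborel) = of_real pi / cos (of_real pi * \<zeta>)"
proof -
  have s: "0 < Re (\<zeta> + 1/2)" "Re (\<zeta> + 1/2) < 1" using assms by auto
  have eq: "exp ((\<zeta> + 1/2) * of_real y) / of_real (1 + exp y) = exp (\<zeta> * of_real y) / of_real (2 * cosh (y/2))" for y
  proof -
    have "1 + exp y = exp (y/2) * (2 * cosh (y/2))"
      by (simp add: cosh_field_def algebra_simps flip: exp_add)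
    moreover have "exp ((\<zeta> + 1/2) * of_real y) = exp (\<zeta> * of_real y) * of_real (exp (y/2))"
      by (simp add: ring_distribs exp_add flip: exp_of_real)
    ultimately show ?thesis by simp
  qed
  have "sin (of_real pi * (\<zeta> + 1/2)) = cos (of_real pi * \<zeta>)"
    by (simp add: ring_distribs sin_add)
  with logistic_exponential_integral[OF s] show "integrable lborel (\<lambda>y. exp (\<zeta> * of_real y) / of_real (2 * cosh (y/2)))"
    "(\<integral>y. exp (\<zeta> * of_real y) / of_real (2 * cosh (y/2)) \<partial>lborel) = of_real pi / cos (of_real pi * \<zeta>)"
    unfolding eq by auto
qed

text \<open>Rescaling y = 2 pi \<nu> with \<zeta> = iL / (2 pi); the condition on
  \<open>Im L\<close> is the strip condition on \<open>\<zeta>\<close>. Complex \<open>L\<close> is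
  allowed because the phase difference of A and B enters through it.\<close>

lemma sech_Fourier_transform:
  assumes "\<bar>Im L\<bar> < pi"
  shows "integrable lborel (\<lambda>\<nu>. exp (\<i> * of_real \<nu> * L) / of_real (cosh (pi * \<nu>)))"
    "(\<integral>\<nu>. exp (\<i> * of_real \<nu> * L) / of_real (cosh (pi * \<nu>)) \<partial>lborel) = 1 / cosh (L / 2)"
proof -
  define \<zeta> where "\<zeta> = \<i> * L / of_real (2 * pi)"
  have \<zeta>: "\<bar>Re \<zeta>\<bar> < 1/2" using assms by (simp add: \<zeta>_def abs_mult)
  let ?f = "\<lambda>y. exp (\<zeta> * of_real y) / of_real (2 * cosh (y/2))"
  have eq: "?f (0 + (2 * pi) * \<nu>) = (exp (\<i> * of_real \<nu> * L) / of_real (cosh (pi * \<nu>))) / 2" for \<nu>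
  proof -
    have "\<zeta> * of_real (2 * pi * \<nu>) = \<i> * of_real \<nu> * L" by (simp add: \<zeta>_def)
    then show ?thesis by (simp only: add_0) (simp add: mult.assoc)
  qed
  have c: "cos (of_real pi * \<zeta>) = cosh (L / 2)"
    by (simp add: \<zeta>_def cosh_conv_cos)
  note S = sech_Fourier_strip[OF \<zeta>]
  have "integrable lborel (\<lambda>\<nu>. ?f (0 + (2 * pi) * \<nu>))"
    by (rule lborel_integrable_real_affine[OF S(1)]) simp
  then show "integrable lborel (\<lambda>\<nu>. exp (\<i> * of_real \<nu> * L) / of_real (cosh (pi * \<nu>)))"
    unfolding eq using integrable_mult_right[where c=2] by fastforce
  have "of_real pi / cosh (L / 2) = \<bar>2 * pi\<bar> *\<^sub>R (\<integral>\<nu>. ?f (0 + (2 * pi) * \<nu>) \<partial>lborel)"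
    unfolding c[symmetric] S(2)[symmetric] by (rule lborel_integral_real_affine) simp
  then show "(\<integral>\<nu>. exp (\<i> * of_real \<nu> * L) / of_real (cosh (pi * \<nu>)) \<partial>lborel) = 1 / cosh (L / 2)"
    unfolding eq integral_divide_zero
    using mult_left_cancel[of "complex_of_real pi" "1 / cosh (L / 2)"] by (simp add: scaleR_conv_of_real field_simps)
qed

lemma Re_cosh: "Re (cosh z) = cosh (Re z) * cos (Im z)"
  by (simp add: cosh_field_def Re_exp field_simps)

lemma cmod_cosh_ge:
  "cosh (Re z) * cos (Im z) \<le> cmod (cosh z)"
  using complex_Re_le_cmod[of "cosh z"] by (simp add: Re_cosh)

lemma cosh_ge_exp_abs: "exp \<bar>x\<bar> / 2 \<le> cosh (x::real)"
  by (cases "x \<ge> 0") (auto simp: cosh_field_def)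

lemma measurable_cosh_complex [measurable]:
  "(cosh :: complex \<Rightarrow> complex) \<in> borel_measurable borel"
  by (intro borel_measurable_continuous_onI continuous_intros)

lemma measurable_cosh_real [measurable]:
  "(cosh :: real \<Rightarrow> real) \<in> borel_measurable borel"
  by (intro borel_measurable_continuous_onI continuous_intros)

lemma integrable_sech: "integrable lborel (\<lambda>y. 1 / cosh (y / 2 :: real))"
proof (rule Bochner_Integration.integrable_bound[of _ "\<lambda>y. 2 * exp (- (1/2) * \<bar>y\<bar>) :: real"])
  show "integrable lborel (\<lambda>y. 2 * exp (- (1/2) * \<bar>y\<bar>) :: real)"
    by (intro integrable_mult_right integrable_exp_abs_decay) auto
  show "AE y::real in lborel. norm (1 / cosh (y / 2)) \<le> norm (2 * exp (- (1/2) * \<bar>y\<bar>))"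
  proof (rule AE_I2)
    fix y :: real
    have "1 / cosh (y / 2) \<le> 1 / (exp \<bar>y/2\<bar> / 2)"
      by (intro divide_left_mono cosh_ge_exp_abs mult_pos_pos) auto
    also have "\<dots> = 2 * exp (- (1/2) * \<bar>y\<bar>)" by (simp add: exp_minus field_simps)
    finally show "norm (1 / cosh (y / 2)) \<le> norm (2 * exp (- (1/2) * \<bar>y\<bar>))" by simp
  qed
qed measurable

text \<open>Re cosh(a + ib) = cosh a cos b, and the cosine stays away from 0 as long as |b| stays a
  fixed amount below pi/2. The estimate is therefore uniform over a closed substrip of |Im L| <
  pi.\<close>

lemma sech_norm_bound:
  assumes "\<bar>Im L\<bar> \<le> b" "b < pi"
  shows "cosh ((L + of_real y) / 2) \<noteq> 0"
    "cmod (1 / cosh ((L + of_real y) / 2)) \<le> (1 / cos (b/2)) * (1 / cosh ((Re L + y) / 2))"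
proof -
  have b: "b \<ge> 0" using assms by linarith
  have cb: "cos (b/2) > 0" using assms b by (intro cos_gt_zero_pi) auto
  have "cos (b/2) \<le> cos (\<bar>Im L / 2\<bar>)"
    by (rule cos_monotone_0_pi_le) (use assms in auto)
  then have "cosh ((Re L + y) / 2) * cos (b/2) \<le> cosh ((Re L + y) / 2) * cos (Im L / 2)"
    by (intro mult_left_mono) (auto simp: abs_if split: if_splits)
  also have "\<dots> \<le> cmod (cosh ((L + of_real y) / 2))"
    using cmod_cosh_ge[of "(L + of_real y) / 2"] by simp
  finally have *: "cosh ((Re L + y) / 2) * cos (b/2) \<le> cmod (cosh ((L + of_real y) / 2))" .
  moreover have p: "cosh ((Re L + y) / 2) * cos (b/2) > 0" using cb by simp
  ultimately show "cosh ((L + of_real y) / 2) \<noteq> 0" by (metis norm_zero not_le)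
  have "cmod (1 / cosh ((L + of_real y) / 2)) = 1 / cmod (cosh ((L + of_real y) / 2))" by (simp add: norm_divide)
  also have "\<dots> \<le> 1 / (cosh ((Re L + y) / 2) * cos (b/2))"
    using * p by (intro divide_left_mono mult_pos_pos[OF less_le_trans[OF p *]]) auto
  finally show "cmod (1 / cosh ((L + of_real y) / 2)) \<le> (1 / cos (b/2)) * (1 / cosh ((Re L + y) / 2))"
    by (simp add: mult.commute)
qed

text \<open>The substitution z = L + y puts the integral on the line Im z = Im L. Since cosh(z/2)
  has no zero with |Im z| < pi, the line can be moved to the real axis, where the strip formula with
  purely imaginary \<zeta> applies.\<close>

lemma sech_inverse_Fourier_transform:
  assumes L: "\<bar>Im L\<bar> < pi"
  shows "integrable lborel (\<lambda>y. exp (- \<i> * of_real \<nu> * of_real y) / cosh ((L + of_real y) / 2))"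
    "(\<integral>y. exp (- \<i> * of_real \<nu> * of_real y) / cosh ((L + of_real y) / 2) \<partial>lborel) =
       2 * of_real pi * exp (\<i> * of_real \<nu> * L) / of_real (cosh (pi * \<nu>))"
proof -
  define \<theta> where "\<theta> = Im L"
  define q where "q = (\<lambda>z. exp (- \<i> * of_real \<nu> * z) / cosh (z / 2))"
  have cb: "cos (\<theta>/2) > 0" using L by (intro cos_gt_zero_pi) (auto simp: \<theta>_def)
  have qn: "cmod (q (Complex x y)) \<le> (exp (\<bar>\<nu>\<bar> * \<bar>\<theta>\<bar>) / cos (\<theta>/2)) * (1 / cosh (x / 2))" if y: "\<bar>y\<bar> \<le> \<bar>\<theta>\<bar>" for x y
  proof -
    have s: "cmod (1 / cosh (Complex x y / 2)) \<le> (1 / cos (\<bar>\<theta>\<bar>/2)) * (1 / cosh (x / 2))"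
      using sech_norm_bound(2)[of "Complex x y" "\<bar>\<theta>\<bar>" 0] y L by (simp add: \<theta>_def)
    have c: "cos (\<bar>\<theta>\<bar>/2) = cos (\<theta>/2)" by (cases "\<theta> \<ge> 0") auto
    have "\<nu> * y \<le> \<bar>\<nu>\<bar> * \<bar>\<theta>\<bar>"
      using y abs_ge_self[of "\<nu> * y"] mult_left_mono[OF y, of "\<bar>\<nu>\<bar>"] by (simp add: abs_mult)
    then have "cmod (exp (- \<i> * of_real \<nu> * Complex x y)) \<le> exp (\<bar>\<nu>\<bar> * \<bar>\<theta>\<bar>)"
      by simp
    then have "cmod (exp (- \<i> * of_real \<nu> * Complex x y)) * cmod (1 / cosh (Complex x y / 2)) \<le>
       exp (\<bar>\<nu>\<bar> * \<bar>\<theta>\<bar>) * ((1 / cos (\<theta>/2)) * (1 / cosh (x / 2)))"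
      using s unfolding c by (intro mult_mono) auto
    then show ?thesis by (simp add: q_def norm_divide)
  qed
  have qm: "(\<lambda>x. q (Complex x y)) \<in> borel_measurable borel" for y
    unfolding q_def Complex_eq by measurable
  have qi: "integrable lborel (\<lambda>x. q (Complex x y))" if y: "\<bar>y\<bar> \<le> \<bar>\<theta>\<bar>" for y
  proof (rule Bochner_Integration.integrable_bound[OF integrable_mult_right[OF integrable_sech, of "exp (\<bar>\<nu>\<bar> * \<bar>\<theta>\<bar>) / cos (\<theta>/2)"]])
    show "AE x in lborel. norm (q (Complex x y)) \<le> norm (exp (\<bar>\<nu>\<bar> * \<bar>\<theta>\<bar>) / cos (\<theta>/2) * (1 / cosh (x / 2)))"
      using qn[OF y] cb by (auto intro!: AE_I2)
  qed (use qm in simp)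
  have r: "complex_of_real x = Complex x 0" for x by (simp add: complex_of_real_def)
  have div2: "filterlim (\<lambda>x::real. 1/2 * x) at_top at_top" "filterlim (\<lambda>x::real. 1/2 * x) at_bot at_bot"
    by (rule filterlim_tendsto_pos_mult_at_top[OF tendsto_const _ filterlim_ident]
       filterlim_tendsto_pos_mult_at_bot[OF tendsto_const _ filterlim_ident], simp)+
  have lim: "((\<lambda>x. 1 / cosh (1/2 * x :: real)) \<longlongrightarrow> 0) at_top" "((\<lambda>x. 1 / cosh (1/2 * x :: real)) \<longlongrightarrow> 0) at_bot"
    by (rule tendsto_divide_0[OF tendsto_const filterlim_at_top_imp_at_infinity],
       rule filterlim_compose[OF cosh_real_at_top] filterlim_compose[OF cosh_real_at_bot], rule div2)+
  have shift: "(\<integral>x. q (Complex x \<theta>) \<partial>lborel) = (\<integral>x. q (of_real x) \<partial>lborel)"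
  proof (rule holomorphic_horizontal_shift[where a="-pi" and b=pi])
    have nz: "cosh (z / 2) \<noteq> 0" if "- pi < Im z" "Im z < pi" for z
      using sech_norm_bound(1)[of z "\<bar>Im z\<bar>" 0] that by simp
    have "(\<lambda>z. cosh (z / 2)) holomorphic_on {z. - pi < Im z \<and> Im z < pi}"
      unfolding cosh_field_def by (intro holomorphic_intros) auto
    then show "q holomorphic_on {z. - pi < Im z \<and> Im z < pi}"
      unfolding q_def using nz
      by (intro holomorphic_intros) auto
    show "cmod (q (Complex x y)) \<le> (exp (\<bar>\<nu>\<bar> * \<bar>\<theta>\<bar>) / cos (\<theta>/2)) * (1 / cosh (x / 2))" if "y \<in> closed_segment 0 \<theta>" for x y
      using that by (intro qn) (auto simp: closed_segment_eq_real_ivl split: if_splits)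
    show "integrable lborel (\<lambda>x. q (of_real x))" unfolding r by (rule qi) simp
    show "integrable lborel (\<lambda>x. q (Complex x \<theta>))" by (rule qi) simp
    show "((\<lambda>x. (exp (\<bar>\<nu>\<bar> * \<bar>\<theta>\<bar>) / cos (\<theta>/2)) * (1 / cosh (x / 2))) \<longlongrightarrow> 0) at_top"
      "((\<lambda>x. (exp (\<bar>\<nu>\<bar> * \<bar>\<theta>\<bar>) / cos (\<theta>/2)) * (1 / cosh (x / 2))) \<longlongrightarrow> 0) at_bot"
      using lim[THEN tendsto_mult_right_zero, of "exp (\<bar>\<nu>\<bar> * \<bar>\<theta>\<bar>) / cos (\<theta>/2)"] by simp_all
  qed (use L in \<open>auto simp: \<theta>_def\<close>)
  have shifted: "exp (- \<i> * of_real \<nu> * of_real y) / cosh ((L + of_real y) / 2) = exp (\<i> * of_real \<nu> * L) * q (Complex (Re L + 1 * y) \<theta>)" for y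
  proof -
    have "Complex (Re L + 1 * y) \<theta> = L + of_real y" by (simp add: complex_eq_iff \<theta>_def)
    then show ?thesis by (simp add: q_def ring_distribs mult.assoc flip: exp_add)
  qed
  have i1: "integrable lborel (\<lambda>y. q (Complex (Re L + 1 * y) \<theta>))"
    by (rule lborel_integrable_real_affine) (use qi in auto)
  then show "integrable lborel (\<lambda>y. exp (- \<i> * of_real \<nu> * of_real y) / cosh ((L + of_real y) / 2))"
    unfolding shifted by (rule integrable_mult_right)
  have "(\<integral>x. q (Complex x \<theta>) \<partial>lborel) = \<bar>1\<bar> *\<^sub>R (\<integral>y. q (Complex (Re L + 1 * y) \<theta>) \<partial>lborel)"
    by (rule lborel_integral_real_affine) simp
  then have "(\<integral>y. exp (- \<i> * of_real \<nu> * of_real y) / cosh ((L + of_real y) / 2) \<partial>lborel) = exp (\<i> * of_real \<nu> * L) * (\<integral>x. q (of_real x) \<partial>lborel)"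
    unfolding shifted shift[symmetric] by simp
  also have "(\<integral>x. q (of_real x) \<partial>lborel) = 2 * (\<integral>y. exp ((- \<i> * of_real \<nu>) * of_real y) / of_real (2 * cosh (y/2)) \<partial>lborel)"
    unfolding q_def integral_mult_right_zero[symmetric]
    by (intro Bochner_Integration.integral_cong refl) (simp add: cosh_of_real_complex[symmetric])
  also have "\<dots> = 2 * of_real pi / of_real (cosh (pi * \<nu>))"
    by (subst sech_Fourier_strip(2)) (auto simp: cosh_of_real_complex[symmetric] cosh_conv_cos mult_ac)
  finally show "(\<integral>y. exp (- \<i> * of_real \<nu> * of_real y) / cosh ((L + of_real y) / 2) \<partial>lborel) =
       2 * of_real pi * exp (\<i> * of_real \<nu> * L) / of_real (cosh (pi * \<nu>))"
    by simp
qed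

section \<open>Bounds in the spectral parameter and the kernel identity in abstract form\<close>

lemma cosh_times_exp_le:
  fixes b :: real
  assumes "0 \<le> b"
  shows "exp (b * \<bar>\<nu>\<bar>) / cosh (pi * \<nu>) \<le> 2 * exp (- (pi - b) * \<bar>\<nu>\<bar>)"
proof -
  have "exp (pi * \<bar>\<nu>\<bar>) / 2 \<le> cosh (pi * \<nu>)" using cosh_ge_exp_abs[of "pi * \<nu>"] by (simp add: abs_mult)
  then have "exp (b * \<bar>\<nu>\<bar>) / cosh (pi * \<nu>) \<le> exp (b * \<bar>\<nu>\<bar>) / (exp (pi * \<bar>\<nu>\<bar>) / 2)"
    by (intro divide_left_mono mult_pos_pos) auto
  also have "\<dots> = 2 * exp (- (pi - b) * \<bar>\<nu>\<bar>)" by (simp add: left_diff_distrib exp_diff)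
  finally show ?thesis .
qed

text \<open>Half of the decay rate is spent on absorbing the factor |\<nu>|.\<close>

lemma abs_exp_decay_bound:
  assumes "c > (0::real)"
  shows "\<bar>\<nu>\<bar> * exp (- c * \<bar>\<nu>\<bar>) \<le> (2 / c) * exp (- (c / 2) * \<bar>\<nu>\<bar>)"
proof -
  have "c / 2 * \<bar>\<nu>\<bar> \<le> exp (c / 2 * \<bar>\<nu>\<bar>)" using exp_ge_add_one_self[of "c / 2 * \<bar>\<nu>\<bar>"] by linarith
  then have "\<bar>\<nu>\<bar> \<le> (2 / c) * exp (c / 2 * \<bar>\<nu>\<bar>)" using assms by (simp add: field_simps)
  then have "\<bar>\<nu>\<bar> * exp (- c * \<bar>\<nu>\<bar>) \<le> (2 / c) * exp (c / 2 * \<bar>\<nu>\<bar>) * exp (- c * \<bar>\<nu>\<bar>)"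
    by (intro mult_right_mono) auto
  also have "\<dots> = (2 / c) * exp (- (c / 2) * \<bar>\<nu>\<bar>)"
    by (simp add: mult.assoc flip: exp_add)
  finally show ?thesis .
qed

lemma tanh_kernel_nonneg: "y > 0 \<Longrightarrow> tanh_kernel y \<ge> 0"
  by (simp add: tanh_kernel_def)

lemma tanh_kernel_measurable [measurable]: "tanh_kernel \<in> borel_measurable borel"
  unfolding tanh_kernel_def sinh_field_def by measurable

lemma tanh_measurable [measurable]: "(tanh :: real \<Rightarrow> real) \<in> borel_measurable borel"
  unfolding tanh_def[abs_def] sinh_field_def by measurable

lemma integral_even_half:
  fixes f :: "real \<Rightarrow> complex"
  assumes i: "integrable lborel f" and even: "\<And>x. f (- x) = f x"
  shows "(\<integral>x. indicator {0<..} x *\<^sub>R f x \<partial>lborel) = (\<integral>x. f x \<partial>lborel) / 2"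
proof -
  have i1: "integrable lborel (\<lambda>x. indicator {0<..} x *\<^sub>R f x)" "integrable lborel (\<lambda>x. indicator {..<0} x *\<^sub>R f x)"
    using i by (auto intro: integrable_mult_indicator)
  have "(\<integral>x. f x \<partial>lborel) = (\<integral>x. indicator {0<..} x *\<^sub>R f x + indicator {..<0} x *\<^sub>R f x \<partial>lborel)"
    by (rule integral_cong_AE) (use i in \<open>auto intro!: eventually_mono[OF AE_lborel_singleton[of 0]] simp: indicator_def\<close>)
  also have "\<dots> = (\<integral>x. indicator {0<..} x *\<^sub>R f x \<partial>lborel) + (\<integral>x. indicator {..<0} x *\<^sub>R f x \<partial>lborel)"
    using i1 by simp
  also have "(\<integral>x. indicator {..<0} x *\<^sub>R f x \<partial>lborel) = \<bar>-1\<bar> *\<^sub>R (\<integral>x. indicator {..<0} (0 + -1 * x) *\<^sub>R f (0 + -1 * x) \<partial>lborel)"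
    by (rule lborel_integral_real_affine) simp
  also have "\<dots> = (\<integral>x. indicator {0<..} x *\<^sub>R f x \<partial>lborel)"
    by (simp add: even indicator_def)
  finally show ?thesis by simp
qed

text \<open>\<open>M\<close> and \<open>L\<close> stand for (AB)^(-1/2) and Ln A - Ln B. Two
  applications of Fubini make J(\<nu>) / cosh(pi \<nu>) and 2 \<phi> a Fourier pair, J being the
  inner integral over \<open>T\<close>. Evenness of \<open>\<phi>\<close> makes J even, which turns
  the half-line integral in \<nu> into a cosine transform. Inserting the representation of \<nu>
  tanh(pi \<nu>) by \<open>tanh_kernel\<close> and exchanging once more gives both claims.\<close>

lemma spectral_kernel_identity:
  fixes M L :: "'a \<Rightarrow> complex" and \<phi> :: "real \<Rightarrow> complex"
  assumes sf: "sigma_finite_measure T"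
    and Mi: "integrable T M" and Lm: "L \<in> borel_measurable T"
    and Lb: "\<And>t. \<bar>Im (L t)\<bar> \<le> b" and b: "b < pi"
    and \<phi>: "\<And>y. (\<integral>t. M t / cosh ((L t + of_real y) / 2) \<partial>T) = 2 * \<phi> y"
    and even: "\<And>y. \<phi> (- y) = \<phi> y"
  shows "integrable lborel (\<lambda>y. indicator {0<..} y *\<^sub>R (of_real (tanh_kernel y) * (\<phi> 0 - \<phi> y)))"
    and "(\<integral>\<nu>. indicator {0<..} \<nu> *\<^sub>R (of_real (\<nu> * tanh (pi * \<nu>) / cosh (pi * \<nu>)) *
            (\<integral>t. M t * exp (\<i> * of_real \<nu> * L t) \<partial>T)) \<partial>lborel) =
         (1 / (2 * of_real pi)) * (\<integral>y. indicator {0<..} y *\<^sub>R (of_real (tanh_kernel y) * (\<phi> 0 - \<phi> y)) \<partial>lborel)"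
proof -
  interpret T: sigma_finite_measure T by (rule sf)
  interpret TL: pair_sigma_finite T lborel ..
  note [measurable] = Lm borel_measurable_integrable[OF Mi]
  \<comment> \<open>\<open>Lb\<close> holds at every element of the type, so any one of them shows
    that \<open>b\<close> is nonnegative.\<close>
  have b0: "b \<ge> 0" using Lb[of undefined] by linarith
  have cb: "cos (b/2) > 0" using b b0 by (intro cos_gt_zero_pi) auto
  define J where "J = (\<lambda>\<nu>::real. \<integral>t. M t * exp (\<i> * of_real \<nu> * L t) \<partial>T)"
  define CM where "CM = (\<integral>t. cmod (M t) \<partial>T)"
  define CS where "CS = (\<integral>y. 1 / cosh (y / 2 :: real) \<partial>lborel)"
  have expb: "cmod (exp (\<i> * of_real \<nu> * L t)) \<le> exp (b * \<bar>\<nu>\<bar>)" for \<nu> t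
  proof -
    have "\<bar>\<nu> * Im (L t)\<bar> \<le> \<bar>\<nu>\<bar> * b" using Lb[of t] by (simp add: abs_mult mult_left_mono)
    then have "- (\<nu> * Im (L t)) \<le> b * \<bar>\<nu>\<bar>" by (simp add: mult.commute)
    then show ?thesis by simp
  qed
  have Jb: "cmod (J \<nu>) \<le> CM * exp (b * \<bar>\<nu>\<bar>)" for \<nu>
  proof -
    have "cmod (J \<nu>) \<le> (\<integral>t. cmod (M t) * exp (b * \<bar>\<nu>\<bar>) \<partial>T)"
      unfolding J_def
    proof (rule order_trans[OF integral_norm_bound integral_mono])
      show i: "integrable T (\<lambda>t. cmod (M t) * exp (b * \<bar>\<nu>\<bar>))" using Mi by simp
      show "integrable T (\<lambda>t. cmod (M t * exp (\<i> * of_real \<nu> * L t)))"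
        by (rule integrable_norm, rule Bochner_Integration.integrable_bound[OF i])
          (use expb[of \<nu>] in \<open>auto simp: norm_mult simp del: norm_exp_eq_Re intro!: mult_left_mono\<close>)
    qed (use expb[of \<nu>] in \<open>auto simp: norm_mult simp del: norm_exp_eq_Re intro!: mult_left_mono\<close>)
    then show ?thesis by (simp add: CM_def)
  qed
  have sech_shift: "integrable lborel (\<lambda>y. 1 / cosh ((a + y) / 2 :: real))"
    "(\<integral>y. 1 / cosh ((a + y) / 2 :: real) \<partial>lborel) = CS" for a
    using lborel_integrable_real_affine[OF integrable_sech, of 1 a]
      lborel_integral_real_affine[of 1 "\<lambda>y. 1 / cosh (y / 2 :: real)" a] by (auto simp: CS_def)

  \<comment> \<open>This inversion serves to show that \<open>J\<close> is even because
    \<open>\<phi>\<close> is, which the definition of \<open>J\<close> does not reveal.\<close>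
  have J_transform: "J \<nu> = of_real (cosh (pi * \<nu>)) / (2 * of_real pi) * (\<integral>y. exp (- \<i> * of_real \<nu> * of_real y) * (2 * \<phi> y) \<partial>lborel)" for \<nu>
  proof -
    define K where "K = (\<lambda>(t, y). M t * (exp (- \<i> * of_real \<nu> * of_real y) / cosh ((L t + of_real y) / 2)))"
    have Km: "K \<in> borel_measurable (T \<Otimes>\<^sub>M lborel)" unfolding K_def by measurable
    have Kn: "norm (K (t, y)) \<le> cmod (M t) * (1 / cos (b/2)) * (1 / cosh ((Re (L t) + y) / 2))" for t y
      using mult_left_mono[OF sech_norm_bound(2)[OF Lb b, of t y], of "cmod (M t)"]
      by (simp add: K_def norm_mult norm_divide mult.assoc)
    have inner: "integrable lborel (\<lambda>y. K (t, y))" "(\<integral>y. K (t, y) \<partial>lborel) = M t * (2 * of_real pi * exp (\<i> * of_real \<nu> * L t) / of_real (cosh (pi * \<nu>)))" for t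
      unfolding K_def prod.case using sech_inverse_Fourier_transform[of "L t" \<nu>] Lb[of t] b
      by (auto simp del: times_divide_eq_right)
    have Ki: "integrable (T \<Otimes>\<^sub>M lborel) K"
    proof (rule TL.Fubini_integrable[OF Km])
      show "integrable T (\<lambda>t. \<integral>y. norm (K (t, y)) \<partial>lborel)"
      proof (rule Bochner_Integration.integrable_bound)
        show "integrable T (\<lambda>t. cmod (M t) * (1 / cos (b/2)) * CS)" using Mi by simp
        show "AE t in T. norm (\<integral>y. norm (K (t, y)) \<partial>lborel) \<le> norm (cmod (M t) * (1 / cos (b/2)) * CS)"
        proof (rule AE_I2)
          fix t
          have "(\<integral>y. norm (K (t, y)) \<partial>lborel) \<le> (\<integral>y. cmod (M t) * (1 / cos (b/2)) * (1 / cosh ((Re (L t) + y) / 2)) \<partial>lborel)"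
            by (intro integral_mono integrable_mult_right sech_shift Kn integrable_norm inner)
          also have "\<dots> = cmod (M t) * (1 / cos (b/2)) * CS"
            by (simp only: integral_mult_right_zero sech_shift)
          finally have le: "(\<integral>y. norm (K (t, y)) \<partial>lborel) \<le> cmod (M t) * (1 / cos (b/2)) * CS" .
          have "0 \<le> (\<integral>y. norm (K (t, y)) \<partial>lborel)" by simp
          with le show "norm (\<integral>y. norm (K (t, y)) \<partial>lborel) \<le> norm (cmod (M t) * (1 / cos (b/2)) * CS)"
            by (metis abs_ge_self abs_of_nonneg order_trans real_norm_def)
        qed
      qed (use Km in measurable)
    qed (use inner in simp)
    have "(\<integral>t. \<integral>y. K (t, y) \<partial>lborel \<partial>T) = (\<integral>y. \<integral>t. K (t, y) \<partial>T \<partial>lborel)"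
      using TL.Fubini_integral[of "\<lambda>t y. K (t, y)"] Ki by simp
    moreover have "(\<integral>t. \<integral>y. K (t, y) \<partial>lborel \<partial>T) = 2 * of_real pi / of_real (cosh (pi * \<nu>)) * J \<nu>"
      unfolding inner J_def integral_mult_right_zero[symmetric]
      by (intro Bochner_Integration.integral_cong refl) simp
    moreover have "(\<integral>t. K (t, y) \<partial>T) = exp (- \<i> * of_real \<nu> * of_real y) * (2 * \<phi> y)" for y
      unfolding \<phi>[symmetric] K_def integral_mult_right_zero[symmetric]
      by (intro Bochner_Integration.integral_cong refl) simp
    ultimately have "2 * of_real pi / of_real (cosh (pi * \<nu>)) * J \<nu> = (\<integral>y. exp (- \<i> * of_real \<nu> * of_real y) * (2 * \<phi> y) \<partial>lborel)"
      by simp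
    then show ?thesis by (simp add: field_simps)
  qed
  have J_even: "J (- \<nu>) = J \<nu>" for \<nu>
  proof -
    have "(\<integral>y. exp (- \<i> * of_real \<nu> * of_real y) * (2 * \<phi> y) \<partial>lborel) =
      \<bar>-1\<bar> *\<^sub>R (\<integral>y. exp (- \<i> * of_real \<nu> * of_real (0 + -1 * y)) * (2 * \<phi> (0 + -1 * y)) \<partial>lborel)"
      by (rule lborel_integral_real_affine) simp
    then show ?thesis by (subst (1 2) J_transform) (simp add: even)
  qed
  define P where "P = (\<lambda>\<nu>. J \<nu> / of_real (cosh (pi * \<nu>)))"
  have J_meas [measurable]: "J \<in> borel_measurable borel" unfolding J_def by measurable
  have Pm [measurable]: "P \<in> borel_measurable borel" unfolding P_def by measurable
  have P_even: "P (- \<nu>) = P \<nu>" for \<nu> by (simp add: P_def J_even)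
  have CM: "CM \<ge> 0" by (simp add: CM_def)
  have Pb: "cmod (P \<nu>) \<le> CM * (2 * exp (- (pi - b) * \<bar>\<nu>\<bar>))" for \<nu>
  proof -
    have "cmod (P \<nu>) \<le> CM * (exp (b * \<bar>\<nu>\<bar>) / cosh (pi * \<nu>))"
      using Jb[of \<nu>] by (simp add: P_def norm_divide divide_right_mono)
    also have "\<dots> \<le> CM * (2 * exp (- (pi - b) * \<bar>\<nu>\<bar>))"
      by (intro mult_left_mono cosh_times_exp_le b0 CM)
    finally show ?thesis .
  qed
  have Pi: "integrable lborel P"
    by (rule Bochner_Integration.integrable_bound[OF integrable_mult_right[OF integrable_mult_right[OF integrable_exp_abs_decay[of "pi - b"]]], of CM 2])
      (use b Pb CM in auto)
  have P_exp: "integrable lborel (\<lambda>\<nu>. P \<nu> * exp (\<i> * of_real \<nu> * of_real y))" for y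
    by (rule Bochner_Integration.integrable_bound[OF Pi]) (auto simp: norm_mult)
  have P_transform: "(\<integral>\<nu>. P \<nu> * exp (\<i> * of_real \<nu> * of_real y) \<partial>lborel) = 2 * \<phi> y" for y
  proof -
    define K where "K = (\<lambda>(t, \<nu>). M t * (exp (\<i> * of_real \<nu> * (L t + of_real y)) / of_real (cosh (pi * \<nu>))))"
    have Km: "K \<in> borel_measurable (T \<Otimes>\<^sub>M lborel)" unfolding K_def by measurable
    have Kn: "norm (K (t, \<nu>)) \<le> cmod (M t) * (2 * exp (- (pi - b) * \<bar>\<nu>\<bar>))" for t \<nu>
    proof -
      have "cmod (exp (\<i> * of_real \<nu> * (L t + of_real y))) \<le> exp (b * \<bar>\<nu>\<bar>)" using expb[of \<nu> t] by simp
      then have "cmod (exp (\<i> * of_real \<nu> * (L t + of_real y))) / cosh (pi * \<nu>) \<le> exp (b * \<bar>\<nu>\<bar>) / cosh (pi * \<nu>)"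
        by (intro divide_right_mono) auto
      also note cosh_times_exp_le[OF b0]
      finally have "cmod (M t) * (cmod (exp (\<i> * of_real \<nu> * (L t + of_real y))) / cosh (pi * \<nu>)) \<le> cmod (M t) * (2 * exp (- (pi - b) * \<bar>\<nu>\<bar>))"
        by (intro mult_left_mono) auto
      then show ?thesis by (simp add: K_def norm_mult norm_divide del: norm_exp_eq_Re)
    qed
    have inner: "integrable lborel (\<lambda>\<nu>. K (t, \<nu>))" "(\<integral>\<nu>. K (t, \<nu>) \<partial>lborel) = M t * (1 / cosh ((L t + of_real y) / 2))" for t
      unfolding K_def prod.case using sech_Fourier_transform[of "L t + of_real y"] Lb[of t] b
      by (auto simp del: times_divide_eq_right)
    have Ki: "integrable (T \<Otimes>\<^sub>M lborel) K"
    proof (rule TL.Fubini_integrable[OF Km])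
      let ?c = "\<integral>\<nu>. 2 * exp (- (pi - b) * \<bar>\<nu>\<bar>) \<partial>lborel"
      have ie: "integrable lborel (\<lambda>\<nu>. 2 * exp (- (pi - b) * \<bar>\<nu>\<bar>) :: real)"
        using b by (intro integrable_mult_right integrable_exp_abs_decay) auto
      show "integrable T (\<lambda>t. \<integral>y. norm (K (t, y)) \<partial>lborel)"
      proof (rule Bochner_Integration.integrable_bound)
        show "integrable T (\<lambda>t. cmod (M t) * ?c)" using Mi by simp
        show "AE t in T. norm (\<integral>y. norm (K (t, y)) \<partial>lborel) \<le> norm (cmod (M t) * ?c)"
        proof (rule AE_I2)
          fix t
          have "(\<integral>y. norm (K (t, y)) \<partial>lborel) \<le> (\<integral>\<nu>. cmod (M t) * (2 * exp (- (pi - b) * \<bar>\<nu>\<bar>)) \<partial>lborel)"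
            by (rule integral_mono) (use ie inner Kn in \<open>auto intro!: integrable_mult_right simp del: mult_minus_left\<close>)
          also have "\<dots> = cmod (M t) * ?c" by (simp only: integral_mult_right_zero)
          finally show "norm (\<integral>y. norm (K (t, y)) \<partial>lborel) \<le> norm (cmod (M t) * ?c)" by simp
        qed
      qed (use Km in measurable)
    qed (use inner in simp)
    have "(\<integral>t. \<integral>y. K (t, y) \<partial>lborel \<partial>T) = (\<integral>y. \<integral>t. K (t, y) \<partial>T \<partial>lborel)"
      using TL.Fubini_integral[of "\<lambda>t y. K (t, y)"] Ki by simp
    moreover have "(\<integral>t. K (t, \<nu>) \<partial>T) = P \<nu> * exp (\<i> * of_real \<nu> * of_real y)" for \<nu>
    proof -
      have "P \<nu> * exp (\<i> * of_real \<nu> * of_real y) = (exp (\<i> * of_real \<nu> * of_real y) / of_real (cosh (pi * \<nu>))) * J \<nu>"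
        by (simp add: P_def)
      also have "\<dots> = (\<integral>t. K (t, \<nu>) \<partial>T)"
        unfolding J_def integral_mult_right_zero[symmetric]
        by (intro Bochner_Integration.integral_cong refl) (simp add: K_def ring_distribs exp_add)
      finally show ?thesis by simp
    qed
    ultimately show ?thesis unfolding inner using \<phi>[of y] by simp
  qed
  \<comment> \<open>The transform takes the same value at y and at -y, so averaging the two
    exponentials to a cosine yields \<phi>(y), and half of the integral over the line is \<phi>(0) -
    \<phi>(y).\<close>
  have half: "(\<integral>\<nu>. indicator {0<..} \<nu> *\<^sub>R (P \<nu> * of_real (1 - cos (\<nu> * y))) \<partial>lborel) = \<phi> 0 - \<phi> y" for y
  proof -
    have e: "P \<nu> * of_real (1 - cos (\<nu> * y)) = P \<nu> - (P \<nu> * exp (\<i> * of_real \<nu> * of_real y) + P \<nu> * exp (\<i> * of_real \<nu> * of_real (- y))) / 2" for \<nu>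
      by (simp add: cos_of_real[symmetric] cos_exp_eq algebra_simps add_divide_distrib)
    have "(\<integral>\<nu>. P \<nu> * of_real (1 - cos (\<nu> * y)) \<partial>lborel) = 2 * \<phi> 0 - (2 * \<phi> y + 2 * \<phi> (- y)) / 2"
      unfolding e P_transform[symmetric] using P_exp[of y] P_exp[of "- y"] Pi by simp
    moreover have "integrable lborel (\<lambda>\<nu>. P \<nu> * of_real (1 - cos (\<nu> * y)))"
      unfolding e using P_exp[of y] P_exp[of "- y"] Pi by simp
    ultimately show ?thesis
      by (subst integral_even_half) (auto simp: P_even even)
  qed
  \<comment> \<open>Since 1 - cos and \<open>tanh_kernel\<close> are nonnegative, the inner integral
    of |Q| is known exactly, and integrability over the product reduces to the decay of
    \<open>P\<close> in \<nu>.\<close>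
  define Q where "Q = (\<lambda>(\<nu>, y). indicator {0<..} \<nu> *\<^sub>R (P \<nu> * of_real (indicator {0<..} y * ((1 - cos (\<nu> * y)) * tanh_kernel y))))"
  have Qm: "Q \<in> borel_measurable (lborel \<Otimes>\<^sub>M lborel)" unfolding Q_def by measurable
  have tk: "has_bochner_integral lborel (\<lambda>y. indicator {0<..} y * ((1 - cos (\<nu> * y)) * tanh_kernel y)) (2 * pi * \<nu> * tanh (pi * \<nu>))"
    if "\<nu> > 0" for \<nu>
  proof (rule has_bochner_integral_nn_integral)
    show "(\<integral>\<^sup>+y. ennreal (indicator {0<..} y * ((1 - cos (\<nu> * y)) * tanh_kernel y)) \<partial>lborel) = ennreal (2 * pi * \<nu> * tanh (pi * \<nu>))"
      unfolding nn_integral_tanh_kernel[OF that, symmetric]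
      by (intro nn_integral_cong) (auto simp: indicator_def)
    show "AE y in lborel. 0 \<le> indicator {0<..} y * ((1 - cos (\<nu> * y)) * tanh_kernel y)"
      by (auto simp: indicator_def intro!: mult_nonneg_nonneg tanh_kernel_nonneg)
  qed (use that in auto)
  have Qin: "integrable lborel (\<lambda>y. Q (\<nu>, y))"
    "(\<integral>y. Q (\<nu>, y) \<partial>lborel) = 2 * of_real pi * (indicator {0<..} \<nu> *\<^sub>R (of_real (\<nu> * tanh (pi * \<nu>) / cosh (pi * \<nu>)) * J \<nu>))"
    "(\<integral>y. norm (Q (\<nu>, y)) \<partial>lborel) = indicator {0<..} \<nu> * (cmod (P \<nu>) * (2 * pi * \<nu> * tanh (pi * \<nu>)))" for \<nu>
  proof -
    have "has_bochner_integral lborel (\<lambda>y. Q (\<nu>, y)) (indicator {0<..} \<nu> *\<^sub>R (P \<nu> * of_real (2 * pi * \<nu> * tanh (pi * \<nu>))))"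
    proof (cases "\<nu> > 0")
      case True
      then show ?thesis using has_bochner_integral_mult_right[OF has_bochner_integral_of_real[OF tk[OF True], where 'a=complex], of "P \<nu>"]
        by (simp add: Q_def)
    qed (simp add: Q_def has_bochner_integral_zero)
    then show "integrable lborel (\<lambda>y. Q (\<nu>, y))"
    "(\<integral>y. Q (\<nu>, y) \<partial>lborel) = 2 * of_real pi * (indicator {0<..} \<nu> *\<^sub>R (of_real (\<nu> * tanh (pi * \<nu>) / cosh (pi * \<nu>)) * J \<nu>))"
      by (auto simp: has_bochner_integral_iff P_def indicator_def)
    show "(\<integral>y. norm (Q (\<nu>, y)) \<partial>lborel) = indicator {0<..} \<nu> * (cmod (P \<nu>) * (2 * pi * \<nu> * tanh (pi * \<nu>)))"
    proof (cases "\<nu> > 0")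
      case True
      have n1: "cmod (1 - complex_of_real (cos x)) = 1 - cos x" for x
        using norm_of_real[of "1 - cos x", where 'a=complex] by simp
      have "norm (Q (\<nu>, y)) = cmod (P \<nu>) * (indicator {0<..} y * ((1 - cos (\<nu> * y)) * tanh_kernel y))" for y
        using True tanh_kernel_nonneg[of y] by (simp add: Q_def norm_mult abs_mult indicator_def n1)
      then show ?thesis using True tk[OF True] by (simp add: has_bochner_integral_iff)
    qed (simp add: Q_def)
  qed
  have Qi: "integrable (lborel \<Otimes>\<^sub>M lborel) Q"
  proof (rule lborel_pair.Fubini_integrable[OF Qm])
    have c: "pi - b > 0" using b by simp
    show "integrable lborel (\<lambda>\<nu>. \<integral>y. norm (Q (\<nu>, y)) \<partial>lborel)"
      unfolding Qin
    proof (rule Bochner_Integration.integrable_bound)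
      show "integrable lborel (\<lambda>\<nu>. 2 * pi * CM * 2 * ((2 / (pi - b)) * exp (- ((pi - b) / 2) * \<bar>\<nu>\<bar>)) :: real)"
        using c by (intro integrable_mult_right integrable_exp_abs_decay) auto
      show "AE \<nu> in lborel. norm (indicator {0<..} \<nu> * (cmod (P \<nu>) * (2 * pi * \<nu> * tanh (pi * \<nu>))))
         \<le> norm (2 * pi * CM * 2 * ((2 / (pi - b)) * exp (- ((pi - b) / 2) * \<bar>\<nu>\<bar>)))"
      proof (rule AE_I2)
        fix \<nu> :: real
        show "norm (indicator {0<..} \<nu> * (cmod (P \<nu>) * (2 * pi * \<nu> * tanh (pi * \<nu>))))
         \<le> norm (2 * pi * CM * 2 * ((2 / (pi - b)) * exp (- ((pi - b) / 2) * \<bar>\<nu>\<bar>)))"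
        proof (cases "\<nu> > 0")
          case True
          have "cmod (P \<nu>) * (2 * pi * \<nu> * tanh (pi * \<nu>)) \<le> CM * (2 * exp (- (pi - b) * \<bar>\<nu>\<bar>)) * (2 * pi * \<nu> * 1)"
            using True CM by (intro mult_mono Pb) (auto intro: less_imp_le tanh_real_lt_1)
          also have "\<dots> = 2 * pi * CM * 2 * (\<bar>\<nu>\<bar> * exp (- (pi - b) * \<bar>\<nu>\<bar>))" using True by simp
          also have "\<dots> \<le> 2 * pi * CM * 2 * ((2 / (pi - b)) * exp (- ((pi - b) / 2) * \<bar>\<nu>\<bar>))"
            using CM by (intro mult_left_mono abs_exp_decay_bound c) auto
          finally show ?thesis using True c CM by (simp add: abs_mult)
        qed (use c in simp)
      qed
    qed measurable
  qed (use Qin in simp)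
  have Q_inner: "(\<integral>\<nu>. Q (\<nu>, y) \<partial>lborel) = indicator {0<..} y *\<^sub>R (of_real (tanh_kernel y) * (\<phi> 0 - \<phi> y))" for y
  proof -
    have "(\<integral>\<nu>. Q (\<nu>, y) \<partial>lborel) = (\<integral>\<nu>. (indicator {0<..} y * of_real (tanh_kernel y)) * (indicator {0<..} \<nu> *\<^sub>R (P \<nu> * of_real (1 - cos (\<nu> * y)))) \<partial>lborel)"
      by (intro Bochner_Integration.integral_cong refl) (auto simp: Q_def indicator_def)
    also have "\<dots> = (indicator {0<..} y * of_real (tanh_kernel y)) * (\<phi> 0 - \<phi> y)"
      by (simp only: integral_mult_right_zero half)
    finally show ?thesis
      by (simp add: indicator_def)
  qed
  show "integrable lborel (\<lambda>y. indicator {0<..} y *\<^sub>R (of_real (tanh_kernel y) * (\<phi> 0 - \<phi> y)))"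
    unfolding Q_inner[symmetric] using lborel_pair.integrable_snd[of "\<lambda>\<nu> y. Q (\<nu>, y)"] Qi by simp
  have "2 * of_real pi * (\<integral>\<nu>. indicator {0<..} \<nu> *\<^sub>R (of_real (\<nu> * tanh (pi * \<nu>) / cosh (pi * \<nu>)) * J \<nu>) \<partial>lborel)
    = (\<integral>\<nu>. \<integral>y. Q (\<nu>, y) \<partial>lborel \<partial>lborel)"
    unfolding Qin by (simp only: integral_mult_right_zero)
  also have "\<dots> = (\<integral>y. \<integral>\<nu>. Q (\<nu>, y) \<partial>lborel \<partial>lborel)"
    using lborel_pair.Fubini_integral[of "\<lambda>\<nu> y. Q (\<nu>, y)"] Qi by simp
  finally show "(\<integral>\<nu>. indicator {0<..} \<nu> *\<^sub>R (of_real (\<nu> * tanh (pi * \<nu>) / cosh (pi * \<nu>)) *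
            (\<integral>t. M t * exp (\<i> * of_real \<nu> * L t) \<partial>T)) \<partial>lborel) =
         (1 / (2 * of_real pi)) * (\<integral>y. indicator {0<..} y *\<^sub>R (of_real (tanh_kernel y) * (\<phi> 0 - \<phi> y)) \<partial>lborel)"
    unfolding J_def Q_inner by (simp add: field_simps)
qed

section \<open>The Mehler-Fock kernel identity\<close>

lemma csqrt_four_mult: "csqrt (4 * z) = 2 * csqrt z"
proof (rule csqrt_unique)
  have "0 \<le> Re (csqrt z)" by (rule Re_csqrt)
  then show "0 < Re (2 * csqrt z) \<or> Re (2 * csqrt z) = 0 \<and> 0 \<le> Im (2 * csqrt z)"
    using csqrt_principal[of z] by auto
qed (simp add: power_mult_distrib)

lemma Re_csqrt_pos:
  assumes "z \<notin> \<real>\<^sub>\<le>\<^sub>0"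
  shows "Re (csqrt z) > 0"
proof -
  have "Re (csqrt z) \<noteq> 0"
  proof
    assume "Re (csqrt z) = 0"
    then have "(csqrt z)\<^sup>2 = of_real (- (Im (csqrt z))\<^sup>2)"
      by (simp add: complex_eq_iff power2_eq_square)
    then have "z = of_real (- (Im (csqrt z))\<^sup>2)" by simp
    then have "z \<in> \<real>\<^sub>\<le>\<^sub>0" by (metis nonpos_Reals_of_real_iff neg_le_0_iff_le zero_le_power2)
    with assms show False by simp
  qed
  then show ?thesis using Re_csqrt[of z] by simp
qed

text \<open>With p = sinh(y/2) and c^2 = (1 + w)/2 the radicand is 4(p^2 + c^2) = 4 S^2. Then 1/(2c)
  - 1/(2S) = p^2 / (2c S (S + c)), whose p^2 cancels the double pole of \<open>tanh_kernel\<close>.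
  What is left has the primitive p / (c^2 (S + c)), which runs from 0 to 1/c^2.\<close>

lemma csqrt_profile_integral:
  fixes w :: complex
  assumes w: "1 + w \<notin> \<real>\<^sub>\<le>\<^sub>0"
  defines "\<phi> \<equiv> \<lambda>y::real. 1 / csqrt (of_real (2 * cosh y) + 2 * w)"
  assumes int: "integrable lborel (\<lambda>y. indicator {0<..} y *\<^sub>R (of_real (tanh_kernel y) * (\<phi> 0 - \<phi> y)))"
  shows "(\<integral>y. indicator {0<..} y *\<^sub>R (of_real (tanh_kernel y) * (\<phi> 0 - \<phi> y)) \<partial>lborel) = 2 / (1 + w)"
proof -
  define c where "c = csqrt ((1 + w) / 2)"
  define p where "p = (\<lambda>y::real. sinh (y / 2))"
  define S where "S = (\<lambda>y. csqrt (of_real ((p y)\<^sup>2) + (1 + w) / 2))"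
  have w2: "of_real x + (1 + w) / 2 \<notin> \<real>\<^sub>\<le>\<^sub>0" if "x \<ge> 0" for x
  proof
    assume "of_real x + (1 + w) / 2 \<in> \<real>\<^sub>\<le>\<^sub>0"
    then have "Im w = 0" "x + (1 + Re w) / 2 \<le> 0" by (auto simp: complex_nonpos_Reals_iff)
    moreover have "1 + Re w \<le> 0" using that \<open>x + (1 + Re w) / 2 \<le> 0\<close> by (simp add: field_simps)
    ultimately have "1 + w \<in> \<real>\<^sub>\<le>\<^sub>0" by (simp add: complex_nonpos_Reals_iff)
    with w show False by simp
  qed
  have c: "Re c > 0" "c\<^sup>2 = (1 + w) / 2"
    using Re_csqrt_pos[OF w2[of 0]] by (simp_all add: c_def del: csqrt.simps)
  have S: "Re (S y) > 0" "(S y)\<^sup>2 = of_real ((p y)\<^sup>2) + c\<^sup>2" for y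
    using Re_csqrt_pos[OF w2[of "(p y)\<^sup>2"]] c(2) by (simp_all add: S_def del: csqrt.simps)
  have nz: "c \<noteq> 0" "S y \<noteq> 0" "S y + c \<noteq> 0" for y
    using c(1) S(1)[of y] by (auto simp: complex_eq_iff)
  have \<phi>S: "\<phi> y = 1 / (2 * S y)" for y
  proof -
    have "cosh y = 2 * (p y)\<^sup>2 + 1" proof -
      have "cosh (y/2 + y/2) = (cosh (y/2))\<^sup>2 + (sinh (y/2))\<^sup>2"
        by (simp only: cosh_add power2_eq_square)
      then show ?thesis by (simp add: p_def cosh_square_eq)
    qed
    then have "of_real (2 * cosh y) + 2 * w = 4 * (of_real ((p y)\<^sup>2) + (1 + w) / 2)"
      by simp
    then have "csqrt (of_real (2 * cosh y) + 2 * w) = 2 * S y" unfolding S_def by (simp only: csqrt_four_mult)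
    then show ?thesis by (simp only: \<phi>_def)
  qed
  have S0: "S 0 = c" by (simp add: S_def p_def c_def)
  define f where "f = (\<lambda>y. of_real (cosh (y / 2)) / (2 * c * S y * (S y + c)))"
  have f_eq: "of_real (tanh_kernel y) * (\<phi> 0 - \<phi> y) = f y" if "y > 0" for y
  proof -
    have p: "p y > 0" using that by (simp add: p_def)
    have "1 / (2 * c) - 1 / (2 * S y) = of_real ((p y)\<^sup>2) / (2 * c * S y * (S y + c))"
    proof -
      have "(S y - c) * (S y + c) = of_real ((p y)\<^sup>2)" using S(2)[of y] by (simp add: algebra_simps power2_eq_square)
      then show ?thesis using nz(1) nz(2)[of y] nz(3)[of y] by (simp add: divide_simps)
    qed
    moreover have "sinh (y / 2) = p y" by (simp add: p_def)
    ultimately show ?thesis using p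
      by (simp add: \<phi>S S0 tanh_kernel_def f_def)
  qed
  define \<Phi> where "\<Phi> = (\<lambda>y. of_real (p y) / (c\<^sup>2 * (S y + c)))"
  have dp: "(p has_real_derivative cosh (y / 2) / 2) (at y)" for y
    unfolding p_def by (auto intro!: derivative_eq_intros)
  have dcp: "((\<lambda>y. complex_of_real (p y)) has_vector_derivative of_real (cosh (y / 2) / 2)) (at y)" for y
    using has_vector_derivative_of_real[OF dp] .
  have dS: "(S has_vector_derivative (of_real (p y * (cosh (y / 2) / 2)) / S y)) (at y)" for y
  proof -
    have "((\<lambda>z. csqrt (z\<^sup>2 + (1 + w) / 2)) has_field_derivative (2 * of_real (p y) / (2 * csqrt ((of_real (p y))\<^sup>2 + (1 + w) / 2)))) (at (of_real (p y)))"
      using w2[of "(p y)\<^sup>2"] by (auto intro!: derivative_eq_intros simp: divide_simps)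
    from field_vector_diff_chain_at[OF dcp this] show ?thesis
      by (simp add: o_def S_def[abs_def] mult_ac)
  qed
  have d\<Phi>: "(\<Phi> has_vector_derivative f y) (at y)" for y
  proof -
    define X where "X = complex_of_real (p y)"
    define C where "C = complex_of_real (cosh (y / 2))"
    have SX: "csqrt (X\<^sup>2 + (1 + w) / 2) = S y" by (simp add: S_def X_def del: csqrt.simps)
    have SS: "S y * S y = X * X + c * c" using S(2)[of y] by (simp add: X_def power2_eq_square)
    have dq: "((\<lambda>z. csqrt (z\<^sup>2 + (1 + w) / 2)) has_field_derivative (X / S y)) (at X)"
      using w2[of "(p y)\<^sup>2", unfolded of_real_power, folded X_def] nz(2)[of y]
      by (auto intro!: derivative_eq_intros simp: SX simp del: csqrt.simps)
    have "((\<lambda>z. z / (c\<^sup>2 * (csqrt (z\<^sup>2 + (1 + w) / 2) + c))) has_field_derivative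
        (1 * (c\<^sup>2 * (S y + c)) - X * (c\<^sup>2 * (X / S y))) / ((c\<^sup>2 * (S y + c)) * (c\<^sup>2 * (S y + c)))) (at X)"
      using DERIV_divide[OF DERIV_ident DERIV_cmult[OF DERIV_add[OF dq DERIV_const]], of "c\<^sup>2" c] nz(1) nz(3)[of y]
      by (simp add: SX del: csqrt.simps)
    from field_vector_diff_chain_at[OF dcp[of y] this[unfolded X_def]]
    have "(\<Phi> has_vector_derivative (C / 2) * ((1 * (c\<^sup>2 * (S y + c)) - X * (c\<^sup>2 * (X / S y))) / ((c\<^sup>2 * (S y + c)) * (c\<^sup>2 * (S y + c))))) (at y)"
      by (simp add: o_def \<Phi>_def[abs_def] S_def[abs_def] C_def X_def del: csqrt.simps)
    moreover have "(C / 2) * ((1 * (c\<^sup>2 * (S y + c)) - X * (c\<^sup>2 * (X / S y))) / ((c\<^sup>2 * (S y + c)) * (c\<^sup>2 * (S y + c)))) = f y"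
    proof -
      have "1 * (c\<^sup>2 * (S y + c)) - X * (c\<^sup>2 * (X / S y)) = c\<^sup>2 * (S y * S y + S y * c - X * X) / S y"
        using nz(2)[of y] by (simp add: field_simps)
      also have "S y * S y + S y * c - X * X = c * (S y + c)" unfolding SS by (simp add: algebra_simps)
      finally show ?thesis
        using nz(1) nz(2)[of y] nz(3)[of y] by (simp add: f_def C_def power2_eq_square)
    qed
    ultimately show ?thesis by simp
  qed
  have Scont: "isCont S y" for y using dS by (rule has_vector_derivative_continuous)
  have fcont: "isCont f y" for y
    unfolding f_def using nz(1) nz(2)[of y] nz(3)[of y] by (intro continuous_intros Scont) auto
  have set_int: "set_integrable lborel (einterval 0 \<infinity>) f"
  proof -
    have "indicator {0<..} y *\<^sub>R (of_real (tanh_kernel y) * (\<phi> 0 - \<phi> y)) = indicator (einterval 0 \<infinity>) y *\<^sub>R f y" for y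
      using f_eq[of y] by (auto simp: indicator_def einterval_def)
    then show ?thesis using int by (simp add: set_integrable_def)
  qed
  have "(LBINT y=0..\<infinity>. f y) = 1 / c\<^sup>2 - 0"
  proof (rule interval_integral_FTC_integrable)
    have "isCont \<Phi> 0" using d\<Phi> by (rule has_vector_derivative_continuous)
    then have "(\<Phi> \<longlongrightarrow> \<Phi> 0) (at_right 0)"
      by (auto simp: isCont_def intro: filterlim_mono[OF _ order_refl at_le])
    then show "((\<Phi> \<circ> real_of_ereal) \<longlongrightarrow> 0) (at_right 0)"
      by (simp add: zero_ereal_def ereal_tendsto_simps1 \<Phi>_def p_def)
    have pt: "filterlim p at_top at_top"
    proof -
      have "filterlim (\<lambda>x::real. 1/2 * x) at_top at_top"
        by (rule filterlim_tendsto_pos_mult_at_top[OF tendsto_const _ filterlim_ident]) simp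
      from filterlim_compose[OF sinh_real_at_top this] show ?thesis by (simp add: p_def)
    qed
    have ip: "((\<lambda>y. inverse (complex_of_real (p y))) \<longlongrightarrow> 0) at_top"
      using tendsto_of_real[OF filterlim_compose[OF tendsto_inverse_0_at_top[OF filterlim_ident] pt], where 'a=complex] by simp
    \<comment> \<open>Numerator and denominator of the primitive are divided by p: S/p is the root
      of 1 + c^2/p^2, which tends to 1, and c/p tends to 0.\<close>
    have "((\<lambda>y. 1 / (c\<^sup>2 * (csqrt (1 + c\<^sup>2 * (inverse (of_real (p y)))\<^sup>2) + c * inverse (of_real (p y))))) \<longlongrightarrow> 1 / (c\<^sup>2 * (csqrt (1 + c\<^sup>2 * 0\<^sup>2) + c * 0))) at_top"
    proof (intro tendsto_intros ip)
      have "((\<lambda>y. 1 + c\<^sup>2 * (inverse (complex_of_real (p y)))\<^sup>2) \<longlongrightarrow> 1 + c\<^sup>2 * 0\<^sup>2) at_top"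
        by (intro tendsto_intros ip)
      then show "((\<lambda>y. csqrt (1 + c\<^sup>2 * (inverse (complex_of_real (p y)))\<^sup>2)) \<longlongrightarrow> csqrt (1 + c\<^sup>2 * 0\<^sup>2)) at_top"
        by (rule isCont_tendsto_compose[rotated]) (auto intro!: continuous_at_csqrt)
    qed (use nz in auto)
    then have "((\<lambda>y. 1 / (c\<^sup>2 * (csqrt (1 + c\<^sup>2 * (inverse (of_real (p y)))\<^sup>2) + c * inverse (of_real (p y))))) \<longlongrightarrow> 1 / c\<^sup>2) at_top"
      by simp
    then have "(\<Phi> \<longlongrightarrow> 1 / c\<^sup>2) at_top"
    proof (rule Lim_transform_eventually)
      show "\<forall>\<^sub>F y in at_top. 1 / (c\<^sup>2 * (csqrt (1 + c\<^sup>2 * (inverse (of_real (p y)))\<^sup>2) + c * inverse (of_real (p y)))) = \<Phi> y"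
        using eventually_gt_at_top[of 0]
      proof eventually_elim
        case (elim y)
        have p: "p y > 0" using elim by (simp add: p_def)
        have "csqrt (1 + c\<^sup>2 * (inverse (of_real (p y)))\<^sup>2) = S y * inverse (of_real (p y))"
        proof (rule csqrt_unique)
          show "(S y * inverse (of_real (p y)))\<^sup>2 = 1 + c\<^sup>2 * (inverse (of_real (p y)))\<^sup>2"
            using p by (simp add: power_mult_distrib S(2) field_simps)
          have "S y * inverse (complex_of_real (p y)) = (1 / p y) *\<^sub>R S y" by (simp add: scaleR_conv_of_real divide_inverse)
          then show "0 < Re (S y * inverse (complex_of_real (p y))) \<or> Re (S y * inverse (complex_of_real (p y))) = 0 \<and> 0 \<le> Im (S y * inverse (complex_of_real (p y)))"
            using S(1)[of y] p by simp
        qed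
        then show ?case using p nz(1) nz(2)[of y] nz(3)[of y] by (simp add: \<Phi>_def field_simps)
      qed
    qed
    then show "((\<Phi> \<circ> real_of_ereal) \<longlongrightarrow> 1 / c\<^sup>2) (at_left \<infinity>)"
      by (simp add: ereal_tendsto_simps1)
  qed (use d\<Phi> fcont set_int in auto)
  moreover have "(LBINT y=0..\<infinity>. f y) = (\<integral>y. indicator {0<..} y *\<^sub>R (of_real (tanh_kernel y) * (\<phi> 0 - \<phi> y)) \<partial>lborel)"
    unfolding interval_lebesgue_integral_def set_lebesgue_integral_def
    using f_eq by (auto intro!: Bochner_Integration.integral_cong simp: indicator_def einterval_def)
  ultimately show ?thesis by (simp add: c(2))
qed

text \<open>M = (AB)^(-1/2) and L = Ln A - Ln B satisfy M / cosh((L + y)/2) = 2 exp(y/2) / (exp(y) A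
  + B), so the integral assumed in \<open>circle\<close>, taken at u = exp y, supplies
  \<open>\<phi>\<close>. Pulling exp(y/2) out of the root leaves 2 cosh y + 2w, which shows at once
  that \<open>\<phi>\<close> is even.\<close>

lemma Mehler_Fock_kernel_identity:
  fixes A B :: "'a \<Rightarrow> complex" and w :: complex
  assumes sf: "sigma_finite_measure T"
    and m [measurable]: "A \<in> borel_measurable T" "B \<in> borel_measurable T"
    and nz: "\<And>t. A t \<noteq> 0" "\<And>t. B t \<noteq> 0"
    and bd: "\<And>t. \<bar>Im (Ln (A t) - Ln (B t))\<bar> \<le> b" "b < pi"
    and int: "integrable T (\<lambda>t. 1 / sqrt (cmod (A t) * cmod (B t)))"
    and w: "1 + w \<notin> \<real>\<^sub>\<le>\<^sub>0"
    and circle: "\<And>u. u > 0 \<Longrightarrow> (\<integral>t. 1 / (of_real u * A t + B t) \<partial>T) = 1 / csqrt (of_real (u\<^sup>2) + 1 + 2 * of_real u * w)"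
  shows "(\<integral>\<nu>. indicator {0<..} \<nu> *\<^sub>R (of_real (\<nu> * tanh (pi * \<nu>) / cosh (pi * \<nu>)) *
            (\<integral>t. A t powr (- 1/2 + \<i> * of_real \<nu>) * B t powr (- 1/2 - \<i> * of_real \<nu>) \<partial>T)) \<partial>lborel) =
         1 / (of_real pi * (1 + w))"
proof -
  define M where "M = (\<lambda>t. exp (- (Ln (A t) + Ln (B t)) / 2))"
  define L where "L = (\<lambda>t. Ln (A t) - Ln (B t))"
  define \<phi> where "\<phi> = (\<lambda>y::real. 1 / csqrt (of_real (2 * cosh y) + 2 * w))"
  have powr_eq: "A t powr (- 1/2 + \<i> * of_real \<nu>) * B t powr (- 1/2 - \<i> * of_real \<nu>) = M t * exp (\<i> * of_real \<nu> * L t)" for t \<nu>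
    using nz[of t] by (simp add: powr_def M_def L_def flip: exp_add) (simp add: algebra_simps add_divide_distrib diff_divide_distrib)
  have Mm [measurable]: "M \<in> borel_measurable T" and Lm: "L \<in> borel_measurable T"
    unfolding M_def L_def by measurable
  have normM: "cmod (M t) = 1 / sqrt (cmod (A t) * cmod (B t))" for t
  proof -
    have "cmod (M t) = exp (- (ln (cmod (A t) * cmod (B t))) / 2)"
      using nz[of t] by (simp add: M_def ln_mult)
    also have "\<dots> = 1 / exp (ln (cmod (A t) * cmod (B t)) / 2)"
      by (simp add: exp_minus inverse_eq_divide)
    also have "exp (ln (cmod (A t) * cmod (B t)) / 2) = sqrt (cmod (A t) * cmod (B t))"
      using nz[of t] by (simp add: ln_sqrt[symmetric])
    finally show ?thesis .
  qed
  have Mi: "integrable T M"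
    by (rule Bochner_Integration.integrable_bound[OF int]) (auto simp: normM)
  have circ: "(\<integral>t. M t / cosh ((L t + of_real y) / 2) \<partial>T) = 2 * \<phi> y" for y
  proof -
    have "M t / cosh ((L t + of_real y) / 2) = of_real (2 * exp (y / 2)) * (1 / (of_real (exp y) * A t + B t))" for t
    proof -
      define a b Y where "a = Ln (A t)" and "b = Ln (B t)" and "Y = complex_of_real y"
      have A: "A t = exp a" and B: "B t = exp b" using nz[of t] by (auto simp: a_def b_def)
      have e: "(a - b + Y) / 2 + (a + b) / 2 = Y / 2 + a" "- ((a - b + Y) / 2) + (a + b) / 2 = - (Y / 2) + b"
        by (simp_all add: field_simps)
      have iM: "M t = inverse (exp ((a + b) / 2))"
        unfolding M_def a_def b_def by (simp only: minus_divide_left[symmetric] exp_minus)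
      have LY: "L t + of_real y = a - b + Y" unfolding L_def a_def b_def Y_def by (rule refl)
      have "cosh ((L t + of_real y) / 2) / M t = cosh ((a - b + Y) / 2) * exp ((a + b) / 2)"
        unfolding LY iM by (simp only: divide_inverse inverse_inverse_eq)
      also have "\<dots> = (exp (Y / 2 + a) + exp (- (Y / 2) + b)) / 2"
        unfolding e[symmetric] cosh_field_def by (simp only: exp_add ring_distribs add_divide_distrib times_divide_eq_left)
      also have "\<dots> = (exp Y * exp a + exp b) / (2 * exp (Y / 2))"
      proof -
        define E where "E = exp (Y / 2)"
        have "exp Y = E * E" by (simp add: E_def flip: exp_add)
        moreover have "exp (Y / 2 + a) = E * exp a" by (simp only: exp_add E_def)
        moreover have "exp (- (Y / 2) + b) = exp b / E"
          by (simp only: exp_add exp_minus E_def divide_inverse mult.commute)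
        moreover have "E \<noteq> 0" by (simp add: E_def)
        ultimately show ?thesis by (simp only: E_def[symmetric]) (simp add: field_simps)
      qed
      finally have eq: "cosh ((L t + of_real y) / 2) / M t = (of_real (exp y) * A t + B t) / of_real (2 * exp (y / 2))"
        by (simp add: A B Y_def flip: exp_of_real)
      have "M t / cosh ((L t + of_real y) / 2) = inverse (cosh ((L t + of_real y) / 2) / M t)" by simp
      then show ?thesis unfolding eq by simp
    qed
    then have "(\<integral>t. M t / cosh ((L t + of_real y) / 2) \<partial>T) = of_real (2 * exp (y / 2)) * (1 / csqrt (of_real ((exp y)\<^sup>2) + 1 + 2 * of_real (exp y) * w))"
      by (simp only: integral_mult_right_zero circle[OF exp_gt_zero])
    also have "csqrt (of_real ((exp y)\<^sup>2) + 1 + 2 * of_real (exp y) * w) = of_real (exp (y / 2)) * csqrt (of_real (2 * cosh y) + 2 * w)"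
    proof (rule csqrt_unique)
      have "exp y = exp (y/2) * exp (y/2)" by (simp flip: exp_add)
      then have e2: "(complex_of_real (exp (y/2)))\<^sup>2 = of_real (exp y)" by (simp add: power2_eq_square)
      have "(exp y)\<^sup>2 + 1 = exp y * (2 * cosh y)"
        by (simp add: cosh_field_def power2_eq_square algebra_simps exp_minus)
      then have "of_real ((exp y)\<^sup>2) + 1 = complex_of_real (exp y) * of_real (2 * cosh y)"
        by (metis of_real_1 of_real_add of_real_mult)
      then show "(of_real (exp (y / 2)) * csqrt (of_real (2 * cosh y) + 2 * w))\<^sup>2 = of_real ((exp y)\<^sup>2) + 1 + 2 * of_real (exp y) * w"
        by (simp add: power_mult_distrib e2 algebra_simps)
      show "0 < Re (of_real (exp (y / 2)) * csqrt (of_real (2 * cosh y) + 2 * w)) \<or>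
        Re (of_real (exp (y / 2)) * csqrt (of_real (2 * cosh y) + 2 * w)) = 0 \<and> 0 \<le> Im (of_real (exp (y / 2)) * csqrt (of_real (2 * cosh y) + 2 * w))"
        using csqrt_principal[of "of_real (2 * cosh y) + 2 * w"] by auto
    qed
    finally show ?thesis by (simp add: \<phi>_def)
  qed
  have even: "\<phi> (- y) = \<phi> y" for y by (simp add: \<phi>_def)
  have Lb: "\<bar>Im (L t)\<bar> \<le> b" for t using bd(1)[of t] by (simp add: L_def)
  note K = spectral_kernel_identity[OF sf Mi Lm Lb bd(2) circ even]
  have I: "(\<integral>y. indicator {0<..} y *\<^sub>R (of_real (tanh_kernel y) * (\<phi> 0 - \<phi> y)) \<partial>lborel) = 2 / (1 + w)"
    unfolding \<phi>_def by (rule csqrt_profile_integral[OF w K(1)[unfolded \<phi>_def]])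
  show ?thesis unfolding powr_eq K(2) I by simp
qed

section \<open>Cycles on the light cone\<close>

text \<open>After division by 2 pi i the Cauchy kernel on the unit circle has this form, so the
  value is a winding number.\<close>

lemma circle_Cauchy_kernel_integral:
  assumes "cmod p \<noteq> 1"
  shows "((\<lambda>t. exp (2 * of_real pi * \<i> * of_real t) / (exp (2 * of_real pi * \<i> * of_real t) - p)) has_integral
      (if cmod p < 1 then 1 else 0)) {0..1}"
proof -
  have "p \<notin> path_image (circlepath 0 1)" using assms by (simp add: path_image_circlepath dist_norm)
  then have "((\<lambda>w. 1 / (w - p)) has_contour_integral (2 * of_real pi * \<i> * winding_number (circlepath 0 1) p)) (circlepath 0 1)"
    using has_contour_integral_winding_number[of "circlepath 0 1" p] by simp
  moreover have "winding_number (circlepath 0 1) p = (if cmod p < 1 then 1 else 0)"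
  proof (cases "cmod p < 1")
    case True
    then show ?thesis using winding_number_circlepath[of p 0 1] by simp
  next
    case False
    have "winding_number (circlepath 0 1) p = 0"
      by (rule winding_number_zero_outside[of _ "cball 0 1"]) (use False assms in \<open>auto simp: path_image_circlepath\<close>)
    then show ?thesis using False by simp
  qed
  ultimately have "((\<lambda>t. 1 / (circlepath 0 1 t - p) * vector_derivative (circlepath 0 1) (at t within {0..1})) has_integral
       2 * of_real pi * \<i> * (if cmod p < 1 then 1 else 0)) {0..1}"
    by (simp add: has_contour_integral_def)
  then have "((\<lambda>t. 1 / (exp (2 * of_real pi * \<i> * of_real t) - p) * (2 * pi * \<i> * exp (2 * of_real pi * \<i> * of_real t))) has_integral
       2 * of_real pi * \<i> * (if cmod p < 1 then 1 else 0)) {0..1}"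
    by (rule has_integral_eq[rotated]) (subst vector_derivative_circlepath01, auto simp: circlepath)
  from has_integral_mult_right[OF this, of "1 / (2 * of_real pi * \<i>)"]
  show ?thesis by (simp add: field_simps)
qed

text \<open>With s on the unit circle, s times the denominator is a quadratic polynomial in s whose
  discriminant is the Lorentz square r^2, and partial fractions reduce the integral to N / r with N
  one of -1, 0, 1. The position of the roots is decided by sign alone: the integral has positive
  real part and so has 1/r, which leaves only N = 1.\<close>

lemma circle_quadratic_integral:
  assumes pos: "\<And>t. t \<in> {0..1} \<Longrightarrow> Re (Y0 - Y1 * of_real (cos (2 * pi * t - pi)) - Y2 * of_real (sin (2 * pi * t - pi))) > 0"
    and Y0: "Re Y0 > 0" and Y: "Y0\<^sup>2 - Y1\<^sup>2 - Y2\<^sup>2 \<notin> \<real>\<^sub>\<le>\<^sub>0"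
  shows "((\<lambda>t. 1 / (Y0 - Y1 * of_real (cos (2 * pi * t - pi)) - Y2 * of_real (sin (2 * pi * t - pi)))) has_integral
            1 / csqrt (Y0\<^sup>2 - Y1\<^sup>2 - Y2\<^sup>2)) {0..1}"
proof -
  define h where "h = (\<lambda>t. Y0 - Y1 * of_real (cos (2 * pi * t - pi)) - Y2 * of_real (sin (2 * pi * t - pi)))"
  define s where "s = (\<lambda>t. exp (2 * of_real pi * \<i> * of_real t))"
  define r where "r = csqrt (Y0\<^sup>2 - Y1\<^sup>2 - Y2\<^sup>2)"
  define c1 c2 where "c1 = Y1 - \<i> * Y2" and "c2 = Y1 + \<i> * Y2"
  \<comment> \<open>The factorization is built on \<eta> = Y0 + r because the outer coefficients,
    proportional to \<open>c1\<close> and \<open>c2\<close>, may vanish, while \<eta> has positive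
    real part.\<close>
  define \<eta> where "\<eta> = Y0 + r"
  define p q where "p = - c2 / \<eta>" and "q = - c1 / \<eta>"
  have r0: "Re r > 0"
    unfolding r_def using Y Re_csqrt_pos by blast
  have r2: "r\<^sup>2 = Y0\<^sup>2 - c1 * c2"
  proof -
    have "c1 * c2 = Y1\<^sup>2 + Y2\<^sup>2" by (simp add: c1_def c2_def algebra_simps power2_eq_square)
    then show ?thesis by (simp add: r_def)
  qed
  have \<eta>: "\<eta> \<noteq> 0" using r0 Y0 by (auto simp: \<eta>_def complex_eq_iff)
  have rn: "r \<noteq> 0" using r0 by auto
  have snorm: "cmod (s t) = 1" for t by (simp add: s_def)
  have snz: "s t \<noteq> 0" for t by (simp add: s_def)
  have s_cis: "s t = cis (2 * pi * t)" for t by (simp add: s_def cis_conv_exp mult_ac)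
  have h_s: "s t * h t = Y0 * s t + c1 * (s t)\<^sup>2 / 2 + c2 / 2" for t
  proof -
    define C S where "C = complex_of_real (cos (2 * pi * t))" and "S = complex_of_real (sin (2 * pi * t))"
    have cs: "C\<^sup>2 + S\<^sup>2 = 1" unfolding C_def S_def by (metis of_real_1 of_real_add of_real_power sin_cos_squared_add2)
    \<comment> \<open>The shift of the angle by pi reverses both signs.\<close>
    have h: "h t = Y0 + Y1 * C + Y2 * S"
      by (simp add: h_def C_def S_def cos_diff sin_diff)
    have st: "s t = C + \<i> * S" by (simp add: s_cis C_def S_def complex_eq_iff)
    have "s t * h t - (Y0 * s t + c1 * (s t)\<^sup>2 / 2 + c2 / 2) = (C\<^sup>2 + S\<^sup>2 - 1) * (c2 / 2)"
      unfolding h st c1_def c2_def by (simp add: field_simps power2_eq_square)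
    then show ?thesis by (simp add: cs)
  qed
  have fac: "2 * (s t * h t) = \<eta> * (s t - p) * (1 - q * s t)" for t
  proof -
    have "\<eta> * (s t - p) * (1 - q * s t) = (\<eta> * s t + c2) * (\<eta> + c1 * s t) / \<eta>"
      using \<eta> by (simp add: p_def q_def field_simps)
    also have "(\<eta> * s t + c2) * (\<eta> + c1 * s t) = \<eta> * (2 * (Y0 * s t + c1 * (s t)\<^sup>2 / 2 + c2 / 2)) + s t * (\<eta>\<^sup>2 - 2 * \<eta> * Y0 + c1 * c2)"
      by (simp add: field_simps power2_eq_square)
    also have "\<eta>\<^sup>2 - 2 * \<eta> * Y0 + c1 * c2 = 0"
      using r2 by (simp add: \<eta>_def field_simps power2_eq_square)
    finally show ?thesis using \<eta> by (simp add: h_s)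
  qed
  have hpos: "Re (h t) > 0" if "t \<in> {0..1}" for t unfolding h_def by (rule pos[OF that])
  have hnz: "h t \<noteq> 0" if "t \<in> {0..1}" for t using hpos[OF that] by auto
  have on_circle: "\<exists>t\<in>{0..1}. s t = z" if "cmod z = 1" for z
  proof -
    have "z \<in> path_image (circlepath 0 1)" using that by (simp add: path_image_circlepath)
    then show ?thesis by (auto simp: path_image_def circlepath s_def)
  qed
  have p1: "cmod p \<noteq> 1"
  proof
    assume "cmod p = 1"
    then obtain t where "t \<in> {0..1}" "s t = p" using on_circle by blast
    then show False using fac[of t] snz[of t] hnz[of t] by simp
  qed
  have q1: "cmod (1 / q) \<noteq> 1" if "q \<noteq> 0"
  proof
    assume "cmod (1 / q) = 1"
    then obtain t where "t \<in> {0..1}" "s t = 1 / q" using on_circle by blast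
    then show False using fac[of t] snz[of t] hnz[of t] that by simp
  qed
  have pq: "\<eta> * (1 - p * q) = 2 * r"
  proof -
    have "\<eta> * (1 - p * q) = (\<eta>\<^sup>2 - c1 * c2) / \<eta>" using \<eta> by (simp add: p_def q_def field_simps power2_eq_square)
    also have "\<eta>\<^sup>2 - c1 * c2 = 2 * r * \<eta>" using r2 by (simp add: \<eta>_def field_simps power2_eq_square)
    finally show ?thesis using \<eta> by simp
  qed
  then have pq1: "1 - p * q \<noteq> 0" using rn by auto
  have inv: "1 / h t = (1 / r) * (s t / (s t - p) + q * s t / (1 - q * s t))" if "t \<in> {0..1}" for t
  proof -
    have n: "s t - p \<noteq> 0" "1 - q * s t \<noteq> 0" using fac[of t] snz[of t] hnz[OF that] by auto
    have "s t / (s t - p) + q * s t / (1 - q * s t) = s t * (1 - p * q) / ((s t - p) * (1 - q * s t))"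
      using n by (simp add: field_simps)
    also have "\<dots> = s t * (\<eta> * (1 - p * q)) / (\<eta> * (s t - p) * (1 - q * s t))" using \<eta> by simp
    also have "\<dots> = r / h t" unfolding fac[symmetric] pq using snz[of t] by simp
    finally show ?thesis using rn by simp
  qed
  have i1: "((\<lambda>t. s t / (s t - p)) has_integral (if cmod p < 1 then 1 else 0)) {0..1}"
    unfolding s_def by (rule circle_Cauchy_kernel_integral[OF p1])
  have i2: "((\<lambda>t. q * s t / (1 - q * s t)) has_integral (if q \<noteq> 0 \<and> cmod (1 / q) < 1 then -1 else 0)) {0..1}"
  proof (cases "q = 0")
    case False
    have "((\<lambda>t. s t / (s t - 1 / q)) has_integral (if cmod (1 / q) < 1 then 1 else 0)) {0..1}"
      unfolding s_def by (rule circle_Cauchy_kernel_integral[OF q1[OF False]])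
    from has_integral_neg[OF this] have "((\<lambda>t. - (s t / (s t - 1 / q))) has_integral (if q \<noteq> 0 \<and> cmod (1 / q) < 1 then -1 else 0)) {0..1}"
      using False by (simp split: if_splits)
    then show ?thesis
    proof (rule has_integral_eq[rotated])
      fix t :: real assume "t \<in> {0..1}"
      then have "1 - q * s t \<noteq> 0" using fac[of t] snz[of t] hnz[of t] by auto
      then show "- (s t / (s t - 1 / q)) = q * s t / (1 - q * s t)"
        using False by (simp add: divide_simps) (simp add: algebra_simps)
    qed
  qed auto
  define N where "N = (if cmod p < 1 then 1 else 0) + (if q \<noteq> 0 \<and> cmod (1 / q) < 1 then -1 else 0 :: complex)"
  have int: "((\<lambda>t. 1 / h t) has_integral (1 / r) * N) {0..1}"
    by (rule has_integral_eq[OF _ has_integral_mult_right[OF has_integral_add[OF i1 i2], of "1 / r", folded N_def]])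
      (simp add: inv)
  have "Re ((1 / r) * N) > 0"
  proof -
    have "((\<lambda>t. Re (1 / h t)) has_integral Re ((1 / r) * N)) {0..1}"
      using has_integral_Re[OF int] by simp
    moreover have hcont: "continuous_on {0..1} h"
      unfolding h_def by (intro continuous_intros)
    have cont: "continuous_on {0..1} (\<lambda>t. Re (1 / h t))"
      by (intro continuous_intros hcont) (use hnz in auto)
    have posr: "Re (1 / h t) > 0" if "t \<in> {0..1}" for t
      using hpos[OF that] hnz[OF that] by (simp add: Re_divide cmod_power2[symmetric] del: Re_divide_of_real)
    have "Re ((1 / r) * N) \<noteq> 0"
    proof
      assume "Re ((1 / r) * N) = 0"
      with calculation have "((\<lambda>t. Re (1 / h t)) has_integral 0) (cbox 0 1)" by simp
      then have "Re (1 / h 0) = 0"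
        using cont posr
        by (intro has_integral_0_cbox_imp_0[of 0 1 "\<lambda>t. Re (1 / h t)" 0]) (auto intro: less_imp_le simp del: Re_divide_of_real)
      with posr[of 0] show False by simp
    qed
    moreover have "Re ((1 / r) * N) \<ge> 0"
      by (rule has_integral_nonneg[OF \<open>((\<lambda>t. Re (1 / h t)) has_integral Re ((1 / r) * N)) {0..1}\<close>])
        (use posr in \<open>auto intro: less_imp_le\<close>)
    ultimately show ?thesis by linarith
  qed
  moreover have "Re (1 / r) > 0" using r0 rn by (simp add: Re_divide cmod_power2[symmetric])
  ultimately have "N = 1" by (auto simp: N_def split: if_splits)
  with int show ?thesis by (simp add: h_def r_def)
qed

text \<open>Near t the continuous logarithm \<open>q\<close> agrees with q(t) + Ln(\<zeta>(s) /
  \<zeta>(t)), since continuity keeps the imaginary parts within pi of each other; the latter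
  expression is differentiated by the chain rule.\<close>

lemma has_vector_derivative_continuous_log:
  fixes q \<zeta> :: "real \<Rightarrow> complex"
  assumes q: "continuous_on {0..1::real} q" and \<zeta>: "\<And>t. t \<in> {0..1} \<Longrightarrow> \<zeta> t = exp (q t)"
    and t: "0 < t" "t < 1" and d: "(\<zeta> has_vector_derivative \<zeta>') (at t)"
  shows "(q has_vector_derivative \<zeta>' / \<zeta> t) (at t)"
proof -
  have \<zeta>t: "\<zeta> t = exp (q t)" using \<zeta> t by simp
  have d1: "((\<lambda>s. \<zeta> s / \<zeta> t) has_vector_derivative \<zeta>' / \<zeta> t) (at t)"
    by (rule has_vector_derivative_divide[OF d])
  have "(Ln has_field_derivative inverse (\<zeta> t / \<zeta> t)) (at (\<zeta> t / \<zeta> t))"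
    by (rule has_field_derivative_Ln) (simp add: \<zeta>t)
  from field_vector_diff_chain_at[OF d1 this]
  have "((\<lambda>s. Ln (\<zeta> s / \<zeta> t)) has_vector_derivative \<zeta>' / \<zeta> t) (at t)"
    by (simp add: o_def \<zeta>t)
  then have d2: "((\<lambda>s. q t + Ln (\<zeta> s / \<zeta> t)) has_vector_derivative \<zeta>' / \<zeta> t) (at t)"
    by (auto intro!: derivative_eq_intros)
  have "isCont q t" using q t continuous_on_interior[of "{0..1}" q t] by simp
  then have "\<forall>\<^sub>F s in nhds t. dist (q s) (q t) < pi"
    unfolding continuous_at_eps_delta eventually_nhds_metric using pi_gt_zero by (metis dist_commute)
  moreover have "\<forall>\<^sub>F s in nhds t. s \<in> {0<..<1}" using t by (intro eventually_nhds_in_open) auto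
  ultimately have "\<forall>\<^sub>F s in nhds t. q t + Ln (\<zeta> s / \<zeta> t) = q s"
  proof eventually_elim
    case (elim s)
    have "\<bar>Im (q s - q t)\<bar> < pi" using elim(1) abs_Im_le_cmod[of "q s - q t"] by (simp add: dist_norm)
    then have "Ln (exp (q s - q t)) = q s - q t" by (intro Ln_exp) (auto simp: abs_less_iff)
    then show ?case using elim(2) by (simp add: \<zeta> \<zeta>t exp_diff)
  qed
  then obtain T where "open T" "t \<in> T" "\<And>s. s \<in> T \<Longrightarrow> q t + Ln (\<zeta> s / \<zeta> t) = q s"
    unfolding eventually_nhds by blast
  with d2 show ?thesis by (rule has_vector_derivative_transform_within_open)
qed

lemma continuous_primitive_real:
  fixes G :: "real \<Rightarrow> complex"
  assumes "continuous_on UNIV G"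
  obtains P where "\<And>x. x \<in> {-N<..<N} \<Longrightarrow> (P has_vector_derivative G x) (at x)"
proof
  fix x assume x: "x \<in> {-N<..<N}"
  have "((\<lambda>u. integral {-N..u} G) has_vector_derivative G x) (at x within {-N..N})"
    using x by (intro integral_has_vector_derivative continuous_on_subset[OF assms]) auto
  then show "((\<lambda>u. integral {-N..u} G) has_vector_derivative G x) (at x)"
    using x at_within_interior[of x "{-N..N}"] by simp
qed

text \<open>In terms of the angle \<alpha> on the cone, a function of degree -1 times the one-form
  is G(\<alpha>) d\<alpha> / 2, with the radius gone. Homotopy to \<open>gamma0\<close> fixes the
  winding number to 1, so a continuous angle along the loop grows by 2 pi in total, and the integral
  of the periodic G over a full period does not depend on its starting point.\<close>

lemma cycle_int_admissible_loop:
  fixes g :: "r3 \<Rightarrow> complex"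
  assumes adm: "admissible_loop \<gamma>"
    and hom: "\<And>\<rho> x0 x1 x2. \<rho> > 0 \<Longrightarrow> (x0, x1, x2) \<in> Cplus \<Longrightarrow> g (\<rho> * x0, \<rho> * x1, \<rho> * x2) = g (x0, x1, x2) / of_real \<rho>"
    and cont: "continuous_on UNIV (\<lambda>\<alpha>. g (1, cos \<alpha>, sin \<alpha>))"
  shows "cycle_int g \<gamma> = of_real pi * integral {0..1} (\<lambda>t. g (gamma0 t))"
proof -
  define G where "G = (\<lambda>\<alpha>. g (1, cos \<alpha>, sin \<alpha>))"
  define c where "c = (\<lambda>\<xi>::r3. Complex (fst (snd \<xi>) / fst \<xi>) (snd (snd \<xi>) / fst \<xi>))"
  have c_eq: "c = (\<lambda>\<xi>. of_real (fst (snd \<xi>) / fst \<xi>) + \<i> * of_real (snd (snd \<xi>) / fst \<xi>))"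
    by (auto simp: c_def Complex_eq)
  have pos: "fst \<xi> > 0" "(fst \<xi>)\<^sup>2 = (fst (snd \<xi>))\<^sup>2 + (snd (snd \<xi>))\<^sup>2" if "\<xi> \<in> Cplus" for \<xi>
    using that by (auto simp: Cplus_def lorR_def power2_eq_square split: prod.splits)
  have c1: "cmod (c \<xi>) = 1" if "\<xi> \<in> Cplus" for \<xi>
  proof -
    have "(cmod (c \<xi>))\<^sup>2 = ((fst (snd \<xi>))\<^sup>2 + (snd (snd \<xi>))\<^sup>2) / (fst \<xi>)\<^sup>2"
      by (simp add: c_def cmod_power2 power_divide add_divide_distrib)
    then have "(cmod (c \<xi>))\<^sup>2 = 1" using pos(1)[OF that] unfolding pos(2)[OF that, symmetric] by simp
    then show ?thesis using abs_square_eq_1[of "cmod (c \<xi>)"] by simp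
  qed
  have ccont: "continuous_on Cplus c"
    unfolding c_eq by (intro continuous_intros) (use pos in force)+
  have pw: "\<gamma> piecewise_C1_differentiable_on {0..1}" and im: "path_image \<gamma> \<subseteq> Cplus"
    and loop: "pathfinish \<gamma> = pathstart \<gamma>" and hl: "homotopic_loops Cplus \<gamma> gamma0"
    using adm by (auto simp: admissible_loop_def)
  have \<gamma>C: "\<gamma> t \<in> Cplus" if "t \<in> {0..1}" for t using im that by (auto simp: path_image_def)
  have path\<gamma>: "path \<gamma>" using pw by (simp add: path_def piecewise_C1_differentiable_on_def)
  define \<zeta> where "\<zeta> = c \<circ> \<gamma>"
  have path\<zeta>: "path \<zeta>" unfolding \<zeta>_def
    by (rule path_continuous_image[OF path\<gamma> continuous_on_subset[OF ccont im]])
  have nz: "0 \<notin> path_image \<zeta>"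
  proof
    assume "0 \<in> path_image \<zeta>"
    then obtain t where "t \<in> {0..1}" "c (\<gamma> t) = 0" by (auto simp: path_image_def \<zeta>_def)
    then show False using c1[OF \<gamma>C[of t]] by simp
  qed
  have c0: "c \<circ> gamma0 = exp \<circ> (\<lambda>t. \<i> * of_real (2 * pi * t - pi))"
    by (rule ext) (simp only: o_def cis_conv_exp[symmetric], simp add: c_def gamma0_def complex_eq_iff)
  have "homotopic_loops (- {0}) (c \<circ> \<gamma>) (c \<circ> gamma0)"
    by (rule homotopic_loops_continuous_image[OF hl ccont]) (use c1 in fastforce)
  then have "winding_number \<zeta> 0 = winding_number (c \<circ> gamma0) 0"
    unfolding \<zeta>_def by (rule winding_number_homotopic_loops)
  also have "\<dots> = 1"
    unfolding c0 by (subst winding_number_compose_exp)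
      (auto simp: path_def pathfinish_def pathstart_def field_simps intro!: continuous_intros)
  finally have wn: "winding_number \<zeta> 0 = 1" .
  obtain q where q: "path q" "pathfinish q - pathstart q = 2 * of_real pi * \<i> * winding_number \<zeta> 0"
    and \<zeta>q: "\<And>t. t \<in> {0..1} \<Longrightarrow> \<zeta> t = 0 + exp (q t)"
    using winding_number_as_continuous_log[OF path\<zeta> nz] by blast
  define \<alpha> where "\<alpha> = (\<lambda>t. Im (q t))"
  have qc: "continuous_on {0..1} q" using q(1) by (simp add: path_def)
  have \<alpha>c: "continuous_on {0..1} \<alpha>" unfolding \<alpha>_def by (intro continuous_intros qc)
  have \<alpha>1: "\<alpha> 1 = \<alpha> 0 + 2 * pi"
    using q(2) wn by (auto simp: \<alpha>_def pathfinish_def pathstart_def complex_eq_iff)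
  have polar: "\<gamma> t = (fst (\<gamma> t) * 1, fst (\<gamma> t) * cos (\<alpha> t), fst (\<gamma> t) * sin (\<alpha> t))" if t: "t \<in> {0..1}" for t
  proof -
    have e: "c (\<gamma> t) = exp (q t)" using \<zeta>q[OF t] by (simp add: \<zeta>_def)
    have "Re (q t) = 0" using c1[OF \<gamma>C[OF t]] by (simp add: e)
    then have "c (\<gamma> t) = Complex (cos (\<alpha> t)) (sin (\<alpha> t))"
      unfolding e by (simp add: complex_eq_iff Re_exp Im_exp \<alpha>_def)
    then have "fst (snd (\<gamma> t)) / fst (\<gamma> t) = cos (\<alpha> t)" "snd (snd (\<gamma> t)) / fst (\<gamma> t) = sin (\<alpha> t)"
      by (auto simp: c_def)
    then show ?thesis using pos(1)[OF \<gamma>C[OF t]] by (auto simp: prod_eq_iff field_simps)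
  qed
  obtain S where S: "finite S" "\<gamma> C1_differentiable_on ({0..1} - S)"
    using pw by (auto simp: piecewise_C1_differentiable_on_def)
  have bdd: "bounded (\<alpha> ` {0..1})"
    by (intro compact_imp_bounded compact_continuous_image \<alpha>c) auto
  then obtain N0 where "\<forall>t\<in>{0..1}. \<bar>\<alpha> t\<bar> \<le> N0" by (auto simp: bounded_iff)
  then have N0: "\<And>t. t \<in> {0..1} \<Longrightarrow> \<bar>\<alpha> t\<bar> \<le> N0" by blast
  \<comment> \<open>Room for the range of the angle, for [-pi, pi], and for a further shift by 2 pi,
    using pi < 4.\<close>
  define N where "N = max N0 0 + 20"
  have Gc: "continuous_on UNIV G" using cont by (simp add: G_def)
  obtain P where P: "\<And>x. x \<in> {-N<..<N} \<Longrightarrow> (P has_vector_derivative G x) (at x)"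
    using continuous_primitive_real[OF Gc] by blast
  have pi4: "pi < 4" using pi_less_4 .
  have Pc: "continuous_on {-N<..<N} P"
    by (intro continuous_at_imp_continuous_on ballI) (use P has_vector_derivative_continuous in blast)
  have \<alpha>N: "\<alpha> t \<in> {-N<..<N}" if "t \<in> {0..1}" for t using N0[OF that] by (auto simp: N_def)
  \<comment> \<open>P(x + 2 pi) - P(x) has derivative 0 by periodicity of \<open>G\<close>, so it
    may be evaluated at -pi instead of the initial angle.\<close>
  have period: "P (\<alpha> 0 + 2 * pi) - P (\<alpha> 0) = P pi - P (- pi)"
  proof -
    have D0: "((\<lambda>x. P (x + 2 * pi) - P x) has_vector_derivative 0) (at x within {-N<..<N - 2 * pi})"
      if x: "x \<in> {-N<..<N - 2 * pi}" for x
    proof -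
      have x2: "x + 2 * pi \<in> {-N<..<N}"
        using x pi_gt_zero unfolding greaterThanLessThan_iff by linarith
      have "((\<lambda>x. x + 2 * pi) has_real_derivative 1) (at x)" by (auto intro!: derivative_eq_intros)
      then have "((P \<circ> (\<lambda>x. x + 2 * pi)) has_vector_derivative 1 *\<^sub>R G (x + 2 * pi)) (at x)"
        by (intro vector_diff_chain_at P[OF x2]) (simp add: has_real_derivative_iff_has_vector_derivative)
      then have "((\<lambda>x. P (x + 2 * pi)) has_vector_derivative G x) (at x)" by (simp add: o_def G_def)
      moreover have "x \<in> {-N<..<N}" using x pi_gt_zero unfolding greaterThanLessThan_iff by linarith
      ultimately have "((\<lambda>x. P (x + 2 * pi) - P x) has_vector_derivative 0) (at x)"
        using has_vector_derivative_diff[OF _ P[of x]] by fastforce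
      then show ?thesis by (rule has_vector_derivative_at_within)
    qed
    obtain k where k: "\<And>x. x \<in> {-N<..<N - 2 * pi} \<Longrightarrow> P (x + 2 * pi) - P x = k"
      by (rule has_vector_derivative_zero_constant[OF _ D0]) auto
    have "\<alpha> 0 \<in> {-N<..<N - 2 * pi}"
      using N0[of 0] pi4 unfolding greaterThanLessThan_iff N_def max_def by (auto split: if_splits)
    moreover have "- pi \<in> {-N<..<N - 2 * pi}"
      using pi4 unfolding greaterThanLessThan_iff N_def max_def by (simp split: if_splits)
    ultimately show ?thesis using k[of "\<alpha> 0"] k[of "-pi"] by simp
  qed
  have I1: "((\<lambda>t. g (\<gamma> t) * complex_of_real
        ((fst (snd (\<gamma> t)) * snd (snd (vector_derivative \<gamma> (at t)))
          - snd (snd (\<gamma> t)) * fst (snd (vector_derivative \<gamma> (at t))))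
         / (2 * fst (\<gamma> t)))) has_integral P (\<alpha> 1) / 2 - P (\<alpha> 0) / 2) {0..1}"
  proof (rule fundamental_theorem_of_calculus_interior_strong[OF S(1)])
    show "continuous_on {0..1} (\<lambda>t. P (\<alpha> t) / 2)"
      by (intro continuous_intros continuous_on_compose2[OF Pc \<alpha>c]) (use \<alpha>N in auto)
    fix t :: real assume t: "t \<in> {0<..<1} - S"
    then have t01: "t \<in> {0..1}" by auto
    have "\<gamma> differentiable at t" using S(2) t by (auto simp: C1_differentiable_on_eq)
    then have d\<gamma>: "(\<gamma> has_vector_derivative vector_derivative \<gamma> (at t)) (at t)"
      by (simp add: vector_derivative_works)
    define v where "v = vector_derivative \<gamma> (at t)"
    obtain v0 v1 v2 where v: "v = (v0, v1, v2)" by (metis prod.exhaust)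
    define x0 x1 x2 where "x0 = fst (\<gamma> t)" and "x1 = fst (snd (\<gamma> t))" and "x2 = snd (snd (\<gamma> t))"
    have x0: "x0 > 0" "x0\<^sup>2 = x1\<^sup>2 + x2\<^sup>2" using pos[OF \<gamma>C[OF t01]] by (auto simp: x0_def x1_def x2_def)
    have dd: "(\<gamma> has_derivative (\<lambda>h. h *\<^sub>R v)) (at t)" using d\<gamma> by (simp add: has_vector_derivative_def v_def)
    have d0: "((\<lambda>t. fst (\<gamma> t)) has_real_derivative v0) (at t)"
      using has_derivative_fst[OF dd] by (simp add: has_field_derivative_def v mult.commute[of _ v0] mult_commute_abs)
    have d1: "((\<lambda>t. fst (snd (\<gamma> t))) has_real_derivative v1) (at t)"
      using has_derivative_fst[OF has_derivative_snd[OF dd]] by (simp add: has_field_derivative_def v mult_commute_abs)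
    have d2: "((\<lambda>t. snd (snd (\<gamma> t))) has_real_derivative v2) (at t)"
      using has_derivative_snd[OF has_derivative_snd[OF dd]] by (simp add: has_field_derivative_def v mult_commute_abs)
    have e1: "((\<lambda>t. fst (snd (\<gamma> t)) / fst (\<gamma> t)) has_real_derivative (v1 * x0 - x1 * v0) / (x0 * x0)) (at t)"
      using DERIV_divide[OF d1 d0] x0 by (simp add: x0_def x1_def)
    have e2: "((\<lambda>t. snd (snd (\<gamma> t)) / fst (\<gamma> t)) has_real_derivative (v2 * x0 - x2 * v0) / (x0 * x0)) (at t)"
      using DERIV_divide[OF d2 d0] x0 by (simp add: x0_def x2_def)
    define \<zeta>' where "\<zeta>' = of_real ((v1 * x0 - x1 * v0) / (x0 * x0)) + \<i> * complex_of_real ((v2 * x0 - x2 * v0) / (x0 * x0))"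
    have d\<zeta>: "(\<zeta> has_vector_derivative \<zeta>') (at t)"
      unfolding \<zeta>_def c_eq o_def \<zeta>'_def
      by (intro has_vector_derivative_add has_vector_derivative_mult_right has_vector_derivative_of_real e1 e2)
    have "(q has_vector_derivative \<zeta>' / \<zeta> t) (at t)"
      by (rule has_vector_derivative_continuous_log[OF qc _ _ _ d\<zeta>]) (use \<zeta>q t in auto)
    then have d\<alpha>: "(\<alpha> has_vector_derivative Im (\<zeta>' / \<zeta> t)) (at t)"
      unfolding \<alpha>_def using bounded_linear.has_vector_derivative[OF bounded_linear_Im] by blast
    \<comment> \<open>The derivative of the radius cancels. One power of 1/x0 is the homogeneity
      factor of \<open>g\<close>, the other belongs to the one-form.\<close>
    have im: "Im (\<zeta>' / \<zeta> t) = (x1 * v2 - x2 * v1) / x0\<^sup>2"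
    proof -
      have z: "\<zeta> t = Complex (x1 / x0) (x2 / x0)" by (simp add: \<zeta>_def c_def x0_def x1_def x2_def)
      have n: "(x1 / x0)\<^sup>2 + (x2 / x0)\<^sup>2 = 1" using x0(1) by (simp add: power_divide x0(2)[symmetric] flip: add_divide_distrib)
      have "Im (\<zeta>' / \<zeta> t) = (v2 * x0 - x2 * v0) / (x0 * x0) * (x1 / x0) - (v1 * x0 - x1 * v0) / (x0 * x0) * (x2 / x0)"
        unfolding z Im_divide using n by (simp add: \<zeta>'_def)
      also have "\<dots> = (x1 * v2 - x2 * v1) / x0\<^sup>2"
        using x0(1) by (simp add: field_simps power2_eq_square)
      finally show ?thesis .
    qed
    have gG: "g (\<gamma> t) = G (\<alpha> t) / of_real x0"
    proof -
      have "(1, cos (\<alpha> t), sin (\<alpha> t)) \<in> Cplus"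
        by (simp add: Cplus_def lorR_def zero_prod_def) (use sin_cos_squared_add3[of "\<alpha> t"] in linarith)
      from hom[OF x0(1) this] show ?thesis
        using polar[OF t01] by (simp add: G_def x0_def)
    qed
    have "((P \<circ> \<alpha>) has_vector_derivative Im (\<zeta>' / \<zeta> t) *\<^sub>R G (\<alpha> t)) (at t)"
      by (rule vector_diff_chain_at[OF d\<alpha> P[OF \<alpha>N[OF t01]]])
    then have "((\<lambda>t. P (\<alpha> t) / 2) has_vector_derivative (Im (\<zeta>' / \<zeta> t) *\<^sub>R G (\<alpha> t)) / 2) (at t)"
      unfolding o_def by (rule has_vector_derivative_divide)
    moreover have "(Im (\<zeta>' / \<zeta> t) *\<^sub>R G (\<alpha> t)) / 2 = g (\<gamma> t) * complex_of_real
        ((fst (snd (\<gamma> t)) * snd (snd (vector_derivative \<gamma> (at t)))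
          - snd (snd (\<gamma> t)) * fst (snd (vector_derivative \<gamma> (at t))))
         / (2 * fst (\<gamma> t)))"
      unfolding im gG v_def[symmetric] v using x0(1)
      by (simp add: x0_def[symmetric] x1_def[symmetric] x2_def[symmetric] scaleR_conv_of_real power2_eq_square mult_ac)
    ultimately show "((\<lambda>t. P (\<alpha> t) / 2) has_vector_derivative g (\<gamma> t) * complex_of_real
        ((fst (snd (\<gamma> t)) * snd (snd (vector_derivative \<gamma> (at t)))
          - snd (snd (\<gamma> t)) * fst (snd (vector_derivative \<gamma> (at t))))
         / (2 * fst (\<gamma> t)))) (at t)" by simp
  qed simp
  have "((\<lambda>t. (2 * pi) *\<^sub>R G (2 * pi * t - pi)) has_integral P (2 * pi * 1 - pi) - P (2 * pi * 0 - pi)) {0..1}"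
  proof (rule fundamental_theorem_of_calculus)
    fix t :: real assume t: "t \<in> {0..1}"
    have "\<bar>2 * pi * t - pi\<bar> \<le> pi" using t mult_left_mono[of t 1 "2 * pi"] by (auto simp: abs_le_iff)
    then have r: "2 * pi * t - pi \<in> {-N<..<N}" using pi4 unfolding greaterThanLessThan_iff N_def max_def by (auto split: if_splits)
    have "((\<lambda>t. 2 * pi * t - pi) has_vector_derivative 2 * pi) (at t)"
      unfolding has_real_derivative_iff_has_vector_derivative[symmetric] by (auto intro!: derivative_eq_intros)
    from vector_diff_chain_at[OF this P[OF r]]
    show "((\<lambda>t. P (2 * pi * t - pi)) has_vector_derivative (2 * pi) *\<^sub>R G (2 * pi * t - pi)) (at t within {0..1})"
      by (simp add: o_def has_vector_derivative_at_within)
  qed simp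
  then have "((\<lambda>t. (2 * pi) *\<^sub>R g (gamma0 t)) has_integral P pi - P (- pi)) {0..1}"
    by (simp add: G_def gamma0_def)
  then have "integral {0..1} (\<lambda>t. (2 * pi) *\<^sub>R g (gamma0 t)) = P pi - P (- pi)"
    by (rule integral_unique)
  then have "2 * (of_real pi * integral {0..1} (\<lambda>t. g (gamma0 t))) = P pi - P (- pi)"
    by (simp add: scaleR_conv_of_real mult.assoc)
  moreover have "2 * cycle_int g \<gamma> = P pi - P (- pi)"
  proof -
    have "cycle_int g \<gamma> = P (\<alpha> 1) / 2 - P (\<alpha> 0) / 2"
      unfolding cycle_int_def by (rule integral_unique[OF I1])
    then show ?thesis using period by (simp add: \<alpha>1 right_diff_distrib)
  qed
  ultimately show ?thesis by (metis mult_cancel_left zero_neq_numeral)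
qed

section \<open>Cauchy integrals on the tubes\<close>

lemma integral_inverse_one_plus_square:
  "integrable lborel (\<lambda>x::real. 1 / (1 + x\<^sup>2))" "(\<integral>x. 1 / (1 + x\<^sup>2) \<partial>lborel) = pi"
proof -
  have d: "(arctan has_real_derivative 1 / (1 + x\<^sup>2)) (at x)" for x
    using DERIV_arctan[of x] by (simp add: inverse_eq_divide)
  have c: "isCont (\<lambda>x::real. 1 / (1 + x\<^sup>2)) x" for x
    by (intro continuous_intros) (metis add.commute add_nonneg_eq_0_iff one_neq_zero zero_le_one zero_le_power2)
  note F = interval_integral_FTC_nonneg[of "-\<infinity>" \<infinity> arctan "\<lambda>x. 1 / (1 + x\<^sup>2)" "- (pi / 2)" "pi / 2"]
  have b: "((arctan \<circ> real_of_ereal) \<longlongrightarrow> - (pi / 2)) (at_right (- \<infinity>))"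
    "((arctan \<circ> real_of_ereal) \<longlongrightarrow> pi / 2) (at_left \<infinity>)"
    using tendsto_arctan_at_bot tendsto_arctan_at_top by (auto simp: ereal_tendsto_simps1)
  have "set_integrable lborel (einterval (-\<infinity>) \<infinity>) (\<lambda>x::real. 1 / (1 + x\<^sup>2))"
    by (rule F(1)) (use d c b in auto)
  then show "integrable lborel (\<lambda>x::real. 1 / (1 + x\<^sup>2))"
    by (simp add: set_integrable_def einterval_def)
  have "(LBINT x=-\<infinity>..\<infinity>. 1 / (1 + x\<^sup>2)) = pi / 2 - - (pi / 2)"
    by (rule F(2)) (use d c b in auto)
  then show "(\<integral>x. 1 / (1 + x\<^sup>2) \<partial>lborel) = pi"
    by (simp add: interval_lebesgue_integral_def set_lebesgue_integral_def einterval_def)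
qed

lemma integral_Poisson_kernel:
  assumes "Im l > 0"
  shows "integrable lborel (\<lambda>u. 1 / (cmod (of_real u - l))\<^sup>2)"
    "(\<integral>u. 1 / (cmod (of_real u - l))\<^sup>2 \<partial>lborel) = pi / Im l"
proof -
  define x y where "x = Re l" and "y = Im l"
  have y: "y > 0" using assms by (simp add: y_def)
  have eq: "1 / (1 + (- x / y + (1 / y) * u)\<^sup>2) = y\<^sup>2 * (1 / (cmod (of_real u - l))\<^sup>2)" for u
  proof -
    have "- x / y + (1 / y) * u = (u - x) / y" using y by (simp add: field_simps)
    then have "1 + (- x / y + (1 / y) * u)\<^sup>2 = (y\<^sup>2 + (u - x)\<^sup>2) / y\<^sup>2"
      using y by (simp add: power_divide add_divide_distrib)
    moreover have "(cmod (of_real u - l))\<^sup>2 = y\<^sup>2 + (u - x)\<^sup>2"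
      by (simp add: cmod_power2 x_def y_def)
    ultimately show ?thesis by simp
  qed
  have "integrable lborel (\<lambda>u. 1 / (1 + (- x / y + (1 / y) * u)\<^sup>2))"
    by (rule lborel_integrable_real_affine[OF integral_inverse_one_plus_square(1)]) (use y in simp)
  then have "integrable lborel (\<lambda>u. (1 / y\<^sup>2) * (y\<^sup>2 * (1 / (cmod (of_real u - l))\<^sup>2)))"
    unfolding eq by (rule integrable_mult_right)
  then show "integrable lborel (\<lambda>u. 1 / (cmod (of_real u - l))\<^sup>2)" using y by simp
  have "pi = \<bar>1 / y\<bar> *\<^sub>R (\<integral>u. 1 / (1 + (- x / y + (1 / y) * u)\<^sup>2) \<partial>lborel)"
    unfolding integral_inverse_one_plus_square(2)[symmetric]
    by (rule lborel_integral_real_affine) (use y in simp)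
  then show "(\<integral>u. 1 / (cmod (of_real u - l))\<^sup>2 \<partial>lborel) = pi / Im l"
    unfolding eq integral_mult_right_zero using y by (simp add: y_def[symmetric] field_simps power2_eq_square)
qed

text \<open>Off the real axis |u - l| dominates a multiple of 1 + |u|; this turns decay like 1/(1 +
  |u|) of a numerator into the integrable majorant 1/(1 + u^2) of the Cauchy integrand.\<close>

lemma cmod_diff_ge_linear:
  assumes "Im l \<noteq> 0"
  shows "\<bar>Im l\<bar> / (1 + cmod l + \<bar>Im l\<bar>) * (1 + \<bar>u\<bar>) \<le> cmod (of_real u - l)"
proof -
  define d where "d = cmod (of_real u - l)"
  have d: "d \<ge> \<bar>Im l\<bar>" using abs_Im_le_cmod[of "of_real u - l"] by (simp add: d_def)
  have "\<bar>u\<bar> \<le> d + cmod l" using norm_triangle_ineq[of "of_real u - l" l] by (simp add: d_def)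
  then have "\<bar>Im l\<bar> * (1 + \<bar>u\<bar>) \<le> \<bar>Im l\<bar> * (1 + cmod l) + \<bar>Im l\<bar> * d"
    using mult_left_mono[of "1 + \<bar>u\<bar>" "1 + cmod l + d" "\<bar>Im l\<bar>"] by (simp add: algebra_simps)
  also have "\<bar>Im l\<bar> * (1 + cmod l) \<le> d * (1 + cmod l)" using d by (intro mult_right_mono) auto
  finally have "\<bar>Im l\<bar> * (1 + \<bar>u\<bar>) \<le> d * (1 + cmod l + \<bar>Im l\<bar>)" by (simp add: algebra_simps)
  then show ?thesis unfolding d_def[symmetric] by (simp add: pos_divide_le_eq add_pos_nonneg field_simps)
qed

lemma inverse_square_bound: "1 / ((1 + \<bar>u\<bar>) * (1 + \<bar>u\<bar>)) \<le> 1 / (1 + u\<^sup>2)" for u :: real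
proof -
  have "(1 + \<bar>u\<bar>) * (1 + \<bar>u\<bar>) = 1 + u\<^sup>2 + 2 * \<bar>u\<bar>" by (simp add: algebra_simps power2_eq_square)
  then show ?thesis by (intro divide_left_mono mult_pos_pos) (auto simp: add_pos_nonneg)
qed

lemma Cauchy_kernel_bound:
  fixes a :: complex and C :: real
  assumes l: "Im l \<noteq> 0" and a: "cmod a \<le> C / (1 + \<bar>u\<bar>)"
  shows "cmod (a / (of_real u - l)) \<le> C * (1 + cmod l + \<bar>Im l\<bar>) / \<bar>Im l\<bar> * (1 / (1 + u\<^sup>2))"
proof -
  define k where "k = \<bar>Im l\<bar> / (1 + cmod l + \<bar>Im l\<bar>)"
  have k: "k > 0" using l by (simp add: k_def add_pos_nonneg)
  have "C / (1 + \<bar>u\<bar>) \<ge> 0" using a norm_ge_zero order_trans by blast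
  moreover have "C = C / (1 + \<bar>u\<bar>) * (1 + \<bar>u\<bar>)" by simp
  ultimately have C: "C \<ge> 0" by (metis abs_ge_zero add_nonneg_nonneg mult_nonneg_nonneg zero_le_one)
  have "cmod (a / (of_real u - l)) \<le> (C / (1 + \<bar>u\<bar>)) / (k * (1 + \<bar>u\<bar>))"
    unfolding norm_divide using a k cmod_diff_ge_linear[OF l, of u]
    by (intro frac_le) (auto simp: k_def[symmetric] C)
  also have "\<dots> = C / k * (1 / ((1 + \<bar>u\<bar>) * (1 + \<bar>u\<bar>)))" by simp
  also have "\<dots> \<le> C / k * (1 / (1 + u\<^sup>2))"
    using C k by (intro mult_left_mono inverse_square_bound) auto
  finally show ?thesis by (simp add: k_def)
qed

text \<open>The pole at l is removed by subtracting h(l) (l - cnj l) / (z - cnj l) from h: this term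
  agrees with h at l, is holomorphic in the upper half-plane and decays like 1/|z|. The quotient of
  the difference by z - l then decays quadratically and integrates to 0, while on the real line the
  subtracted part is a multiple of the Poisson kernel.\<close>

lemma upper_half_plane_Cauchy:
  assumes hol: "h holomorphic_on {z. Im z > -d}" and d: "d > 0" and l: "Im l > 0"
    and bound: "\<And>z. Im z \<ge> 0 \<Longrightarrow> cmod (h z) \<le> C / (1 + cmod z)"
  shows "integrable lborel (\<lambda>u. h (of_real u) / (of_real u - l))"
    "(\<integral>u. h (of_real u) / (of_real u - l) \<partial>lborel) = 2 * of_real pi * \<i> * h l"
proof -
  have hc: "continuous_on UNIV (\<lambda>u::real. h (of_real u))"
    using d by (intro continuous_on_compose2[OF holomorphic_on_imp_continuous_on[OF hol]] continuous_intros) auto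
  have ul: "of_real u - l \<noteq> 0" "of_real u - cnj l \<noteq> 0" for u
    using l by (auto simp: complex_eq_iff)
  have bm: "(\<lambda>u. h (of_real u) / (of_real u - l)) \<in> borel_measurable borel"
    by (intro borel_measurable_continuous_onI continuous_intros hc) (use ul in auto)
  show i1: "integrable lborel (\<lambda>u. h (of_real u) / (of_real u - l))"
  proof (rule Bochner_Integration.integrable_bound)
    show "integrable lborel (\<lambda>u. C * (1 + cmod l + \<bar>Im l\<bar>) / \<bar>Im l\<bar> * (1 / (1 + u\<^sup>2)) :: real)"
      by (intro integrable_mult_right integral_inverse_one_plus_square)
    show "AE u in lborel. norm (h (of_real u) / (of_real u - l)) \<le> norm (C * (1 + cmod l + \<bar>Im l\<bar>) / \<bar>Im l\<bar> * (1 / (1 + u\<^sup>2)))"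
    proof (rule AE_I2)
      fix u :: real
      have "cmod (h (of_real u)) \<le> C / (1 + \<bar>u\<bar>)" using bound[of "of_real u"] by simp
      then show "norm (h (of_real u) / (of_real u - l)) \<le> norm (C * (1 + cmod l + \<bar>Im l\<bar>) / \<bar>Im l\<bar> * (1 / (1 + u\<^sup>2)))"
        using l unfolding real_norm_def by (intro order_trans[OF Cauchy_kernel_bound abs_ge_self]) auto
    qed
  qed (use bm in simp)
  define N where "N = (\<lambda>z. h z - h l * (l - cnj l) / (z - cnj l))"
  define q where "q = (\<lambda>z. if z = l then deriv N l else (N z - N l) / (z - l))"
  \<comment> \<open>Keeps the pole at cnj l outside the half-plane.\<close>
  define d' where "d' = min d (Im l)"
  have d': "d' > 0" using d l by (simp add: d'_def)
  have Nl: "N l = 0" using l by (simp add: N_def complex_eq_iff)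
  have "N holomorphic_on {z. Im z > -d'}"
    unfolding N_def
    by (intro holomorphic_intros holomorphic_on_subset[OF hol]) (auto simp: d'_def complex_eq_iff)
  then have qh: "q holomorphic_on {z. Im z > -d'}"
    unfolding q_def by (rule pole_lemma_open) (rule open_halfspace_Im_gt)
  have C: "C \<ge> 0" using order_trans[OF norm_ge_zero bound[of 0]] by simp
  have qr: "q (of_real u) = h (of_real u) / (of_real u - l) - (h l * (2 * \<i> * of_real (Im l))) * of_real (1 / (cmod (of_real u - l))\<^sup>2)" for u
  proof -
    have "l - cnj l = 2 * \<i> * of_real (Im l)" by (simp add: complex_eq_iff)
    moreover have "of_real ((cmod (of_real u - l))\<^sup>2) = (of_real u - l) * (of_real u - cnj l)"
      by (simp add: complex_norm_square del: of_real_power)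
    ultimately show ?thesis
      using ul[of u] l by (simp add: q_def Nl N_def diff_divide_distrib)
  qed
  have i2: "integrable lborel (\<lambda>u. (h l * (2 * \<i> * of_real (Im l))) * of_real (1 / (cmod (of_real u - l))\<^sup>2))"
    using integral_Poisson_kernel(1)[OF l] by (intro integrable_mult_right integrable_of_real)
  have "(\<integral>u. q (of_real u) \<partial>lborel) = 0"
  proof (rule upper_half_plane_integral_zero[OF qh d'])
    show "integrable lborel (\<lambda>x. q (complex_of_real x))" unfolding qr using i1 i2 by simp
    fix z assume z: "Im z \<ge> 0" "cmod z \<ge> 2 * cmod l + 1"
    have zp: "cmod z > 0" using z(2) norm_ge_zero[of l] by linarith
    have zl: "cmod (z - l) \<ge> cmod z / 2" using norm_triangle_ineq2[of z l] z(2) by (simp add: field_simps)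
    have zl': "cmod (z - cnj l) \<ge> cmod z / 2" using norm_triangle_ineq2[of z "cnj l"] z(2) by (simp add: field_simps)
    have n1: "cmod (h z) \<le> C / cmod z"
      using bound[OF z(1)] C zp by (elim order_trans) (intro divide_left_mono mult_pos_pos, auto simp: add_pos_nonneg)
    have n2: "cmod (h l * (l - cnj l) / (z - cnj l)) \<le> cmod (h l * (l - cnj l)) / (cmod z / 2)"
      unfolding norm_divide using zl' zp by (intro divide_left_mono mult_pos_pos) auto
    have "cmod (N z) \<le> C / cmod z + cmod (h l * (l - cnj l)) / (cmod z / 2)"
      unfolding N_def by (rule order_trans[OF norm_triangle_ineq4 add_mono[OF n1 n2]])
    also have "\<dots> = (C + 2 * cmod (h l * (l - cnj l))) / cmod z" by (simp add: add_divide_distrib)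
    finally have Nz: "cmod (N z) \<le> (C + 2 * cmod (h l * (l - cnj l))) / cmod z" .
    have "z \<noteq> l" using zl zp by auto
    then have "cmod (q z) = cmod (N z) / cmod (z - l)" by (simp add: q_def Nl norm_divide)
    also have "\<dots> \<le> ((C + 2 * cmod (h l * (l - cnj l))) / cmod z) / (cmod z / 2)"
      using Nz zl zp C by (intro frac_le) auto
    also have "\<dots> = 2 * (C + 2 * cmod (h l * (l - cnj l))) / (cmod z)\<^sup>2" by (simp add: power2_eq_square)
    finally show "cmod (q z) \<le> 2 * (C + 2 * cmod (h l * (l - cnj l))) / (cmod z)\<^sup>2" .
  qed
  moreover have "(\<integral>u. q (of_real u) \<partial>lborel) = (\<integral>u. h (of_real u) / (of_real u - l) \<partial>lborel) - (h l * (2 * \<i> * of_real (Im l))) * of_real (pi / Im l)"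
    unfolding qr Bochner_Integration.integral_diff[OF i1 i2]
    by (simp only: integral_mult_right_zero integral_complex_of_real integral_Poisson_kernel(2)[OF l])
  ultimately show "(\<integral>u. h (of_real u) / (of_real u - l) \<partial>lborel) = 2 * of_real pi * \<i> * h l"
    using l by simp
qed

text \<open>The lower half-plane is carried to the upper one by z -> -z; the reversed orientation of
  the real line gives the sign \<open>\<sigma>\<close>.\<close>

lemma half_plane_Cauchy:
  fixes \<sigma> :: real
  assumes \<sigma>: "\<sigma> \<in> {1, -1}"
    and hol: "h holomorphic_on {z. \<sigma> * Im z > -d}" and d: "d > 0" and l: "\<sigma> * Im l > 0"
    and bound: "\<And>z. \<sigma> * Im z \<ge> 0 \<Longrightarrow> cmod (h z) \<le> C / (1 + cmod z)"
  shows "integrable lborel (\<lambda>u. h (of_real u) / (of_real u - l))"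
    "(\<integral>u. h (of_real u) / (of_real u - l) \<partial>lborel) = 2 * of_real pi * \<i> * of_real \<sigma> * h l"
proof -
  have "integrable lborel (\<lambda>u. h (of_real u) / (of_real u - l)) \<and>
    (\<integral>u. h (of_real u) / (of_real u - l) \<partial>lborel) = 2 * of_real pi * \<i> * of_real \<sigma> * h l"
  proof (cases "\<sigma> = 1")
    case True
    then show ?thesis using upper_half_plane_Cauchy[of h d l C] hol d l bound by simp
  next
    case False
    then have s: "\<sigma> = -1" using \<sigma> by simp
    have hm: "(\<lambda>z. h (- z)) holomorphic_on {z. Im z > -d}"
    proof -
      have "h \<circ> (\<lambda>z. - z) holomorphic_on {z. Im z > -d}"
        by (rule holomorphic_on_compose_gen[OF _ hol]) (auto simp: s intro!: holomorphic_intros)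
      then show ?thesis by (simp add: o_def)
    qed
    have b: "cmod (h (- z)) \<le> C / (1 + cmod z)" if "Im z \<ge> 0" for z
      using bound[of "- z"] that by (simp add: s)
    note U = upper_half_plane_Cauchy[OF hm d _ b, of "- l"]
    have eq: "h (- of_real u) / (of_real u - - l) = - (h (of_real (0 + -1 * u)) / (of_real (0 + -1 * u) - l))" for u
      by (simp add: minus_divide_right)
    have i: "integrable lborel (\<lambda>u. h (- of_real u) / (of_real u - - l))"
      using U(1) l by (simp add: s)
    have "integrable lborel (\<lambda>u. h (- of_real (0 + -1 * u)) / (of_real (0 + -1 * u) - - l))"
      by (rule lborel_integrable_real_affine[OF i]) simp
    moreover have "h (- of_real (0 + -1 * u)) / (of_real (0 + -1 * u) - - l) = - (h (of_real u) / (of_real u - l))" for u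
      by (simp add: minus_divide_right)
    ultimately have I: "integrable lborel (\<lambda>u. h (of_real u) / (of_real u - l))" by simp
    have "(\<integral>u. h (of_real u) / (of_real u - l) \<partial>lborel) = \<bar>-1\<bar> *\<^sub>R (\<integral>u. h (of_real (0 + -1 * u)) / (of_real (0 + -1 * u) - l) \<partial>lborel)"
      by (rule lborel_integral_real_affine) simp
    also have "\<dots> = - (\<integral>u. h (- of_real u) / (of_real u - - l) \<partial>lborel)"
      unfolding eq by simp
    also have "\<dots> = - (2 * of_real pi * \<i> * h l)"
      using U(2) l by (simp add: s)
    finally show ?thesis using I by (simp add: s)
  qed
  then show "integrable lborel (\<lambda>u. h (of_real u) / (of_real u - l))"
    "(\<integral>u. h (of_real u) / (of_real u - l) \<partial>lborel) = 2 * of_real pi * \<i> * of_real \<sigma> * h l" by auto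
qed

section \<open>The Cauchy formula in two variables\<close>

lemma holo2_continuous_on: "holo2 G S \<Longrightarrow> continuous_on S G"
  unfolding holo2_def
  by (intro continuous_at_imp_continuous_on ballI) (blast intro: has_derivative_continuous)

lemma holo2_slice:
  assumes "holo2 G S" "(l, m) \<in> S"
  shows "(\<lambda>z. G (z, m)) field_differentiable at l" "(\<lambda>z. G (l, z)) field_differentiable at m"
proof -
  obtain a b where d: "(G has_derivative (\<lambda>(h, k). a * h + b * k)) (at (l, m))"
    using assms unfolding holo2_def by blast
  have "((\<lambda>z. (z, m)) has_derivative (\<lambda>h. (h, 0))) (at l)"
    by (auto intro!: derivative_eq_intros)
  from has_derivative_compose[OF this d] have "((\<lambda>z. G (z, m)) has_derivative (\<lambda>h. a * h)) (at l)"
    by simp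
  then show "(\<lambda>z. G (z, m)) field_differentiable at l"
    unfolding field_differentiable_def has_field_derivative_def by blast
  have "((\<lambda>z. (l, z)) has_derivative (\<lambda>h. (0, h))) (at m)"
    by (auto intro!: derivative_eq_intros)
  from has_derivative_compose[OF this d] have "((\<lambda>z. G (l, z)) has_derivative (\<lambda>h. b * h)) (at m)"
    by simp
  then show "(\<lambda>z. G (l, z)) field_differentiable at m"
    unfolding field_differentiable_def has_field_derivative_def by blast
qed

lemma integrable_product_lborel:
  fixes f g :: "real \<Rightarrow> real"
  assumes "integrable lborel f" "integrable lborel g"
  shows "integrable lborel (\<lambda>p. f (fst p) * g (snd p))"
proof -
  have "integrable (lborel \<Otimes>\<^sub>M lborel) (\<lambda>(x, y). f x * g y)"
    by (rule lborel_pair.Fubini_integrable)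
      (use assms in \<open>auto simp: abs_mult intro!: integrable_mult_left integrable_mult_right integrable_abs\<close>)
  then show ?thesis by (simp add: lborel_prod case_prod_beta')
qed

lemma cmod_Complex_ge: "\<bar>x\<bar> \<le> cmod (Complex x y)"
  using abs_Re_le_cmod[of "Complex x y"] by simp

lemma integrable_tube_kernel:
  fixes f :: "real \<times> real \<Rightarrow> complex"
  assumes c: "c \<ge> 0" and nz: "Im l \<noteq> 0" "Im m \<noteq> 0" and fm: "f \<in> borel_measurable borel"
    and bd: "AE p in lborel. cmod (f p) \<le> c / ((1 + \<bar>fst p\<bar>) * (1 + \<bar>snd p\<bar>))"
  shows "integrable lborel (\<lambda>p. f p / ((of_real (fst p) - l) * (of_real (snd p) - m)))"
proof -
  define k where "k = (\<lambda>l::complex. (1 + cmod l + \<bar>Im l\<bar>) / \<bar>Im l\<bar>)"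
  have ne: "of_real u - l \<noteq> 0" "of_real u - m \<noteq> 0" for u using nz by (auto simp: complex_eq_iff)
  have km: "(\<lambda>p. (of_real (fst p) - l) * (of_real (snd p) - m)) \<in> borel_measurable borel"
    by (intro borel_measurable_continuous_onI continuous_intros)
  have Hb: "cmod (f (u, v) / ((of_real u - l) * (of_real v - m))) \<le> (c * k l * (1 / (1 + u\<^sup>2))) * (k m * (1 / (1 + v\<^sup>2)))"
    if "cmod (f (u, v)) \<le> c / ((1 + \<bar>u\<bar>) * (1 + \<bar>v\<bar>))" for u v
  proof -
    have "cmod (of_real (c / (1 + \<bar>u\<bar>)) / (of_real u - l)) \<le> c * (1 + cmod l + \<bar>Im l\<bar>) / \<bar>Im l\<bar> * (1 / (1 + u\<^sup>2))"
      by (rule Cauchy_kernel_bound[OF nz(1)]) (simp only: norm_of_real, use c in simp)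
    moreover have "cmod (of_real (1 / (1 + \<bar>v\<bar>)) / (of_real v - m)) \<le> 1 * (1 + cmod m + \<bar>Im m\<bar>) / \<bar>Im m\<bar> * (1 / (1 + v\<^sup>2))"
      by (rule Cauchy_kernel_bound[OF nz(2)]) (simp only: norm_of_real, simp)
    ultimately have "cmod (of_real (c / (1 + \<bar>u\<bar>)) / (of_real u - l)) * cmod (of_real (1 / (1 + \<bar>v\<bar>)) / (of_real v - m))
       \<le> (c * k l * (1 / (1 + u\<^sup>2))) * (k m * (1 / (1 + v\<^sup>2)))"
      using c by (intro mult_mono) (auto simp: k_def)
    moreover have "cmod (f (u, v) / ((of_real u - l) * (of_real v - m))) \<le> c / ((1 + \<bar>u\<bar>) * (1 + \<bar>v\<bar>)) / (cmod (of_real u - l) * cmod (of_real v - m))"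
      unfolding norm_divide norm_mult by (intro divide_right_mono that) auto
    moreover have "c / ((1 + \<bar>u\<bar>) * (1 + \<bar>v\<bar>)) / (cmod (of_real u - l) * cmod (of_real v - m)) =
        cmod (of_real (c / (1 + \<bar>u\<bar>)) / (of_real u - l)) * cmod (of_real (1 / (1 + \<bar>v\<bar>)) / (of_real v - m))"
      unfolding norm_divide norm_of_real using c by (simp add: mult_ac)
    ultimately show ?thesis by linarith
  qed
  show ?thesis
  proof (rule Bochner_Integration.integrable_bound)
    show "integrable lborel (\<lambda>p. (c * k l * (1 / (1 + (fst p)\<^sup>2))) * (k m * (1 / (1 + (snd p)\<^sup>2))) :: real)"
      by (intro integrable_product_lborel[of "\<lambda>u. c * k l * (1 / (1 + u\<^sup>2))" "\<lambda>v. k m * (1 / (1 + v\<^sup>2))"] integrable_mult_right integral_inverse_one_plus_square)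
    show "AE p in lborel. norm (f p / ((of_real (fst p) - l) * (of_real (snd p) - m))) \<le> norm ((c * k l * (1 / (1 + (fst p)\<^sup>2))) * (k m * (1 / (1 + (snd p)\<^sup>2))))"
      using bd
    proof eventually_elim
      case (elim p)
      show ?case
        unfolding real_norm_def[of "_ * _"] using Hb[of "fst p" "snd p"] elim
        by (intro order_trans[OF _ abs_ge_self]) simp
    qed
  qed (use fm km in \<open>simp add: borel_measurable_divide\<close>)
qed

text \<open>After the shifts by ia and ib the function is holomorphic beyond the real axis in each
  variable, so the half-plane formula applies in one variable after the other. The two half-planes
  carry opposite signs E and -E, so the two factors 2 pi i combine to +4 pi^2.\<close>

lemma tube_Cauchy_shifted:
  assumes E: "E \<in> {1, -1::real}" and G: "holo2 G (ptube E)"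
    and bound: "\<And>l m. (l, m) \<in> ptube E \<Longrightarrow> cmod (G (l, m)) \<le> c / ((1 + cmod l) * (1 + cmod m))"
    and ab: "(a, b) \<in> pquad E" and lm: "(l, m) \<in> ptube E"
  shows "integrable lborel (\<lambda>p. G (Complex (fst p) a, Complex (snd p) b) / ((of_real (fst p) - l) * (of_real (snd p) - m)))"
    "(\<integral>p. G (Complex (fst p) a, Complex (snd p) b) / ((of_real (fst p) - l) * (of_real (snd p) - m)) \<partial>lborel)
       = 4 * of_real (pi\<^sup>2) * G (l + \<i> * of_real a, m + \<i> * of_real b)"
proof -
  have ab': "- E * a > 0" "E * b > 0" using ab by (auto simp: pquad_def)
  have lm': "- E * Im l > 0" "E * Im m > 0" using lm by (auto simp: ptube_def)
  have Eabs: "\<bar>E\<bar> = 1" and Enz: "E \<noteq> 0" using E by auto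
  have nz: "Im l \<noteq> 0" "Im m \<noteq> 0" using lm' by auto
  have "(Complex 0 a, Complex 0 b) \<in> ptube E" using ab' by (simp add: ptube_def)
  from order_trans[OF norm_ge_zero bound[OF this]] have "0 \<le> c / ((1 + cmod (Complex 0 a)) * (1 + cmod (Complex 0 b)))" .
  moreover have "(1 + cmod (Complex 0 a)) * (1 + cmod (Complex 0 b)) > 0" by (intro mult_pos_pos add_pos_nonneg) auto
  ultimately have c: "c \<ge> 0" by (simp add: pos_le_divide_eq)
  define H where "H = (\<lambda>p. G (Complex (fst p) a, Complex (snd p) b) / ((of_real (fst p) - l) * (of_real (snd p) - m)))"
  have in_tube: "(Complex u a, Complex v b) \<in> ptube E" for u v using ab' by (simp add: ptube_def)
  have Gc: "continuous_on UNIV (\<lambda>p::real\<times>real. G (Complex (fst p) a, Complex (snd p) b))"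
    by (rule continuous_on_compose2[OF holo2_continuous_on[OF G]])
      (use in_tube in \<open>auto simp: Complex_eq intro!: continuous_intros\<close>)
  have ne: "of_real u - l \<noteq> 0" "of_real u - m \<noteq> 0" for u using nz by (auto simp: complex_eq_iff)
  have bd1: "cmod (G (Complex u a, Complex v b)) \<le> c / ((1 + \<bar>u\<bar>) * (1 + \<bar>v\<bar>))" for u v
  proof -
    have "c / ((1 + cmod (Complex u a)) * (1 + cmod (Complex v b))) \<le> c / ((1 + \<bar>u\<bar>) * (1 + \<bar>v\<bar>))"
      using c cmod_Complex_ge by (intro divide_left_mono mult_mono mult_pos_pos) (auto simp: add_pos_nonneg)
    then show ?thesis using bound[OF in_tube[of u v]] by simp
  qed
  have "integrable lborel H"
    unfolding H_def using bd1 borel_measurable_continuous_onI[OF Gc] by (intro integrable_tube_kernel[OF c nz]) auto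
  then show I: "integrable lborel (\<lambda>p. G (Complex (fst p) a, Complex (snd p) b) / ((of_real (fst p) - l) * (of_real (snd p) - m)))"
    by (simp add: H_def)
  have "integrable (lborel \<Otimes>\<^sub>M lborel) (case_prod (\<lambda>u v. H (u, v)))"
    using \<open>integrable lborel H\<close> by (simp add: lborel_prod)
  from lborel_pair.integral_fst'[OF this] have "(\<integral>p. H p \<partial>lborel) = (\<integral>u. \<integral>v. H (u, v) \<partial>lborel \<partial>lborel)"
    by (simp add: lborel_prod)
  also have "\<dots> = (\<integral>u. (2 * of_real pi * \<i> * of_real E) * (G (Complex u a, m + \<i> * of_real b) / (of_real u - l)) \<partial>lborel)"
  proof (rule Bochner_Integration.integral_cong[OF refl])
    fix u
    have "(\<integral>v. (\<lambda>z. G (Complex u a, z + \<i> * of_real b)) (of_real v) / (of_real v - m) \<partial>lborel) = 2 * of_real pi * \<i> * of_real E * G (Complex u a, m + \<i> * of_real b)"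
    proof (rule half_plane_Cauchy(2))
      show "E \<in> {1, -1}" by (rule E)
      show "E * b > 0" "E * Im m > 0" using ab' lm' by auto
      show "(\<lambda>z. G (Complex u a, z + \<i> * of_real b)) holomorphic_on {z. - (E * b) < E * Im z}"
      proof (rule holomorphic_onI, rule field_differentiable_at_within)
        fix z assume "z \<in> {z. - (E * b) < E * Im z}"
        then have "(Complex u a, z + \<i> * of_real b) \<in> ptube E"
          using ab' by (simp add: ptube_def ring_distribs)
        from holo2_slice(2)[OF G this]
        show "(\<lambda>z. G (Complex u a, z + \<i> * of_real b)) field_differentiable at z"
          using field_differentiable_compose[of "\<lambda>z. z + \<i> * of_real b" z "\<lambda>w. G (Complex u a, w)"]
          by (simp add: o_def field_differentiable_add)
      qed
      fix z assume z: "0 \<le> E * Im z"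
      then have t: "(Complex u a, z + \<i> * of_real b) \<in> ptube E"
        using ab' by (simp add: ptube_def ring_distribs)
      \<comment> \<open>The shift points into the half-plane, so it does not decrease the modulus,
        and the decay bound survives in the unshifted variable.\<close>
      have "\<bar>Im z\<bar> \<le> \<bar>Im z + b\<bar>" using z ab' E by auto
      then have "cmod z \<le> cmod (z + \<i> * of_real b)" unfolding cmod_def
        by (intro real_sqrt_le_mono add_mono) (auto simp: abs_le_square_iff)
      then have "c / ((1 + cmod (Complex u a)) * (1 + cmod (z + \<i> * of_real b))) \<le> c / (1 * (1 + cmod z))"
        using c by (intro divide_left_mono mult_mono mult_pos_pos) (auto simp: add_pos_nonneg)
      then show "cmod (G (Complex u a, z + \<i> * of_real b)) \<le> c / (1 + cmod z)"
        using bound[OF t] by simp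
    qed
    moreover have "H (u, v) = (1 / (of_real u - l)) * ((\<lambda>z. G (Complex u a, z + \<i> * of_real b)) (of_real v) / (of_real v - m))" for v
      by (simp add: H_def Complex_eq)
    ultimately show "(\<integral>v. H (u, v) \<partial>lborel) = (2 * of_real pi * \<i> * of_real E) * (G (Complex u a, m + \<i> * of_real b) / (of_real u - l))"
      by (simp only: integral_mult_right_zero) simp
  qed
  also have "\<dots> = (2 * of_real pi * \<i> * of_real E) * (\<integral>u. (\<lambda>z. G (z + \<i> * of_real a, m + \<i> * of_real b)) (of_real u) / (of_real u - l) \<partial>lborel)"
    unfolding integral_mult_right_zero[symmetric] by (simp add: Complex_eq)
  also have "(\<integral>u. (\<lambda>z. G (z + \<i> * of_real a, m + \<i> * of_real b)) (of_real u) / (of_real u - l) \<partial>lborel) = 2 * of_real pi * \<i> * of_real (- E) * G (l + \<i> * of_real a, m + \<i> * of_real b)"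
  proof (rule half_plane_Cauchy(2))
    show "- E \<in> {1, -1}" using E by auto
    show "- E * a > 0" "- E * Im l > 0" using ab' lm' by auto
    show "(\<lambda>z. G (z + \<i> * of_real a, m + \<i> * of_real b)) holomorphic_on {z. - (- E * a) < - E * Im z}"
    proof (rule holomorphic_onI, rule field_differentiable_at_within)
      fix z assume "z \<in> {z. - (- E * a) < - E * Im z}"
      then have "(z + \<i> * of_real a, m + \<i> * of_real b) \<in> ptube E"
        using ab' lm' by (simp add: ptube_def ring_distribs)
      from holo2_slice(1)[OF G this]
      show "(\<lambda>z. G (z + \<i> * of_real a, m + \<i> * of_real b)) field_differentiable at z"
        using field_differentiable_compose[of "\<lambda>z. z + \<i> * of_real a" z "\<lambda>w. G (w, m + \<i> * of_real b)"]
        by (simp add: o_def field_differentiable_add)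
    qed
    fix z assume z: "0 \<le> - E * Im z"
    then have t: "(z + \<i> * of_real a, m + \<i> * of_real b) \<in> ptube E"
      using ab' lm' by (simp add: ptube_def ring_distribs)
    have "\<bar>Im z\<bar> \<le> \<bar>Im z + a\<bar>" using z ab' E by auto
    then have "cmod z \<le> cmod (z + \<i> * of_real a)" unfolding cmod_def
      by (intro real_sqrt_le_mono add_mono) (auto simp: abs_le_square_iff)
    then have "c / ((1 + cmod (z + \<i> * of_real a)) * (1 + cmod (m + \<i> * of_real b))) \<le> c / ((1 + cmod z) * 1)"
      using c by (intro divide_left_mono mult_mono mult_pos_pos) (auto simp: add_pos_nonneg)
    then show "cmod (G (z + \<i> * of_real a, m + \<i> * of_real b)) \<le> c / (1 + cmod z)"
      using bound[OF t] by simp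
  qed
  finally have "(\<integral>p. H p \<partial>lborel) = (2 * of_real pi * \<i> * of_real E) * (2 * of_real pi * \<i> * of_real (- E) * G (l + \<i> * of_real a, m + \<i> * of_real b))" .
  also have "\<dots> = 4 * of_real (pi\<^sup>2) * G (l + \<i> * of_real a, m + \<i> * of_real b)"
    using E by (auto simp: power2_eq_square algebra_simps)
  finally show "(\<integral>p. G (Complex (fst p) a, Complex (snd p) b) / ((of_real (fst p) - l) * (of_real (snd p) - m)) \<partial>lborel)
       = 4 * of_real (pi\<^sup>2) * G (l + \<i> * of_real a, m + \<i> * of_real b)"
    by (simp add: H_def)
qed

text \<open>Cauchy-Schwarz in the form |Dk| <= |D|^2 / (2 \<eta>) + \<eta> |k|^2 / 2, with \<eta> of
  the order of the L2 norm of D and tending to 0.\<close>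

lemma L2_pairing_tendsto_zero:
  fixes D :: "nat \<Rightarrow> 'a \<Rightarrow> complex" and k :: "'a \<Rightarrow> complex"
  assumes ev: "\<forall>\<^sub>F n in sequentially. integrable M (\<lambda>x. (cmod (D n x))\<^sup>2)"
    and lim: "(\<lambda>n. \<integral>x. (cmod (D n x))\<^sup>2 \<partial>M) \<longlonglongrightarrow> 0"
    and k: "integrable M (\<lambda>x. (cmod (k x))\<^sup>2)"
    and Dk: "\<And>n. integrable M (\<lambda>x. D n x * k x)"
  shows "(\<lambda>n. \<integral>x. D n x * k x \<partial>M) \<longlonglongrightarrow> 0"
proof -
  define \<delta> where "\<delta> = (\<lambda>n. \<integral>x. (cmod (D n x))\<^sup>2 \<partial>M)"
  define K where "K = (\<integral>x. (cmod (k x))\<^sup>2 \<partial>M)"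
  \<comment> \<open>The summand 1/(n + 1) keeps \<eta> positive when the norm vanishes.\<close>
  define \<eta> where "\<eta> = (\<lambda>n. sqrt (\<delta> n) + inverse (real (Suc n)))"
  have \<delta>: "\<delta> n \<ge> 0" for n by (simp add: \<delta>_def)
  have \<eta>: "\<eta> n > 0" for n using \<delta>[of n] by (simp add: \<eta>_def add_nonneg_pos)
  have s0: "(\<lambda>n. sqrt (\<delta> n)) \<longlonglongrightarrow> 0" using tendsto_real_sqrt[OF lim] by (simp add: \<delta>_def)
  have \<eta>0: "\<eta> \<longlonglongrightarrow> 0" unfolding \<eta>_def using tendsto_add[OF s0 LIMSEQ_inverse_real_of_nat] by simp
  show ?thesis
  proof (rule Lim_null_comparison)
    show "\<forall>\<^sub>F n in sequentially. norm (\<integral>x. D n x * k x \<partial>M) \<le> (sqrt (\<delta> n) + \<eta> n * K) / 2"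
      using ev
    proof eventually_elim
      case (elim n)
      have pw: "cmod (D n x * k x) \<le> (1 / (2 * \<eta> n)) * (cmod (D n x))\<^sup>2 + (\<eta> n / 2) * (cmod (k x))\<^sup>2" for x
      proof -
        have "0 \<le> (cmod (D n x) - \<eta> n * cmod (k x))\<^sup>2 / (2 * \<eta> n)" using \<eta>[of n] by simp
        then show ?thesis using \<eta>[of n]
          by (simp add: norm_mult field_simps power2_eq_square)
      qed
      have "norm (\<integral>x. D n x * k x \<partial>M) \<le> (\<integral>x. cmod (D n x * k x) \<partial>M)" by (rule integral_norm_bound)
      also have "\<dots> \<le> (\<integral>x. (1 / (2 * \<eta> n)) * (cmod (D n x))\<^sup>2 + (\<eta> n / 2) * (cmod (k x))\<^sup>2 \<partial>M)"
        by (intro integral_mono integrable_norm Dk Bochner_Integration.integrable_add integrable_mult_right elim k pw)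
      also have "\<dots> = (1 / (2 * \<eta> n)) * \<delta> n + (\<eta> n / 2) * K"
        using elim k by (simp add: \<delta>_def K_def)
      also have "(1 / (2 * \<eta> n)) * \<delta> n \<le> sqrt (\<delta> n) / 2"
      proof -
        have "sqrt (\<delta> n) * sqrt (\<delta> n) \<le> sqrt (\<delta> n) * \<eta> n"
          using \<delta>[of n] by (intro mult_left_mono) (auto simp: \<eta>_def)
        then show ?thesis using \<eta>[of n] \<delta>[of n] by (simp add: field_simps)
      qed
      finally show ?case by simp
    qed
    show "(\<lambda>n. (sqrt (\<delta> n) + \<eta> n * K) / 2) \<longlonglongrightarrow> 0"
      using tendsto_divide[OF tendsto_add[OF s0 tendsto_mult_left_zero[OF \<eta>0]] tendsto_const[of 2], of K] by simp
  qed
qed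

lemma integrable_Poisson_kernel_nonreal:
  assumes "Im l \<noteq> 0"
  shows "integrable lborel (\<lambda>u. 1 / (cmod (of_real u - l))\<^sup>2)"
proof (cases "Im l > 0")
  case False
  have "cmod (of_real u - cnj l) = cmod (of_real u - l)" for u by (simp add: cmod_def)
  then show ?thesis using integral_Poisson_kernel(1)[of "cnj l"] False assms by simp
qed (rule integral_Poisson_kernel(1))

text \<open>Only L2 convergence to \<open>g\<close> is known, so the pointwise bound is transferred
  through the excess of |g| over it: that excess is at most |Gn - g| for every n, hence its square
  has integral 0. The Cauchy formula passes to the limit because its kernel is square
  integrable.\<close>

lemma tube_Cauchy_boundary:
  assumes E: "E \<in> {1, -1::real}" and G: "holo2 G (ptube E)"
    and bound: "\<And>l m. (l, m) \<in> ptube E \<Longrightarrow> cmod (G (l, m)) \<le> c / ((1 + cmod l) * (1 + cmod m))"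
    and bv: "bval2 E G g" and gm: "g \<in> borel_measurable borel"
  shows "c \<ge> 0"
    "AE p in lborel. cmod (g p) \<le> c / ((1 + \<bar>fst p\<bar>) * (1 + \<bar>snd p\<bar>))"
    "\<And>l m. (l, m) \<in> ptube E \<Longrightarrow>
      (\<integral>p. g p / ((of_real (fst p) - l) * (of_real (snd p) - m)) \<partial>lborel) = 4 * of_real (pi\<^sup>2) * G (l, m)"
proof -
  \<comment> \<open>The vertex of the quadrant \<open>pquad E\<close> is approached along its
    diagonal.\<close>
  define a where "a = (\<lambda>n. - E * inverse (real (Suc n)))"
  define b where "b = (\<lambda>n. E * inverse (real (Suc n)))"
  have ab: "(a n, b n) \<in> pquad E" for n using E by (auto simp: a_def b_def pquad_def)
  have a0: "a \<longlonglongrightarrow> 0" and b0: "b \<longlonglongrightarrow> 0"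
    unfolding a_def b_def by (intro tendsto_mult_right_zero LIMSEQ_inverse_real_of_nat)+
  have fl: "filterlim (\<lambda>n. (a n, b n)) (at (0, 0) within pquad E) sequentially"
  proof -
    have "b n \<noteq> 0" for n using E by (auto simp: b_def)
    then show ?thesis
      unfolding filterlim_at using tendsto_Pair[OF a0 b0] ab by (auto intro!: always_eventually)
  qed
  define Gn where "Gn = (\<lambda>n p. G (Complex (fst p) (a n), Complex (snd p) (b n)))"
  have ev: "\<forall>\<^sub>F n in sequentially. integrable lborel (\<lambda>p. (cmod (Gn n p - g p))\<^sup>2)"
    and lim: "(\<lambda>n. \<integral>p. (cmod (Gn n p - g p))\<^sup>2 \<partial>lborel) \<longlonglongrightarrow> 0"
    using bv filterlim_compose[OF _ fl] eventually_compose_filterlim[OF _ fl]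
    unfolding bval2_def Gn_def by (force, force)
  have in_tube: "(Complex u (a n), Complex v (b n)) \<in> ptube E" for u v n using ab[of n] by (simp add: ptube_def pquad_def)
  from order_trans[OF norm_ge_zero bound[OF this[of 0 0 0]]]
  have "0 \<le> c / ((1 + cmod (Complex 0 (a 0))) * (1 + cmod (Complex 0 (b 0))))" .
  moreover have "(1 + cmod (Complex 0 (a 0))) * (1 + cmod (Complex 0 (b 0))) > 0" by (intro mult_pos_pos add_pos_nonneg) auto
  ultimately show c: "c \<ge> 0" by (simp add: pos_le_divide_eq)
  have bd1: "cmod (Gn n p) \<le> c / ((1 + \<bar>fst p\<bar>) * (1 + \<bar>snd p\<bar>))" for n p
  proof -
    have "c / ((1 + cmod (Complex (fst p) (a n))) * (1 + cmod (Complex (snd p) (b n)))) \<le> c / ((1 + \<bar>fst p\<bar>) * (1 + \<bar>snd p\<bar>))"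
      using c cmod_Complex_ge by (intro divide_left_mono mult_mono mult_pos_pos) (auto simp: add_pos_nonneg)
    then show ?thesis using bound[OF in_tube[of "fst p" n "snd p"]] by (simp add: Gn_def)
  qed
  define d where "d = (\<lambda>p. (max 0 (cmod (g p) - c / ((1 + \<bar>fst p\<bar>) * (1 + \<bar>snd p\<bar>))))\<^sup>2)"
  have bm: "(\<lambda>p::real\<times>real. c / ((1 + \<bar>fst p\<bar>) * (1 + \<bar>snd p\<bar>))) \<in> borel_measurable borel"
    by (intro borel_measurable_continuous_onI continuous_intros) (auto simp: add_pos_nonneg add_nonneg_eq_0_iff)
  have dm: "d \<in> borel_measurable borel"
    unfolding d_def using gm bm by (intro borel_measurable_power borel_measurable_max borel_measurable_diff borel_measurable_norm) auto
  have dle: "d p \<le> (cmod (Gn n p - g p))\<^sup>2" for n p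
    unfolding d_def
  proof (rule power_mono)
    show "max 0 (cmod (g p) - c / ((1 + \<bar>fst p\<bar>) * (1 + \<bar>snd p\<bar>))) \<le> cmod (Gn n p - g p)"
      using bd1[of n p] norm_triangle_ineq2[of "g p" "Gn n p"] by (simp add: norm_minus_commute)
  qed simp
  obtain n0 where n0: "\<And>n. n \<ge> n0 \<Longrightarrow> integrable lborel (\<lambda>p. (cmod (Gn n p - g p))\<^sup>2)"
    using ev by (auto simp: eventually_sequentially)
  have d0: "d p \<ge> 0" for p by (simp add: d_def)
  have di: "integrable lborel d"
    by (rule Bochner_Integration.integrable_bound[OF n0[OF order_refl]]) (use dm dle d0 in auto)
  have "(\<integral>p. d p \<partial>lborel) \<le> 0"
  proof (rule LIMSEQ_le_const[OF lim], intro exI[of _ n0] allI impI)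
    fix n assume "n \<ge> n0"
    then show "(\<integral>p. d p \<partial>lborel) \<le> (\<integral>p. (cmod (Gn n p - g p))\<^sup>2 \<partial>lborel)"
      by (intro integral_mono di n0 dle)
  qed
  moreover have "(\<integral>p. d p \<partial>lborel) \<ge> 0" using d0 by simp
  ultimately have "(\<integral>p. d p \<partial>lborel) = 0" by simp
  then have "AE p in lborel. d p = 0"
    using integral_nonneg_eq_0_iff_AE[OF di] d0 by simp
  then show gb: "AE p in lborel. cmod (g p) \<le> c / ((1 + \<bar>fst p\<bar>) * (1 + \<bar>snd p\<bar>))"
    by eventually_elim (auto simp: d_def max_def split: if_splits)
  fix l m assume lm: "(l, m) \<in> ptube E"
  have nz: "Im l \<noteq> 0" "Im m \<noteq> 0" using lm by (auto simp: ptube_def)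
  define k where "k = (\<lambda>p::real\<times>real. 1 / ((of_real (fst p) - l) * (of_real (snd p) - m)))"
  have kd: "f p / ((of_real (fst p) - l) * (of_real (snd p) - m)) = f p * k p" for f :: "real \<times> real \<Rightarrow> complex" and p
    by (simp add: k_def)
  have Gk: "integrable lborel (\<lambda>p. Gn n p * k p)" for n
    using tube_Cauchy_shifted(1)[OF E G bound ab[of n] lm] by (simp add: Gn_def k_def)
  have Gk2: "(\<integral>p. Gn n p * k p \<partial>lborel) = 4 * of_real (pi\<^sup>2) * G (l + \<i> * of_real (a n), m + \<i> * of_real (b n))" for n
    using tube_Cauchy_shifted(2)[OF E G bound ab[of n] lm] by (simp add: Gn_def k_def)
  have gk: "integrable lborel (\<lambda>p. g p * k p)"
    using integrable_tube_kernel[OF c nz gm gb] by (simp add: k_def)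
  have "integrable lborel (\<lambda>p. 1 / (cmod (of_real (fst p) - l))\<^sup>2 * (1 / (cmod (of_real (snd p) - m))\<^sup>2))"
    by (rule integrable_product_lborel[OF integrable_Poisson_kernel_nonreal[OF nz(1)] integrable_Poisson_kernel_nonreal[OF nz(2)]])
  then have k2: "integrable lborel (\<lambda>p. (cmod (k p))\<^sup>2)"
    by (simp add: k_def norm_divide norm_mult power_divide power_mult_distrib)
  have "(\<lambda>n. \<integral>p. (Gn n p - g p) * k p \<partial>lborel) \<longlonglongrightarrow> 0"
    by (rule L2_pairing_tendsto_zero[OF ev lim k2]) (use Gk gk in \<open>simp add: left_diff_distrib\<close>)
  then have "(\<lambda>n. (\<integral>p. Gn n p * k p \<partial>lborel) - (\<integral>p. g p * k p \<partial>lborel)) \<longlonglongrightarrow> 0"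
    using Gk gk by (simp add: left_diff_distrib)
  then have "(\<lambda>n. \<integral>p. Gn n p * k p \<partial>lborel) \<longlonglongrightarrow> (\<integral>p. g p * k p \<partial>lborel)"
    by (rule LIM_zero_cancel)
  moreover have "(\<lambda>n. \<integral>p. Gn n p * k p \<partial>lborel) \<longlonglongrightarrow> 4 * of_real (pi\<^sup>2) * G (l, m)"
  proof -
    have cont: "isCont G (l, m)" using G lm unfolding holo2_def by (blast intro: has_derivative_continuous)
    have "(\<lambda>n. (l + \<i> * of_real (a n), m + \<i> * of_real (b n))) \<longlonglongrightarrow> (l + \<i> * of_real 0, m + \<i> * of_real 0)"
      by (intro tendsto_intros a0 b0)
    then have "(\<lambda>n. G (l + \<i> * of_real (a n), m + \<i> * of_real (b n))) \<longlonglongrightarrow> G (l, m)"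
      by (intro isCont_tendsto_compose[OF cont]) simp
    then show ?thesis unfolding Gk2 by (intro tendsto_mult_left)
  qed
  ultimately have "(\<integral>p. g p * k p \<partial>lborel) = 4 * of_real (pi\<^sup>2) * G (l, m)"
    using LIMSEQ_unique by blast
  then show "(\<integral>p. g p / ((of_real (fst p) - l) * (of_real (snd p) - m)) \<partial>lborel) = 4 * of_real (pi\<^sup>2) * G (l, m)"
    by (simp add: k_def)
qed

section \<open>Hyperbolic coordinates on the quadric\<close>

text \<open>Stated for the extended integral so that it can be used before any integrability is
  known: if one side is not integrable, neither is the other, and both integrals are
  infinite.\<close>

lemma nn_integral_change_of_variables_1:
  fixes f g g' :: "real \<Rightarrow> real"
  assumes S: "S \<in> sets borel" and T: "g ` S \<in> sets borel"
    and der: "\<And>x. x \<in> S \<Longrightarrow> (g has_field_derivative g' x) (at x)" and inj: "inj_on g S"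
    and fm: "f \<in> borel_measurable borel" and f0: "\<And>x. f x \<ge> 0"
    and gm: "(\<lambda>x. indicator S x * (\<bar>g' x\<bar> * f (g x))) \<in> borel_measurable borel"
  shows "(\<integral>\<^sup>+x. ennreal (indicator (g ` S) x * f x) \<partial>lborel) = (\<integral>\<^sup>+x. ennreal (indicator S x * (\<bar>g' x\<bar> * f (g x))) \<partial>lborel)"
proof -
  let ?F = "\<lambda>x. indicator (g ` S) x * f x" and ?H = "\<lambda>x. indicator S x * (\<bar>g' x\<bar> * f (g x))"
  have Fm: "?F \<in> borel_measurable borel" using T fm by measurable
  have S': "S \<in> sets lebesgue" using S by simp
  have der': "(g has_field_derivative g' x) (at x within S)" if "x \<in> S" for x
    using der[OF that] has_field_derivative_at_within by blast
  note cov = has_absolute_integral_change_of_variables_1'[OF S' der' inj, of f]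
  have F_eq: "f absolutely_integrable_on (g ` S) \<longleftrightarrow> integrable lborel ?F"
    using Fm by (simp add: set_integrable_def integrable_completion)
  have H_eq: "(\<lambda>x. \<bar>g' x\<bar> * f (g x)) absolutely_integrable_on S \<longleftrightarrow> integrable lborel ?H"
    using gm by (simp add: set_integrable_def integrable_completion)
  have nn: "0 \<le> ?F x" "0 \<le> ?H x" for x using f0 by auto
  show ?thesis
  proof (cases "integrable lborel ?F")
    case True
    then have a: "f absolutely_integrable_on (g ` S)" by (simp add: F_eq)
    with cov[of "integral (g ` S) f"] have b: "(\<lambda>x. \<bar>g' x\<bar> * f (g x)) absolutely_integrable_on S"
      and eq: "integral S (\<lambda>x. \<bar>g' x\<bar> * f (g x)) = integral (g ` S) f" by auto
    have "(\<integral>x. ?F x \<partial>lborel) = integral (g ` S) f"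
      using set_lebesgue_integral_eq_integral(2)[OF a] Fm
      by (simp add: set_lebesgue_integral_def integral_completion)
    moreover have "(\<integral>x. ?H x \<partial>lborel) = integral S (\<lambda>x. \<bar>g' x\<bar> * f (g x))"
      using set_lebesgue_integral_eq_integral(2)[OF b] gm
      by (simp add: set_lebesgue_integral_def integral_completion)
    ultimately show ?thesis
      using nn_integral_eq_integral[of lborel ?F] nn_integral_eq_integral[of lborel ?H] True b H_eq nn eq by auto
  next
    case False
    then have "\<not> integrable lborel ?H" using cov F_eq H_eq by blast
    with False show ?thesis
      using nn Fm gm by (simp add: integrable_iff_bounded abs_of_nonneg not_less top_unique)
  qed
qed

text \<open>The components x1, x2 of the point with real parameters. They determine x0 up to its
  sign, which is what \<open>sheet_domain\<close> records.\<close>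

definition hyperboloid_chart :: "real \<times> real \<Rightarrow> real \<times> real" where
  "hyperboloid_chart p = ((1 - fst p * snd p) / (fst p - snd p), (fst p + snd p) / (fst p - snd p))"

definition sheet_domain :: "real \<Rightarrow> (real \<times> real) set" where
  "sheet_domain e = {p. fst p \<noteq> snd p \<and> e * ((1 + fst p * snd p) / (fst p - snd p)) > 0}"

lemma hyperboloid_chart_measurable [measurable]: "hyperboloid_chart \<in> borel_measurable borel"
  unfolding hyperboloid_chart_def[abs_def] borel_prod[symmetric] by measurable

lemma sheet_domain_measurable [measurable]: "sheet_domain e \<in> sets borel"
proof -
  have "{p \<in> space (borel \<Otimes>\<^sub>M borel). fst p \<noteq> snd p \<and> e * ((1 + fst p * snd p) / (fst p - snd p)) > 0} \<in> sets (borel \<Otimes>\<^sub>M (borel :: real measure))"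
    by measurable
  then show ?thesis unfolding sheet_domain_def borel_prod[symmetric] by (simp add: space_pair_measure)
qed

lemma Xdom_measurable [measurable]: "Xdom \<in> sets borel"
proof -
  have "{p \<in> space (borel \<Otimes>\<^sub>M borel). (fst p)\<^sup>2 + (snd p)\<^sup>2 > 1} \<in> sets (borel \<Otimes>\<^sub>M (borel :: real measure))"
    by measurable
  then show ?thesis unfolding Xdom_def borel_prod[symmetric] by (simp add: space_pair_measure)
qed

text \<open>For fixed \<open>x\<^sub>2 = y\<close>, the point with \<open>x\<^sub>0 + x\<^sub>1 = 2 / d\<close> has the coordinates below, because
  \<open>x\<^sub>0 - x\<^sub>1 = (y\<^sup>2 - 1) / (x\<^sub>0 + x\<^sub>1)\<close>.\<close>

lemma hyperbola_substitution:
  fixes y :: real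
  assumes e: "e \<in> {1, -1::real}" and y: "y\<^sup>2 \<noteq> 1" and A: "A \<in> sets (borel :: (real \<times> real) measure)"
  defines "x0 \<equiv> \<lambda>d. 1 / d + (y\<^sup>2 - 1) * d / 4" and "x1 \<equiv> \<lambda>d. 1 / d - (y\<^sup>2 - 1) * d / 4"
  shows "(\<integral>\<^sup>+d. ennreal (indicator {d. d \<noteq> 0 \<and> e * x0 d > 0} d * (indicator A (x1 d, y) / (2 * \<bar>d\<bar>))) \<partial>lborel) =
    (\<integral>\<^sup>+x. ennreal (indicator {x. x\<^sup>2 + y\<^sup>2 > 1} x * (indicator A (x, y) / (2 * sqrt (x\<^sup>2 + y\<^sup>2 - 1)))) \<partial>lborel)"
proof -
  define S where "S = {d. d \<noteq> 0 \<and> e * x0 d > 0}"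
  define f where "f = (\<lambda>x. indicator {x. x\<^sup>2 + y\<^sup>2 > 1} x * (indicator A (x, y) / (2 * sqrt (x\<^sup>2 + y\<^sup>2 - 1))) :: real)"
  have [measurable]: "A \<in> sets (borel \<Otimes>\<^sub>M borel)" by (subst borel_prod) (rule A)
  have sq: "(x0 d)\<^sup>2 = (x1 d)\<^sup>2 + y\<^sup>2 - 1" if "d \<noteq> 0" for d
    using that by (simp add: x0_def x1_def power2_eq_square field_simps)
  have sum: "x0 d + x1 d = 2 / d" for d by (simp add: x0_def x1_def)
  have x0_root: "x0 d = e * sqrt ((x1 d)\<^sup>2 + y\<^sup>2 - 1)" if "d \<in> S" for d
  proof -
    have "sqrt ((x1 d)\<^sup>2 + y\<^sup>2 - 1) = \<bar>x0 d\<bar>" using sq[of d] that by (simp add: S_def flip: sq)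
    then show ?thesis using that e by (auto simp: S_def)
  qed
  \<comment> \<open>The sheet fixes the sign of x0, so x1 determines x0, and then d through x0 + x1
    = 2/d.\<close>
  have inj: "inj_on x1 S"
  proof (rule inj_onI)
    fix d d' assume a: "d \<in> S" "d' \<in> S" "x1 d = x1 d'"
    then have "2 / d = 2 / d'" using x0_root[of d] x0_root[of d'] sum[of d] sum[of d'] by simp
    then show "d = d'" using a by (simp add: S_def)
  qed
  have img: "x1 ` S = {x. x\<^sup>2 + y\<^sup>2 > 1}"
  proof (intro equalityI subsetI)
    fix x assume "x \<in> x1 ` S"
    then obtain d where d: "d \<in> S" "x = x1 d" by blast
    then have "(x0 d)\<^sup>2 > 0" by (auto simp: S_def)
    moreover have "d \<noteq> 0" using d by (simp add: S_def)
    ultimately have "0 < (x1 d)\<^sup>2 + y\<^sup>2 - 1" by (metis sq)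
    then show "x \<in> {x. x\<^sup>2 + y\<^sup>2 > 1}" using d by simp
  next
    fix x assume "x \<in> {x. x\<^sup>2 + y\<^sup>2 > 1}"
    then have x: "x\<^sup>2 + y\<^sup>2 - 1 > 0" by simp
    define r where "r = e * sqrt (x\<^sup>2 + y\<^sup>2 - 1)"
    have r2: "r\<^sup>2 = x\<^sup>2 + y\<^sup>2 - 1" using x e by (auto simp: r_def power_mult_distrib)
    then have prod: "(r + x) * (r - x) = y\<^sup>2 - 1" by (simp add: algebra_simps power2_eq_square)
    \<comment> \<open>The product y^2 - 1 is nonzero, so neither factor vanishes and d = 2 / (r + x)
      makes sense.\<close>
    then have nz: "r + x \<noteq> 0" using y by auto
    define d where "d = 2 / (r + x)"
    have "(y\<^sup>2 - 1) * d / 4 = (r - x) / 2" unfolding prod[symmetric] d_def using nz by simp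
    moreover have "1 / d = (r + x) / 2" by (simp add: d_def)
    ultimately have "x0 d = r" "x1 d = x" unfolding x0_def x1_def by (simp_all only:) (simp_all add: field_simps)
    moreover have "e * r > 0" using x e by (auto simp: r_def)
    moreover have "d \<noteq> 0" using nz by (simp add: d_def)
    ultimately show "x \<in> x1 ` S" by (auto simp: S_def intro!: image_eqI[of _ _ d])
  qed
  have Sb: "S \<in> sets borel" unfolding S_def x0_def by measurable
  have fm: "f \<in> borel_measurable borel" unfolding f_def by measurable
  have x1m: "x1 \<in> borel_measurable borel" unfolding x1_def by measurable
  have x0m: "x0 \<in> borel_measurable borel" unfolding x0_def by measurable
  have "(\<integral>\<^sup>+x. ennreal (indicator (x1 ` S) x * f x) \<partial>lborel) = (\<integral>\<^sup>+d. ennreal (indicator S d * (\<bar>- x0 d / d\<bar> * f (x1 d))) \<partial>lborel)"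
  proof (rule nn_integral_change_of_variables_1[OF Sb _ _ inj fm])
    show "x1 ` S \<in> sets borel" unfolding img by measurable
    show "(x1 has_field_derivative - x0 d / d) (at d)" if "d \<in> S" for d
      using that unfolding x1_def S_def by (auto intro!: derivative_eq_intros simp: x0_def field_simps power2_eq_square)
    show "f x \<ge> 0" for x by (simp add: f_def indicator_def)
    show "(\<lambda>d. indicator S d * (\<bar>- x0 d / d\<bar> * f (x1 d))) \<in> borel_measurable borel"
      using Sb fm x1m x0m by measurable
  qed
  \<comment> \<open>The derivative of x1 has modulus |x0| / |d|, and the density carries the square
    root |x0| in its denominator, so x0 cancels.\<close>
  also have "(\<lambda>d. indicator S d * (\<bar>- x0 d / d\<bar> * f (x1 d))) = (\<lambda>d. indicator S d * (indicator A (x1 d, y) / (2 * \<bar>d\<bar>)))"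
  proof (rule ext)
    fix d
    show "indicator S d * (\<bar>- x0 d / d\<bar> * f (x1 d)) = indicator S d * (indicator A (x1 d, y) / (2 * \<bar>d\<bar>))"
    proof (cases "d \<in> S")
      case True
      then have "sqrt ((x1 d)\<^sup>2 + y\<^sup>2 - 1) = \<bar>x0 d\<bar>" "x0 d \<noteq> 0" "d \<noteq> 0" using sq[of d] by (auto simp: S_def simp flip: sq)
      moreover have "x1 d \<in> {x. x\<^sup>2 + y\<^sup>2 > 1}" using True img by blast
      ultimately show ?thesis using True by (simp add: f_def abs_mult)
    qed simp
  qed
  also have "(\<lambda>x. indicator (x1 ` S) x * f x) = (\<lambda>x. indicator {x. x\<^sup>2 + y\<^sup>2 > 1} x * (indicator A (x, y) / (2 * sqrt (x\<^sup>2 + y\<^sup>2 - 1))))"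
    unfolding img f_def by (auto simp: fun_eq_iff indicator_def)
  finally show ?thesis unfolding S_def by simp
qed

lemma nn_integral_pair_lborel:
  fixes f :: "real \<times> real \<Rightarrow> ennreal"
  assumes [measurable]: "f \<in> borel_measurable borel"
  shows "(\<integral>\<^sup>+p. f p \<partial>lborel) = (\<integral>\<^sup>+x. \<integral>\<^sup>+y. f (x, y) \<partial>lborel \<partial>lborel)"
    "(\<integral>\<^sup>+p. f p \<partial>lborel) = (\<integral>\<^sup>+y. \<integral>\<^sup>+x. f (x, y) \<partial>lborel \<partial>lborel)"
proof -
  have m: "f \<in> borel_measurable (lborel \<Otimes>\<^sub>M lborel)" by (simp add: lborel_prod)
  show "(\<integral>\<^sup>+p. f p \<partial>lborel) = (\<integral>\<^sup>+x. \<integral>\<^sup>+y. f (x, y) \<partial>lborel \<partial>lborel)"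
    using lborel.nn_integral_fst[OF m] by (simp add: lborel_prod)
  show "(\<integral>\<^sup>+p. f p \<partial>lborel) = (\<integral>\<^sup>+y. \<integral>\<^sup>+x. f (x, y) \<partial>lborel \<partial>lborel)"
    using lborel_pair.nn_integral_snd[OF m] by (simp add: lborel_prod)
qed

text \<open>The parameters are traded for d = \<lambda> - \<mu> and y = (\<lambda> + \<mu>) / d =
  x2, that is \<lambda> = (y + 1) d/2 and \<mu> = (y - 1) d/2. For fixed d the passage from
  \<lambda> to y is affine with Jacobian |d|/2, which turns 1/d^2 into 1/(2|d|); for fixed y the
  passage from d to x1 is \<open>hyperbola_substitution\<close>.\<close>

lemma hyperboloid_chart_nn_integral:
  assumes e: "e \<in> {1, -1::real}" and A: "A \<in> sets (borel :: (real \<times> real) measure)"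
  shows "(\<integral>\<^sup>+p. ennreal (indicator (sheet_domain e) p * (indicator A (hyperboloid_chart p) / (fst p - snd p)\<^sup>2)) \<partial>lborel) =
    (\<integral>\<^sup>+p. ennreal (indicator Xdom p * (indicator A p / (2 * sqrt ((fst p)\<^sup>2 + (snd p)\<^sup>2 - 1)))) \<partial>lborel)"
proof -
  define F where "F = (\<lambda>p. ennreal (indicator (sheet_domain e) p * (indicator A (hyperboloid_chart p) / (fst p - snd p)\<^sup>2)))"
  define x0 where "x0 = (\<lambda>y d::real. 1 / d + (y\<^sup>2 - 1) * d / 4)"
  define x1 where "x1 = (\<lambda>y d::real. 1 / d - (y\<^sup>2 - 1) * d / 4)"
  have [measurable]: "(fst :: real \<times> real \<Rightarrow> real) \<in> borel_measurable borel" "(snd :: real \<times> real \<Rightarrow> real) \<in> borel_measurable borel"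
    unfolding borel_prod[symmetric] by measurable
  note [measurable] = A
  have Fm [measurable]: "F \<in> borel_measurable borel" unfolding F_def by measurable
  have pm: "(\<lambda>p. F (g p)) \<in> borel_measurable (borel \<Otimes>\<^sub>M borel)" if "g \<in> borel_measurable (borel \<Otimes>\<^sub>M borel)" for g
    using measurable_compose[OF that Fm] .
  have F_eq: "F ((y + 1) * d / 2, (y - 1) * d / 2) = ennreal (indicator {d. d \<noteq> 0 \<and> e * x0 y d > 0} d * (indicator A (x1 y d, y) / d\<^sup>2))" for y d
  proof (cases "d = 0")
    case False
    have 1: "(y + 1) * d / 2 - (y - 1) * d / 2 = d" "(y + 1) * d / 2 + (y - 1) * d / 2 = y * d" by (simp_all add: field_simps)
    have 2: "(1 + (y + 1) * d / 2 * ((y - 1) * d / 2)) / d = x0 y d" "(1 - (y + 1) * d / 2 * ((y - 1) * d / 2)) / d = x1 y d"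
      using False by (simp_all add: x0_def x1_def field_simps power2_eq_square)
    have "((y + 1) * d / 2, (y - 1) * d / 2) \<in> sheet_domain e \<longleftrightarrow> d \<noteq> 0 \<and> e * x0 y d > 0"
      using 1 unfolding sheet_domain_def mem_Collect_eq fst_conv snd_conv 1 2 by auto
    moreover have "hyperboloid_chart ((y + 1) * d / 2, (y - 1) * d / 2) = (x1 y d, y)"
      unfolding hyperboloid_chart_def fst_conv snd_conv 1 2 using False by simp
    ultimately show ?thesis unfolding F_def fst_conv snd_conv 1 by (auto simp: indicator_def)
  qed (simp add: F_def sheet_domain_def)
  have "(\<integral>\<^sup>+p. F p \<partial>lborel) = (\<integral>\<^sup>+l. \<integral>\<^sup>+m. F (l, m) \<partial>lborel \<partial>lborel)"
    by (rule nn_integral_pair_lborel(1)[OF Fm])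
  also have "\<dots> = (\<integral>\<^sup>+l. \<integral>\<^sup>+d. F (l, l - d) \<partial>lborel \<partial>lborel)"
  proof (rule nn_integral_cong)
    fix l
    have m: "(\<lambda>m. F (l, m)) \<in> borel_measurable borel"
      by (rule measurable_compose[OF _ Fm]) (simp add: borel_prod[symmetric])
    have "(\<integral>\<^sup>+m. F (l, m) \<partial>lborel) = ennreal \<bar>-1\<bar> * (\<integral>\<^sup>+d. F (l, l + -1 * d) \<partial>lborel)"
      by (rule nn_integral_real_affine[OF m]) simp
    then show "(\<integral>\<^sup>+m. F (l, m) \<partial>lborel) = (\<integral>\<^sup>+d. F (l, l - d) \<partial>lborel)" by simp
  qed
  also have "\<dots> = (\<integral>\<^sup>+d. \<integral>\<^sup>+l. F (l, l - d) \<partial>lborel \<partial>lborel)"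
    using nn_integral_pair_lborel[of "\<lambda>p. F (fst p, fst p - snd p)"] pm[of "\<lambda>p. (fst p, fst p - snd p)"] by (simp add: borel_prod)
  also have "\<dots> = (\<integral>\<^sup>+d. \<integral>\<^sup>+y. ennreal (indicator {d. d \<noteq> 0 \<and> e * x0 y d > 0} d * (indicator A (x1 y d, y) / (2 * \<bar>d\<bar>))) \<partial>lborel \<partial>lborel)"
  proof (rule nn_integral_cong_AE, rule eventually_mono[OF AE_lborel_singleton[of 0]])
    fix d :: real assume d: "d \<noteq> 0"
    have m: "(\<lambda>l. F (l, l - d)) \<in> borel_measurable borel"
      by (rule measurable_compose[OF _ Fm]) (simp add: borel_prod[symmetric])
    have m2: "(\<lambda>y. F ((y + 1) * d / 2, (y - 1) * d / 2)) \<in> borel_measurable borel"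
      by (rule measurable_compose[OF _ Fm]) (simp add: borel_prod[symmetric])
    have "(\<integral>\<^sup>+l. F (l, l - d) \<partial>lborel) = ennreal \<bar>d / 2\<bar> * (\<integral>\<^sup>+y. F (d / 2 + d / 2 * y, d / 2 + d / 2 * y - d) \<partial>lborel)"
      by (rule nn_integral_real_affine[OF m]) (use d in simp)
    also have "(\<lambda>y. F (d / 2 + d / 2 * y, d / 2 + d / 2 * y - d)) = (\<lambda>y. F ((y + 1) * d / 2, (y - 1) * d / 2))"
    proof
      fix y
      have "d / 2 + d / 2 * y = (y + 1) * d / 2" "d / 2 + d / 2 * y - d = (y - 1) * d / 2" by (simp_all add: field_simps)
      then show "F (d / 2 + d / 2 * y, d / 2 + d / 2 * y - d) = F ((y + 1) * d / 2, (y - 1) * d / 2)" by (simp only:)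
    qed
    also have "ennreal \<bar>d / 2\<bar> * (\<integral>\<^sup>+y. F ((y + 1) * d / 2, (y - 1) * d / 2) \<partial>lborel) = (\<integral>\<^sup>+y. ennreal \<bar>d / 2\<bar> * F ((y + 1) * d / 2, (y - 1) * d / 2) \<partial>lborel)"
      by (rule nn_integral_cmult[symmetric]) (use m2 in simp)
    also have "\<dots> = (\<integral>\<^sup>+y. ennreal (indicator {d. d \<noteq> 0 \<and> e * x0 y d > 0} d * (indicator A (x1 y d, y) / (2 * \<bar>d\<bar>))) \<partial>lborel)"
    proof (rule nn_integral_cong)
      fix y
      have "\<bar>d / 2\<bar> * (a / d\<^sup>2) = a / (2 * \<bar>d\<bar>)" for a
        using d by (simp add: power2_eq_square field_simps abs_if)
      then show "ennreal \<bar>d / 2\<bar> * F ((y + 1) * d / 2, (y - 1) * d / 2) = ennreal (indicator {d. d \<noteq> 0 \<and> e * x0 y d > 0} d * (indicator A (x1 y d, y) / (2 * \<bar>d\<bar>)))"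
        unfolding F_eq by (subst ennreal_mult'[symmetric]) (auto simp: indicator_def)
    qed
    finally show "(\<integral>\<^sup>+l. F (l, l - d) \<partial>lborel) = (\<integral>\<^sup>+y. ennreal (indicator {d. d \<noteq> 0 \<and> e * x0 y d > 0} d * (indicator A (x1 y d, y) / (2 * \<bar>d\<bar>))) \<partial>lborel)" .
  qed
  also have "\<dots> = (\<integral>\<^sup>+y. \<integral>\<^sup>+d. ennreal (indicator {d. d \<noteq> 0 \<and> e * x0 y d > 0} d * (indicator A (x1 y d, y) / (2 * \<bar>d\<bar>))) \<partial>lborel \<partial>lborel)"
  proof -
    define H where "H = (\<lambda>p. ennreal (indicator {p. fst p \<noteq> 0 \<and> e * x0 (snd p) (fst p) > 0} p * (indicator A (x1 (snd p) (fst p), snd p) / (2 * \<bar>fst p\<bar>))))"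
    have [measurable]: "A \<in> sets (borel \<Otimes>\<^sub>M borel)" by (subst borel_prod) (rule A)
    have "H \<in> borel_measurable (borel \<Otimes>\<^sub>M borel)" unfolding H_def x0_def x1_def by measurable
    then have Hm: "H \<in> borel_measurable borel" by (simp add: borel_prod)
    have "H (d, y) = ennreal (indicator {d. d \<noteq> 0 \<and> e * x0 y d > 0} d * (indicator A (x1 y d, y) / (2 * \<bar>d\<bar>)))" for d y
      by (simp add: H_def indicator_def)
    then show ?thesis using nn_integral_pair_lborel[OF Hm] by simp
  qed
  also have "\<dots> = (\<integral>\<^sup>+y. \<integral>\<^sup>+x. ennreal (indicator {x. x\<^sup>2 + y\<^sup>2 > 1} x * (indicator A (x, y) / (2 * sqrt (x\<^sup>2 + y\<^sup>2 - 1)))) \<partial>lborel \<partial>lborel)"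
  proof (rule nn_integral_cong_AE)
    have "AE y in lborel. y \<noteq> (1::real)" "AE y in lborel. y \<noteq> (-1::real)" by (rule AE_lborel_singleton)+
    then show "AE y in lborel. (\<integral>\<^sup>+d. ennreal (indicator {d. d \<noteq> 0 \<and> e * x0 y d > 0} d * (indicator A (x1 y d, y) / (2 * \<bar>d\<bar>))) \<partial>lborel) =
       (\<integral>\<^sup>+x. ennreal (indicator {x. x\<^sup>2 + y\<^sup>2 > 1} x * (indicator A (x, y) / (2 * sqrt (x\<^sup>2 + y\<^sup>2 - 1)))) \<partial>lborel)"
    proof eventually_elim
      case (elim y)
      then have "y\<^sup>2 \<noteq> 1" by (simp add: power2_eq_1_iff)
      from hyperbola_substitution[OF e this A] show ?case by (simp add: x0_def x1_def)
    qed
  qed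
  also have "\<dots> = (\<integral>\<^sup>+p. ennreal (indicator Xdom p * (indicator A p / (2 * sqrt ((fst p)\<^sup>2 + (snd p)\<^sup>2 - 1)))) \<partial>lborel)"
  proof -
    define H where "H = (\<lambda>p. ennreal (indicator Xdom p * (indicator A p / (2 * sqrt ((fst p)\<^sup>2 + (snd p)\<^sup>2 - 1)))))"
    have Hm: "H \<in> borel_measurable borel" unfolding H_def by measurable
    have "H (x, y) = ennreal (indicator {x. x\<^sup>2 + y\<^sup>2 > 1} x * (indicator A (x, y) / (2 * sqrt (x\<^sup>2 + y\<^sup>2 - 1))))" for x y
      by (simp add: H_def indicator_def Xdom_def)
    then show ?thesis using nn_integral_pair_lborel(2)[OF Hm] by (simp add: H_def)
  qed
  finally show ?thesis by (simp add: F_def)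
qed

section \<open>Boundary points of the quadric and the invariant measure\<close>

definition xpar :: "real \<times> real \<Rightarrow> r3" where
  "xpar p = re3 (zpar (of_real (fst p)) (of_real (snd p)))"

lemma xpar_eq: "xpar p = ((1 + fst p * snd p) / (fst p - snd p), (1 - fst p * snd p) / (fst p - snd p), (fst p + snd p) / (fst p - snd p))"
proof -
  have "zpar (of_real l) (of_real m) = (of_real ((1 + l * m) / (l - m)), of_real ((1 - l * m) / (l - m)), of_real ((l + m) / (l - m)))" for l m :: real
    by (simp add: zpar_def)
  then show ?thesis by (simp only: xpar_def re3_def prod.case Re_complex_of_real)
qed

lemma xpar_hyperboloid: "fst p \<noteq> snd p \<Longrightarrow> ((1 + fst p * snd p) / (fst p - snd p))\<^sup>2 = (fst (hyperboloid_chart p))\<^sup>2 + (snd (hyperboloid_chart p))\<^sup>2 - 1"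
proof -
  assume ne: "fst p \<noteq> snd p"
  have e: "(1 + fst p * snd p)\<^sup>2 = (1 - fst p * snd p)\<^sup>2 + (fst p + snd p)\<^sup>2 - (fst p - snd p)\<^sup>2"
    by (simp add: power2_eq_square algebra_simps)
  show ?thesis
    unfolding hyperboloid_chart_def fst_conv snd_conv power_divide e
    using ne by (simp add: add_divide_distrib diff_divide_distrib)
qed

lemma Xchart_hyperboloid_chart:
  assumes "fst p \<noteq> snd p" "e \<in> {1, -1}" "e * ((1 + fst p * snd p) / (fst p - snd p)) \<ge> 0"
  shows "Xchart e (hyperboloid_chart p) = xpar p"
proof -
  define X where "X = (1 + fst p * snd p) / (fst p - snd p)"
  have "sqrt ((fst (hyperboloid_chart p))\<^sup>2 + (snd (hyperboloid_chart p))\<^sup>2 - 1) = \<bar>X\<bar>"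
    unfolding xpar_hyperboloid[OF assms(1), symmetric] X_def[symmetric] by simp
  moreover have "e * \<bar>X\<bar> = X" using assms(2,3) unfolding X_def[symmetric] by auto
  ultimately have "e * sqrt ((fst (hyperboloid_chart p))\<^sup>2 + (snd (hyperboloid_chart p))\<^sup>2 - 1) = (1 + fst p * snd p) / (fst p - snd p)"
    by (simp add: X_def)
  then show ?thesis unfolding Xchart_def xpar_eq by (simp add: hyperboloid_chart_def)
qed

lemma fst_snd_borel_measurable [measurable]:
  "(fst :: real \<times> real \<Rightarrow> real) \<in> borel_measurable borel" "(snd :: real \<times> real \<Rightarrow> real) \<in> borel_measurable borel"
  unfolding borel_prod[symmetric] by measurable

text \<open>Measurability is given only in the two charts, so the parametrization is factored
  through them, sheet by sheet. On the diagonal, division by zero yields the fixed point (0, 0,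
  0).\<close>

lemma xpar_compose_measurable:
  fixes h :: "r3 \<Rightarrow> complex"
  assumes "\<And>e. e \<in> {1, -1::real} \<Longrightarrow> (\<lambda>p. h (Xchart e p)) \<in> borel_measurable borel"
  shows "(\<lambda>p. h (xpar p)) \<in> borel_measurable borel"
proof -
  have [measurable]: "(\<lambda>p. h (Xchart e (hyperboloid_chart p))) \<in> borel_measurable borel" if "e \<in> {1, -1}" for e
    using assms[OF that] by (rule measurable_compose[OF hyperboloid_chart_measurable])
  have eq: "h (xpar p) = (if fst p = snd p then h (0, 0, 0)
      else if (1 + fst p * snd p) / (fst p - snd p) \<ge> 0 then h (Xchart 1 (hyperboloid_chart p)) else h (Xchart (-1) (hyperboloid_chart p)))" for p
  proof -
    define X where "X = (1 + fst p * snd p) / (fst p - snd p)"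
    consider "fst p = snd p" | "fst p \<noteq> snd p" "X \<ge> 0" | "fst p \<noteq> snd p" "X < 0" by linarith
    then show ?thesis
    proof cases
      case 1
      then show ?thesis by (simp add: xpar_eq)
    next
      case 2
      then show ?thesis using Xchart_hyperboloid_chart[of p 1] unfolding X_def[symmetric] by simp
    next
      case 3
      then show ?thesis using Xchart_hyperboloid_chart[of p "-1"] unfolding X_def[symmetric] by simp
    qed
  qed
  show ?thesis unfolding eq by measurable
qed

text \<open>The identity of extended integrals, read as an equality of measures, so that Bochner
  integrals of complex functions can be transported along the chart.\<close>

lemma distr_hyperboloid_chart:
  assumes e: "e \<in> {1, -1::real}"
  shows "distr (density lborel (\<lambda>p. ennreal (indicator (sheet_domain e) p * (1 / (fst p - snd p)\<^sup>2)))) borel hyperboloid_chart =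
    density lborel (\<lambda>p. ennreal (indicator Xdom p * (1 / (2 * sqrt ((fst p)\<^sup>2 + (snd p)\<^sup>2 - 1)))))" (is "?L = ?R")
proof (rule measure_eqI)
  fix A assume "A \<in> sets ?L"
  then have A: "A \<in> sets borel" by simp
  note [measurable] = A
  have "emeasure ?L A = (\<integral>\<^sup>+p. ennreal (indicator (sheet_domain e) p * (1 / (fst p - snd p)\<^sup>2)) * indicator (hyperboloid_chart -` A) p \<partial>lborel)"
    using measurable_sets[OF hyperboloid_chart_measurable A] by (subst emeasure_distr) (auto simp: emeasure_density)
  also have "\<dots> = (\<integral>\<^sup>+p. ennreal (indicator (sheet_domain e) p * (indicator A (hyperboloid_chart p) / (fst p - snd p)\<^sup>2)) \<partial>lborel)"
    by (intro nn_integral_cong) (auto simp: indicator_def)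
  also have "\<dots> = (\<integral>\<^sup>+p. ennreal (indicator Xdom p * (indicator A p / (2 * sqrt ((fst p)\<^sup>2 + (snd p)\<^sup>2 - 1)))) \<partial>lborel)"
    by (rule hyperboloid_chart_nn_integral[OF e A])
  also have "\<dots> = (\<integral>\<^sup>+p. ennreal (indicator Xdom p * (1 / (2 * sqrt ((fst p)\<^sup>2 + (snd p)\<^sup>2 - 1)))) * indicator A p \<partial>lborel)"
    by (intro nn_integral_cong) (auto simp: indicator_def)
  also have "\<dots> = emeasure ?R A" by (simp add: emeasure_density)
  finally show "emeasure ?L A = emeasure ?R A" .
qed simp

lemma sheet_integral:
  fixes c :: "real \<times> real \<Rightarrow> complex"
  assumes e: "e \<in> {1, -1::real}" and c [measurable]: "c \<in> borel_measurable borel"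
    and int: "integrable lborel (\<lambda>p. (indicator (sheet_domain e) p * (1 / (fst p - snd p)\<^sup>2)) *\<^sub>R c (hyperboloid_chart p))"
  shows "integrable lborel (\<lambda>p. (indicator Xdom p * (1 / (2 * sqrt ((fst p)\<^sup>2 + (snd p)\<^sup>2 - 1)))) *\<^sub>R c p)"
    "(\<integral>p. (indicator Xdom p * (1 / (2 * sqrt ((fst p)\<^sup>2 + (snd p)\<^sup>2 - 1)))) *\<^sub>R c p \<partial>lborel) =
     (\<integral>p. (indicator (sheet_domain e) p * (1 / (fst p - snd p)\<^sup>2)) *\<^sub>R c (hyperboloid_chart p) \<partial>lborel)"
proof -
  let ?a = "\<lambda>p. indicator (sheet_domain e) p * (1 / (fst p - snd p)\<^sup>2) :: real"
  let ?b = "\<lambda>p. indicator Xdom p * (1 / (2 * sqrt ((fst p)\<^sup>2 + (snd p)\<^sup>2 - 1))) :: real"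
  have b0: "?b p \<ge> 0" for p by (auto simp: indicator_def Xdom_def)
  have a0: "?a p \<ge> 0" for p by (auto simp: indicator_def)
  have ccm: "(\<lambda>p. c (hyperboloid_chart p)) \<in> borel_measurable borel" by measurable
  have 1: "integrable (density lborel ?a) (\<lambda>p. c (hyperboloid_chart p))"
    using int ccm a0 by (subst integrable_density) auto
  then have "integrable (distr (density lborel ?a) borel hyperboloid_chart) c"
    by (subst integrable_distr_eq) auto
  then show "integrable lborel (\<lambda>p. ?b p *\<^sub>R c p)"
    unfolding distr_hyperboloid_chart[OF e] using b0 by (subst (asm) integrable_density) auto
  have "(\<integral>p. ?b p *\<^sub>R c p \<partial>lborel) = integral\<^sup>L (density lborel ?b) c"
    using b0 by (subst integral_density) auto
  also have "\<dots> = (\<integral>p. c (hyperboloid_chart p) \<partial>(density lborel ?a))"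
    unfolding distr_hyperboloid_chart[OF e, symmetric] by (subst integral_distr) auto
  also have "\<dots> = (\<integral>p. ?a p *\<^sub>R c (hyperboloid_chart p) \<partial>lborel)"
    using a0 ccm by (subst integral_density) auto
  finally show "(\<integral>p. ?b p *\<^sub>R c p \<partial>lborel) = (\<integral>p. ?a p *\<^sub>R c (hyperboloid_chart p) \<partial>lborel)" .
qed

lemma AE_lborel_pair:
  assumes "{p. P (fst p) (snd p)} \<in> sets (borel :: (real \<times> real) measure)"
    and "\<And>x. AE y in lborel. P x y"
  shows "AE p in lborel. P (fst p) (snd p)"
proof -
  have "{p \<in> space (lborel \<Otimes>\<^sub>M lborel). P (fst p) (snd p)} \<in> sets (lborel \<Otimes>\<^sub>M lborel)"
    using assms(1) unfolding borel_prod[symmetric] by (simp add: space_pair_measure)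
  from lborel_pair.AE_pair_iff[OF this] assms(2) show ?thesis
    unfolding lborel_prod[symmetric] by blast
qed

text \<open>The excluded curves are the diagonal, where the parametrization breaks down, and the
  locus x0 = 0, where the two sheets meet.\<close>

lemma AE_sheets: "AE p in lborel. fst p \<noteq> snd p \<and> 1 + fst p * snd p \<noteq> (0::real)"
proof (rule AE_lborel_pair)
  have "{p \<in> space (borel \<Otimes>\<^sub>M borel). fst p \<noteq> snd p \<and> 1 + fst p * snd p \<noteq> (0::real)} \<in> sets (borel \<Otimes>\<^sub>M (borel :: real measure))"
    by measurable
  then show "{p. fst p \<noteq> snd p \<and> 1 + fst p * snd p \<noteq> (0::real)} \<in> sets borel"
    unfolding borel_prod[symmetric] by (simp add: space_pair_measure)
  fix x :: real
  show "AE y in lborel. x \<noteq> y \<and> 1 + x * y \<noteq> 0"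
    using AE_lborel_singleton[of x] AE_lborel_singleton[of "- 1 / x"]
  proof eventually_elim
    case (elim y)
    show ?case
    proof (intro conjI notI)
      assume a: "1 + x * y = 0"
      then have "x \<noteq> 0" by auto
      with a have "y = - 1 / x" by (simp add: field_simps)
      with elim show False by simp
    qed (use elim in simp)
  qed
qed

text \<open>In the parameters the measure d\<sigma> becomes d\<lambda> d\<mu> / (\<lambda> -
  \<mu>)^2, and the two sheets fill the parameter plane up to a null set.\<close>

lemma Xint_xpar:
  fixes h :: "r3 \<Rightarrow> complex"
  assumes hm: "\<And>e. e \<in> {1, -1::real} \<Longrightarrow> (\<lambda>p. h (Xchart e p)) \<in> borel_measurable borel"
    and int: "integrable lborel (\<lambda>p. h (xpar p) / of_real ((fst p - snd p)\<^sup>2))"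
  shows "Xint h = (\<integral>p. h (xpar p) / of_real ((fst p - snd p)\<^sup>2) \<partial>lborel)"
proof -
  define k where "k = (\<lambda>p. h (xpar p) / of_real ((fst p - snd p)\<^sup>2))"
  have on_sheet: "(indicator (sheet_domain e) p * (1 / (fst p - snd p)\<^sup>2)) *\<^sub>R h (Xchart e (hyperboloid_chart p)) = indicator (sheet_domain e) p *\<^sub>R k p"
    if e: "e \<in> {1, -1}" for e p
  proof (cases "p \<in> sheet_domain e")
    case True
    then have "Xchart e (hyperboloid_chart p) = xpar p"
      using e by (intro Xchart_hyperboloid_chart) (auto simp: sheet_domain_def)
    then show ?thesis by (simp add: k_def scaleR_conv_of_real)
  qed simp
  have ki: "integrable lborel (\<lambda>p. indicator (sheet_domain e) p *\<^sub>R k p)" for e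
    using int by (intro integrable_mult_indicator) (auto simp: k_def)
  have I: "integrable lborel (\<lambda>p. (indicator Xdom p * (1 / (2 * sqrt ((fst p)\<^sup>2 + (snd p)\<^sup>2 - 1)))) *\<^sub>R h (Xchart e p))"
    "(\<integral>p. (indicator Xdom p * (1 / (2 * sqrt ((fst p)\<^sup>2 + (snd p)\<^sup>2 - 1)))) *\<^sub>R h (Xchart e p) \<partial>lborel) = (\<integral>p. indicator (sheet_domain e) p *\<^sub>R k p \<partial>lborel)"
    if e: "e \<in> {1, -1}" for e
    using sheet_integral[OF e hm[OF e]] ki[of e] unfolding on_sheet[OF e] by auto
  have "Xint h = (\<integral>p. (indicator Xdom p * (1 / (2 * sqrt ((fst p)\<^sup>2 + (snd p)\<^sup>2 - 1)))) *\<^sub>R h (Xchart 1 p) +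
      (indicator Xdom p * (1 / (2 * sqrt ((fst p)\<^sup>2 + (snd p)\<^sup>2 - 1)))) *\<^sub>R h (Xchart (-1) p) \<partial>lborel)"
    unfolding Xint_def by (intro Bochner_Integration.integral_cong refl) (simp add: scaleR_conv_of_real add_divide_distrib ring_distribs indicator_def)
  also have "\<dots> = (\<integral>p. indicator (sheet_domain 1) p *\<^sub>R k p \<partial>lborel) + (\<integral>p. indicator (sheet_domain (-1)) p *\<^sub>R k p \<partial>lborel)"
    by (subst Bochner_Integration.integral_add) (use I[of 1] I[of "-1"] in auto)
  also have "\<dots> = (\<integral>p. indicator (sheet_domain 1) p *\<^sub>R k p + indicator (sheet_domain (-1)) p *\<^sub>R k p \<partial>lborel)"
    using ki[of 1] ki[of "-1"] by simp
  also have "\<dots> = (\<integral>p. k p \<partial>lborel)"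
  proof (rule integral_cong_AE)
    show "AE p in lborel. indicator (sheet_domain 1) p *\<^sub>R k p + indicator (sheet_domain (-1)) p *\<^sub>R k p = k p"
      using AE_sheets
    proof eventually_elim
      case (elim p)
      define X where "X = (1 + fst p * snd p) / (fst p - snd p)"
      have "X \<noteq> 0" using elim by (simp add: X_def)
      moreover have "p \<in> sheet_domain 1 \<longleftrightarrow> X > 0" "p \<in> sheet_domain (-1) \<longleftrightarrow> X < 0"
        using elim unfolding sheet_domain_def mem_Collect_eq X_def[symmetric] by auto
      ultimately show ?case by (auto simp: indicator_def)
    qed
  qed (use ki[of 1] ki[of "-1"] int in \<open>auto simp: k_def\<close>)
  finally show ?thesis by (simp add: k_def)
qed

section \<open>Uniform integrability of the wave kernels\<close>

lemma sin_ge_half: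
  assumes "0 \<le> x" "x \<le> pi / 2"
  shows "x / 2 \<le> sin x"
proof (cases "x = 0")
  case False
  define y where "y = x / 2"
  have y: "0 < y" "y \<le> pi / 4" using assms False by (auto simp: y_def)
  obtain z where z: "0 < z" "z < y" "sin y - sin 0 = (y - 0) * cos z"
    using MVT2[of 0 y sin cos] y by (auto intro: DERIV_sin)
  have cy: "cos y \<ge> sqrt 2 / 2"
    using cos_monotone_0_pi_le[of y "pi/4"] y by (simp add: cos_45)
  have "cos z \<ge> cos y" using cos_monotone_0_pi_le[of z y] z y by simp
  then have "sin y \<ge> y * cos y" using z y by (simp add: mult_left_mono)
  moreover have cos0: "0 \<le> cos y" by (rule order_trans[OF _ cy]) simp
  ultimately have "2 * sin y * cos y \<ge> 2 * (y * cos y) * cos y"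
    by (intro mult_right_mono mult_left_mono) auto
  moreover have "cos y * cos y \<ge> sqrt 2 / 2 * (sqrt 2 / 2)"
    using cy cos0 by (intro mult_mono) auto
  then have "2 * (y * cos y) * cos y \<ge> 2 * y * (1/2)"
    using y by (simp add: mult.assoc mult_left_mono)
  ultimately have "2 * sin y * cos y \<ge> y" by linarith
  then show ?thesis using sin_double[of y] by (simp add: y_def)
qed simp

text \<open>On [-pi, pi] the sine vanishes only at 0, pi and -pi, and its modulus is at least half
  the distance to the nearest of them; the constant 2 bounds 2^r.\<close>

lemma abs_sin_powr_bound:
  assumes x: "\<bar>x\<bar> \<le> pi" and r: "0 < r" "r < 1"
  shows "\<bar>sin x\<bar> powr (- r) \<le> 2 * (\<bar>x\<bar> powr (- r) + \<bar>x - pi\<bar> powr (- r) + \<bar>x + pi\<bar> powr (- r))"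
proof -
  have half: "\<bar>sin y\<bar> powr (- r) \<le> 2 * \<bar>y\<bar> powr (- r)" if y: "\<bar>y\<bar> \<le> pi / 2" for y
  proof (cases "y = 0")
    case False
    have "\<bar>y\<bar> / 2 \<le> sin \<bar>y\<bar>" by (rule sin_ge_half) (use y in auto)
    also have "sin \<bar>y\<bar> = \<bar>sin y\<bar>" using y sin_ge_zero[of "\<bar>y\<bar>"] by (cases "y \<ge> 0") auto
    finally have "\<bar>sin y\<bar> powr (- r) \<le> (\<bar>y\<bar> / 2) powr (- r)"
      using False r by (intro powr_mono2') auto
    also have "\<dots> = 2 powr r * \<bar>y\<bar> powr (- r)" by (simp add: powr_divide powr_minus field_simps)
    also have "\<dots> \<le> 2 powr 1 * \<bar>y\<bar> powr (- r)" using r by (intro mult_right_mono powr_mono) auto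
    finally show ?thesis by simp
  qed simp
  consider "\<bar>x\<bar> \<le> pi / 2" | "x > pi / 2" | "x < - (pi / 2)" by linarith
  then show ?thesis
  proof cases
    case 1
    then show ?thesis using half[of x] by (smt (verit) powr_ge_zero)
  next
    case 2
    then have "\<bar>x - pi\<bar> \<le> pi / 2" using x by linarith
    from half[OF this] have "\<bar>sin x\<bar> powr (- r) \<le> 2 * \<bar>x - pi\<bar> powr (- r)" by (simp add: sin_diff)
    then show ?thesis by (smt (verit) powr_ge_zero)
  next
    case 3
    then have "\<bar>x + pi\<bar> \<le> pi / 2" using x by linarith
    from half[OF this] have "\<bar>sin x\<bar> powr (- r) \<le> 2 * \<bar>x + pi\<bar> powr (- r)" by (simp add: sin_add)
    then show ?thesis by (smt (verit) powr_ge_zero)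
  qed
qed

text \<open>For u = tan \<theta> and (c, s) = (cos \<beta>, sin \<beta>) this is |sin(\<beta> -
  \<theta>)|, the rotation-invariant distance of two points of the projective line. Infinity is a
  point like any other for it, which is what makes the bounds uniform in the direction.\<close>

definition chord :: "real \<Rightarrow> real \<Rightarrow> real \<Rightarrow> real" where
  "chord c s u = \<bar>s - u * c\<bar> / sqrt (1 + u\<^sup>2)"

lemma chord_nonneg [simp]: "chord c s u \<ge> 0"
  by (simp add: chord_def)

lemma chord_measurable [measurable]:
  "(\<lambda>x. chord (f x) (g x) (h x)) \<in> borel_measurable M"
  if [measurable]: "f \<in> borel_measurable M" "g \<in> borel_measurable M" "h \<in> borel_measurable M"
  unfolding chord_def by measurable

text \<open>The interval [-8, 8] covers all arguments that will occur: \<beta> - \<theta> has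
  modulus at most pi, is shifted by at most pi, and pi < 4.\<close>

lemma integrable_abs_powr_local:
  assumes "0 < r" "r < (1::real)"
  shows "integrable lborel (\<lambda>x. indicator {-8..8} x * \<bar>x\<bar> powr (- r))"
proof -
  let ?h = "\<lambda>x. indicator {0..8} x * x powr (- r)"
  have "((\<lambda>x. x powr (- r)) has_integral (8 powr (- r + 1) / (- r + 1))) {0..8}"
    by (rule has_integral_powr_from_0) (use assms in auto)
  then have "(\<lambda>x. x powr (- r)) absolutely_integrable_on {0..8}"
    by (intro nonnegative_absolutely_integrable_1) (auto simp: integrable_on_def)
  then have i: "integrable lborel ?h"
    by (simp add: set_integrable_def integrable_completion)
  have i': "integrable lborel (\<lambda>x. ?h (0 + -1 * x))" by (rule lborel_integrable_real_affine[OF i]) simp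
  show ?thesis
    by (rule Bochner_Integration.integrable_bound[OF Bochner_Integration.integrable_add[OF i i']])
      (auto simp: indicator_def)
qed

text \<open>Under u = tan \<theta> the measure du / (1 + u^2) becomes d\<theta>, and the integral is
  that of |sin(\<beta> - \<theta>)|^(-r) over an interval of length pi, which is bounded
  independently of \<beta>.\<close>

lemma chord_powr_integral_bound:
  assumes r: "0 < r" "r < 1"
  obtains K where "K \<ge> 0" "\<And>c s. c\<^sup>2 + s\<^sup>2 = 1 \<Longrightarrow> (\<integral>\<^sup>+u. ennreal (chord c s u powr (- r) / (1 + u\<^sup>2)) \<partial>lborel) \<le> ennreal K"
proof -
  let ?k = "\<lambda>x::real. indicator {-8..8} x * \<bar>x\<bar> powr (- r)"
  define K0 where "K0 = (\<integral>x. ?k x \<partial>lborel)"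
  have ki: "integrable lborel ?k" by (rule integrable_abs_powr_local[OF r])
  have K0: "K0 \<ge> 0" by (simp add: K0_def)
  have kn: "(\<integral>\<^sup>+\<theta>. ennreal (?k (\<beta> + -1 * \<theta>)) \<partial>lborel) = ennreal K0" for \<beta>
  proof -
    have "(\<integral>\<^sup>+x. ennreal (?k x) \<partial>lborel) = ennreal \<bar>-1\<bar> * (\<integral>\<^sup>+\<theta>. ennreal (?k (\<beta> + -1 * \<theta>)) \<partial>lborel)"
      by (rule nn_integral_real_affine) auto
    moreover have "(\<integral>\<^sup>+x. ennreal (?k x) \<partial>lborel) = ennreal K0"
      unfolding K0_def by (rule nn_integral_eq_integral[OF ki]) auto
    ultimately show ?thesis by simp
  qed
  have main: "(\<integral>\<^sup>+u. ennreal (chord (cos \<beta>) (sin \<beta>) u powr (- r) / (1 + u\<^sup>2)) \<partial>lborel) \<le> ennreal (6 * K0)" if \<beta>: "\<bar>\<beta>\<bar> \<le> pi / 2" for \<beta>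
  proof -
    let ?S = "{- (pi / 2)<..<pi / 2}"
    let ?f = "\<lambda>u. chord (cos \<beta>) (sin \<beta>) u powr (- r) / (1 + u\<^sup>2)"
    have img: "tan ` ?S = UNIV"
    proof (intro equalityI subsetI UNIV_I)
      fix x :: real
      have "x = tan (arctan x)" "arctan x \<in> ?S" using arctan_lbound[of x] arctan_ubound[of x] by (auto simp: tan_arctan)
      then show "x \<in> tan ` ?S" by blast
    qed
    have cp: "cos \<theta> > 0" if "\<theta> \<in> ?S" for \<theta> using that by (intro cos_gt_zero_pi) auto
    have inj: "inj_on tan ?S"
      by (rule inj_onI) (metis arctan_tan greaterThanLessThan_iff minus_divide_left)
    have sub: "\<bar>1 / (cos \<theta>)\<^sup>2\<bar> * ?f (tan \<theta>) = \<bar>sin (\<beta> - \<theta>)\<bar> powr (- r)" if "\<theta> \<in> ?S" for \<theta>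
    proof -
      note c = cp[OF that]
      have t: "1 + (tan \<theta>)\<^sup>2 = 1 / (cos \<theta>)\<^sup>2"
        using c tan_sec[of \<theta>] by (simp add: power_inverse inverse_eq_divide power_one_over)
      have "chord (cos \<beta>) (sin \<beta>) (tan \<theta>) = \<bar>sin (\<beta> - \<theta>)\<bar>"
      proof -
        have "sqrt (1 + (tan \<theta>)\<^sup>2) = 1 / cos \<theta>" unfolding t using c by (simp add: real_sqrt_divide)
        moreover have "sin \<beta> - tan \<theta> * cos \<beta> = sin (\<beta> - \<theta>) / cos \<theta>"
          using c by (simp add: tan_def sin_diff field_simps)
        ultimately show ?thesis using c by (simp add: chord_def)
      qed
      then show ?thesis using c unfolding t by simp
    qed
    have fm: "?f \<in> borel_measurable borel" by measurable
    have tm: "(\<lambda>\<theta>. indicator ?S \<theta> * (\<bar>1 / (cos \<theta>)\<^sup>2\<bar> * ?f (tan \<theta>))) \<in> borel_measurable borel"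
    proof -
      have "(\<lambda>\<theta>. indicator ?S \<theta> * (\<bar>1 / (cos \<theta>)\<^sup>2\<bar> * ?f (tan \<theta>))) = (\<lambda>\<theta>. indicator ?S \<theta> * \<bar>sin (\<beta> - \<theta>)\<bar> powr (- r))"
        using sub by (auto simp: indicator_def fun_eq_iff)
      then show ?thesis by simp
    qed
    have "(\<integral>\<^sup>+u. ennreal (indicator (tan ` ?S) u * ?f u) \<partial>lborel) = (\<integral>\<^sup>+\<theta>. ennreal (indicator ?S \<theta> * (\<bar>1 / (cos \<theta>)\<^sup>2\<bar> * ?f (tan \<theta>))) \<partial>lborel)"
    proof (rule nn_integral_change_of_variables_1[OF _ _ _ inj fm _ tm])
      show "(tan has_field_derivative 1 / (cos \<theta>)\<^sup>2) (at \<theta>)" if "\<theta> \<in> ?S" for \<theta>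
        using DERIV_tan[of \<theta>] cp[OF that] by (simp add: inverse_eq_divide power_inverse)
    qed (auto simp: img)
    also have "\<dots> \<le> (\<integral>\<^sup>+\<theta>. ennreal 2 * (ennreal (?k (\<beta> + -1 * \<theta>)) + ennreal (?k ((\<beta> - pi) + -1 * \<theta>)) + ennreal (?k ((\<beta> + pi) + -1 * \<theta>))) \<partial>lborel)"
    proof (rule nn_integral_mono)
      fix \<theta>
      show "ennreal (indicator ?S \<theta> * (\<bar>1 / (cos \<theta>)\<^sup>2\<bar> * ?f (tan \<theta>))) \<le> ennreal 2 * (ennreal (?k (\<beta> + -1 * \<theta>)) + ennreal (?k ((\<beta> - pi) + -1 * \<theta>)) + ennreal (?k ((\<beta> + pi) + -1 * \<theta>)))"
      proof (cases "\<theta> \<in> ?S")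
        case True
        have x: "\<bar>\<beta> - \<theta>\<bar> \<le> pi" using True \<beta> by (auto simp: abs_le_iff)
        have in8: "\<beta> - \<theta> \<in> {-8..8}" "\<beta> - \<theta> - pi \<in> {-8..8}" "\<beta> - \<theta> + pi \<in> {-8..8}"
          using x pi_less_4 unfolding atLeastAtMost_iff by linarith+
        have "ennreal (indicator ?S \<theta> * (\<bar>1 / (cos \<theta>)\<^sup>2\<bar> * ?f (tan \<theta>))) = ennreal (\<bar>sin (\<beta> - \<theta>)\<bar> powr (- r))"
          using True sub[OF True] by simp
        also have "\<dots> \<le> ennreal (2 * (\<bar>\<beta> - \<theta>\<bar> powr (- r) + \<bar>\<beta> - \<theta> - pi\<bar> powr (- r) + \<bar>\<beta> - \<theta> + pi\<bar> powr (- r)))"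
          by (intro ennreal_leI abs_sin_powr_bound x r)
        also have "\<dots> = ennreal 2 * (ennreal (?k (\<beta> + -1 * \<theta>)) + ennreal (?k ((\<beta> - pi) + -1 * \<theta>)) + ennreal (?k ((\<beta> + pi) + -1 * \<theta>)))"
        proof -
          have e3: "ennreal (2 * (a + b + c)) = ennreal 2 * (ennreal a + ennreal b + ennreal c)" if "a \<ge> 0" "b \<ge> 0" "c \<ge> 0" for a b c :: real
            using that by (subst ennreal_mult) auto
          have kk: "?k (\<beta> + -1 * \<theta>) = \<bar>\<beta> - \<theta>\<bar> powr (- r)" "?k ((\<beta> - pi) + -1 * \<theta>) = \<bar>\<beta> - \<theta> - pi\<bar> powr (- r)"
            "?k ((\<beta> + pi) + -1 * \<theta>) = \<bar>\<beta> - \<theta> + pi\<bar> powr (- r)"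
            using in8 by (simp_all add: algebra_simps)
          show ?thesis unfolding kk by (rule e3) auto
        qed
        finally show ?thesis .
      qed simp
    qed
    also have "\<dots> = ennreal 2 * (ennreal K0 + ennreal K0 + ennreal K0)"
      by (subst nn_integral_cmult, measurable, subst nn_integral_add, measurable, subst nn_integral_add, measurable) (simp only: kn)
    also have "\<dots> = ennreal (6 * K0)" using K0 ennreal_mult[of 2 "3 * K0"] by (simp flip: ennreal_plus)
    finally show ?thesis by (simp add: img)
  qed
  show ?thesis
  proof (rule that[of "6 * K0"])
    show "6 * K0 \<ge> 0" using K0 by simp
    fix c s :: real assume cs: "c\<^sup>2 + s\<^sup>2 = 1"
    \<comment> \<open>Changing the sign of (c, s) does not affect \<open>chord\<close>, so the
      direction may be taken with nonnegative cosine.\<close>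
    define \<sigma> where "\<sigma> = (if c \<ge> 0 then 1 else - 1 :: real)"
    have s1: "s\<^sup>2 \<le> 1" using cs zero_le_power2[of c] by linarith
    then have sb: "- 1 \<le> \<sigma> * s" "\<sigma> * s \<le> 1" using abs_le_square_iff[of s 1] by (auto simp: \<sigma>_def)
    define \<beta> where "\<beta> = arcsin (\<sigma> * s)"
    have sin\<beta>: "sin \<beta> = \<sigma> * s" unfolding \<beta>_def using sb by simp
    have cos\<beta>: "cos \<beta> = \<sigma> * c"
    proof -
      have "cos \<beta> = sqrt (1 - s\<^sup>2)" unfolding \<beta>_def using sb by (simp add: cos_arcsin \<sigma>_def)
      also have "1 - s\<^sup>2 = c\<^sup>2" using cs by simp
      finally show ?thesis by (simp add: \<sigma>_def)
    qed
    have "\<bar>\<beta>\<bar> \<le> pi / 2" unfolding \<beta>_def using arcsin_bounded[OF sb] by (intro abs_leI) auto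
    from main[OF this] have "(\<integral>\<^sup>+u. ennreal (chord (cos \<beta>) (sin \<beta>) u powr (- r) / (1 + u\<^sup>2)) \<partial>lborel) \<le> ennreal (6 * K0)" .
    moreover have "chord (cos \<beta>) (sin \<beta>) u = chord c s u" for u
      by (simp add: chord_def sin\<beta> cos\<beta> \<sigma>_def abs_minus_commute)
    ultimately show "(\<integral>\<^sup>+u. ennreal (chord c s u powr (- r) / (1 + u\<^sup>2)) \<partial>lborel) \<le> ennreal (6 * K0)" by simp
  qed
qed

text \<open>Bounded moments of order q > 1 take the place of a common majorant. Truncation at level
  N changes each integral by at most K N^(1 - q), uniformly in n, and the truncated integrals
  converge by dominated convergence.\<close>

lemma Vitali_powr_convergence:
  fixes \<Theta> :: "nat \<Rightarrow> 'a \<Rightarrow> complex" and w :: "'a \<Rightarrow> real"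
  assumes w0: "\<And>x. w x \<ge> 0" and wi: "integrable M w" and q: "q > 1"
    and m: "\<And>n. \<Theta> n \<in> borel_measurable M" "\<Theta>0 \<in> borel_measurable M"
    and lim: "AE x in M. (\<lambda>n. \<Theta> n x) \<longlonglongrightarrow> \<Theta>0 x"
    and I: "\<And>n. integrable M (\<lambda>x. w x * cmod (\<Theta> n x) powr q)" "integrable M (\<lambda>x. w x * cmod (\<Theta>0 x) powr q)"
    and K: "\<And>n. (\<integral>x. w x * cmod (\<Theta> n x) powr q \<partial>M) \<le> K" "(\<integral>x. w x * cmod (\<Theta>0 x) powr q \<partial>M) \<le> K"
  shows "(\<lambda>n. \<integral>x. w x *\<^sub>R \<Theta> n x \<partial>M) \<longlonglongrightarrow> (\<integral>x. w x *\<^sub>R \<Theta>0 x \<partial>M)"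
proof -
  note [measurable] = m borel_measurable_integrable[OF wi]
  \<comment> \<open>Radial projection onto the disc of radius N; unlike a cut-off by an indicator it
    is continuous, so it respects pointwise limits.\<close>
  define T where "T = (\<lambda>N z. of_real (N / max N (cmod z)) * z)"
  have Tn: "cmod (T N z) \<le> N" if "N > 0" for N z
  proof -
    have "N * cmod z / max N (cmod z) \<le> N" using that by (auto simp: max_def pos_divide_le_eq)
    then show ?thesis using that by (simp add: T_def norm_mult norm_divide del: of_real_divide flip: of_real_divide)
  qed
  have Td: "cmod (z - T N z) \<le> cmod z powr q * N powr (1 - q)" if N: "N > 0" for N z
  proof (cases "cmod z \<le> N")
    case True
    then show ?thesis using N by (simp add: T_def max_def)
  next
    case False
    then have z: "cmod z > N" by simp
    have "z - T N z = of_real (1 - N / cmod z) * z" using z by (simp add: T_def max_def algebra_simps)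
    then have "cmod (z - T N z) = \<bar>1 - N / cmod z\<bar> * cmod z" by (simp only: norm_mult norm_of_real)
    also have "\<dots> \<le> 1 * cmod z" using N z by (intro mult_right_mono) (auto simp: abs_le_iff divide_le_eq)
    also have "\<dots> = cmod z powr q * cmod z powr (1 - q)" using z N by (simp flip: powr_add)
    also have "\<dots> \<le> cmod z powr q * N powr (1 - q)" using z N q by (intro mult_left_mono powr_mono2') auto
    finally show ?thesis .
  qed
  have Tm [measurable]: "T N \<in> borel_measurable borel" if "N > 0" for N
    unfolding T_def using that by (intro borel_measurable_continuous_onI continuous_intros) auto
  have Tc: "isCont (T N) z" if "N > 0" for N z
    unfolding T_def using that by (intro continuous_intros) auto
  have wT: "integrable M (\<lambda>x. w x *\<^sub>R T N (f x))" if N: "N > 0" and f [measurable]: "f \<in> borel_measurable M" for N and f :: "'a \<Rightarrow> complex"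
  proof (rule Bochner_Integration.integrable_bound[OF integrable_mult_left[OF wi, of N]])
    show "(\<lambda>x. w x *\<^sub>R T N (f x)) \<in> borel_measurable M" using Tm[OF N] by measurable
    show "AE x in M. norm (w x *\<^sub>R T N (f x)) \<le> norm (w x * N)"
      using Tn[OF N] w0 N by (auto simp: abs_mult intro!: mult_left_mono)
  qed
  have wd: "integrable M (\<lambda>x. w x *\<^sub>R (f x - T N (f x)))"
    "cmod (\<integral>x. w x *\<^sub>R (f x - T N (f x)) \<partial>M) \<le> K * N powr (1 - q)"
    if N: "N > 0" and f [measurable]: "f \<in> borel_measurable M" and fi: "integrable M (\<lambda>x. w x * cmod (f x) powr q)"
      and fK: "(\<integral>x. w x * cmod (f x) powr q \<partial>M) \<le> K" for N and f :: "'a \<Rightarrow> complex"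
  proof -
    have b: "norm (w x *\<^sub>R (f x - T N (f x))) \<le> w x * cmod (f x) powr q * N powr (1 - q)" for x
      using mult_left_mono[OF Td[OF N, of "f x"] w0[of x]] w0[of x] by (simp add: mult.assoc)
    have i: "integrable M (\<lambda>x. w x * cmod (f x) powr q * N powr (1 - q))" using fi by simp
    show 1: "integrable M (\<lambda>x. w x *\<^sub>R (f x - T N (f x)))"
    proof (rule Bochner_Integration.integrable_bound[OF i])
      show "(\<lambda>x. w x *\<^sub>R (f x - T N (f x))) \<in> borel_measurable M" using Tm[OF N] by measurable
    qed (use b order_trans[OF _ abs_ge_self] in auto)
    have "cmod (\<integral>x. w x *\<^sub>R (f x - T N (f x)) \<partial>M) \<le> (\<integral>x. w x * cmod (f x) powr q * N powr (1 - q) \<partial>M)"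
      by (rule order_trans[OF integral_norm_bound integral_mono[OF integrable_norm[OF 1] i b]])
    also have "\<dots> \<le> K * N powr (1 - q)" using fK by (simp add: mult_right_mono)
    finally show "cmod (\<integral>x. w x *\<^sub>R (f x - T N (f x)) \<partial>M) \<le> K * N powr (1 - q)" .
  qed
  have split: "(\<integral>x. w x *\<^sub>R f x \<partial>M) = (\<integral>x. w x *\<^sub>R T N (f x) \<partial>M) + (\<integral>x. w x *\<^sub>R (f x - T N (f x)) \<partial>M)"
    if "N > 0" "f \<in> borel_measurable M" "integrable M (\<lambda>x. w x * cmod (f x) powr q)" "(\<integral>x. w x * cmod (f x) powr q \<partial>M) \<le> K" for N and f :: "'a \<Rightarrow> complex"
    using wT[OF that(1,2)] wd(1)[OF that] by (subst Bochner_Integration.integral_add[symmetric]) (auto simp: algebra_simps)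
  show ?thesis
  proof (rule LIMSEQ_I)
    fix \<epsilon> :: real assume \<epsilon>: "\<epsilon> > 0"
    have "((\<lambda>N. K * N powr (1 - q)) \<longlongrightarrow> 0) at_top"
      by (intro tendsto_mult_right_zero tendsto_neg_powr filterlim_ident) (use q in auto)
    then have "\<forall>\<^sub>F N in at_top. K * N powr (1 - q) < \<epsilon> / 4" using \<epsilon> by (intro order_tendstoD) auto
    from eventually_conj[OF this eventually_gt_at_top[of 0]] obtain N where N: "N > 0" "K * N powr (1 - q) < \<epsilon> / 4"
      by (auto simp: eventually_at_top_linorder)
    have "(\<lambda>n. \<integral>x. w x *\<^sub>R T N (\<Theta> n x) \<partial>M) \<longlonglongrightarrow> (\<integral>x. w x *\<^sub>R T N (\<Theta>0 x) \<partial>M)"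
    proof (rule integral_dominated_convergence[where w="\<lambda>x. w x * N"])
      show "AE x in M. (\<lambda>n. w x *\<^sub>R T N (\<Theta> n x)) \<longlonglongrightarrow> w x *\<^sub>R T N (\<Theta>0 x)"
        using lim by eventually_elim (intro tendsto_intros isCont_tendsto_compose[OF Tc[OF N(1)]])
      show "AE x in M. norm (w x *\<^sub>R T N (\<Theta> n x)) \<le> w x * N" for n
        using Tn[OF N(1)] w0 by (auto intro!: mult_left_mono)
    qed (use wi borel_measurable_integrable[OF wT[OF N(1)]] m in auto)
    from LIMSEQ_D[OF this, of "\<epsilon> / 2"] \<epsilon> obtain n0 where n0: "\<And>n. n \<ge> n0 \<Longrightarrow> cmod ((\<integral>x. w x *\<^sub>R T N (\<Theta> n x) \<partial>M) - (\<integral>x. w x *\<^sub>R T N (\<Theta>0 x) \<partial>M)) < \<epsilon> / 2" by auto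
    have "cmod ((\<integral>x. w x *\<^sub>R \<Theta> n x \<partial>M) - (\<integral>x. w x *\<^sub>R \<Theta>0 x \<partial>M)) < \<epsilon>" if "n \<ge> n0" for n
    proof -
      let ?a = "(\<integral>x. w x *\<^sub>R T N (\<Theta> n x) \<partial>M) - (\<integral>x. w x *\<^sub>R T N (\<Theta>0 x) \<partial>M)"
      let ?b = "\<integral>x. w x *\<^sub>R (\<Theta> n x - T N (\<Theta> n x)) \<partial>M" and ?c = "\<integral>x. w x *\<^sub>R (\<Theta>0 x - T N (\<Theta>0 x)) \<partial>M"
      have eq: "(\<integral>x. w x *\<^sub>R \<Theta> n x \<partial>M) - (\<integral>x. w x *\<^sub>R \<Theta>0 x \<partial>M) = ?a + (?b - ?c)"
        using split[OF N(1) m(1) I(1) K(1), of n] split[OF N(1) m(2) I(2) K(2)] by simp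
      have bc: "cmod ?b \<le> K * N powr (1 - q)" "cmod ?c \<le> K * N powr (1 - q)"
        by (rule wd(2)[OF N(1) m(1) I(1) K(1)], rule wd(2)[OF N(1) m(2) I(2) K(2)])
      have "cmod (?a + (?b - ?c)) \<le> cmod ?a + (cmod ?b + cmod ?c)"
        by (rule order_trans[OF norm_triangle_ineq add_left_mono[OF norm_triangle_ineq4]])
      also have "\<dots> < \<epsilon>" using n0[OF that] N(2) bc by linarith
      finally show ?thesis unfolding eq .
    qed
    then show "\<exists>no. \<forall>n\<ge>no. norm ((\<integral>x. w x *\<^sub>R \<Theta> n x \<partial>M) - (\<integral>x. w x *\<^sub>R \<Theta>0 x \<partial>M)) < \<epsilon>" by blast
  qed
qed

text \<open>Product of the three mutual distances, in the sense of \<open>chord\<close>, of the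
  points fst p, snd p and s/c of the projective line.\<close>

definition chord_product :: "real \<Rightarrow> real \<Rightarrow> real \<times> real \<Rightarrow> real" where
  "chord_product c s p = chord c s (fst p) * chord c s (snd p) *
     (\<bar>fst p - snd p\<bar> / (sqrt (1 + (fst p)\<^sup>2) * sqrt (1 + (snd p)\<^sup>2)))"

text \<open>Density of the product of two copies of the rotation-invariant measure on the projective
  line.\<close>

definition cayley_weight :: "real \<times> real \<Rightarrow> real" where
  "cayley_weight p = 1 / (1 + (fst p)\<^sup>2) * (1 / (1 + (snd p)\<^sup>2))"

lemma cayley_weight_pos: "cayley_weight p > 0"
  by (simp add: cayley_weight_def add_pos_nonneg)

lemma integrable_cayley_weight: "integrable lborel cayley_weight"
  unfolding cayley_weight_def[abs_def]
  by (rule integrable_product_lborel[OF integral_inverse_one_plus_square(1) integral_inverse_one_plus_square(1)])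

lemma chord_eq_distance: "chord (1 / sqrt (1 + u\<^sup>2)) (u / sqrt (1 + u\<^sup>2)) v = \<bar>u - v\<bar> / (sqrt (1 + u\<^sup>2) * sqrt (1 + v\<^sup>2))"
proof -
  have "u / sqrt (1 + u\<^sup>2) - v * (1 / sqrt (1 + u\<^sup>2)) = (u - v) / sqrt (1 + u\<^sup>2)" by (simp add: diff_divide_distrib)
  then show ?thesis by (simp add: chord_def abs_mult)
qed

lemma unit_direction: "(1 / sqrt (1 + u\<^sup>2))\<^sup>2 + (u / sqrt (1 + u\<^sup>2))\<^sup>2 = (1::real)"
proof -
  have "1 + u\<^sup>2 > 0" by (simp add: add_pos_nonneg)
  then show ?thesis by (simp add: power_divide flip: add_divide_distrib)
qed

text \<open>The square of the smallest of the three numbers is at most the product of the other two.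
  So three factors are traded for two, at the price of raising the exponent from 2 to 3.\<close>

lemma three_cubes: "a\<^sup>2 * b\<^sup>2 * c\<^sup>2 \<le> a^3 * b^3 + a^3 * c^3 + b^3 * (c::real)^3"
  if "a \<ge> 0" "b \<ge> 0" "c \<ge> 0"
proof -
  have key: "x\<^sup>2 * y\<^sup>2 * z\<^sup>2 \<le> x^3 * y^3" if "0 \<le> z" "z \<le> x" "z \<le> y" for x y z :: real
  proof -
    have "z\<^sup>2 \<le> x * y" unfolding power2_eq_square using that by (intro mult_mono) auto
    then have "x\<^sup>2 * y\<^sup>2 * z\<^sup>2 \<le> x\<^sup>2 * y\<^sup>2 * (x * y)" by (intro mult_left_mono) auto
    then show ?thesis by (simp add: power2_eq_square power3_eq_cube mult_ac)
  qed
  have nn: "a^3 * b^3 \<ge> 0" "a^3 * c^3 \<ge> 0" "b^3 * c^3 \<ge> 0" using that by auto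
  consider "c \<le> a" "c \<le> b" | "b \<le> a" "b \<le> c" | "a \<le> b" "a \<le> c" by linarith
  then show ?thesis
  proof cases
    case 1 then show ?thesis using key[of c a b] nn that by linarith
  next
    case 2
    have "a\<^sup>2 * b\<^sup>2 * c\<^sup>2 = a\<^sup>2 * c\<^sup>2 * b\<^sup>2" by (simp add: mult_ac)
    then show ?thesis using key[of b a c] 2 nn that by linarith
  next
    case 3
    have "a\<^sup>2 * b\<^sup>2 * c\<^sup>2 = b\<^sup>2 * c\<^sup>2 * a\<^sup>2" by (simp add: mult_ac)
    then show ?thesis using key[of a b c] 3 nn that by linarith
  qed
qed

text \<open>\<open>three_cubes\<close> applied to the powers of order -3/10. Each term keeps two of
  the three singular factors, of order 9/10 < 1, so it can be integrated one variable at a time even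
  where all three points coalesce. The order 3/5 lies above the order 1/2 of the kernel and still
  satisfies 3/2 * 3/5 < 1.\<close>

lemma powr_triple_bound:
  fixes U V D :: real
  assumes "U \<ge> 0" "V \<ge> 0" "D \<ge> 0"
  shows "(U * V * D) powr (- 3/5) \<le> U powr (- 9/10) * V powr (- 9/10) + U powr (- 9/10) * D powr (- 9/10) + V powr (- 9/10) * D powr (- 9/10)"
proof -
  have e: "x powr (- 3/5) = (x powr (- 3/10))\<^sup>2" "x powr (- 9/10) = (x powr (- 3/10))^3" for x :: real
    unfolding power2_eq_square power3_eq_cube by (simp_all flip: powr_add)
  have "(U * V * D) powr (- 3/5) = (U powr (- 3/10))\<^sup>2 * (V powr (- 3/10))\<^sup>2 * (D powr (- 3/10))\<^sup>2"
    unfolding e(1)[symmetric] using assms by (simp add: powr_mult)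
  also have "\<dots> \<le> (U powr (- 3/10))^3 * (V powr (- 3/10))^3 + (U powr (- 3/10))^3 * (D powr (- 3/10))^3 + (V powr (- 3/10))^3 * (D powr (- 3/10))^3"
    by (rule three_cubes) auto
  finally show ?thesis by (simp only: e)
qed

text \<open>Each of the three terms is an iterated integral of one-dimensional bounds, since the
  distance of u and v is itself the \<open>chord\<close> of v from the direction of u. This gives
  three times K^2 for every direction (c, s).\<close>

lemma chord_product_powr_integral_bound:
  obtains K where "K \<ge> 0"
    "\<And>c s. c\<^sup>2 + s\<^sup>2 = 1 \<Longrightarrow> integrable lborel (\<lambda>p. cayley_weight p * chord_product c s p powr (- 3/5))"
    "\<And>c s. c\<^sup>2 + s\<^sup>2 = 1 \<Longrightarrow> (\<integral>p. cayley_weight p * chord_product c s p powr (- 3/5) \<partial>lborel) \<le> K"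
proof -
  obtain K where K: "K \<ge> 0"
    and bd: "\<And>c s. c\<^sup>2 + s\<^sup>2 = 1 \<Longrightarrow> (\<integral>\<^sup>+u. ennreal (chord c s u powr (- 9/10) / (1 + u\<^sup>2)) \<partial>lborel) \<le> ennreal K"
    using chord_powr_integral_bound[of "9/10"] by auto
  have nn: "(\<integral>\<^sup>+p. ennreal (cayley_weight p * chord_product c s p powr (- 3/5)) \<partial>lborel) \<le> ennreal (3 * K * K)" if cs: "c\<^sup>2 + s\<^sup>2 = 1" for c s
  proof -
    define h where "h = (\<lambda>u. chord c s u powr (- 9/10) / (1 + u\<^sup>2))"
    define d where "d = (\<lambda>u v. chord (1 / sqrt (1 + u\<^sup>2)) (u / sqrt (1 + u\<^sup>2)) v powr (- 9/10) / (1 + v\<^sup>2))"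
    have hm [measurable]: "h \<in> borel_measurable borel" unfolding h_def by measurable
    have dm [measurable]: "(\<lambda>p. d (fst p) (snd p)) \<in> borel_measurable borel" "(\<lambda>p. d (snd p) (fst p)) \<in> borel_measurable borel"
      unfolding d_def by measurable
    have dm1 [measurable]: "d u \<in> borel_measurable borel" for u unfolding d_def by measurable
    have h0: "h u \<ge> 0" for u by (simp add: h_def)
    have d0: "d u v \<ge> 0" for u v by (simp add: d_def)
    have hb: "(\<integral>\<^sup>+u. ennreal (h u) \<partial>lborel) \<le> ennreal K" unfolding h_def by (rule bd[OF cs])
    have db: "(\<integral>\<^sup>+v. ennreal (d u v) \<partial>lborel) \<le> ennreal K" for u
      unfolding d_def by (rule bd[OF unit_direction])
    have pw: "cayley_weight p * chord_product c s p powr (- 3/5) \<le> h (fst p) * h (snd p) + h (fst p) * d (fst p) (snd p) + h (snd p) * d (snd p) (fst p)" for p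
    proof -
      obtain u v where p: "p = (u, v)" by force
      define U V D where "U = chord c s u" and "V = chord c s v" and "D = \<bar>u - v\<bar> / (sqrt (1 + u\<^sup>2) * sqrt (1 + v\<^sup>2))"
      have D: "chord (1 / sqrt (1 + u\<^sup>2)) (u / sqrt (1 + u\<^sup>2)) v = D" "chord (1 / sqrt (1 + v\<^sup>2)) (v / sqrt (1 + v\<^sup>2)) u = D"
        unfolding D_def chord_eq_distance by (simp_all add: abs_minus_commute mult.commute)
      have "cayley_weight p * (U * V * D) powr (- 3/5) \<le> cayley_weight p * (U powr (- 9/10) * V powr (- 9/10) + U powr (- 9/10) * D powr (- 9/10) + V powr (- 9/10) * D powr (- 9/10))"
        using cayley_weight_pos[of p] by (intro mult_left_mono powr_triple_bound) (auto simp: U_def V_def D_def)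
      moreover have "chord_product c s p = U * V * D" by (simp add: chord_product_def p U_def V_def D_def)
      ultimately show ?thesis
        unfolding h_def d_def p fst_conv snd_conv D U_def[symmetric] V_def[symmetric] cayley_weight_def by (simp add: algebra_simps)
    qed
    have "(\<integral>\<^sup>+p. ennreal (cayley_weight p * chord_product c s p powr (- 3/5)) \<partial>lborel)
      \<le> (\<integral>\<^sup>+p. ennreal (h (fst p)) * ennreal (h (snd p)) + ennreal (h (fst p)) * ennreal (d (fst p) (snd p)) + ennreal (h (snd p)) * ennreal (d (snd p) (fst p)) \<partial>lborel)"
    proof (rule nn_integral_mono)
      fix p :: "real \<times> real"
      have "ennreal (cayley_weight p * chord_product c s p powr (- 3/5)) \<le> ennreal (h (fst p) * h (snd p) + h (fst p) * d (fst p) (snd p) + h (snd p) * d (snd p) (fst p))"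
        by (rule ennreal_leI[OF pw])
      also have "\<dots> = ennreal (h (fst p)) * ennreal (h (snd p)) + ennreal (h (fst p)) * ennreal (d (fst p) (snd p)) + ennreal (h (snd p)) * ennreal (d (snd p) (fst p))"
        using h0 d0 by (simp add: ennreal_mult)
      finally show "ennreal (cayley_weight p * chord_product c s p powr (- 3/5)) \<le> \<dots>" .
    qed
    also have "\<dots> = (\<integral>\<^sup>+p. ennreal (h (fst p)) * ennreal (h (snd p)) \<partial>lborel) + (\<integral>\<^sup>+p. ennreal (h (fst p)) * ennreal (d (fst p) (snd p)) \<partial>lborel) + (\<integral>\<^sup>+p. ennreal (h (snd p)) * ennreal (d (snd p) (fst p)) \<partial>lborel)"
      by (subst nn_integral_add, measurable, subst nn_integral_add, measurable)
    also have "\<dots> \<le> ennreal K * ennreal K + ennreal K * ennreal K + ennreal K * ennreal K"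
    proof (intro add_mono)
      have "(\<integral>\<^sup>+p. ennreal (h (fst p)) * ennreal (h (snd p)) \<partial>lborel) = (\<integral>\<^sup>+u. \<integral>\<^sup>+v. ennreal (h u) * ennreal (h v) \<partial>lborel \<partial>lborel)"
        by (subst nn_integral_pair_lborel(1)) auto
      also have "\<dots> \<le> (\<integral>\<^sup>+u. ennreal (h u) * ennreal K \<partial>lborel)"
        using hb by (intro nn_integral_mono) (auto simp: nn_integral_cmult intro!: mult_left_mono)
      also have "\<dots> \<le> ennreal K * ennreal K" using hb by (auto simp: nn_integral_multc intro!: mult_right_mono)
      finally show "(\<integral>\<^sup>+p. ennreal (h (fst p)) * ennreal (h (snd p)) \<partial>lborel) \<le> ennreal K * ennreal K" .
      have "(\<integral>\<^sup>+p. ennreal (h (fst p)) * ennreal (d (fst p) (snd p)) \<partial>lborel) = (\<integral>\<^sup>+u. \<integral>\<^sup>+v. ennreal (h u) * ennreal (d u v) \<partial>lborel \<partial>lborel)"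
        by (subst nn_integral_pair_lborel(1)) auto
      also have "\<dots> \<le> (\<integral>\<^sup>+u. ennreal (h u) * ennreal K \<partial>lborel)"
        using db by (intro nn_integral_mono) (auto simp: nn_integral_cmult intro!: mult_left_mono)
      also have "\<dots> \<le> ennreal K * ennreal K" using hb by (auto simp: nn_integral_multc intro!: mult_right_mono)
      finally show "(\<integral>\<^sup>+p. ennreal (h (fst p)) * ennreal (d (fst p) (snd p)) \<partial>lborel) \<le> ennreal K * ennreal K" .
      have "(\<integral>\<^sup>+p. ennreal (h (snd p)) * ennreal (d (snd p) (fst p)) \<partial>lborel) = (\<integral>\<^sup>+v. \<integral>\<^sup>+u. ennreal (h v) * ennreal (d v u) \<partial>lborel \<partial>lborel)"
        by (subst nn_integral_pair_lborel(2)) auto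
      also have "\<dots> \<le> (\<integral>\<^sup>+u. ennreal (h u) * ennreal K \<partial>lborel)"
        using db by (intro nn_integral_mono) (auto simp: nn_integral_cmult intro!: mult_left_mono)
      also have "\<dots> \<le> ennreal K * ennreal K" using hb by (auto simp: nn_integral_multc intro!: mult_right_mono)
      finally show "(\<integral>\<^sup>+p. ennreal (h (snd p)) * ennreal (d (snd p) (fst p)) \<partial>lborel) \<le> ennreal K * ennreal K" .
    qed
    also have "\<dots> = ennreal (3 * K * K)" using K by (simp flip: ennreal_plus ennreal_mult)
    finally show ?thesis .
  qed
  have m: "(\<lambda>p. cayley_weight p * chord_product c s p powr (- 3/5)) \<in> borel_measurable borel" for c s
    unfolding cayley_weight_def chord_product_def by measurable
  have nonneg: "cayley_weight p * chord_product c s p powr (- 3/5) \<ge> 0" for c s p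
    using cayley_weight_pos[of p] by simp
  have i: "integrable lborel (\<lambda>p. cayley_weight p * chord_product c s p powr (- 3/5))" if cs: "c\<^sup>2 + s\<^sup>2 = 1" for c s
    by (rule integrableI_bounded) (use m nn[OF cs] nonneg in \<open>auto simp: abs_of_nonneg intro: le_less_trans\<close>)
  show ?thesis
  proof (rule that[of "3 * K * K"])
    show "3 * K * K \<ge> 0" using K by simp
    fix c s :: real assume cs: "c\<^sup>2 + s\<^sup>2 = 1"
    show "integrable lborel (\<lambda>p. cayley_weight p * chord_product c s p powr (- 3/5))" by (rule i[OF cs])
    have "ennreal (\<integral>p. cayley_weight p * chord_product c s p powr (- 3/5) \<partial>lborel) \<le> ennreal (3 * K * K)"
      using nn[OF cs] nn_integral_eq_integral[OF i[OF cs]] nonneg by simp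
    then show "(\<integral>p. cayley_weight p * chord_product c s p powr (- 3/5) \<partial>lborel) \<le> 3 * K * K"
      using K by (simp add: ennreal_le_iff)
  qed
qed

section \<open>The pairing of a boundary point with a null direction\<close>

definition lor_angle :: "real \<Rightarrow> real \<times> real \<Rightarrow> real" where
  "lor_angle \<alpha> p = lorR (xpar p) (1, cos \<alpha>, sin \<alpha>)"

text \<open>In half-angles the numerator factors: the null direction corresponds to the single point
  tan(\<alpha>/2) of the projective line, and the pairing vanishes when one of the parameters equals
  it.\<close>

lemma lor_angle_eq:
  assumes "fst p \<noteq> snd p"
  shows "lor_angle \<alpha> p = 2 * (sin (\<alpha>/2) - fst p * cos (\<alpha>/2)) * (sin (\<alpha>/2) - snd p * cos (\<alpha>/2)) / (fst p - snd p)"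
proof -
  define s c where "s = sin (\<alpha>/2)" and "c = cos (\<alpha>/2)"
  have ca: "cos \<alpha> = c\<^sup>2 - s\<^sup>2" using cos_double[of "\<alpha>/2"] by (simp add: s_def c_def)
  have sa: "sin \<alpha> = 2 * s * c" using sin_double[of "\<alpha>/2"] by (simp add: s_def c_def)
  have one: "1 = c\<^sup>2 + s\<^sup>2" by (simp add: s_def c_def)
  have "lor_angle \<alpha> p = ((1 + fst p * snd p) * 1 - (1 - fst p * snd p) * cos \<alpha> - (fst p + snd p) * sin \<alpha>) / (fst p - snd p)"
    unfolding lor_angle_def xpar_eq lorR_def prod.case times_divide_eq_left by (simp only: diff_divide_distrib)
  also have "(1 + fst p * snd p) * 1 - (1 - fst p * snd p) * cos \<alpha> - (fst p + snd p) * sin \<alpha> = 2 * (s - fst p * c) * (s - snd p * c)"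
  proof -
    have t: "(1 + fst p * snd p) * 1 = (1 + fst p * snd p) * (c\<^sup>2 + s\<^sup>2)" unfolding one[symmetric] ..
    show ?thesis unfolding t ca sa by (simp add: algebra_simps power2_eq_square)
  qed
  finally show ?thesis by (simp add: s_def c_def)
qed

lemma lor_angle_measurable [measurable]: "lor_angle \<alpha> \<in> borel_measurable borel"
  unfolding lor_angle_def[abs_def] xpar_eq lorR_def by simp

lemma abs_lor_angle:
  assumes "fst p \<noteq> snd p"
  shows "\<bar>lor_angle \<alpha> p\<bar> = 2 * (chord (cos (\<alpha>/2)) (sin (\<alpha>/2)) (fst p) * chord (cos (\<alpha>/2)) (sin (\<alpha>/2)) (snd p)) /
     (\<bar>fst p - snd p\<bar> / (sqrt (1 + (fst p)\<^sup>2) * sqrt (1 + (snd p)\<^sup>2)))"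
proof -
  have "sqrt (1 + (fst p)\<^sup>2) \<noteq> 0" "sqrt (1 + (snd p)\<^sup>2) \<noteq> 0"
    by (simp_all add: add_nonneg_eq_0_iff)
  moreover have "2 * X * Y / d = 2 * (X / a * (Y / b)) / (d / (a * b))" if "a \<noteq> 0" "b \<noteq> 0" for X Y d a b :: real
    using that by simp
  ultimately show ?thesis unfolding lor_angle_eq[OF assms] chord_def abs_divide abs_mult abs_numeral by blast
qed

text \<open>With U, V the distances of the parameters to the direction and D their mutual distance,
  the singular factor is at most (UV)^(-1/2) D^(1/2), and the decay factor is at most
  \<open>cayley_weight\<close> / D. The powers of D combine to -1/2, so the three distances enter
  symmetrically.\<close>

lemma lor_angle_kernel_bound:
  assumes ne: "fst p \<noteq> snd p"
  shows "\<bar>lor_angle \<alpha> p\<bar> powr (- 1/2) * (1 / (\<bar>fst p - snd p\<bar> * ((1 + \<bar>fst p\<bar>) * (1 + \<bar>snd p\<bar>)))) \<le>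
    cayley_weight p * chord_product (cos (\<alpha>/2)) (sin (\<alpha>/2)) p powr (- 1/2)"
proof -
  define U V where "U = chord (cos (\<alpha>/2)) (sin (\<alpha>/2)) (fst p)" and "V = chord (cos (\<alpha>/2)) (sin (\<alpha>/2)) (snd p)"
  define a b where "a = sqrt (1 + (fst p)\<^sup>2)" and "b = sqrt (1 + (snd p)\<^sup>2)"
  define D where "D = \<bar>fst p - snd p\<bar> / (a * b)"
  have ab: "a > 0" "b > 0" by (auto simp: a_def b_def add_pos_nonneg)
  have D: "D > 0" using ne ab by (simp add: D_def)
  have a2: "a * a = 1 + (fst p)\<^sup>2" "b * b = 1 + (snd p)\<^sup>2" by (auto simp: a_def b_def)
  have sle: "sqrt (1 + x\<^sup>2) \<le> 1 + \<bar>x\<bar>" for x :: real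
    by (rule real_le_lsqrt) (auto simp: power2_eq_square algebra_simps)
  have absD: "\<bar>fst p - snd p\<bar> = D * (a * b)" using ab by (simp add: D_def)
  have "\<bar>lor_angle \<alpha> p\<bar> = 2 * (U * V) / D"
    unfolding abs_lor_angle[OF ne] U_def V_def D_def a_def b_def ..
  then have "\<bar>lor_angle \<alpha> p\<bar> powr (- 1/2) = 2 powr (- 1/2) * (U * V) powr (- 1/2) * D powr (1/2)"
    using D by (simp add: powr_divide powr_mult powr_minus_divide U_def V_def)
  also have "\<dots> \<le> 1 * (U * V) powr (- 1/2) * D powr (1/2)"
    using powr_mono[of "-1/2" 0 "2::real"] by (intro mult_right_mono) auto
  finally have 1: "\<bar>lor_angle \<alpha> p\<bar> powr (- 1/2) \<le> (U * V) powr (- 1/2) * D powr (1/2)" by simp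
  have "1 / (\<bar>fst p - snd p\<bar> * ((1 + \<bar>fst p\<bar>) * (1 + \<bar>snd p\<bar>))) \<le> 1 / (\<bar>fst p - snd p\<bar> * (a * b))"
    using ne ab sle unfolding a_def b_def by (intro divide_left_mono mult_left_mono mult_mono mult_pos_pos) (auto simp: add_pos_nonneg)
  also have "\<dots> = cayley_weight p / D"
    unfolding absD cayley_weight_def a2[symmetric] by simp
  finally have 2: "1 / (\<bar>fst p - snd p\<bar> * ((1 + \<bar>fst p\<bar>) * (1 + \<bar>snd p\<bar>))) \<le> cayley_weight p / D" .
  have "\<bar>lor_angle \<alpha> p\<bar> powr (- 1/2) * (1 / (\<bar>fst p - snd p\<bar> * ((1 + \<bar>fst p\<bar>) * (1 + \<bar>snd p\<bar>)))) \<le>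
      ((U * V) powr (- 1/2) * D powr (1/2)) * (cayley_weight p / D)"
    by (rule mult_mono[OF 1 2]) auto
  also have "\<dots> = cayley_weight p * ((U * V) powr (- 1/2) * D powr (- 1/2))"
  proof -
    have "D powr (- 1) = 1 / D" using D by (simp add: powr_minus_divide)
    then have "D powr (1/2) / D = D powr (1/2) * D powr (- 1)" by simp
    also have "\<dots> = D powr (- 1/2)" unfolding powr_add[symmetric] by simp
    finally have "D powr (1/2) / D = D powr (- 1/2)" .
    moreover have "(U * V) powr (- 1/2) * D powr (1/2) * (cayley_weight p / D) = cayley_weight p * ((U * V) powr (- 1/2) * (D powr (1/2) / D))"
      by simp
    ultimately show ?thesis by (simp only:)
  qed
  also have "\<dots> = cayley_weight p * (U * V * D) powr (- 1/2)"
    using D by (simp add: powr_mult U_def V_def)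
  also have "U * V * D = chord_product (cos (\<alpha>/2)) (sin (\<alpha>/2)) p"
    by (simp add: chord_product_def U_def V_def D_def a_def b_def)
  finally show ?thesis .
qed

lemma norm_tpow_le:
  assumes "e \<in> {1, -1}"
  shows "cmod (tpow e t (- 1/2 - \<i> * of_real \<nu>)) \<le> exp (pi * \<bar>\<nu>\<bar>) * \<bar>t\<bar> powr (- 1/2)"
proof -
  have n: "cmod (complex_of_real x powr (- 1/2 - \<i> * of_real \<nu>)) = x powr (- 1/2)" if "x > 0" for x
    using that by (subst norm_powr_real_powr) auto
  consider "t > 0" | "t < 0" | "t = 0" by linarith
  then show ?thesis
  proof cases
    case 1
    then show ?thesis using n[of t] mult_right_mono[of 1 "exp (pi * \<bar>\<nu>\<bar>)" "t powr (- 1/2)"] by (simp add: tpow_def)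
  next
    case 2
    have "cmod (exp (complex_of_real (e * pi) * \<i> * (- 1/2 - \<i> * of_real \<nu>))) = exp (e * pi * \<nu>)" by simp
    also have "\<dots> \<le> exp (pi * \<bar>\<nu>\<bar>)" using assms by (auto simp: abs_if)
    finally have "cmod (exp (complex_of_real (e * pi) * \<i> * (- 1/2 - \<i> * of_real \<nu>))) \<le> exp (pi * \<bar>\<nu>\<bar>)" .
    then show ?thesis using 2 n[of "- t"] by (simp add: tpow_def norm_mult mult_right_mono del: norm_exp_eq_Re)
  qed (simp add: tpow_def)
qed

lemma tpow_measurable [measurable]: "(\<lambda>t. tpow e t s) \<in> borel_measurable borel"
  unfolding tpow_def by measurable

lemma isCont_tpow:
  assumes "t \<noteq> 0"
  shows "isCont (\<lambda>t. tpow e t s) t"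
proof (cases "t > 0")
  case True
  have "isCont (\<lambda>t. complex_of_real t powr s) t"
    using True by (intro continuous_intros) (auto simp: complex_nonpos_Reals_iff)
  moreover have "\<forall>\<^sub>F x in nhds t. tpow e x s = complex_of_real x powr s"
    using eventually_nhds_in_open[of "{0<..}" t] True by (auto elim!: eventually_mono simp: tpow_def)
  ultimately show ?thesis by (subst isCont_cong)
next
  case False
  then have t: "t < 0" using assms by simp
  have "isCont (\<lambda>t. exp (complex_of_real (e * pi) * \<i> * s) * complex_of_real (- t) powr s) t"
    using t by (intro continuous_intros) (auto simp: complex_nonpos_Reals_iff)
  moreover have "\<forall>\<^sub>F x in nhds t. tpow e x s = exp (complex_of_real (e * pi) * \<i> * s) * complex_of_real (- x) powr s"
    using eventually_nhds_in_open[of "{..<0}" t] t by (auto elim!: eventually_mono simp: tpow_def)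
  ultimately show ?thesis by (subst isCont_cong)
qed

lemma AE_lor_angle_nonzero: "AE p in lborel. fst p \<noteq> snd p \<and> lor_angle \<alpha> p \<noteq> 0"
proof -
  define s c where "s = sin (\<alpha>/2)" and "c = cos (\<alpha>/2)"
  have sc: "s \<noteq> 0 \<or> c \<noteq> 0" using sin_zero_abs_cos_one[of "\<alpha>/2"] by (auto simp: s_def c_def)
  have meas: "{p. s - fst p * c \<noteq> (0::real) \<and> s - snd p * c \<noteq> 0} \<in> sets (borel :: (real \<times> real) measure)"
  proof -
    have "{p \<in> space (borel \<Otimes>\<^sub>M borel). s - fst p * c \<noteq> 0 \<and> s - snd p * c \<noteq> 0} \<in> sets (borel \<Otimes>\<^sub>M (borel :: real measure))"
      by measurable
    then show ?thesis unfolding borel_prod[symmetric] by (simp add: space_pair_measure)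
  qed
  have 1: "AE x in lborel. s - x * c \<noteq> 0"
    using AE_lborel_singleton[of "s / c"] sc by (auto elim!: eventually_mono simp: field_simps)
  have m1: "{p. s - fst p * c \<noteq> (0::real)} \<in> sets (borel :: (real \<times> real) measure)"
  proof -
    have "{p \<in> space (borel \<Otimes>\<^sub>M borel). s - fst p * c \<noteq> 0} \<in> sets (borel \<Otimes>\<^sub>M (borel :: real measure))"
      by measurable
    then show ?thesis unfolding borel_prod[symmetric] by (simp add: space_pair_measure)
  qed
  have m2: "{p. s - snd p * c \<noteq> (0::real)} \<in> sets (borel :: (real \<times> real) measure)"
  proof -
    have "{p \<in> space (borel \<Otimes>\<^sub>M borel). s - snd p * c \<noteq> 0} \<in> sets (borel \<Otimes>\<^sub>M (borel :: real measure))"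
      by measurable
    then show ?thesis unfolding borel_prod[symmetric] by (simp add: space_pair_measure)
  qed
  have A2: "AE p :: real \<times> real in lborel. s - snd p * c \<noteq> 0"
    by (rule AE_lborel_pair[where P="\<lambda>x y. s - y * c \<noteq> 0"]) (use m2 1 in auto)
  have A1: "AE p :: real \<times> real in lborel. s - fst p * c \<noteq> 0"
    unfolding lborel_prod[symmetric]
  proof (rule lborel_pair.AE_pair_measure)
    show "{p \<in> space (lborel \<Otimes>\<^sub>M lborel). s - fst p * c \<noteq> 0} \<in> sets (lborel \<Otimes>\<^sub>M (lborel :: real measure))"
      using m1 unfolding borel_prod[symmetric] by (simp add: space_pair_measure)
    show "AE x in lborel. AE y in (lborel :: real measure). s - fst (x, y) * c \<noteq> 0"
      using 1 by eventually_elim simp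
  qed
  show ?thesis
    using A1 A2 AE_sheets
  proof eventually_elim
    case (elim p)
    then show ?case by (simp add: lor_angle_eq s_def c_def)
  qed
qed

text \<open>\<open>fw\<close> models f(x) / (\<lambda> - \<mu>)^2, the boundary value together with
  the density of d\<sigma>. The bound is the regularity bound on f / (\<lambda> - \<mu>), divided
  once more by |\<lambda> - \<mu>|.\<close>

locale boundary_density =
  fixes fw :: "real \<times> real \<Rightarrow> complex" and c :: real
  assumes fw_measurable [measurable]: "fw \<in> borel_measurable borel" and c_nonneg: "c \<ge> 0"
    and fw_bound: "AE p in lborel. cmod (fw p) \<le> c * (1 / (\<bar>fst p - snd p\<bar> * ((1 + \<bar>fst p\<bar>) * (1 + \<bar>snd p\<bar>))))"
begin

lemma kernel_fw_bound:
  "AE p in lborel. \<bar>lor_angle \<alpha> p\<bar> powr (- 1/2) * cmod (fw p) \<le> c * (cayley_weight p * chord_product (cos (\<alpha>/2)) (sin (\<alpha>/2)) p powr (- 1/2))"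
  using fw_bound AE_sheets
proof eventually_elim
  case (elim p)
  have "\<bar>lor_angle \<alpha> p\<bar> powr (- 1/2) * cmod (fw p) \<le> \<bar>lor_angle \<alpha> p\<bar> powr (- 1/2) * (c * (1 / (\<bar>fst p - snd p\<bar> * ((1 + \<bar>fst p\<bar>) * (1 + \<bar>snd p\<bar>)))))"
    using elim(1) by (rule mult_left_mono) simp
  also have "\<dots> = c * (\<bar>lor_angle \<alpha> p\<bar> powr (- 1/2) * (1 / (\<bar>fst p - snd p\<bar> * ((1 + \<bar>fst p\<bar>) * (1 + \<bar>snd p\<bar>)))))"
    by (rule mult.left_commute)
  also have "\<dots> \<le> c * (cayley_weight p * chord_product (cos (\<alpha>/2)) (sin (\<alpha>/2)) p powr (- 1/2))"
    using elim(2) by (intro mult_left_mono lor_angle_kernel_bound c_nonneg) auto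
  finally show ?case .
qed

lemma kernel_fw_integrable_uniform:
  obtains K where "\<And>\<alpha>. integrable lborel (\<lambda>p. \<bar>lor_angle \<alpha> p\<bar> powr (- 1/2) * cmod (fw p))"
    "\<And>\<alpha>. (\<integral>p. \<bar>lor_angle \<alpha> p\<bar> powr (- 1/2) * cmod (fw p) \<partial>lborel) \<le> K"
proof -
  obtain K where K: "K \<ge> 0"
    "\<And>c s. c\<^sup>2 + s\<^sup>2 = 1 \<Longrightarrow> integrable lborel (\<lambda>p. cayley_weight p * chord_product c s p powr (- 3/5))"
    "\<And>c s. c\<^sup>2 + s\<^sup>2 = 1 \<Longrightarrow> (\<integral>p. cayley_weight p * chord_product c s p powr (- 3/5) \<partial>lborel) \<le> K"
    using chord_product_powr_integral_bound by blast
  have cs: "(cos (\<alpha>/2))\<^sup>2 + (sin (\<alpha>/2))\<^sup>2 = 1" for \<alpha> :: real by simp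
  have cp: "chord_product c s p \<ge> 0" for c s p by (simp add: chord_product_def)
  \<comment> \<open>Trades the order 1/2 for 3/5, so that the uniform bound already proved for
    \<open>chord_product\<close> applies.\<close>
  have le: "x powr (- 1/2) \<le> 1 + x powr (- 3/5)" if "x \<ge> 0" for x :: real
  proof (cases "x \<ge> 1")
    case True
    then have "x powr (- 1/2) \<le> x powr 0" by (intro powr_mono) auto
    then show ?thesis using True by (simp add: add_increasing2)
  next
    case False
    then have "x powr (- 1/2) \<le> x powr (- 3/5)" using that by (intro powr_mono') auto
    then show ?thesis by simp
  qed
  let ?G = "\<lambda>\<alpha> p. c * (cayley_weight p + cayley_weight p * chord_product (cos (\<alpha>/2)) (sin (\<alpha>/2)) p powr (- 3/5))"
  have Gi: "integrable lborel (?G \<alpha>)" for \<alpha>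
    using integrable_cayley_weight K(2)[OF cs] by (intro integrable_mult_right Bochner_Integration.integrable_add)
  have b: "AE p in lborel. \<bar>lor_angle \<alpha> p\<bar> powr (- 1/2) * cmod (fw p) \<le> ?G \<alpha> p" for \<alpha>
    using kernel_fw_bound[of \<alpha>]
  proof eventually_elim
    case (elim p)
    have "cayley_weight p * chord_product (cos (\<alpha>/2)) (sin (\<alpha>/2)) p powr (- 1/2) \<le> cayley_weight p * (1 + chord_product (cos (\<alpha>/2)) (sin (\<alpha>/2)) p powr (- 3/5))"
      using cayley_weight_pos[of p] by (intro mult_left_mono le cp) auto
    then have "c * (cayley_weight p * chord_product (cos (\<alpha>/2)) (sin (\<alpha>/2)) p powr (- 1/2)) \<le> ?G \<alpha> p"
      using c_nonneg by (intro mult_left_mono) (simp_all add: ring_distribs)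
    with elim show ?case by linarith
  qed
  have i: "integrable lborel (\<lambda>p. \<bar>lor_angle \<alpha> p\<bar> powr (- 1/2) * cmod (fw p))" for \<alpha>
  proof (rule Bochner_Integration.integrable_bound[OF Gi[of \<alpha>]])
    show "AE p in lborel. norm (\<bar>lor_angle \<alpha> p\<bar> powr (- 1/2) * cmod (fw p)) \<le> norm (?G \<alpha> p)"
      using b[of \<alpha>]
    proof eventually_elim
      case (elim p)
      have "\<bar>\<bar>lor_angle \<alpha> p\<bar> powr (- 1/2) * cmod (fw p)\<bar> = \<bar>lor_angle \<alpha> p\<bar> powr (- 1/2) * cmod (fw p)"
        by (simp add: abs_mult)
      then show ?case unfolding real_norm_def using elim abs_ge_self[of "?G \<alpha> p"] by linarith
    qed
  qed measurable
  show ?thesis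
  proof (rule that[OF i])
    fix \<alpha>
    have "(\<integral>p. \<bar>lor_angle \<alpha> p\<bar> powr (- 1/2) * cmod (fw p) \<partial>lborel) \<le> (\<integral>p. ?G \<alpha> p \<partial>lborel)"
      by (rule integral_mono_AE[OF i Gi b])
    also have "\<dots> = c * ((\<integral>p. cayley_weight p \<partial>lborel) + (\<integral>p. cayley_weight p * chord_product (cos (\<alpha>/2)) (sin (\<alpha>/2)) p powr (- 3/5) \<partial>lborel))"
      using integrable_cayley_weight K(2)[OF cs] by simp
    also have "\<dots> \<le> c * ((\<integral>p. cayley_weight p \<partial>lborel) + K)"
      using K(3)[OF cs] c_nonneg by (intro mult_left_mono add_left_mono) auto
    finally show "(\<integral>p. \<bar>lor_angle \<alpha> p\<bar> powr (- 1/2) * cmod (fw p) \<partial>lborel) \<le> c * ((\<integral>p. cayley_weight p \<partial>lborel) + K)" .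
  qed
qed

lemma tpow_fw_integrable:
  assumes "e \<in> {1, -1}"
  shows "integrable lborel (\<lambda>p. tpow e (lor_angle \<alpha> p) (- 1/2 - \<i> * of_real \<nu>) * fw p)"
proof -
  obtain K where K: "\<And>\<alpha>. integrable lborel (\<lambda>p. \<bar>lor_angle \<alpha> p\<bar> powr (- 1/2) * cmod (fw p))"
    using kernel_fw_integrable_uniform by blast
  show ?thesis
  proof (rule Bochner_Integration.integrable_bound[OF integrable_mult_right[OF K[of \<alpha>], of "exp (pi * \<bar>\<nu>\<bar>)"]])
    show "AE p in lborel. norm (tpow e (lor_angle \<alpha> p) (- 1/2 - \<i> * of_real \<nu>) * fw p) \<le> norm (exp (pi * \<bar>\<nu>\<bar>) * (\<bar>lor_angle \<alpha> p\<bar> powr (- 1/2) * cmod (fw p)))"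
      using mult_right_mono[OF norm_tpow_le[OF assms] norm_ge_zero] by (intro AE_I2) (simp add: norm_mult abs_mult mult.assoc)
    have [measurable]: "(\<lambda>p. tpow e (lor_angle \<alpha> p) (- 1/2 - \<i> * of_real \<nu>)) \<in> borel_measurable borel"
      by (rule measurable_compose[OF lor_angle_measurable tpow_measurable])
    show "(\<lambda>p. tpow e (lor_angle \<alpha> p) (- 1/2 - \<i> * of_real \<nu>) * fw p) \<in> borel_measurable lborel" by simp
  qed
qed

text \<open>The singular lines of the pairing move with \<alpha>, so a fixed majorant is not at
  hand. Instead the integrand divided by \<open>cayley_weight\<close> has moments of order 6/5
  bounded uniformly in \<alpha>, since 6/5 * 1/2 = 3/5, and pointwise convergence holds off the zero
  set of the limiting pairing.\<close>

lemma tpow_fw_continuous: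
  assumes e: "e \<in> {1, -1}"
  shows "continuous_on UNIV (\<lambda>\<alpha>. \<integral>p. tpow e (lor_angle \<alpha> p) (- 1/2 - \<i> * of_real \<nu>) * fw p \<partial>lborel)"
proof -
  define s where "s = - 1/2 - \<i> * complex_of_real \<nu>"
  obtain K where K: "K \<ge> 0"
    "\<And>c s. c\<^sup>2 + s\<^sup>2 = 1 \<Longrightarrow> integrable lborel (\<lambda>p. cayley_weight p * chord_product c s p powr (- 3/5))"
    "\<And>c s. c\<^sup>2 + s\<^sup>2 = 1 \<Longrightarrow> (\<integral>p. cayley_weight p * chord_product c s p powr (- 3/5) \<partial>lborel) \<le> K"
    using chord_product_powr_integral_bound by blast
  have cs: "(cos (\<alpha>/2))\<^sup>2 + (sin (\<alpha>/2))\<^sup>2 = 1" for \<alpha> :: real by simp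
  define \<Theta> where "\<Theta> = (\<lambda>\<alpha> p. of_real (1 / cayley_weight p) * (tpow e (lor_angle \<alpha> p) s * fw p))"
  define C where "C = exp (pi * \<bar>\<nu>\<bar>) * c"
  have C0: "C \<ge> 0" using c_nonneg by (simp add: C_def)
  have [measurable]: "(\<lambda>p. tpow e (lor_angle \<alpha> p) s) \<in> borel_measurable borel" for \<alpha>
    by (rule measurable_compose[OF lor_angle_measurable tpow_measurable])
  have wm [measurable]: "cayley_weight \<in> borel_measurable borel" using borel_measurable_integrable[OF integrable_cayley_weight] by simp
  have \<Theta>m [measurable]: "\<Theta> \<alpha> \<in> borel_measurable borel" for \<alpha> unfolding \<Theta>_def by measurable
  have \<Theta>m': "\<Theta> \<alpha> \<in> borel_measurable lborel" for \<alpha> by simp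
  have w\<Theta>: "cayley_weight p *\<^sub>R \<Theta> \<alpha> p = tpow e (lor_angle \<alpha> p) s * fw p" for \<alpha> p
    using cayley_weight_pos[of p] by (simp add: \<Theta>_def scaleR_conv_of_real)
  have \<Theta>b: "AE p in lborel. cmod (\<Theta> \<alpha> p) \<le> C * chord_product (cos (\<alpha>/2)) (sin (\<alpha>/2)) p powr (- 1/2)" for \<alpha>
    using kernel_fw_bound[of \<alpha>]
  proof eventually_elim
    case (elim p)
    have "cayley_weight p * cmod (\<Theta> \<alpha> p) = cmod (tpow e (lor_angle \<alpha> p) s) * cmod (fw p)"
      using w\<Theta>[of p \<alpha>] cayley_weight_pos[of p] by (metis abs_of_pos norm_mult norm_scaleR)
    also have "\<dots> \<le> exp (pi * \<bar>\<nu>\<bar>) * \<bar>lor_angle \<alpha> p\<bar> powr (- 1/2) * cmod (fw p)"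
      unfolding s_def by (intro mult_right_mono norm_tpow_le e) auto
    also have "\<dots> \<le> exp (pi * \<bar>\<nu>\<bar>) * (c * (cayley_weight p * chord_product (cos (\<alpha>/2)) (sin (\<alpha>/2)) p powr (- 1/2)))"
      using elim by (simp add: mult.assoc)
    also have "\<dots> = cayley_weight p * (C * chord_product (cos (\<alpha>/2)) (sin (\<alpha>/2)) p powr (- 1/2))"
      by (simp add: C_def)
    finally show ?case using cayley_weight_pos[of p] by simp
  qed
  have cp: "chord_product c s p \<ge> 0" for c s p by (simp add: chord_product_def)
  let ?G = "\<lambda>\<alpha> p. C powr (6/5) * (cayley_weight p * chord_product (cos (\<alpha>/2)) (sin (\<alpha>/2)) p powr (- 3/5))"
  have Gi: "integrable lborel (?G \<alpha>)" for \<alpha> by (intro integrable_mult_right K cs)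
  have \<Theta>q: "AE p in lborel. cayley_weight p * cmod (\<Theta> \<alpha> p) powr (6/5) \<le> ?G \<alpha> p" for \<alpha>
    using \<Theta>b[of \<alpha>]
  proof eventually_elim
    case (elim p)
    have "cmod (\<Theta> \<alpha> p) powr (6/5) \<le> (C * chord_product (cos (\<alpha>/2)) (sin (\<alpha>/2)) p powr (- 1/2)) powr (6/5)"
      using elim by (intro powr_mono2) auto
    also have "\<dots> = C powr (6/5) * chord_product (cos (\<alpha>/2)) (sin (\<alpha>/2)) p powr (- 3/5)"
      using C0 cp by (simp add: powr_mult powr_powr)
    finally show ?case using cayley_weight_pos[of p] by (simp add: mult.left_commute mult_left_mono)
  qed
  have wq0: "cayley_weight p * cmod (\<Theta> \<alpha> p) powr (6/5) \<ge> 0" for \<alpha> p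
    using cayley_weight_pos[of p] by simp
  have Qi: "integrable lborel (\<lambda>p. cayley_weight p * cmod (\<Theta> \<alpha> p) powr (6/5))" for \<alpha>
  proof (rule Bochner_Integration.integrable_bound[OF Gi[of \<alpha>]])
    show "AE p in lborel. norm (cayley_weight p * cmod (\<Theta> \<alpha> p) powr (6/5)) \<le> norm (?G \<alpha> p)"
      using \<Theta>q[of \<alpha>] by eventually_elim (use wq0 in \<open>simp add: abs_of_nonneg\<close>)
  qed measurable
  have QK: "(\<integral>p. cayley_weight p * cmod (\<Theta> \<alpha> p) powr (6/5) \<partial>lborel) \<le> C powr (6/5) * K" for \<alpha>
  proof -
    have "(\<integral>p. cayley_weight p * cmod (\<Theta> \<alpha> p) powr (6/5) \<partial>lborel) \<le> (\<integral>p. ?G \<alpha> p \<partial>lborel)"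
      by (rule integral_mono_AE[OF Qi Gi \<Theta>q])
    also have "\<dots> \<le> C powr (6/5) * K"
      using K(3)[OF cs] by (subst integral_mult_right_zero) (intro mult_left_mono, auto)
    finally show ?thesis .
  qed
  have "(\<lambda>n. \<integral>p. cayley_weight p *\<^sub>R \<Theta> (\<alpha> n) p \<partial>lborel) \<longlonglongrightarrow> (\<integral>p. cayley_weight p *\<^sub>R \<Theta> \<alpha>0 p \<partial>lborel)"
    if lim: "\<alpha> \<longlonglongrightarrow> \<alpha>0" for \<alpha> \<alpha>0
  proof (rule Vitali_powr_convergence[where q="6/5" and K="C powr (6/5) * K"])
    show "AE p in lborel. (\<lambda>n. \<Theta> (\<alpha> n) p) \<longlonglongrightarrow> \<Theta> \<alpha>0 p"
      using AE_lor_angle_nonzero[of \<alpha>0]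
    proof eventually_elim
      case (elim p)
      have "(\<lambda>n. lor_angle (\<alpha> n) p) \<longlonglongrightarrow> lor_angle \<alpha>0 p"
        unfolding lor_angle_def lorR_def by (simp add: xpar_eq) (intro tendsto_intros lim; use elim in simp)
      then show ?case unfolding \<Theta>_def using elim
        by (intro tendsto_intros isCont_tendsto_compose[OF isCont_tpow]) auto
    qed
  qed ((rule less_imp_le[OF cayley_weight_pos] integrable_cayley_weight \<Theta>m' Qi QK | simp)+)
  then have L: "(\<lambda>n. \<integral>p. tpow e (lor_angle (\<alpha> n) p) s * fw p \<partial>lborel) \<longlonglongrightarrow> (\<integral>p. tpow e (lor_angle \<alpha>0 p) s * fw p \<partial>lborel)"
    if "\<alpha> \<longlonglongrightarrow> \<alpha>0" for \<alpha> \<alpha>0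
    using that unfolding w\<Theta> .
  show ?thesis
    unfolding s_def[symmetric] continuous_on_sequentially o_def
    by (intro allI ballI impI, elim conjE, rule L)
qed

end

section \<open>Pairings of tube points\<close>

text \<open>Inverting the parametrization gives l = (z2 + 1) / (z0 + z1) and m = (z2 - 1) / (z0 +
  z1). Their imaginary parts have the signs of k - Y and k + Y, so the claim comes down to |k| <
  |Y|.\<close>

lemma Ttube_parameters:
  assumes e: "e \<in> {1, -1}" and z: "z \<in> Ttube e"
  obtains l m where "(l, m) \<in> ptube e" "zpar l m = z"
proof -
  obtain z0 z1 z2 where zz: "z = (z0, z1, z2)" by (metis prod.collapse)
  obtain x0 y0 x1 y1 x2 y2 where c: "z0 = Complex x0 y0" "z1 = Complex x1 y1" "z2 = Complex x2 y2"
    by (metis complex.exhaust)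
  from z have z2: "z0 * z0 - z1 * z1 - z2 * z2 = -1" and y2: "y0 * y0 - y1 * y1 - y2 * y2 > 0" and ey: "e * y0 > 0"
    unfolding Ttube_def Xc_def Vcone_def zz c by (auto simp: lorC_def lorR_def im3_def)
  define X p Y q where "X = x0 + x1" and "p = x0 - x1" and "Y = y0 + y1" and "q = y0 - y1"
  have re: "X * p - x2 * x2 - (Y * q - y2 * y2) = -1"
    using z2 by (simp add: c complex_eq_iff X_def p_def Y_def q_def algebra_simps)
  have im: "X * q + p * Y = 2 * x2 * y2"
    using z2 by (simp add: c complex_eq_iff X_def p_def Y_def q_def algebra_simps)
  have yq: "y2 * y2 < Y * q" using y2 by (simp add: Y_def q_def algebra_simps)
  have "\<bar>y1\<bar> < \<bar>y0\<bar>"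
  proof (rule power2_less_imp_less)
    have "0 \<le> y2 * y2" by (rule zero_le_square)
    then have "y1 * y1 < y0 * y0" using y2 by linarith
    then show "\<bar>y1\<bar>\<^sup>2 < \<bar>y0\<bar>\<^sup>2" by (simp add: power2_eq_square)
  qed simp
  then have Yp: "e * Y > 0" using e ey by (auto simp: Y_def)
  define k where "k = y2 * X - x2 * Y"
  \<comment> \<open>Follows from the two real equations of the quadric; the subtracted product is
    positive because Im z is timelike.\<close>
  have "k * k = Y * Y - (Y * q - y2 * y2) * (X * X + Y * Y)"
  proof -
    have "k * k - (Y * Y - (Y * q - y2 * y2) * (X * X + Y * Y)) =
        Y * Y * ((X * p - x2 * x2 - (Y * q - y2 * y2)) * (-1) - 1) + X * Y * (X * q + p * Y - 2 * x2 * y2)"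
      by (simp add: k_def algebra_simps)
    then show ?thesis by (simp add: re im)
  qed
  moreover have "(Y * q - y2 * y2) * (X * X + Y * Y) > 0"
  proof (rule mult_pos_pos)
    show "X * X + Y * Y > 0" using Yp by (auto simp: sum_squares_gt_zero_iff)
  qed (use yq in simp)
  ultimately have "\<bar>k\<bar>\<^sup>2 < \<bar>Y\<bar>\<^sup>2" by (simp add: power2_eq_square)
  then have kY: "\<bar>k\<bar> < \<bar>Y\<bar>" by (rule power2_less_imp_less) simp
  define D where "D = z0 + z1"
  have D: "D = Complex X Y" by (simp add: D_def c X_def Y_def complex_eq_iff)
  have D0: "D \<noteq> 0" using Yp by (auto simp: D complex_eq_iff)
  have nD: "X\<^sup>2 + Y\<^sup>2 > 0" using Yp by (auto simp: sum_power2_gt_zero_iff)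
  have "Im ((z2 + 1) / D) = (k - Y) / (X\<^sup>2 + Y\<^sup>2)" "Im ((z2 - 1) / D) = (k + Y) / (X\<^sup>2 + Y\<^sup>2)"
    unfolding Im_divide by (simp_all add: D c k_def algebra_simps)
  moreover have "- e * (k - Y) > 0" "e * (k + Y) > 0" using e kY Yp by (auto simp: abs_if split: if_splits)
  ultimately have "((z2 + 1) / D, (z2 - 1) / D) \<in> ptube e"
    unfolding ptube_def using nD e by (auto simp: divide_neg_pos divide_pos_pos)
  moreover have "zpar ((z2 + 1) / D) ((z2 - 1) / D) = z"
  proof -
    have d: "(z2 + 1) / D - (z2 - 1) / D = 2 / D" by (simp add: diff_divide_distrib[symmetric])
    have pr: "(z2 + 1) / D * ((z2 - 1) / D) = (z0 - z1) / D"
    proof -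
      have "(z2 + 1) * (z2 - 1) = (z0 - z1) * D" using z2 by (simp add: D_def algebra_simps)
      then have "(z2 + 1) / D * ((z2 - 1) / D) = (z0 - z1) * D / (D * D)" by simp
      then show ?thesis using D0 by simp
    qed
    have s: "(z2 + 1) / D + (z2 - 1) / D = 2 * z2 / D" by (simp add: add_divide_distrib[symmetric])
    have "(1 + (z0 - z1) / D) / (2 / D) = (D + (z0 - z1)) / 2" "(1 - (z0 - z1) / D) / (2 / D) = (D - (z0 - z1)) / 2"
      using D0 by (simp_all add: field_simps)
    then show ?thesis unfolding zpar_def d pr s zz using D0 by (simp add: D_def)
  qed
  ultimately show ?thesis by (rule that)
qed

text \<open>On the quadric 1 + [z.x] = -(z - x)^2 / 2, which vanishes when z and x lie on a common
  null line, that is when their first or their second parameters agree; hence the product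
  form.\<close>

lemma lorC_zpar_xpar:
  assumes "l \<noteq> m" "fst p \<noteq> snd p"
  shows "1 + lorC (zpar l m) (cplx3 (xpar p)) = 2 * (of_real (fst p) - l) * (of_real (snd p) - m) / ((l - m) * of_real (fst p - snd p))"
proof -
  define u v where "u = complex_of_real (fst p)" and "v = complex_of_real (snd p)"
  have ne: "l - m \<noteq> 0" "u - v \<noteq> 0" using assms by (auto simp: u_def v_def)
  have "lorC (zpar l m) (cplx3 (xpar p)) = ((1 + l * m) * (1 + u * v) - (1 - l * m) * (1 - u * v) - (l + m) * (u + v)) / ((l - m) * (u - v))"
    unfolding zpar_def xpar_eq cplx3_def lorC_def prod.case of_real_divide times_divide_times_eq
    by (simp add: u_def v_def diff_divide_distrib[symmetric])
  then have "1 + lorC (zpar l m) (cplx3 (xpar p)) = ((l - m) * (u - v) + ((1 + l * m) * (1 + u * v) - (1 - l * m) * (1 - u * v) - (l + m) * (u + v))) / ((l - m) * (u - v))"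
    using ne by (simp add: add_divide_distrib)
  also have "(l - m) * (u - v) + ((1 + l * m) * (1 + u * v) - (1 - l * m) * (1 - u * v) - (l + m) * (u + v)) = 2 * (u - l) * (v - m)"
    by (simp add: algebra_simps)
  finally show ?thesis by (simp add: u_def v_def)
qed

lemma Vcone_pairing_pos:
  assumes "y \<in> Vcone 1"
  shows "fst y - fst (snd y) * cos \<alpha> - snd (snd y) * sin \<alpha> > 0"
proof -
  obtain a b c where y: "y = (a, b, c)" by (metis prod.collapse)
  have a: "a > 0" "b\<^sup>2 + c\<^sup>2 < a\<^sup>2" using assms by (auto simp: y Vcone_def lorR_def power2_eq_square)
  have "(b * cos \<alpha> + c * sin \<alpha>)\<^sup>2 + (b * sin \<alpha> - c * cos \<alpha>)\<^sup>2 = (b\<^sup>2 + c\<^sup>2) * ((cos \<alpha>)\<^sup>2 + (sin \<alpha>)\<^sup>2)"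
    by (simp only: power2_eq_square) (simp only: algebra_simps)
  then have "(b * cos \<alpha> + c * sin \<alpha>)\<^sup>2 \<le> b\<^sup>2 + c\<^sup>2"
    using zero_le_power2[of "b * sin \<alpha> - c * cos \<alpha>"] unfolding sin_cos_squared_add2 mult_1_right by linarith
  also note a(2)
  finally have "b * cos \<alpha> + c * sin \<alpha> < a" using a(1) by (intro power2_less_imp_less[of _ a]) simp_all
  then show ?thesis by (simp add: y)
qed

text \<open>Cauchy-Schwarz for the spatial parts: a vector orthogonal to a timelike one cannot be
  timelike.\<close>

lemma Vcone_orthogonal:
  assumes a: "lorR a a > 0" and "lorR a b = 0"
  shows "lorR b b \<le> 0"
proof -
  obtain a0 a1 a2 b0 b1 b2 where ab: "a = (a0, a1, a2)" "b = (b0, b1, b2)" by (metis prod.collapse)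
  have a: "a1\<^sup>2 + a2\<^sup>2 < a0\<^sup>2" using a by (simp add: ab lorR_def power2_eq_square)
  have o: "a0 * b0 = a1 * b1 + a2 * b2" using assms(2) by (simp add: ab lorR_def)
  have "(a1 * b1 + a2 * b2)\<^sup>2 + (a1 * b2 - a2 * b1)\<^sup>2 = (a1\<^sup>2 + a2\<^sup>2) * (b1\<^sup>2 + b2\<^sup>2)"
    by (simp add: power2_eq_square algebra_simps)
  then have "(a0 * b0)\<^sup>2 \<le> (a1\<^sup>2 + a2\<^sup>2) * (b1\<^sup>2 + b2\<^sup>2)"
    unfolding o using zero_le_power2[of "a1 * b2 - a2 * b1"] by linarith
  also have "\<dots> \<le> a0\<^sup>2 * (b1\<^sup>2 + b2\<^sup>2)" using a by (intro mult_right_mono) auto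
  finally have "a0\<^sup>2 * b0\<^sup>2 \<le> a0\<^sup>2 * (b1\<^sup>2 + b2\<^sup>2)" by (simp add: power_mult_distrib)
  moreover have "a0\<^sup>2 > 0" using a by (smt (verit) zero_le_power2)
  ultimately have "b0\<^sup>2 \<le> b1\<^sup>2 + b2\<^sup>2" by (simp add: mult_le_cancel_left_pos)
  then show ?thesis by (simp add: ab lorR_def power2_eq_square)
qed

text \<open>If the square is real, the real and imaginary parts of Y are orthogonal; the imaginary
  part is then not timelike, so the square is at least that of the real part, which is
  positive.\<close>

lemma lorC_square_Re_cone:
  assumes "re3 Y \<in> Vcone 1"
  shows "lorC Y Y \<notin> \<real>\<^sub>\<le>\<^sub>0"
proof
  assume n: "lorC Y Y \<in> \<real>\<^sub>\<le>\<^sub>0"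
  have re: "Re (lorC Y Y) = lorR (re3 Y) (re3 Y) - lorR (im3 Y) (im3 Y)"
    and im: "Im (lorC Y Y) = 2 * lorR (re3 Y) (im3 Y)"
    by (auto simp: lorC_def lorR_def re3_def im3_def split: prod.splits)
  have p: "lorR (re3 Y) (re3 Y) > 0" using assms by (simp add: Vcone_def)
  have "lorR (re3 Y) (im3 Y) = 0" using n im by (simp add: complex_nonpos_Reals_iff)
  from Vcone_orthogonal[OF p this] show False using n re p by (simp add: complex_nonpos_Reals_iff)
qed

text \<open>Multiplication by i e is a quarter turn h with Ln \<zeta> = Ln A - h, and no branch cut
  is crossed as Re A > 0. For the real factor, the phase that \<open>tpow\<close> carries at
  negative L is exactly twice the quarter turn, so both signs of L lead to the same correction
  exp(-s' h). At L = 0 both sides are 0 by convention.\<close>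

lemma powr_rotated_product:
  fixes \<zeta> :: complex and L :: real
  assumes e: "e \<in> {1, -1}" and \<zeta>: "Re (\<i> * of_real e * \<zeta>) > 0"
  shows "of_real (exp (- e * pi * \<nu>)) * (\<zeta> powr (- 1/2 + \<i> * of_real \<nu>) * tpow e L (- 1/2 - \<i> * of_real \<nu>)) =
    (\<i> * of_real e * \<zeta>) powr (- 1/2 + \<i> * of_real \<nu>) * (- \<i> * of_real e * of_real L) powr (- 1/2 - \<i> * of_real \<nu>)"
proof (cases "L = 0")
  case False
  define s s' where "s = - 1/2 + \<i> * complex_of_real \<nu>" and "s' = - 1/2 - \<i> * complex_of_real \<nu>"
  have pi2: "- (pi / 2) \<le> pi" using pi_gt_zero by linarith
  define h where "h = complex_of_real (e * pi / 2) * \<i>"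
  have eh: "exp h = \<i> * of_real e" "exp (- h) = - \<i> * of_real e"
    using e by (auto simp: h_def exp_eq_polar cis_def complex_eq_iff exp_minus)
  define A where "A = \<i> * of_real e * \<zeta>"
  have A0: "A \<noteq> 0" using \<zeta> by (auto simp: A_def)
  have imA: "\<bar>Im (Ln A)\<bar> < pi / 2" using \<zeta> Re_Ln_pos_lt[OF A0] by (simp add: A_def)
  have z0: "\<zeta> \<noteq> 0" using A0 by (auto simp: A_def)
  have LA: "Ln \<zeta> = Ln A - h"
  proof (rule Ln_unique)
    show "exp (Ln A - h) = \<zeta>" using e A0 by (auto simp: exp_diff eh A_def)
    show "- pi < Im (Ln A - h)" "Im (Ln A - h) \<le> pi" using imA e by (auto simp: h_def)
  qed
  have 1: "\<zeta> powr s = A powr s * exp (- (s * h))"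
    using A0 z0 by (simp add: powr_def LA right_diff_distrib exp_diff exp_minus field_simps)
  have 2: "(- \<i> * of_real e * of_real L) powr s' = tpow e L s' * exp (- (s' * h))"
  proof (cases "L > 0")
    case True
    have "Ln (- \<i> * of_real e * of_real L) = of_real (ln L) - h"
    proof (rule Ln_unique)
      show "exp (of_real (ln L) - h) = - \<i> * of_real e * of_real L"
        using True e by (auto simp: exp_diff eh exp_of_real)
      show "- pi < Im (of_real (ln L) - h)" "Im (of_real (ln L) - h) \<le> pi" using e pi2 by (auto simp: h_def)
    qed
    then have "(- \<i> * of_real e * of_real L) powr s' = exp (s' * of_real (ln L) - s' * h)"
      using True e by (auto simp: powr_def right_diff_distrib)
    moreover have "tpow e L s' = exp (s' * of_real (ln L))"
      using True by (simp add: tpow_def powr_def Ln_of_real)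
    ultimately show ?thesis by (simp add: exp_diff exp_minus divide_inverse)
  next
    case L: False
    then have L: "L < 0" using \<open>L \<noteq> 0\<close> by simp
    have "Ln (- \<i> * of_real e * of_real L) = of_real (ln (- L)) + h"
    proof (rule Ln_unique)
      show "exp (of_real (ln (- L)) + h) = - \<i> * of_real e * of_real L"
        using L e by (auto simp: exp_add eh exp_of_real)
      show "- pi < Im (of_real (ln (- L)) + h)" "Im (of_real (ln (- L)) + h) \<le> pi" using e pi2 by (auto simp: h_def)
    qed
    then have "(- \<i> * of_real e * of_real L) powr s' = exp (s' * of_real (ln (- L)) + s' * h)"
      using L e by (auto simp: powr_def algebra_simps)
    moreover have "tpow e L s' = exp (2 * (s' * h)) * exp (s' * of_real (ln (- L)))"
      using L Ln_of_real[of "- L"] by (simp add: tpow_def powr_def h_def mult_ac)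
    ultimately show ?thesis by (simp add: exp_add[symmetric] mult.commute add.commute)
  qed
  have "- (s * h) - s' * h = h" by (simp add: s_def s'_def algebra_simps)
  \<comment> \<open>s' h exceeds s h by e pi \<nu>; this is where the factor exp(-e pi \<nu>) comes
    from.\<close>
  have 3: "exp (- (s' * h)) = of_real (exp (- e * pi * \<nu>)) * exp (- (s * h))"
  proof -
    have "- (s' * h) = of_real (- e * pi * \<nu>) + - (s * h)"
      by (simp add: s_def s'_def h_def complex_eq_iff)
    then show ?thesis by (simp only: exp_add exp_of_real)
  qed
  have "of_real (exp (- e * pi * \<nu>)) * (\<zeta> powr s * tpow e L s') = A powr s * (tpow e L s' * exp (- (s' * h)))"
    unfolding 1 3 by (simp add: mult_ac)
  then show ?thesis unfolding A_def 2[symmetric] by (simp only: s_def s'_def)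
qed (simp add: tpow_def)

text \<open>For fixed \<nu> the inner two integrals are exchanged, then \<nu> and p with t already
  integrated out; the product majorant serves both exchanges.\<close>

lemma triple_Fubini_dominated:
  fixes h :: "real \<times> 'a \<times> 'b \<Rightarrow> complex" and k :: "'a \<Rightarrow> 'b \<Rightarrow> real"
  assumes T: "sigma_finite_measure T" and P: "sigma_finite_measure P"
    and h [measurable]: "h \<in> borel_measurable (lborel \<Otimes>\<^sub>M (T \<Otimes>\<^sub>M P))"
    and k: "integrable (T \<Otimes>\<^sub>M P) (\<lambda>(t, p). k t p)" and \<phi>: "integrable lborel \<phi>"
    and bound: "\<And>\<nu> t p. cmod (h (\<nu>, t, p)) \<le> \<phi> \<nu> * k t p"
  shows "(\<integral>\<nu>. \<integral>t. \<integral>p. h (\<nu>, t, p) \<partial>P \<partial>T \<partial>lborel) = (\<integral>p. \<integral>\<nu>. \<integral>t. h (\<nu>, t, p) \<partial>T \<partial>lborel \<partial>P)"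
proof -
  interpret T: sigma_finite_measure T by fact
  interpret P: sigma_finite_measure P by fact
  interpret TP: pair_sigma_finite T P ..
  interpret LP: pair_sigma_finite lborel P ..
  have [measurable]: "(\<lambda>(t, p). k t p) \<in> borel_measurable (T \<Otimes>\<^sub>M P)" "\<phi> \<in> borel_measurable lborel"
    using k \<phi> by (auto simp: borel_measurable_integrable)
  have slice: "integrable (T \<Otimes>\<^sub>M P) (\<lambda>(t, p). h (\<nu>, t, p))" for \<nu>
  proof (rule Bochner_Integration.integrable_bound[OF integrable_mult_right[OF k, of "\<phi> \<nu>"]])
    show "AE x in T \<Otimes>\<^sub>M P. norm (case x of (t, p) \<Rightarrow> h (\<nu>, t, p)) \<le> norm (\<phi> \<nu> * (case x of (t, p) \<Rightarrow> k t p))"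
      using bound by (intro AE_I2) (auto intro: order_trans[OF _ abs_ge_self])
  qed (use measurable_compose[OF measurable_Pair1' h, of \<nu>] in \<open>simp add: case_prod_unfold\<close>)
  have "(\<integral>t. \<integral>p. h (\<nu>, t, p) \<partial>P \<partial>T) = (\<integral>p. \<integral>t. h (\<nu>, t, p) \<partial>T \<partial>P)" for \<nu>
    using TP.Fubini_integral[OF slice[of \<nu>]] by simp
  moreover have "integrable (lborel \<Otimes>\<^sub>M P) (\<lambda>(\<nu>, p). \<integral>t. h (\<nu>, t, p) \<partial>T)"
  proof (rule LP.Fubini_integrable)
    show meas [measurable]: "(\<lambda>(\<nu>, p). \<integral>t. h (\<nu>, t, p) \<partial>T) \<in> borel_measurable (lborel \<Otimes>\<^sub>M P)"
      by measurable
    have Hi: "integrable P (\<lambda>p. \<integral>t. h (\<nu>, t, p) \<partial>T)" for \<nu>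
      using TP.integrable_snd[OF slice[of \<nu>]] by simp
    then show "AE \<nu> in lborel. integrable P (\<lambda>p. case (\<nu>, p) of (\<nu>, p) \<Rightarrow> \<integral>t. h (\<nu>, t, p) \<partial>T)"
      by simp
    have kP: "integrable P (\<lambda>p. \<integral>t. k t p \<partial>T)" by (rule TP.integrable_snd[OF k])
    have le: "(\<integral>p. cmod (\<integral>t. h (\<nu>, t, p) \<partial>T) \<partial>P) \<le> \<phi> \<nu> * (\<integral>p. \<integral>t. k t p \<partial>T \<partial>P)" for \<nu>
    proof -
      have "(\<integral>p. cmod (\<integral>t. h (\<nu>, t, p) \<partial>T) \<partial>P) \<le> (\<integral>p. \<phi> \<nu> * (\<integral>t. k t p \<partial>T) \<partial>P)"
      proof (rule integral_mono_AE)
        show "AE p in P. cmod (\<integral>t. h (\<nu>, t, p) \<partial>T) \<le> \<phi> \<nu> * (\<integral>t. k t p \<partial>T)"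
          using TP.AE_integrable_snd[OF k] TP.AE_integrable_snd[OF slice[of \<nu>]]
        proof eventually_elim
          case (elim p)
          have "cmod (\<integral>t. h (\<nu>, t, p) \<partial>T) \<le> (\<integral>t. cmod (h (\<nu>, t, p)) \<partial>T)" by simp
          also have "\<dots> \<le> (\<integral>t. \<phi> \<nu> * k t p \<partial>T)"
            using elim by (intro integral_mono integrable_norm integrable_mult_right bound) auto
          finally show ?case by simp
        qed
      qed (use Hi kP in auto)
      then show ?thesis by simp
    qed
    have 0: "(\<integral>p. cmod (\<integral>t. h (\<nu>, t, p) \<partial>T) \<partial>P) \<ge> 0" for \<nu> by simp
    show "integrable lborel (\<lambda>\<nu>. \<integral>p. norm (case (\<nu>, p) of (\<nu>, p) \<Rightarrow> \<integral>t. h (\<nu>, t, p) \<partial>T) \<partial>P)"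
    proof (rule Bochner_Integration.integrable_bound[OF integrable_mult_left[OF \<phi>]])
      show "AE \<nu> in lborel. norm (\<integral>p. norm (case (\<nu>, p) of (\<nu>, p) \<Rightarrow> \<integral>t. h (\<nu>, t, p) \<partial>T) \<partial>P) \<le> norm (\<phi> \<nu> * (\<integral>p. \<integral>t. k t p \<partial>T \<partial>P))"
        using le 0 by (intro AE_I2) (auto intro: order_trans[OF _ abs_ge_self])
      show "(\<lambda>\<nu>. \<integral>p. norm (case (\<nu>, p) of (\<nu>, p) \<Rightarrow> \<integral>t. h (\<nu>, t, p) \<partial>T) \<partial>P) \<in> borel_measurable lborel"
        by measurable
    qed
  qed
  ultimately show ?thesis by (simp add: LP.Fubini_integral)
qed

text \<open>The directions form a compact circle on which the rotated pairing has positive real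
  part, so the modulus of its argument has a maximum below pi/2. Adding the pi/2 contributed by an
  imaginary second factor still leaves \<open>b\<close> below pi.\<close>

lemma tube_pairing_bounds:
  assumes e: "e \<in> {1, -1}" and z: "z \<in> Ttube (- e)"
  obtains b C where "b < pi" "\<And>\<alpha>. Re (\<i> * of_real e * lorC z (cplx3 (1, cos \<alpha>, sin \<alpha>))) > 0"
    "\<And>\<alpha>. \<bar>Im (Ln (\<i> * of_real e * lorC z (cplx3 (1, cos \<alpha>, sin \<alpha>))))\<bar> + pi / 2 \<le> b"
    "\<And>\<alpha>. cmod (\<i> * of_real e * lorC z (cplx3 (1, cos \<alpha>, sin \<alpha>))) powr (- 1/2) \<le> C"
    "continuous_on UNIV (\<lambda>\<alpha>. Ln (\<i> * of_real e * lorC z (cplx3 (1, cos \<alpha>, sin \<alpha>))))"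
proof -
  obtain z0 z1 z2 where zz: "z = (z0, z1, z2)" by (metis prod.collapse)
  define A where "A = (\<lambda>\<alpha>. \<i> * complex_of_real e * lorC z (cplx3 (1, cos \<alpha>, sin \<alpha>)))"
  have A_eq: "A = (\<lambda>\<alpha>. \<i> * of_real e * (z0 - z1 * of_real (cos \<alpha>) - z2 * of_real (sin \<alpha>)))"
    by (simp add: A_def zz lorC_def cplx3_def)
  have "(- e * Im z0, - e * Im z1, - e * Im z2) \<in> Vcone 1"
    using z e by (auto simp: Ttube_def Vcone_def zz im3_def lorR_def)
  then have pos: "Re (A \<alpha>) > 0" for \<alpha>
    using Vcone_pairing_pos[of "(- e * Im z0, - e * Im z1, - e * Im z2)" \<alpha>]
    by (simp add: A_eq algebra_simps)
  then have np: "A \<alpha> \<notin> \<real>\<^sub>\<le>\<^sub>0" for \<alpha> by (metis complex_nonpos_Reals_iff not_less)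
  have contA: "continuous_on UNIV A" unfolding A_eq by (intro continuous_intros)
  have contL: "continuous_on UNIV (\<lambda>\<alpha>. Ln (A \<alpha>))" using contA np by (intro continuous_intros) auto
  have A0: "A \<alpha> \<noteq> 0" for \<alpha> using pos[of \<alpha>] by auto
  have ne: "{-pi..pi} \<noteq> {}" using pi_gt_zero by simp
  have "continuous_on {-pi..pi} (\<lambda>\<alpha>. \<bar>Im (Ln (A \<alpha>))\<bar>)"
    by (intro continuous_intros continuous_on_subset[OF contL]) auto
  then obtain \<alpha>1 where \<alpha>1: "\<And>\<alpha>. \<alpha> \<in> {-pi..pi} \<Longrightarrow> \<bar>Im (Ln (A \<alpha>))\<bar> \<le> \<bar>Im (Ln (A \<alpha>1))\<bar>"
    using continuous_attains_sup[of "{-pi..pi}" "\<lambda>\<alpha>. \<bar>Im (Ln (A \<alpha>))\<bar>"] by (meson compact_Icc ne)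
  have "continuous_on {-pi..pi} (\<lambda>\<alpha>. cmod (A \<alpha>) powr (- 1/2))"
    using A0 by (intro continuous_intros continuous_on_subset[OF contA]) auto
  then obtain \<alpha>2 where \<alpha>2: "\<And>\<alpha>. \<alpha> \<in> {-pi..pi} \<Longrightarrow> cmod (A \<alpha>) powr (- 1/2) \<le> cmod (A \<alpha>2) powr (- 1/2)"
    using continuous_attains_sup[of "{-pi..pi}" "\<lambda>\<alpha>. cmod (A \<alpha>) powr (- 1/2)"] by (meson compact_Icc ne)
  have per: "\<exists>\<beta>\<in>{-pi..pi}. A \<beta> = A \<alpha>" for \<alpha>
  proof -
    obtain \<beta> where \<beta>: "- pi < \<beta>" "\<beta> \<le> pi" "sin \<beta> = sin \<alpha>" "cos \<beta> = cos \<alpha>"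
      using sincos_principal_value[of \<alpha>] by blast
    then show ?thesis by (intro bexI[of _ \<beta>]) (auto simp: A_eq)
  qed
  have A\<alpha>: "\<i> * of_real e * lorC z (cplx3 (1, cos \<alpha>, sin \<alpha>)) = A \<alpha>" for \<alpha> by (simp add: A_def)
  show ?thesis
  proof (rule that)
    show "\<bar>Im (Ln (A \<alpha>1))\<bar> + pi / 2 < pi" using pos[of \<alpha>1] Re_Ln_pos_lt[OF A0[of \<alpha>1]] by simp
    show "\<bar>Im (Ln (\<i> * of_real e * lorC z (cplx3 (1, cos \<alpha>, sin \<alpha>))))\<bar> + pi / 2 \<le> \<bar>Im (Ln (A \<alpha>1))\<bar> + pi / 2" for \<alpha>
      using per[of \<alpha>] \<alpha>1 unfolding A\<alpha> by (metis add_right_mono)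
    show "cmod (\<i> * of_real e * lorC z (cplx3 (1, cos \<alpha>, sin \<alpha>))) powr (- 1/2) \<le> cmod (A \<alpha>2) powr (- 1/2)" for \<alpha>
      using per[of \<alpha>] \<alpha>2 unfolding A\<alpha> by metis
  qed (use pos contL in \<open>simp_all only: A\<alpha>\<close>)
qed

lemma Im_Ln_imaginary:
  assumes "t \<noteq> 0" "e \<in> {1, -1::real}"
  shows "\<bar>Im (Ln (- \<i> * of_real e * of_real t))\<bar> = pi / 2"
proof -
  define B where "B = - \<i> * complex_of_real e * complex_of_real t"
  have B: "B \<noteq> 0" "Re B = 0" using assms by (auto simp: B_def)
  have "\<bar>Im (Ln B)\<bar> \<le> pi / 2" using Re_Ln_pos_le[OF B(1)] B(2) by simp
  moreover have "\<not> \<bar>Im (Ln B)\<bar> < pi / 2" using Re_Ln_pos_lt[OF B(1)] B(2) by simp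
  ultimately show ?thesis unfolding B_def by linarith
qed

text \<open>For Y = i e (u z - x) the real vector x contributes nothing to Re Y, which is -e u Im z
  and lies in the forward cone. This gives both the position of the Lorentz square off the negative
  axis and the positivity that the circle integral requires.\<close>

lemma tube_boundary_square:
  assumes e: "e \<in> {1, -1}" and z: "z \<in> Ttube (- e)" and x: "lorR x x = -1" and u: "u > 0"
  shows "of_real (u\<^sup>2) + 1 + 2 * of_real u * lorC z (cplx3 x) \<notin> \<real>\<^sub>\<le>\<^sub>0"
    "((\<lambda>t. 1 / (of_real u * (\<i> * of_real e * lorC z (cplx3 (gamma0 t))) + - \<i> * of_real e * of_real (lorR x (gamma0 t)))) has_integral
       1 / csqrt (of_real (u\<^sup>2) + 1 + 2 * of_real u * lorC z (cplx3 x))) {0..1}"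
proof -
  obtain z0 z1 z2 where zz: "z = (z0, z1, z2)" by (metis prod.collapse)
  obtain x0 x1 x2 where xx: "x = (x0, x1, x2)" by (metis prod.collapse)
  define Y where "Y = (\<lambda>\<zeta> \<xi>. \<i> * complex_of_real e * (of_real u * \<zeta> - complex_of_real \<xi>))"
  have ee: "complex_of_real e * complex_of_real e = 1" using e by auto
  have YY: "Y a b * Y a b = - (of_real u * a - of_real b)\<^sup>2" for a b
  proof -
    have "Y a b * Y a b = (\<i> * \<i>) * (complex_of_real e * complex_of_real e) * (of_real u * a - of_real b)\<^sup>2"
      unfolding Y_def power2_eq_square by (simp only: mult_ac)
    then show ?thesis unfolding ee by simp
  qed
  have z2: "z0 * z0 - z1 * z1 - z2 * z2 = -1" using z by (simp add: Ttube_def Xc_def zz lorC_def)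
  have "complex_of_real (x0 * x0 - x1 * x1 - x2 * x2) = -1" using x by (simp add: xx lorR_def)
  then have x2: "of_real x0 * of_real x0 - of_real x1 * of_real x1 - of_real x2 * of_real x2 = (-1 :: complex)" by simp
  have sq: "lorC (Y z0 x0, Y z1 x1, Y z2 x2) (Y z0 x0, Y z1 x1, Y z2 x2) = of_real (u\<^sup>2) + 1 + 2 * of_real u * lorC z (cplx3 x)"
  proof -
    have "lorC (Y z0 x0, Y z1 x1, Y z2 x2) (Y z0 x0, Y z1 x1, Y z2 x2) =
        - (of_real u * of_real u) * (z0 * z0 - z1 * z1 - z2 * z2) - (of_real x0 * of_real x0 - of_real x1 * of_real x1 - of_real x2 * of_real x2)
        + 2 * of_real u * lorC z (cplx3 x)"
      by (simp only: lorC_def prod.case YY zz xx cplx3_def) (simp add: power2_eq_square algebra_simps)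
    then show ?thesis unfolding z2 x2 by (simp add: power2_eq_square)
  qed
  have V: "(- (e * u) * Im z0, - (e * u) * Im z1, - (e * u) * Im z2) \<in> Vcone 1"
  proof -
    have "lorR (im3 z) (im3 z) > 0" "- e * Im z0 > 0" using z by (auto simp: Ttube_def Vcone_def zz im3_def)
    moreover have "lorR (- (e * u) * Im z0, - (e * u) * Im z1, - (e * u) * Im z2) (- (e * u) * Im z0, - (e * u) * Im z1, - (e * u) * Im z2)
        = (e * e) * (u * u) * lorR (im3 z) (im3 z)"
      by (simp add: lorR_def im3_def zz algebra_simps)
    moreover have "e * e = 1" using e by auto
    ultimately show ?thesis using u mult_pos_pos[of u "- e * Im z0"] by (simp add: Vcone_def mult_ac)
  qed
  have re: "Re (Y a b) = - (e * u) * Im a" for a b by (simp add: Y_def algebra_simps)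
  have reY: "re3 (Y z0 x0, Y z1 x1, Y z2 x2) = (- (e * u) * Im z0, - (e * u) * Im z1, - (e * u) * Im z2)"
    by (simp add: re3_def re)
  show nr: "of_real (u\<^sup>2) + 1 + 2 * of_real u * lorC z (cplx3 x) \<notin> \<real>\<^sub>\<le>\<^sub>0"
    unfolding sq[symmetric] by (rule lorC_square_Re_cone) (simp only: reY V)
  have sq': "(Y z0 x0)\<^sup>2 - (Y z1 x1)\<^sup>2 - (Y z2 x2)\<^sup>2 = of_real (u\<^sup>2) + 1 + 2 * of_real u * lorC z (cplx3 x)"
    unfolding sq[symmetric] by (simp add: lorC_def power2_eq_square)
  have "((\<lambda>t. 1 / (Y z0 x0 - Y z1 x1 * of_real (cos (2 * pi * t - pi)) - Y z2 x2 * of_real (sin (2 * pi * t - pi)))) has_integral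
            1 / csqrt ((Y z0 x0)\<^sup>2 - (Y z1 x1)\<^sup>2 - (Y z2 x2)\<^sup>2)) {0..1}"
  proof (rule circle_quadratic_integral)
    show "Re (Y z0 x0 - Y z1 x1 * of_real (cos (2 * pi * t - pi)) - Y z2 x2 * of_real (sin (2 * pi * t - pi))) > 0" for t
      using Vcone_pairing_pos[OF V, of "2 * pi * t - pi"] by (simp add: re)
    show "Re (Y z0 x0) > 0" using V by (simp add: re Vcone_def)
    show "(Y z0 x0)\<^sup>2 - (Y z1 x1)\<^sup>2 - (Y z2 x2)\<^sup>2 \<notin> \<real>\<^sub>\<le>\<^sub>0" unfolding sq' by (rule nr)
  qed
  moreover have "Y z0 x0 - Y z1 x1 * of_real (cos (2 * pi * t - pi)) - Y z2 x2 * of_real (sin (2 * pi * t - pi)) =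
     of_real u * (\<i> * of_real e * lorC z (cplx3 (gamma0 t))) + - \<i> * of_real e * of_real (lorR x (gamma0 t))" for t
    by (simp add: Y_def lorC_def lorR_def cplx3_def gamma0_def zz xx algebra_simps)
  ultimately show "((\<lambda>t. 1 / (of_real u * (\<i> * of_real e * lorC z (cplx3 (gamma0 t))) + - \<i> * of_real e * of_real (lorR x (gamma0 t)))) has_integral
       1 / csqrt (of_real (u\<^sup>2) + 1 + 2 * of_real u * lorC z (cplx3 x))) {0..1}"
    unfolding sq' by simp
qed

section \<open>The spectral kernel for a tube point and a boundary point\<close>

abbreviation unit_measure :: "real measure" where
  "unit_measure \<equiv> restrict_space lborel {0..1}"

lemma finite_unit_measure: "finite_measure unit_measure"
  by (rule finite_measureI) (simp add: emeasure_restrict_space space_restrict_space)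

lemma sigma_finite_unit_measure: "sigma_finite_measure unit_measure"
  using finite_unit_measure by (rule finite_measure.axioms)

lemma lorR_xpar:
  assumes "fst p \<noteq> snd p"
  shows "lorR (xpar p) (xpar p) = -1"
proof -
  have "lorR (xpar p) (xpar p) = ((1 + fst p * snd p) * (1 + fst p * snd p) - (1 - fst p * snd p) * (1 - fst p * snd p)
      - (fst p + snd p) * (fst p + snd p)) / ((fst p - snd p) * (fst p - snd p))"
    unfolding xpar_eq lorR_def prod.case times_divide_times_eq by (simp only: diff_divide_distrib)
  also have "(1 + fst p * snd p) * (1 + fst p * snd p) - (1 - fst p * snd p) * (1 - fst p * snd p)
      - (fst p + snd p) * (fst p + snd p) = - ((fst p - snd p) * (fst p - snd p))"
    by (simp add: algebra_simps)
  finally show ?thesis using assms by simp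
qed

lemma lor_angle_gamma0: "lor_angle (2 * pi * t - pi) p = lorR (xpar p) (gamma0 t)"
  by (simp add: lor_angle_def gamma0_def)

lemma continuous_on_lorC_gamma0: "continuous_on S (\<lambda>t. lorC z (cplx3 (gamma0 t)))"
proof -
  have eq: "lorC z (cplx3 (gamma0 t)) = fst z - fst (snd z) * of_real (cos (2 * pi * t - pi)) - snd (snd z) * of_real (sin (2 * pi * t - pi))" for t
    by (simp add: lorC_def cplx3_def gamma0_def case_prod_unfold)
  show ?thesis unfolding eq by (intro continuous_intros)
qed

lemma tube_boundary_kernel:
  assumes e: "e \<in> {1, -1}" and z: "z \<in> Ttube (- e)" and ne: "fst p \<noteq> snd p"
    and nz: "AE t in unit_measure. lor_angle (2 * pi * t - pi) p \<noteq> 0"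
    and int: "integrable unit_measure (\<lambda>t. \<bar>lor_angle (2 * pi * t - pi) p\<bar> powr (- 1/2))"
  shows "(\<integral>\<nu>. indicator {0<..} \<nu> *\<^sub>R (of_real (\<nu> * tanh (pi * \<nu>) / cosh (pi * \<nu>)) *
      (\<integral>t. (\<i> * of_real e * lorC z (cplx3 (gamma0 t))) powr (- 1/2 + \<i> * of_real \<nu>) *
         (- \<i> * of_real e * of_real (lor_angle (2 * pi * t - pi) p)) powr (- 1/2 - \<i> * of_real \<nu>) \<partial>unit_measure)) \<partial>lborel) =
    1 / (of_real pi * (1 + lorC z (cplx3 (xpar p))))"
proof -
  obtain b C where bC: "b < pi" "\<And>\<alpha>. Re (\<i> * of_real e * lorC z (cplx3 (1, cos \<alpha>, sin \<alpha>))) > 0"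
    "\<And>\<alpha>. \<bar>Im (Ln (\<i> * of_real e * lorC z (cplx3 (1, cos \<alpha>, sin \<alpha>))))\<bar> + pi / 2 \<le> b"
    "\<And>\<alpha>. cmod (\<i> * of_real e * lorC z (cplx3 (1, cos \<alpha>, sin \<alpha>))) powr (- 1/2) \<le> C"
    "continuous_on UNIV (\<lambda>\<alpha>. Ln (\<i> * of_real e * lorC z (cplx3 (1, cos \<alpha>, sin \<alpha>))))"
    by (rule tube_pairing_bounds[OF e z], rule that; assumption)
  define L where "L = (\<lambda>t. lor_angle (2 * pi * t - pi) p)"
  define A where "A = (\<lambda>t. \<i> * complex_of_real e * lorC z (cplx3 (gamma0 t)))"
  \<comment> \<open>The value 1 replaces 0 on the null set where the pairing vanishes, because the
    abstract identity asks for nonzero values everywhere.\<close>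
  define B where "B = (\<lambda>t. if L t = 0 then 1 else - \<i> * complex_of_real e * of_real (L t))"
  have gA: "A t = \<i> * of_real e * lorC z (cplx3 (1, cos (2 * pi * t - pi), sin (2 * pi * t - pi)))" for t
    by (simp add: A_def gamma0_def)
  have L_cont: "continuous_on UNIV L"
    unfolding L_def lor_angle_eq[OF ne] using ne by (intro continuous_intros) auto
  have [measurable]: "L \<in> borel_measurable borel" by (rule borel_measurable_continuous_onI[OF L_cont])
  have Am: "A \<in> borel_measurable borel" unfolding A_def by (intro borel_measurable_continuous_onI continuous_on_mult continuous_on_const continuous_on_lorC_gamma0)
  have Bm: "B \<in> borel_measurable borel" unfolding B_def by measurable
  have restr: "f \<in> borel_measurable borel \<Longrightarrow> f \<in> borel_measurable unit_measure" for f :: "real \<Rightarrow> complex"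
    by (rule measurable_restrict_space1) simp
  have A0: "A t \<noteq> 0" for t using bC(2)[of "2 * pi * t - pi"] unfolding gA by (metis less_irrefl zero_complex.simps(1))
  have nz': "AE t in unit_measure. L t \<noteq> 0" using nz unfolding L_def .
  have w: "lorR (xpar p) (xpar p) = -1" by (rule lorR_xpar[OF ne])
  have "(\<integral>\<nu>. indicator {0<..} \<nu> *\<^sub>R (of_real (\<nu> * tanh (pi * \<nu>) / cosh (pi * \<nu>)) *
      (\<integral>t. A t powr (- 1/2 + \<i> * of_real \<nu>) * B t powr (- 1/2 - \<i> * of_real \<nu>) \<partial>unit_measure)) \<partial>lborel) =
    1 / (of_real pi * (1 + lorC z (cplx3 (xpar p))))"
  proof (rule Mehler_Fock_kernel_identity[where b=b])
    show "sigma_finite_measure unit_measure" by (rule sigma_finite_unit_measure)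
    show "A \<in> borel_measurable unit_measure" "B \<in> borel_measurable unit_measure" using Am Bm by (simp_all add: restr)
    show "A t \<noteq> 0" "B t \<noteq> 0" for t using A0 e by (auto simp: B_def)
    show "\<bar>Im (Ln (A t) - Ln (B t))\<bar> \<le> b" for t
    proof -
      have "\<bar>Im (Ln (B t))\<bar> \<le> pi / 2" using Im_Ln_imaginary[OF _ e, of "L t"] by (auto simp: B_def)
      moreover have "\<bar>Im (Ln (A t))\<bar> + pi / 2 \<le> b" unfolding gA by (rule bC)
      ultimately show ?thesis by simp
    qed
    show "b < pi" by fact
    show "integrable unit_measure (\<lambda>t. 1 / sqrt (cmod (A t) * cmod (B t)))"
    proof (rule Bochner_Integration.integrable_bound[OF integrable_mult_right[OF int, of C]])
      show "AE t in unit_measure. norm (1 / sqrt (cmod (A t) * cmod (B t))) \<le> norm (C * \<bar>lor_angle (2 * pi * t - pi) p\<bar> powr (- 1/2))"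
        using nz'
      proof eventually_elim
        case (elim t)
        have sq: "1 / sqrt x = x powr (- 1/2)" if "x \<ge> 0" for x :: real
          using that by (simp add: powr_minus_divide powr_half_sqrt)
        have nB: "cmod (B t) = \<bar>L t\<bar>" using elim e by (auto simp: B_def norm_mult)
        have "norm (1 / sqrt (cmod (A t) * cmod (B t))) = 1 / sqrt (cmod (A t)) * (1 / sqrt \<bar>L t\<bar>)"
          by (simp add: nB real_sqrt_mult)
        also have "\<dots> = cmod (A t) powr (- 1/2) * \<bar>L t\<bar> powr (- 1/2)"
          by (simp only: sq norm_ge_zero abs_ge_zero)
        also have "\<dots> \<le> C * \<bar>L t\<bar> powr (- 1/2)"
          unfolding gA by (intro mult_right_mono bC) auto
        finally show ?case unfolding L_def by simp
      qed
      show "(\<lambda>t. 1 / sqrt (cmod (A t) * cmod (B t))) \<in> borel_measurable unit_measure"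
        using restr[OF Am] restr[OF Bm] by simp
    qed
    \<comment> \<open>At u = 1 the Lorentz square is twice this number.\<close>
    show "1 + lorC z (cplx3 (xpar p)) \<notin> \<real>\<^sub>\<le>\<^sub>0"
      using tube_boundary_square(1)[OF e z w, of 1] by (auto simp: complex_nonpos_Reals_iff)
    fix u :: real assume u: "u > 0"
    have hi: "((\<lambda>t. 1 / (of_real u * A t + - \<i> * of_real e * of_real (L t))) has_integral
       1 / csqrt (of_real (u\<^sup>2) + 1 + 2 * of_real u * lorC z (cplx3 (xpar p)))) {0..1}"
      using tube_boundary_square(2)[OF e z w u] unfolding A_def L_def lor_angle_gamma0 .
    have nzd: "of_real u * A t + - \<i> * of_real e * of_real (L t) \<noteq> 0" for t
    proof -
      have "Re (of_real u * A t + - \<i> * of_real e * of_real (L t)) = u * Re (A t)" by simp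
      moreover have "u * Re (A t) > 0" unfolding gA using u bC(2) by (rule mult_pos_pos)
      ultimately show ?thesis by (metis less_irrefl zero_complex.simps(1))
    qed
    have cont: "continuous_on {0..1} (\<lambda>t. 1 / (of_real u * A t + - \<i> * of_real e * of_real (L t)))"
      using nzd unfolding A_def by (intro continuous_intros continuous_on_lorC_gamma0 continuous_on_subset[OF L_cont]) auto
    have "(\<integral>t. 1 / (of_real u * A t + B t) \<partial>unit_measure) = (\<integral>t. 1 / (of_real u * A t + - \<i> * of_real e * of_real (L t)) \<partial>unit_measure)"
    proof (rule integral_cong_AE)
      show "AE t in unit_measure. 1 / (of_real u * A t + B t) = 1 / (of_real u * A t + - \<i> * of_real e * of_real (L t))"
        using nz' by eventually_elim (simp add: B_def)
    qed (use Am Bm in \<open>auto intro!: restr\<close>)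
    also have "\<dots> = (\<integral>t. indicator {0..1} t *\<^sub>R (1 / (of_real u * A t + - \<i> * of_real e * of_real (L t))) \<partial>lborel)"
      by (subst integral_restrict_space) auto
    also have "\<dots> = integral {0..1} (\<lambda>t. 1 / (of_real u * A t + - \<i> * of_real e * of_real (L t)))"
      using set_borel_integral_eq_integral(2)[OF borel_integrable_atLeastAtMost'[OF cont]]
      unfolding set_lebesgue_integral_def .
    also have "\<dots> = 1 / csqrt (of_real (u\<^sup>2) + 1 + 2 * of_real u * lorC z (cplx3 (xpar p)))"
      using hi by (rule integral_unique)
    finally show "(\<integral>t. 1 / (of_real u * A t + B t) \<partial>unit_measure) = 1 / csqrt (of_real (u\<^sup>2) + 1 + 2 * of_real u * lorC z (cplx3 (xpar p)))" .
  qed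
  moreover have "(\<integral>t. A t powr (- 1/2 + \<i> * of_real \<nu>) * B t powr (- 1/2 - \<i> * of_real \<nu>) \<partial>unit_measure) =
      (\<integral>t. A t powr (- 1/2 + \<i> * of_real \<nu>) * (- \<i> * of_real e * of_real (L t)) powr (- 1/2 - \<i> * of_real \<nu>) \<partial>unit_measure)" for \<nu>
  proof (rule integral_cong_AE)
    show "AE t in unit_measure. A t powr (- 1/2 + \<i> * of_real \<nu>) * B t powr (- 1/2 - \<i> * of_real \<nu>) =
        A t powr (- 1/2 + \<i> * of_real \<nu>) * (- \<i> * of_real e * of_real (L t)) powr (- 1/2 - \<i> * of_real \<nu>)"
      using nz' by eventually_elim (simp add: B_def)
  qed (use Am Bm in \<open>auto intro!: restr\<close>)
  ultimately show ?thesis unfolding A_def L_def by simp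
qed

section \<open>The inversion formula\<close>

text \<open>The imaginary parts of the exponents turn the arguments of A and B into the real
  exponential exp(\<nu> (arg B - arg A)), which is controlled by \<open>b\<close>.\<close>

lemma norm_powr_pair_le:
  assumes A: "A \<noteq> 0" and b: "\<bar>Im (Ln A)\<bar> + \<bar>Im (Ln B)\<bar> \<le> b"
  shows "cmod (A powr (- 1/2 + \<i> * of_real \<nu>) * B powr (- 1/2 - \<i> * of_real \<nu>)) \<le> exp (b * \<bar>\<nu>\<bar>) * (cmod A powr (- 1/2) * cmod B powr (- 1/2))"
proof (cases "B = 0")
  case False
  have "cmod (A powr (- 1/2 + \<i> * of_real \<nu>) * B powr (- 1/2 - \<i> * of_real \<nu>)) =
      exp (\<nu> * (Im (Ln B) - Im (Ln A))) * (exp (- ln (cmod A) / 2) * exp (- ln (cmod B) / 2))"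
    using A False by (simp add: powr_def norm_mult algebra_simps flip: exp_add)
  also have "exp (\<nu> * (Im (Ln B) - Im (Ln A))) \<le> exp (b * \<bar>\<nu>\<bar>)"
  proof -
    have "\<nu> * (Im (Ln B) - Im (Ln A)) \<le> \<bar>\<nu>\<bar> * \<bar>Im (Ln B) - Im (Ln A)\<bar>" by (metis abs_ge_self abs_mult)
    also have "\<dots> \<le> \<bar>\<nu>\<bar> * b" using b by (intro mult_left_mono) auto
    finally show ?thesis by (simp add: mult.commute)
  qed
  finally show ?thesis using A False by (simp add: powr_def mult_right_mono)
qed simp

lemma tpow_scale:
  assumes "\<rho> > 0"
  shows "tpow e (\<rho> * t) s = of_real \<rho> powr s * tpow e t s"
proof -
  consider "t > 0" | "t < 0" | "t = 0" by linarith
  then show ?thesis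
  proof cases
    case 1
    then show ?thesis using assms by (simp add: tpow_def powr_times_real)
  next
    case 2
    then have "complex_of_real (- (\<rho> * t)) powr s = of_real \<rho> powr s * of_real (- t) powr s"
      using assms powr_times_real[of "of_real \<rho>" "of_real (- t)" s] by simp
    moreover have "\<rho> * t < 0" using 2 assms by (simp add: mult_pos_neg)
    ultimately show ?thesis using 2 by (simp add: tpow_def)
  qed (simp add: tpow_def)
qed

lemma powr_of_real_mult:
  fixes c s :: complex
  assumes "\<rho> > 0"
  shows "(of_real \<rho> * c) powr s = of_real \<rho> powr s * c powr s"
proof (cases "c = 0")
  case False
  then show ?thesis using assms by (simp add: powr_def Ln_times_of_real Ln_of_real ring_distribs exp_add)
qed simp

text \<open>The degree -1/2 - i \<nu> of the transform complements the degree -1/2 + i \<nu> of the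
  tube power to -1, the degree for which the cycle integral does not depend on the loop.\<close>

lemma FH_scale:
  assumes "\<rho> > 0"
  shows "FH e f \<nu> (\<rho> * x0, \<rho> * x1, \<rho> * x2) = of_real \<rho> powr (- 1/2 - \<i> * of_real \<nu>) * FH e f \<nu> (x0, x1, x2)"
proof -
  define s where "s = - 1/2 - \<i> * complex_of_real \<nu>"
  have l: "lorR x (\<rho> * x0, \<rho> * x1, \<rho> * x2) = \<rho> * lorR x (x0, x1, x2)" for x
    by (cases x) (simp add: lorR_def algebra_simps)
  have "FH e f \<nu> (\<rho> * x0, \<rho> * x1, \<rho> * x2) = (\<integral>p. of_real \<rho> powr s * (indicator Xdom p *\<^sub>R
      ((tpow e (lorR (Xchart 1 p) (x0, x1, x2)) s * f (Xchart 1 p) + tpow e (lorR (Xchart (-1) p) (x0, x1, x2)) s * f (Xchart (-1) p))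
        / complex_of_real (2 * sqrt ((fst p)\<^sup>2 + (snd p)\<^sup>2 - 1)))) \<partial>lborel)"
    unfolding FH_def Xint_def l tpow_scale[OF assms] s_def[symmetric] scaleR_conv_of_real
    by (intro Bochner_Integration.integral_cong refl) (simp only: ring_distribs mult_ac times_divide_eq_right add_divide_distrib)
  also have "\<dots> = of_real \<rho> powr s * FH e f \<nu> (x0, x1, x2)"
    unfolding FH_def Xint_def s_def by (rule integral_mult_right_zero)
  finally show ?thesis unfolding s_def .
qed

text \<open>The majorant is a product: |\<nu>| exp(b |\<nu>|) / cosh(pi \<nu>) is integrable as b <
  pi, and the singular factor times |fw| is integrable in (t, p) by the bound uniform in the
  direction. After the exchange the kernel identity is applied for almost every p.\<close>

lemma (in boundary_density) spectral_density_formula: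
  assumes e: "e \<in> {1, -1}" and z: "z \<in> Ttube (- e)"
  shows "(\<integral>\<nu>. \<integral>t. \<integral>p. of_real (indicator {0<..} \<nu> * (\<nu> * tanh (pi * \<nu>) / cosh (pi * \<nu>))) * (of_real (exp (- e * pi * \<nu>)) *
       (lorC z (cplx3 (gamma0 t)) powr (- 1/2 + \<i> * of_real \<nu>) * tpow e (lor_angle (2 * pi * t - pi) p) (- 1/2 - \<i> * of_real \<nu>))) * fw p
       \<partial>lborel \<partial>unit_measure \<partial>lborel) = (\<integral>p. fw p / (of_real pi * (1 + lorC z (cplx3 (xpar p)))) \<partial>lborel)"
proof -
  obtain b C where bC: "b < pi" "\<And>\<alpha>. Re (\<i> * of_real e * lorC z (cplx3 (1, cos \<alpha>, sin \<alpha>))) > 0"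
    "\<And>\<alpha>. \<bar>Im (Ln (\<i> * of_real e * lorC z (cplx3 (1, cos \<alpha>, sin \<alpha>))))\<bar> + pi / 2 \<le> b"
    "\<And>\<alpha>. cmod (\<i> * of_real e * lorC z (cplx3 (1, cos \<alpha>, sin \<alpha>))) powr (- 1/2) \<le> C"
    "continuous_on UNIV (\<lambda>\<alpha>. Ln (\<i> * of_real e * lorC z (cplx3 (1, cos \<alpha>, sin \<alpha>))))"
    by (rule tube_pairing_bounds[OF e z], rule that; assumption)
  obtain K where K: "\<And>\<alpha>. integrable lborel (\<lambda>p. \<bar>lor_angle \<alpha> p\<bar> powr (- 1/2) * cmod (fw p))"
    "\<And>\<alpha>. (\<integral>p. \<bar>lor_angle \<alpha> p\<bar> powr (- 1/2) * cmod (fw p) \<partial>lborel) \<le> K"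
    using kernel_fw_integrable_uniform by blast
  define \<theta> where "\<theta> = (\<lambda>t::real. 2 * pi * t - pi)"
  define A where "A = (\<lambda>t. \<i> * complex_of_real e * lorC z (cplx3 (gamma0 t)))"
  define B where "B = (\<lambda>t p. - \<i> * complex_of_real e * of_real (lor_angle (\<theta> t) p))"
  define r where "r = (\<lambda>\<nu>::real. indicator {0<..} \<nu> * (\<nu> * tanh (pi * \<nu>) / cosh (pi * \<nu>)) :: real)"
  define AB where "AB = (\<lambda>\<nu> t p. A t powr (- 1/2 + \<i> * of_real \<nu>) * B t p powr (- 1/2 - \<i> * of_real \<nu>))"
  define h where "h = (\<lambda>(\<nu>, t, p). of_real (r \<nu>) * AB \<nu> t p * fw p)"
  have gA: "A t = \<i> * of_real e * lorC z (cplx3 (1, cos (\<theta> t), sin (\<theta> t)))" for t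
    by (simp add: A_def gamma0_def \<theta>_def)
  have A0: "A t \<noteq> 0" for t using bC(2)[of "\<theta> t"] unfolding gA by (metis less_irrefl zero_complex.simps(1))
  have b0: "b \<ge> 0" using bC(3)[of 0] pi_ge_zero by (smt (verit) abs_ge_zero divide_nonneg_nonneg)
  have C0: "C \<ge> 0" using bC(4)[of 0] by (rule order_trans[rotated]) simp
  have AB_eq: "of_real (exp (- e * pi * \<nu>)) * (lorC z (cplx3 (gamma0 t)) powr (- 1/2 + \<i> * of_real \<nu>) *
      tpow e (lor_angle (2 * pi * t - pi) p) (- 1/2 - \<i> * of_real \<nu>)) = AB \<nu> t p" for \<nu> t p
    unfolding AB_def A_def B_def \<theta>_def
    by (rule powr_rotated_product[OF e bC(2)[of "\<theta> t", folded gA, unfolded A_def]])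
  interpret T: finite_measure unit_measure by (rule finite_unit_measure)
  interpret TP: pair_sigma_finite unit_measure "lborel :: (real \<times> real) measure" ..
  have idT [measurable]: "(\<lambda>t. t) \<in> unit_measure \<rightarrow>\<^sub>M borel" by (rule measurable_restrict_space1) simp
  have fst_T: "fst \<in> borel_measurable (unit_measure \<Otimes>\<^sub>M (lborel :: (real \<times> real) measure))"
    by (rule measurable_compose[OF measurable_fst idT])
  have snd_T: "snd \<in> unit_measure \<Otimes>\<^sub>M (lborel :: (real \<times> real) measure) \<rightarrow>\<^sub>M borel"
    by (rule measurable_compose[OF measurable_snd]) simp
  have L_meas: "(\<lambda>x. lor_angle (\<theta> (fst x)) (snd x)) \<in> borel_measurable (borel \<Otimes>\<^sub>M borel)"
  proof -
    have [measurable]: "(\<lambda>x :: real \<times> real \<times> real. fst (snd x)) \<in> borel_measurable (borel \<Otimes>\<^sub>M borel)"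
      "(\<lambda>x :: real \<times> real \<times> real. snd (snd x)) \<in> borel_measurable (borel \<Otimes>\<^sub>M borel)"
      by (rule measurable_compose[OF measurable_snd fst_snd_borel_measurable(1)] measurable_compose[OF measurable_snd fst_snd_borel_measurable(2)])+
    show ?thesis unfolding lor_angle_def xpar_eq lorR_def prod.case \<theta>_def by measurable
  qed
  have LT_meas [measurable]: "(\<lambda>x. lor_angle (\<theta> (fst x)) (snd x)) \<in> borel_measurable (unit_measure \<Otimes>\<^sub>M lborel)"
    using measurable_compose[OF measurable_Pair[OF fst_T snd_T] L_meas] by simp
  have A_meas: "A \<in> borel_measurable borel"
    unfolding A_def by (intro borel_measurable_continuous_onI continuous_on_mult continuous_on_const continuous_on_lorC_gamma0)
  have AT_meas [measurable]: "(\<lambda>x. A (fst x)) \<in> borel_measurable (unit_measure \<Otimes>\<^sub>M (lborel :: (real \<times> real) measure))"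
    by (rule measurable_compose[OF fst_T A_meas])
  have fwT_meas [measurable]: "(\<lambda>x. fw (snd x)) \<in> borel_measurable (unit_measure \<Otimes>\<^sub>M lborel)"
    by (rule measurable_compose[OF snd_T fw_measurable])
  have h_meas [measurable]: "h \<in> borel_measurable (lborel \<Otimes>\<^sub>M (unit_measure \<Otimes>\<^sub>M lborel))"
  proof -
    have [measurable]: "(\<lambda>x :: real \<times> real \<times> real \<times> real. A (fst (snd x))) \<in> borel_measurable (lborel \<Otimes>\<^sub>M (unit_measure \<Otimes>\<^sub>M lborel))"
      "(\<lambda>x :: real \<times> real \<times> real \<times> real. lor_angle (\<theta> (fst (snd x))) (snd (snd x))) \<in> borel_measurable (lborel \<Otimes>\<^sub>M (unit_measure \<Otimes>\<^sub>M lborel))"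
      "(\<lambda>x :: real \<times> real \<times> real \<times> real. fw (snd (snd x))) \<in> borel_measurable (lborel \<Otimes>\<^sub>M (unit_measure \<Otimes>\<^sub>M lborel))"
      by (rule measurable_compose[OF measurable_snd AT_meas] measurable_compose[OF measurable_snd LT_meas] measurable_compose[OF measurable_snd fwT_meas])+
    show ?thesis unfolding h_def AB_def B_def r_def case_prod_unfold powr_def by measurable
  qed
  define k where "k = (\<lambda>t p. C * (\<bar>lor_angle (\<theta> t) p\<bar> powr (- 1/2) * cmod (fw p)))"
  \<comment> \<open>The constant is the 2 from the bound on 1 / cosh times the 2 / (pi - b) paid for
    absorbing |\<nu>|.\<close>
  define \<phi> where "\<phi> = (\<lambda>\<nu>. 4 / (pi - b) * exp (- ((pi - b) / 2) * \<bar>\<nu>\<bar>))"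
  have k_int: "integrable (unit_measure \<Otimes>\<^sub>M lborel) (\<lambda>(t, p). k t p)"
  proof (rule TP.Fubini_integrable)
    show "(\<lambda>(t, p). k t p) \<in> borel_measurable (unit_measure \<Otimes>\<^sub>M lborel)"
      unfolding k_def case_prod_unfold by measurable
    show "AE t in unit_measure. integrable lborel (\<lambda>p. case (t, p) of (t, p) \<Rightarrow> k t p)"
      using K(1) by (simp add: k_def)
    have eq: "(\<integral>p. norm (case (t, p) of (t, p) \<Rightarrow> k t p) \<partial>lborel) = C * (\<integral>p. \<bar>lor_angle (\<theta> t) p\<bar> powr (- 1/2) * cmod (fw p) \<partial>lborel)" for t
      using C0 by (simp add: k_def abs_mult)
    show "integrable unit_measure (\<lambda>t. \<integral>p. norm (case (t, p) of (t, p) \<Rightarrow> k t p) \<partial>lborel)"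
    proof (rule T.integrable_const_bound)
      show "AE t in unit_measure. norm (\<integral>p. norm (case (t, p) of (t, p) \<Rightarrow> k t p) \<partial>lborel) \<le> C * K"
        unfolding eq using C0 K(2) by (intro AE_I2) (simp add: mult_left_mono abs_mult)
      show "(\<lambda>t. \<integral>p. norm (case (t, p) of (t, p) \<Rightarrow> k t p) \<partial>lborel) \<in> borel_measurable unit_measure"
        unfolding k_def case_prod_unfold by measurable
    qed
  qed
  have \<phi>_int: "integrable lborel \<phi>"
    unfolding \<phi>_def using bC(1) by (intro integrable_mult_right integrable_exp_abs_decay) simp
  have AB_le: "cmod (AB \<nu> t p) \<le> exp (b * \<bar>\<nu>\<bar>) * (C * \<bar>lor_angle (\<theta> t) p\<bar> powr (- 1/2))" for \<nu> t p
  proof (cases "lor_angle (\<theta> t) p = 0")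
    case True
    then show ?thesis using C0 by (simp add: AB_def B_def)
  next
    case False
    have "cmod (AB \<nu> t p) \<le> exp (b * \<bar>\<nu>\<bar>) * (cmod (A t) powr (- 1/2) * cmod (B t p) powr (- 1/2))"
    proof -
      have "\<bar>Im (Ln (A t))\<bar> + \<bar>Im (Ln (B t p))\<bar> \<le> b"
        using bC(3)[of "\<theta> t"] Im_Ln_imaginary[OF False e] unfolding B_def gA by linarith
      then show ?thesis unfolding AB_def by (rule norm_powr_pair_le[OF A0])
    qed
    also have "cmod (B t p) = \<bar>lor_angle (\<theta> t) p\<bar>" using e by (auto simp: B_def norm_mult)
    also have "exp (b * \<bar>\<nu>\<bar>) * (cmod (A t) powr (- 1/2) * \<bar>lor_angle (\<theta> t) p\<bar> powr (- 1/2)) \<le> exp (b * \<bar>\<nu>\<bar>) * (C * \<bar>lor_angle (\<theta> t) p\<bar> powr (- 1/2))"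
      unfolding gA by (intro mult_left_mono mult_right_mono bC) auto
    finally show ?thesis .
  qed
  have r_le: "\<bar>r \<nu>\<bar> * exp (b * \<bar>\<nu>\<bar>) \<le> \<phi> \<nu>" for \<nu>
  proof -
    have "\<bar>\<nu>\<bar> * \<bar>tanh (pi * \<nu>)\<bar> \<le> \<bar>\<nu>\<bar>"
      using tanh_real_bounds[of "pi * \<nu>"] by (intro mult_left_le) auto
    then have "\<bar>\<nu>\<bar> * \<bar>tanh (pi * \<nu>)\<bar> / cosh (pi * \<nu>) \<le> \<bar>\<nu>\<bar> / cosh (pi * \<nu>)"
      by (rule divide_right_mono) simp
    moreover have "\<bar>r \<nu>\<bar> \<le> \<bar>\<nu>\<bar> * \<bar>tanh (pi * \<nu>)\<bar> / cosh (pi * \<nu>)"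
    proof (cases "\<nu> > 0")
      case False
      then have "r \<nu> = 0" by (simp add: r_def)
      moreover have "0 \<le> \<bar>\<nu>\<bar> * \<bar>tanh (pi * \<nu>)\<bar> / cosh (pi * \<nu>)"
        by (intro divide_nonneg_nonneg mult_nonneg_nonneg) auto
      ultimately show ?thesis by (simp only: abs_zero)
    qed (simp add: r_def abs_mult)
    ultimately have "\<bar>r \<nu>\<bar> \<le> \<bar>\<nu>\<bar> / cosh (pi * \<nu>)" by linarith
    then have "\<bar>r \<nu>\<bar> * exp (b * \<bar>\<nu>\<bar>) \<le> \<bar>\<nu>\<bar> / cosh (pi * \<nu>) * exp (b * \<bar>\<nu>\<bar>)" by (rule mult_right_mono) simp
    also have "\<dots> = \<bar>\<nu>\<bar> * (exp (b * \<bar>\<nu>\<bar>) / cosh (pi * \<nu>))" by simp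
    also have "\<dots> \<le> \<bar>\<nu>\<bar> * (2 * exp (- (pi - b) * \<bar>\<nu>\<bar>))" by (intro mult_left_mono cosh_times_exp_le b0) simp
    also have "\<dots> \<le> 2 * ((2 / (pi - b)) * exp (- ((pi - b) / 2) * \<bar>\<nu>\<bar>))"
      using abs_exp_decay_bound[of "pi - b" \<nu>] bC(1) by simp
    finally show ?thesis by (simp add: \<phi>_def)
  qed
  have bound: "cmod (h (\<nu>, t, p)) \<le> \<phi> \<nu> * k t p" for \<nu> t p
  proof -
    have "cmod (h (\<nu>, t, p)) = \<bar>r \<nu>\<bar> * cmod (AB \<nu> t p) * cmod (fw p)" by (simp add: h_def norm_mult)
    also have "\<dots> \<le> \<bar>r \<nu>\<bar> * (exp (b * \<bar>\<nu>\<bar>) * (C * \<bar>lor_angle (\<theta> t) p\<bar> powr (- 1/2))) * cmod (fw p)"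
      by (intro mult_right_mono mult_left_mono AB_le) auto
    also have "\<dots> = (\<bar>r \<nu>\<bar> * exp (b * \<bar>\<nu>\<bar>)) * k t p" by (simp add: k_def)
    also have "\<dots> \<le> \<phi> \<nu> * k t p" using C0 by (intro mult_right_mono r_le) (simp add: k_def)
    finally show ?thesis .
  qed
  have "(\<integral>\<nu>. \<integral>t. \<integral>p. h (\<nu>, t, p) \<partial>lborel \<partial>unit_measure \<partial>lborel) = (\<integral>p. \<integral>\<nu>. \<integral>t. h (\<nu>, t, p) \<partial>unit_measure \<partial>lborel \<partial>lborel)"
    by (rule triple_Fubini_dominated[OF sigma_finite_unit_measure _ h_meas k_int \<phi>_int bound]) (rule lborel.sigma_finite_measure_axioms)
  also have "\<dots> = (\<integral>p. fw p / (of_real pi * (1 + lorC z (cplx3 (xpar p)))) \<partial>lborel)"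
  proof (rule integral_cong_AE)
    have "AE p in lborel. lor_angle \<alpha> p \<noteq> 0" for \<alpha>
      using AE_lor_angle_nonzero[of \<alpha>] by eventually_elim simp
    then have "AE t in unit_measure. AE p in lborel. lor_angle (\<theta> t) p \<noteq> 0"
      by (rule AE_I2)
    moreover have "{x \<in> space (unit_measure \<Otimes>\<^sub>M lborel). lor_angle (\<theta> (fst x)) (snd x) \<noteq> 0} \<in> sets (unit_measure \<Otimes>\<^sub>M lborel)"
      by measurable
    \<comment> \<open>For each direction only a null set of p is bad; the exchange of quantifiers
      gives, for almost every p, a null set of bad directions.\<close>
    ultimately have nz: "AE p in lborel. AE t in unit_measure. lor_angle (\<theta> t) p \<noteq> 0"
      using TP.AE_commute[of "\<lambda>t p. lor_angle (\<theta> t) p \<noteq> 0"] by simp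
    have ki: "AE p in lborel. integrable unit_measure (\<lambda>t. k t p)" by (rule TP.AE_integrable_snd[OF k_int])
    show "AE p in lborel. (\<integral>\<nu>. \<integral>t. h (\<nu>, t, p) \<partial>unit_measure \<partial>lborel) = fw p / (of_real pi * (1 + lorC z (cplx3 (xpar p))))"
      using nz ki AE_sheets
    proof eventually_elim
      case (elim p)
      show ?case
      \<comment> \<open>Where \<open>fw p\<close> is 0 both sides vanish; elsewhere the
        integrability in t of the singular factor alone is recovered from that of \<open>k\<close>
        by dividing by a multiple of |fw p|.\<close>
      proof (cases "fw p = 0")
        case True
        then show ?thesis by (simp add: h_def)
      next
        case False
        have Cpos: "C > 0"
          using bC(4)[of "\<theta> 0"] A0[of 0] unfolding gA by (smt (verit) powr_gt_zero zero_less_norm_iff)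
        have "integrable unit_measure (\<lambda>t. k t p * (1 / (C * cmod (fw p))))"
          using elim(2) by (rule integrable_mult_left)
        moreover have "(\<lambda>t. k t p * (1 / (C * cmod (fw p)))) = (\<lambda>t. \<bar>lor_angle (\<theta> t) p\<bar> powr (- 1/2))"
          using False Cpos by (simp add: k_def)
        ultimately have i: "integrable unit_measure (\<lambda>t. \<bar>lor_angle (2 * pi * t - pi) p\<bar> powr (- 1/2))"
          unfolding \<theta>_def by simp
        have ne: "fst p \<noteq> snd p" using elim by simp
        have "(\<integral>\<nu>. \<integral>t. h (\<nu>, t, p) \<partial>unit_measure \<partial>lborel) = (\<integral>\<nu>. (indicator {0<..} \<nu> *\<^sub>R (of_real (\<nu> * tanh (pi * \<nu>) / cosh (pi * \<nu>)) *
            (\<integral>t. AB \<nu> t p \<partial>unit_measure))) * fw p \<partial>lborel)"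
          by (simp add: h_def r_def scaleR_conv_of_real mult.assoc)
        also have "\<dots> = (\<integral>\<nu>. indicator {0<..} \<nu> *\<^sub>R (of_real (\<nu> * tanh (pi * \<nu>) / cosh (pi * \<nu>)) *
            (\<integral>t. AB \<nu> t p \<partial>unit_measure)) \<partial>lborel) * fw p"
          by (rule integral_mult_left_zero)
        also have "\<dots> = 1 / (of_real pi * (1 + lorC z (cplx3 (xpar p)))) * fw p"
          using tube_boundary_kernel[OF e z ne elim(1)[unfolded \<theta>_def] i] unfolding AB_def A_def B_def \<theta>_def by simp
        finally show ?thesis by simp
      qed
    qed
    show "(\<lambda>p. \<integral>\<nu>. \<integral>t. h (\<nu>, t, p) \<partial>unit_measure \<partial>lborel) \<in> borel_measurable lborel"
      by measurable
    show "(\<lambda>p. fw p / (of_real pi * (1 + lorC z (cplx3 (xpar p))))) \<in> borel_measurable lborel"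
      unfolding lorC_def cplx3_def xpar_eq case_prod_unfold fst_conv snd_conv by measurable
  qed
  finally show ?thesis unfolding AB_eq h_def r_def prod.case .
qed

lemma FH_unit_circle:
  assumes e: "e \<in> {1, -1}" and f: "\<And>e. e \<in> {1, -1::real} \<Longrightarrow> (\<lambda>p. f (Xchart e p)) \<in> borel_measurable borel"
    and bd: "boundary_density (\<lambda>p. f (xpar p) / of_real ((fst p - snd p)\<^sup>2)) c"
  shows "FH e f \<nu> (1, cos \<alpha>, sin \<alpha>) =
    (\<integral>p. tpow e (lor_angle \<alpha> p) (- 1/2 - \<i> * of_real \<nu>) * (f (xpar p) / of_real ((fst p - snd p)\<^sup>2)) \<partial>lborel)"
proof -
  interpret boundary_density "\<lambda>p. f (xpar p) / of_real ((fst p - snd p)\<^sup>2)" c by fact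
  have "FH e f \<nu> (1, cos \<alpha>, sin \<alpha>) = (\<integral>p. tpow e (lorR (xpar p) (1, cos \<alpha>, sin \<alpha>)) (- 1/2 - \<i> * of_real \<nu>) * f (xpar p) / of_real ((fst p - snd p)\<^sup>2) \<partial>lborel)"
    unfolding FH_def
  proof (rule Xint_xpar)
    fix e' :: real assume e': "e' \<in> {1, -1}"
    have "(\<lambda>p. lorR (Xchart e' p) (1, cos \<alpha>, sin \<alpha>)) \<in> borel_measurable borel"
      unfolding Xchart_def lorR_def prod.case by measurable
    then have "(\<lambda>p. tpow e (lorR (Xchart e' p) (1, cos \<alpha>, sin \<alpha>)) (- 1/2 - \<i> * of_real \<nu>)) \<in> borel_measurable borel"
      by (rule measurable_compose[OF _ tpow_measurable])
    then show "(\<lambda>p. tpow e (lorR (Xchart e' p) (1, cos \<alpha>, sin \<alpha>)) (- 1/2 - \<i> * of_real \<nu>) * f (Xchart e' p)) \<in> borel_measurable borel"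
      using f[OF e'] by (rule borel_measurable_times)
  next
    show "integrable lborel (\<lambda>p. tpow e (lorR (xpar p) (1, cos \<alpha>, sin \<alpha>)) (- 1/2 - \<i> * of_real \<nu>) * f (xpar p) / of_real ((fst p - snd p)\<^sup>2))"
      using tpow_fw_integrable[OF e, of \<alpha> \<nu>] by (simp add: lor_angle_def)
  qed
  then show ?thesis by (simp add: lor_angle_def)
qed

theorem theorem2:
  fixes e :: real and F :: "c3 \<Rightarrow> complex" and f :: "r3 \<Rightarrow> complex"
    and \<gamma> :: "real \<Rightarrow> r3" and z :: c3
  assumes "e \<in> {1, -1}"
    and "H2reg (- e) F f"
    and "admissible_loop \<gamma>"
    and "z \<in> Ttube (- e)"
  shows "F z = 1 / (2 * complex_of_real (pi\<^sup>2)) *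
     (\<integral>\<nu>. indicator {0<..} \<nu> *\<^sub>R
        (complex_of_real (\<nu> * tanh (pi * \<nu>) / (exp (e * pi * \<nu>) * cosh (pi * \<nu>))) *
         cycle_int (\<lambda>\<xi>. lorC z (cplx3 \<xi>) powr (- 1/2 + \<i> * complex_of_real \<nu>) * FH e f \<nu> \<xi>) \<gamma>)
      \<partial>lborel)"
proof -
  note e = assms(1) and loop = assms(3) and z = assms(4)
  define G where "G = (\<lambda>(l, m). F (zpar l m) / (l - m))"
  define g where "g = (\<lambda>p::real\<times>real. f (xpar p) / complex_of_real (fst p - snd p))"
  have g_eq: "g = (\<lambda>p. f (re3 (zpar (of_real (fst p)) (of_real (snd p)))) / complex_of_real (fst p - snd p))"
    by (simp add: g_def xpar_def)
  from assms(2)[unfolded H2reg_def Let_def, folded G_def g_eq]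
  obtain c where L2: "L2X f" and G: "holo2 G (ptube (- e))" and bv: "bval2 (- e) G g"
    and bound: "\<And>l m. (l, m) \<in> ptube (- e) \<Longrightarrow> cmod (G (l, m)) \<le> c / ((1 + cmod l) * (1 + cmod m))"
    unfolding hardy2_def by blast
  have f_meas: "(\<lambda>p. f (Xchart e p)) \<in> borel_measurable borel" if "e \<in> {1, -1}" for e
    using L2 that by (auto simp: L2X_def)
  have fx_meas [measurable]: "(\<lambda>p. f (xpar p)) \<in> borel_measurable borel" by (rule xpar_compose_measurable[OF f_meas])
  have g_meas: "g \<in> borel_measurable borel" unfolding g_def by measurable
  have e': "- e \<in> {1, -1}" using e by auto
  have c0: "c \<ge> 0" by (rule tube_Cauchy_boundary(1)[OF e' G _ bv g_meas]) (rule bound)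
  have g_bound: "AE p in lborel. cmod (g p) \<le> c / ((1 + \<bar>fst p\<bar>) * (1 + \<bar>snd p\<bar>))"
    by (rule tube_Cauchy_boundary(2)[OF e' G _ bv g_meas]) (rule bound)
  have Cauchy: "(\<integral>p. g p / ((of_real (fst p) - l) * (of_real (snd p) - m)) \<partial>lborel) = 4 * of_real (pi\<^sup>2) * G (l, m)"
    if "(l, m) \<in> ptube (- e)" for l m
    by (rule tube_Cauchy_boundary(3)[OF e' G _ bv g_meas that]) (rule bound)
  define fw where "fw = (\<lambda>p. f (xpar p) / complex_of_real ((fst p - snd p)\<^sup>2))"
  have bd: "boundary_density fw c"
  proof
    show "fw \<in> borel_measurable borel" unfolding fw_def by measurable
    show "c \<ge> 0" by (rule c0)
    show "AE p in lborel. cmod (fw p) \<le> c * (1 / (\<bar>fst p - snd p\<bar> * ((1 + \<bar>fst p\<bar>) * (1 + \<bar>snd p\<bar>))))"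
      using g_bound
    proof eventually_elim
      case (elim p)
      have "cmod (fw p) = cmod (g p) / \<bar>fst p - snd p\<bar>"
        by (simp add: fw_def g_def norm_divide power2_eq_square norm_mult flip: of_real_diff)
      also have "\<dots> \<le> c / ((1 + \<bar>fst p\<bar>) * (1 + \<bar>snd p\<bar>)) / \<bar>fst p - snd p\<bar>"
        using elim by (rule divide_right_mono) simp
      finally show ?case by (simp add: mult.commute)
    qed
  qed
  interpret boundary_density fw c by (rule bd)
  have FH_eq: "FH e f \<nu> (1, cos \<alpha>, sin \<alpha>) = (\<integral>p. tpow e (lor_angle \<alpha> p) (- 1/2 - \<i> * of_real \<nu>) * fw p \<partial>lborel)" for \<nu> \<alpha>
    using FH_unit_circle[OF e f_meas bd[unfolded fw_def]] unfolding fw_def .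
  obtain b C where bC: "b < pi" "\<And>\<alpha>. Re (\<i> * of_real e * lorC z (cplx3 (1, cos \<alpha>, sin \<alpha>))) > 0"
    "\<And>\<alpha>. \<bar>Im (Ln (\<i> * of_real e * lorC z (cplx3 (1, cos \<alpha>, sin \<alpha>))))\<bar> + pi / 2 \<le> b"
    "\<And>\<alpha>. cmod (\<i> * of_real e * lorC z (cplx3 (1, cos \<alpha>, sin \<alpha>))) powr (- 1/2) \<le> C"
    "continuous_on UNIV (\<lambda>\<alpha>. Ln (\<i> * of_real e * lorC z (cplx3 (1, cos \<alpha>, sin \<alpha>))))"
    by (rule tube_pairing_bounds[OF e z], rule that; assumption)
  have nonreal: "Im (lorC z (cplx3 (1, cos \<alpha>, sin \<alpha>))) \<noteq> 0" for \<alpha>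
    using bC(2)[of \<alpha>] by auto
  have nonzero: "lorC z (cplx3 (1, cos \<alpha>, sin \<alpha>)) \<noteq> 0" for \<alpha>
    using nonreal[of \<alpha>] by auto
  \<comment> \<open>Homogeneity and continuity of the integrand reduce the loop to
    \<open>gamma0\<close>, contributing the factor pi. By continuity the gauge integral is also a
    Lebesgue integral, the form in which the exchange of integrations is available.\<close>
  have cycle: "cycle_int (\<lambda>\<xi>. lorC z (cplx3 \<xi>) powr (- 1/2 + \<i> * of_real \<nu>) * FH e f \<nu> \<xi>) \<gamma> =
      of_real pi * (\<integral>t. lorC z (cplx3 (gamma0 t)) powr (- 1/2 + \<i> * of_real \<nu>) *
        (\<integral>p. tpow e (lor_angle (2 * pi * t - pi) p) (- 1/2 - \<i> * of_real \<nu>) * fw p \<partial>lborel) \<partial>unit_measure)" for \<nu>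
  proof -
    define q where "q = (\<lambda>\<xi>. lorC z (cplx3 \<xi>) powr (- 1/2 + \<i> * of_real \<nu>) * FH e f \<nu> \<xi>)"
    have cq: "continuous_on UNIV (\<lambda>\<alpha>. q (1, cos \<alpha>, sin \<alpha>))"
    proof -
      have "continuous_on UNIV (\<lambda>\<alpha>. lorC z (cplx3 (1, cos \<alpha>, sin \<alpha>)))"
        unfolding lorC_def cplx3_def prod.case case_prod_unfold by (intro continuous_intros)
      then show ?thesis unfolding q_def FH_eq
        using nonreal nonzero by (intro continuous_intros tpow_fw_continuous e) auto
    qed
    have "cycle_int q \<gamma> = of_real pi * integral {0..1} (\<lambda>t. q (gamma0 t))"
    proof (rule cycle_int_admissible_loop[OF loop _ cq])
      fix \<rho> x0 x1 x2 :: real assume \<rho>: "\<rho> > 0"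
      have l: "lorC z (cplx3 (\<rho> * x0, \<rho> * x1, \<rho> * x2)) = of_real \<rho> * lorC z (cplx3 (x0, x1, x2))"
        by (simp add: lorC_def cplx3_def case_prod_unfold algebra_simps)
      have "complex_of_real \<rho> powr (- 1/2 + \<i> * of_real \<nu>) * of_real \<rho> powr (- 1/2 - \<i> * of_real \<nu>) = of_real \<rho> powr (- 1)"
        by (simp flip: powr_add)
      also have "\<dots> = 1 / of_real \<rho>" using \<rho> by (simp add: powr_minus_divide)
      finally have "(complex_of_real \<rho> powr (- 1/2 + \<i> * of_real \<nu>) * of_real \<rho> powr (- 1/2 - \<i> * of_real \<nu>)) * q (x0, x1, x2) = q (x0, x1, x2) / of_real \<rho>"
        by simp
      then show "q (\<rho> * x0, \<rho> * x1, \<rho> * x2) = q (x0, x1, x2) / of_real \<rho>"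
        unfolding q_def l powr_of_real_mult[OF \<rho>] FH_scale[OF \<rho>] by (simp only: mult_ac)
    qed
    also have "integral {0..1} (\<lambda>t. q (gamma0 t)) = (\<integral>t. indicator {0..1} t *\<^sub>R q (gamma0 t) \<partial>lborel)"
    proof -
      have "continuous_on {0..1} ((\<lambda>\<alpha>. q (1, cos \<alpha>, sin \<alpha>)) \<circ> (\<lambda>t. 2 * pi * t - pi))"
        by (intro continuous_on_compose continuous_intros continuous_on_subset[OF cq]) auto
      then have "continuous_on {0..1} (\<lambda>t. q (gamma0 t))" by (simp add: gamma0_def o_def)
      from set_borel_integral_eq_integral(2)[OF borel_integrable_atLeastAtMost'[OF this]]
      show ?thesis unfolding set_lebesgue_integral_def by simp
    qed
    also have "\<dots> = (\<integral>t. q (gamma0 t) \<partial>unit_measure)" by (subst integral_restrict_space) auto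
    finally show ?thesis unfolding q_def by (simp only: gamma0_def FH_eq)
  qed
  have "(\<integral>\<nu>. indicator {0<..} \<nu> *\<^sub>R
        (complex_of_real (\<nu> * tanh (pi * \<nu>) / (exp (e * pi * \<nu>) * cosh (pi * \<nu>))) *
         cycle_int (\<lambda>\<xi>. lorC z (cplx3 \<xi>) powr (- 1/2 + \<i> * complex_of_real \<nu>) * FH e f \<nu> \<xi>) \<gamma>) \<partial>lborel) =
    (\<integral>\<nu>. of_real pi * (\<integral>t. \<integral>p. of_real (indicator {0<..} \<nu> * (\<nu> * tanh (pi * \<nu>) / cosh (pi * \<nu>))) * (of_real (exp (- e * pi * \<nu>)) *
       (lorC z (cplx3 (gamma0 t)) powr (- 1/2 + \<i> * of_real \<nu>) * tpow e (lor_angle (2 * pi * t - pi) p) (- 1/2 - \<i> * of_real \<nu>))) * fw p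
       \<partial>lborel \<partial>unit_measure) \<partial>lborel)"
  proof (rule Bochner_Integration.integral_cong[OF refl])
    fix \<nu> :: real
    define S where "S = (\<lambda>t. lorC z (cplx3 (gamma0 t)) powr (- 1/2 + \<i> * complex_of_real \<nu>))"
    define W where "W = (\<lambda>t p. tpow e (lor_angle (2 * pi * t - pi) p) (- 1/2 - \<i> * complex_of_real \<nu>))"
    define r x where "r = complex_of_real (indicator {0<..} \<nu> * (\<nu> * tanh (pi * \<nu>) / cosh (pi * \<nu>)))" and "x = complex_of_real (exp (- e * pi * \<nu>))"
    have "(\<integral>t. \<integral>p. r * (x * (S t * W t p)) * fw p \<partial>lborel \<partial>unit_measure) = (\<integral>t. \<integral>p. r * x * S t * (W t p * fw p) \<partial>lborel \<partial>unit_measure)"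
      by (simp only: mult.assoc)
    also have "\<dots> = (\<integral>t. r * x * S t * (\<integral>p. W t p * fw p \<partial>lborel) \<partial>unit_measure)"
      by (simp only: integral_mult_right_zero)
    also have "\<dots> = r * x * (\<integral>t. S t * (\<integral>p. W t p * fw p \<partial>lborel) \<partial>unit_measure)"
      by (simp only: mult.assoc integral_mult_right_zero)
    finally have *: "(\<integral>t. \<integral>p. r * (x * (S t * W t p)) * fw p \<partial>lborel \<partial>unit_measure) = r * x * (\<integral>t. S t * (\<integral>p. W t p * fw p \<partial>lborel) \<partial>unit_measure)" .
    have rx: "indicator {0<..} \<nu> *\<^sub>R (complex_of_real (\<nu> * tanh (pi * \<nu>) / (exp (e * pi * \<nu>) * cosh (pi * \<nu>))) * Z) = r * x * Z" for Z
    proof -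
      have "\<nu> * tanh (pi * \<nu>) / (exp (e * pi * \<nu>) * cosh (pi * \<nu>)) = \<nu> * tanh (pi * \<nu>) / cosh (pi * \<nu>) * exp (- e * pi * \<nu>)"
        by (simp add: exp_minus divide_simps)
      then show ?thesis by (simp only: scaleR_conv_of_real r_def x_def of_real_mult mult.assoc)
    qed
    show "indicator {0<..} \<nu> *\<^sub>R
        (complex_of_real (\<nu> * tanh (pi * \<nu>) / (exp (e * pi * \<nu>) * cosh (pi * \<nu>))) *
         cycle_int (\<lambda>\<xi>. lorC z (cplx3 \<xi>) powr (- 1/2 + \<i> * complex_of_real \<nu>) * FH e f \<nu> \<xi>) \<gamma>) =
      of_real pi * (\<integral>t. \<integral>p. of_real (indicator {0<..} \<nu> * (\<nu> * tanh (pi * \<nu>) / cosh (pi * \<nu>))) * (of_real (exp (- e * pi * \<nu>)) *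
       (lorC z (cplx3 (gamma0 t)) powr (- 1/2 + \<i> * of_real \<nu>) * tpow e (lor_angle (2 * pi * t - pi) p) (- 1/2 - \<i> * of_real \<nu>))) * fw p
       \<partial>lborel \<partial>unit_measure)"
      unfolding rx cycle using * unfolding r_def x_def S_def W_def by (simp only: mult_ac)
  qed
  also have "\<dots> = of_real pi * (\<integral>p. fw p / (of_real pi * (1 + lorC z (cplx3 (xpar p)))) \<partial>lborel)"
    unfolding integral_mult_right_zero spectral_density_formula[OF e z] ..
  also have "(\<integral>p. fw p / (of_real pi * (1 + lorC z (cplx3 (xpar p)))) \<partial>lborel) = 2 * of_real pi * F z"
  proof -
    obtain l m where lm: "(l, m) \<in> ptube (- e)" and zlm: "zpar l m = z" using Ttube_parameters[OF e' z] by blast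
    have ne: "l \<noteq> m" using lm by (auto simp: ptube_def)
    have im: "Im l \<noteq> 0" "Im m \<noteq> 0" using lm by (auto simp: ptube_def)
    \<comment> \<open>Here d is the difference of the parameters of the boundary point and k that of
      the parameters of z. One factor 1/d of the density is cancelled by the d in the numerator of 1
      / (1 + [z.x]); the other turns f into \<open>g\<close>.\<close>
    have cancel: "a / (d * d) / (of_real pi * (2 * u * v / (k * d))) = k / (2 * of_real pi) * (a / d / (u * v))"
      if "d \<noteq> 0" "k \<noteq> 0" for a d k u v :: complex
      using that by (cases "u = 0 \<or> v = 0") (auto simp: field_simps)
    have "(\<integral>p. fw p / (of_real pi * (1 + lorC z (cplx3 (xpar p)))) \<partial>lborel) =
        (\<integral>p. (l - m) / (2 * of_real pi) * (g p / ((of_real (fst p) - l) * (of_real (snd p) - m))) \<partial>lborel)"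
    proof (rule integral_cong_AE)
      show "AE p in lborel. fw p / (of_real pi * (1 + lorC z (cplx3 (xpar p)))) = (l - m) / (2 * of_real pi) * (g p / ((of_real (fst p) - l) * (of_real (snd p) - m)))"
        using AE_sheets
      proof eventually_elim
        case (elim p)
        then have "fst p \<noteq> snd p" by simp
        then have d: "complex_of_real (fst p - snd p) \<noteq> 0" by simp
        show ?case
          unfolding zlm[symmetric] lorC_zpar_xpar[OF ne \<open>fst p \<noteq> snd p\<close>] fw_def g_def power2_eq_square of_real_mult
          by (rule cancel) (use d ne in simp_all)
      qed
      show "(\<lambda>p. fw p / (of_real pi * (1 + lorC z (cplx3 (xpar p))))) \<in> borel_measurable lborel"
        unfolding lorC_def cplx3_def xpar_eq case_prod_unfold fst_conv snd_conv by measurable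
      show "(\<lambda>p. (l - m) / (2 * of_real pi) * (g p / ((of_real (fst p) - l) * (of_real (snd p) - m)))) \<in> borel_measurable lborel"
        using g_meas by measurable
    qed
    also have "\<dots> = (l - m) / (2 * of_real pi) * (4 * of_real (pi\<^sup>2) * G (l, m))"
      unfolding integral_mult_right_zero Cauchy[OF lm] ..
    also have "\<dots> = 2 * of_real pi * F z"
      using ne by (simp add: G_def zlm power2_eq_square)
    finally show ?thesis .
  qed
  finally show ?thesis by (simp add: power2_eq_square)
qed

end
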